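(* Let $n\ge1$ and suppose that the symbol $\sigma:\mathbb{R}^n\times\mathbb{N}_0^n\to\mathbb{C}$ satisfies at least one of the following conditions: (a) for some $0\le\delta<1$, $\sigma\in\mathcal{S}^{0,\mathcal{K},\mathcal{N}}_{1,\delta}$ with $\mathcal{K}=n+1$ and $\mathcal{N}=2\Big\lceil\dfrac{n+1}{2(1-\delta)}\Big\rceil$; (b) for some $0\le\delta<1$, $\sigma\in\mathcal{S}^{0,\mathcal{K},\mathcal{N}}_{1,\delta}$ with $\mathcal{K}=\lfloor n/2\rfloor+1$ and $\mathcal{N}=\Big\lfloor\dfrac{2n}{1-\delta}\Big\rfloor+1$; (c) for some $m<0$, and for every multi-index $\kappa\in\mathbb{N}_0^n$ with $|\kappa|\le\lfloor n/2\rfloor+1$, there is a constant $C_\kappa$ such that $\Vert\triangle_\xi^\kappa\sigma(\cdot,\xi)\Vert_{L^\infty(\mathbb{R}^n)}\le C_\kappa\langle\xi\rangle^{\frac m2-|\kappa|}$ for all $\xi\in\mathbb{N}_0^n$; (d) for every multi-index $\nu\in\mathbb{N}_0^n$ with $|\nu|\le\lfloor n/2\rfloor+1$ there is a constant $C_\nu$ such that $\sup_{\xi\in\mathbb{N}_0^n}\Vert\partial_x^\nu\sigma(\cdot,\xi)\Vert_{L^2(\mathbb{R}^n)}\le C_\nu$ (Lebesgue measure). Then the Gaussian pseudo-multiplier $\sigma(\cdot,\mathbb{L})$ extends to a bounded operator on $L^2(\gamma)$.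
   Context: $\mathbb{N}_0=\{0,1,2,\dots\}$; for $\xi\in\mathbb{N}_0^n$, $|\xi|=\xi_1+\dots+\xi_n$, $\xi!=\xi_1!\cdots\xi_n!$ and $\langle\xi\rangle=1+|\xi|$. Symbols are assumed measurable in $x$; the derivatives in (d) are weak derivatives. Finite differences: for $g$ defined on $\mathbb{N}_0^n$, $\triangle_i g(\xi)=g(\xi+e_i)-g(\xi)$ ($e_i$ the $i$-th standard basis vector), $\triangle_i^\ell g=\triangle_i(\triangle_i^{\ell-1}g)$ for $\ell\ge2$, and $\triangle_\xi^\kappa=\triangle_1^{\kappa_1}\cdots\triangle_n^{\kappa_n}$, acting in the variable $\xi$. Symbol class: $\sigma\in\mathcal{S}^{0,\mathcal{K},\mathcal{N}}_{1,\delta}$ means that $\sigma(\cdot,\xi)\in C^{\mathcal{N}}(\mathbb{R}^n)$ for each $\xi\in\mathbb{N}_0^n$ and, for all $\nu,\kappa\in\mathbb{N}_0^n$ with $0\le|\nu|\le\mathcal{N}$, $0\le|\kappa|\le\mathcal{K}$, there is $C_{\nu,\kappa}>0$ with $|\partial_x^\nu\triangle_\xi^\kappa\sigma(x,\xi)|\le C_{\nu,\kappa}\langle\xi\rangle^{-|\kappa|+\frac\delta2|\nu|}$ for all $(x,\xi)\in\mathbb{R}^n\times\mathbb{N}_0^n$. Gaussian setting: $d\gamma=\pi^{-n/2}e^{-|x|^2}dx$, $L^2(\gamma)=L^2(\mathbb{R}^n,d\gamma)$, $\langle f,g\rangle_\gamma=\int_{\mathbb{R}^n}fg\,d\gamma$.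 With $H_k(t)=(-1)^ke^{t^2}\partial_t^k(e^{-t^2})$ and $H_\xi(x)=\prod_{j=1}^nH_{\xi_j}(x_j)$, the normalized Hermite polynomials are $\mathcal{H}_\xi(x)=(2^{|\xi|}\xi!)^{-1/2}H_\xi(x)$, $\xi\in\mathbb{N}_0^n$; they form a complete orthonormal basis of $L^2(\gamma)$. With $\mathbb{L}=-\frac12\Delta+x\cdot\nabla$ the Ornstein–Uhlenbeck operator, the Gaussian pseudo-multiplier with symbol $\sigma$ is $$\sigma(x,\mathbb{L})f(x)=\sum_{\xi\in\mathbb{N}_0^n}\sigma(x,\xi)\langle f,\mathcal{H}_\xi\rangle_\gamma\mathcal{H}_\xi(x),$$ initially defined on finite linear combinations of the $\mathcal{H}_\xi$. *)

theory Defs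
  imports "HOL-Probability.Probability"
begin

text \<open>
  Multi-indices in \<open>\<nat>\<^sub>0\<^sup>n\<close> are vectors \<open>nat ^ 'n\<close>, with \<open>n = CARD('n)\<close>.
\<close>

definition mi_abs :: "nat ^ 'n \<Rightarrow> nat" where
  "mi_abs \<xi> = (\<Sum>i\<in>UNIV. \<xi> $ i)"

definition mi_fact :: "nat ^ 'n \<Rightarrow> nat" where
  "mi_fact \<xi> = (\<Prod>i\<in>UNIV. fact (\<xi> $ i))"

definition mi_bracket :: "nat ^ 'n \<Rightarrow> real" where
  "mi_bracket \<xi> = 1 + real (mi_abs \<xi>)"

text \<open>
  The index type \<open>'n\<close> carries no order, so the composite operators
  \<open>D\<^sub>1\<^bsup>\<kappa>\<^sub>1\<^esup> \<dots> D\<^sub>n\<^bsup>\<kappa>\<^sub>n\<^esup>\<close> are formed along an arbitrary but fixed enumeration of the coordinates.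
  The enumeration is irrelevant for finite differences, which commute (lemma \<open>diff1_commute\<close>),
  and for partial derivatives of order at most \<open>N\<close> of a \<open>C\<^sup>N\<close> function.
\<close>

definition coords :: "'n::finite list" where
  "coords = (SOME is. distinct is \<and> set is = (UNIV :: 'n set))"

lemma coords: "distinct (coords :: 'n::finite list)" "set (coords :: 'n list) = UNIV"
proof -
  have "\<exists>is. distinct is \<and> set is = (UNIV :: 'n set)"
    using finite_distinct_list[of "UNIV :: 'n set"] by auto
  from someI_ex[OF this] show "distinct (coords :: 'n list)" "set (coords :: 'n list) = UNIV"
    unfolding coords_def by auto
qed

definition mi_pow :: "('n \<Rightarrow> 'f \<Rightarrow> 'f) \<Rightarrow> nat ^ 'n \<Rightarrow> 'f \<Rightarrow> 'f" where
  "mi_pow D \<kappa> = foldr (\<lambda>i h. (D i ^^ (\<kappa> $ i)) \<circ> h) coords id"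


definition diff1 :: "'n \<Rightarrow> (nat ^ 'n \<Rightarrow> complex) \<Rightarrow> nat ^ 'n \<Rightarrow> complex" where
  "diff1 i g \<xi> = g (\<xi> + axis i 1) - g \<xi>"

abbreviation diff_mi :: "nat ^ 'n \<Rightarrow> (nat ^ 'n \<Rightarrow> complex) \<Rightarrow> nat ^ 'n \<Rightarrow> complex" where
  "diff_mi \<equiv> mi_pow diff1"

lemma diff1_commute: "diff1 i (diff1 j g) = diff1 j (diff1 i g)"
  by (rule ext) (simp add: diff1_def add_ac)

definition partial1 :: "'n \<Rightarrow> (real ^ 'n \<Rightarrow> complex) \<Rightarrow> real ^ 'n \<Rightarrow> complex" where
  "partial1 i f x = vector_derivative (\<lambda>t. f (x + t *\<^sub>R axis i 1)) (at 0)"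

abbreviation partial_mi :: "nat ^ 'n \<Rightarrow> (real ^ 'n \<Rightarrow> complex) \<Rightarrow> real ^ 'n \<Rightarrow> complex" where
  "partial_mi \<equiv> mi_pow partial1"

text \<open>\<open>C\<^sup>k(\<real>\<^sup>n)\<close>: all iterated partial derivatives of order at most \<open>k\<close> exist and are continuous.\<close>

fun C_k :: "nat \<Rightarrow> (real ^ 'n \<Rightarrow> complex) \<Rightarrow> bool" where
  "C_k 0 f \<longleftrightarrow> continuous_on UNIV f"
| "C_k (Suc k) f \<longleftrightarrow> continuous_on UNIV f \<and>
     (\<forall>i. (\<forall>x. (\<lambda>t. f (x + t *\<^sub>R axis i 1)) differentiable at (0::real)) \<and> C_k k (partial1 i f))"

text \<open>The class \<open>S\<^sup>0\<^sup>,\<^sup>K\<^sup>,\<^sup>N\<^sub>1\<^sub>,\<^sub>\<delta>\<close>.\<close>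

definition symbol_class ::
    "real \<Rightarrow> nat \<Rightarrow> nat \<Rightarrow> (real ^ 'n \<Rightarrow> nat ^ 'n \<Rightarrow> complex) \<Rightarrow> bool" where
  "symbol_class \<delta> K N \<sigma> \<longleftrightarrow>
     (\<forall>\<xi>. C_k N (\<lambda>x. \<sigma> x \<xi>)) \<and>
     (\<forall>\<nu> \<kappa>. mi_abs \<nu> \<le> N \<longrightarrow> mi_abs \<kappa> \<le> K \<longrightarrow>
        (\<exists>C>0. \<forall>x \<xi>. cmod (partial_mi \<nu> (\<lambda>y. diff_mi \<kappa> (\<sigma> y) \<xi>) x)
           \<le> C * mi_bracket \<xi> powr (- real (mi_abs \<kappa>) + \<delta> / 2 * real (mi_abs \<nu>))))"


definition in_L2 :: "'a measure \<Rightarrow> ('a \<Rightarrow> complex) \<Rightarrow> bool" where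
  "in_L2 M f \<longleftrightarrow> f \<in> borel_measurable M \<and> integrable M (\<lambda>x. (cmod (f x))\<^sup>2)"

definition L2_norm :: "'a measure \<Rightarrow> ('a \<Rightarrow> complex) \<Rightarrow> real" where
  "L2_norm M f = sqrt (\<integral>x. (cmod (f x))\<^sup>2 \<partial>M)"

definition locally_integrable :: "(real ^ 'n \<Rightarrow> complex) \<Rightarrow> bool" where
  "locally_integrable f \<longleftrightarrow> (\<forall>S. compact S \<longrightarrow> f absolutely_integrable_on S)"

definition test_function :: "(real ^ 'n \<Rightarrow> complex) \<Rightarrow> bool" where
  "test_function \<phi> \<longleftrightarrow> (\<forall>k. C_k k \<phi>) \<and> compact (closure {x. \<phi> x \<noteq> 0})"

definition is_weak_partial ::
    "nat ^ 'n \<Rightarrow> (real ^ 'n \<Rightarrow> complex) \<Rightarrow> (real ^ 'n \<Rightarrow> complex) \<Rightarrow> bool" where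
  "is_weak_partial \<nu> f g \<longleftrightarrow> locally_integrable f \<and> locally_integrable g \<and>
     (\<forall>\<phi>. test_function \<phi> \<longrightarrow>
        (\<integral>x. f x * partial_mi \<nu> \<phi> x \<partial>lebesgue)
          = (-1) ^ mi_abs \<nu> * (\<integral>x. g x * \<phi> x \<partial>lebesgue))"


definition gauss_measure :: "(real ^ 'n) measure" where
  "gauss_measure =
     density lebesgue (\<lambda>x. ennreal (pi powr (- real CARD('n) / 2) * exp (- (norm x)\<^sup>2)))"

definition hermite1 :: "nat \<Rightarrow> real \<Rightarrow> real" where
  "hermite1 k t = (-1) ^ k * exp (t\<^sup>2) * (deriv ^^ k) (\<lambda>s. exp (- (s\<^sup>2))) t"

definition hermite :: "nat ^ 'n \<Rightarrow> real ^ 'n \<Rightarrow> real" where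
  "hermite \<xi> x = (\<Prod>j\<in>UNIV. hermite1 (\<xi> $ j) (x $ j))"

definition nhermite :: "nat ^ 'n \<Rightarrow> real ^ 'n \<Rightarrow> complex" where
  "nhermite \<xi> x =
     complex_of_real ((2 ^ mi_abs \<xi> * real (mi_fact \<xi>)) powr (- 1 / 2) * hermite \<xi> x)"

text \<open>The pairing is bilinear; the Hermite polynomials are real-valued.\<close>

definition gauss_pairing :: "(real ^ 'n \<Rightarrow> complex) \<Rightarrow> (real ^ 'n \<Rightarrow> complex) \<Rightarrow> complex" where
  "gauss_pairing f g = (\<integral>x. f x * g x \<partial>gauss_measure)"

definition hermite_span :: "(real ^ 'n \<Rightarrow> complex) set" where
  "hermite_span = {f. \<exists>S c. finite S \<and> f = (\<lambda>x. \<Sum>\<xi>\<in>S. c \<xi> * nhermite \<xi> x)}"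

text \<open>For \<open>f\<close> in \<open>hermite_span\<close> only finitely many terms of the series are nonzero.\<close>

definition pseudo_multiplier ::
    "(real ^ 'n \<Rightarrow> nat ^ 'n \<Rightarrow> complex) \<Rightarrow> (real ^ 'n \<Rightarrow> complex) \<Rightarrow> real ^ 'n \<Rightarrow> complex" where
  "pseudo_multiplier \<sigma> f x =
     (\<Sum>\<^sub>\<infinity>\<xi>\<in>UNIV. \<sigma> x \<xi> * gauss_pairing f (nhermite \<xi>) * nhermite \<xi> x)"

text \<open>
  Elements of \<open>L\<^sup>2(M)\<close> are represented by functions, identified when they agree almost everywhere.
  The values of \<open>T\<close> outside \<open>L\<^sup>2(M)\<close> are irrelevant.
\<close>

definition bounded_operator_L2 ::
    "'a measure \<Rightarrow> (('a \<Rightarrow> complex) \<Rightarrow> 'a \<Rightarrow> complex) \<Rightarrow> bool" where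
  "bounded_operator_L2 M T \<longleftrightarrow>
     (\<forall>f. in_L2 M f \<longrightarrow> in_L2 M (T f)) \<and>
     (\<forall>f g. in_L2 M f \<longrightarrow> in_L2 M g \<longrightarrow> (AE x in M. f x = g x) \<longrightarrow> (AE x in M. T f x = T g x)) \<and>
     (\<forall>f g a b. in_L2 M f \<longrightarrow> in_L2 M g \<longrightarrow>
        (AE x in M. T (\<lambda>y. a * f y + b * g y) x = a * T f x + b * T g x)) \<and>
     (\<exists>C. \<forall>f. in_L2 M f \<longrightarrow> L2_norm M (T f) \<le> C * L2_norm M f)"

definition extends_to_bounded_L2 ::
    "'a measure \<Rightarrow> ('a \<Rightarrow> complex) set \<Rightarrow> (('a \<Rightarrow> complex) \<Rightarrow> 'a \<Rightarrow> complex) \<Rightarrow> bool" where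
  "extends_to_bounded_L2 M D A \<longleftrightarrow>
     (\<exists>T. bounded_operator_L2 M T \<and> (\<forall>f\<in>D. AE x in M. T f x = A f x))"

end

theory Submission imports Defs begin

text \<open>
  On a finite sum \<open>f = \<Sum>\<^sub>\<xi> c\<^sub>\<xi> hn \<xi>\<close> of normalized Hermite polynomials the pseudo-multiplier is
  \<open>\<Sum>\<^sub>\<xi> c\<^sub>\<xi> \<sigma>(x,\<xi>) hn \<xi> x\<close>. Everything reduces to bounding the Gaussian \<open>L\<^sup>2\<close> norm of this function
  by a constant times \<open>(\<Sum>\<^sub>\<xi> |c\<^sub>\<xi>|\<^sup>2)\<^sup>1\<^sup>/\<^sup>2\<close>, uniformly over finite sums: Bessel's inequality and
  completeness of \<open>L\<^sup>2\<close> then give the extension (\<open>extends_to_bounded_L2_if_bounded_on_sums\<close>).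

  Under conditions (a), (b) and (c) the symbol is cut into blocks living on \<open>|\<xi>| \<approx> q\<^sup>j\<close>. The analytic core is
  that one block is bounded, uniformly in \<open>j\<close>, when its differences in each coordinate direction up to order
  \<open>K > n/2\<close> obey the natural scaling (\<open>localized_symbol_bounded\<close>). Multiplication by \<open>x\<^sub>c - y\<^sub>c\<close> acts on the kernel
  \<open>\<Sum>\<^sub>\<xi> a\<^sub>\<xi> hn \<xi> x hn \<xi> y\<close> through the three-term recurrence and produces a difference of \<open>a\<close>;
  iterating, the kernel concentrates at distance \<open>R\<^sup>-\<^sup>1\<^sup>/\<^sup>2\<close> from the diagonal in a weighted \<open>L\<^sup>2\<close> sense,
  with a size governed by the Christoffel function \<open>\<Sum> (hn \<xi> x)\<^sup>2\<close>, \<open>|\<xi>| \<le> R\<close>. Cauchy--Schwarz against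
  the weight gives the bound.

  For a symbol of negative order, which is condition (c), the norms of the blocks decay geometrically and can be added
  (\<open>negative_order_symbol_bounded\<close>). For order zero, which is conditions (a) and (b), the blocks are almost
  orthogonal: the inner product of two of them is integrated by parts once, moving a derivative from the
  high-frequency Hermite polynomials to the low-frequency block or to the symbol, where an \<open>x\<close>-derivative costs
  only \<open>|\<xi>|\<^sup>\<delta>\<^sup>/\<^sup>2\<close> and \<open>\<delta> < 1\<close> (\<open>smooth_symbol_bounded\<close>).

  Condition (d) rests on the Sobolev embedding in the form of explicit kernels (\<open>ex_sobolev_kernels\<close>):
  \<open>\<sigma>(x,\<xi>)\<close> is a sum over \<open>m\<close> of integrals over \<open>y\<close> of weak derivatives of \<open>\<sigma>(y,\<xi>)\<close> against kernels in \<open>y - x\<close>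
  whose \<open>L\<^sup>2\<close> norms decay geometrically in \<open>m\<close>. Cauchy--Schwarz in \<open>y\<close> separates the variable of the symbol from \<open>x\<close>,
  and for fixed \<open>y\<close> the Hermite polynomials are orthonormal in \<open>x\<close> (\<open>weakly_differentiable_symbol_bounded\<close>).
\<close>


section \<open>Hermite polynomials on the line\<close>

fun hermite_poly :: "nat \<Rightarrow> real poly" where
  "hermite_poly 0 = 1"
| "hermite_poly (Suc k) = [:0, 2:] * hermite_poly k - pderiv (hermite_poly k)"

lemma higher_deriv_gaussian:
  "(deriv ^^ k) (\<lambda>s::real. exp (- (s\<^sup>2))) = (\<lambda>t. (-1) ^ k * poly (hermite_poly k) t * exp (- (t\<^sup>2)))"
proof (induction k)
  case (Suc k)
  have "((\<lambda>t. (-1) ^ k * poly (hermite_poly k) t * exp (- (t\<^sup>2))) has_real_derivative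
      (-1) ^ Suc k * poly (hermite_poly (Suc k)) t * exp (- (t\<^sup>2))) (at t)" for t :: real
    by (rule derivative_eq_intros poly_DERIV refl | simp)+ (simp add: algebra_simps)
  then show ?case
    unfolding funpow.simps o_apply Suc by (intro ext DERIV_imp_deriv)
qed simp

lemma hermite1_eq_poly: "hermite1 k t = poly (hermite_poly k) t"
  by (simp add: hermite1_def higher_deriv_gaussian mult_exp_exp mult.assoc mult.left_commute[of _ "exp _"]
      flip: power_mult_distrib exp_add)

lemma pderiv_hermite_poly: "pderiv (hermite_poly (Suc k)) = smult (2 * real (Suc k)) (hermite_poly k)"
proof (induction k)
  case 0
  show ?case by (simp add: pderiv_pCons pderiv_minus pderiv_diff)
next
  case (Suc k)
  have *: "pderiv ([:0, 2:] * p) = smult 2 p + [:0, 2:] * pderiv p" for p :: "real poly"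
    by (simp add: pderiv_mult pderiv_pCons pderiv_smult)
  have "pderiv (hermite_poly (Suc (Suc k))) =
      smult 2 (hermite_poly (Suc k)) + [:0, 2:] * pderiv (hermite_poly (Suc k)) - pderiv (pderiv (hermite_poly (Suc k)))"
    by (subst hermite_poly.simps) (simp only: pderiv_diff *)
  also have "\<dots> = smult 2 (hermite_poly (Suc k)) + smult (2 * real (Suc k)) (hermite_poly (Suc k))"
    unfolding Suc by (simp add: pderiv_smult smult_diff_right)
  also have "\<dots> = smult (2 * real (Suc (Suc k))) (hermite_poly (Suc k))"
    by (simp add: smult_add_left[symmetric] del: hermite_poly.simps)
  finally show ?case .
qed

lemma hermite1_0 [simp]: "hermite1 0 t = 1"
  by (simp add: hermite1_def mult_exp_exp)

lemma hermite1_has_derivative: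
  "(hermite1 k has_real_derivative 2 * real k * hermite1 (k - 1) t) (at t)"
proof (cases k)
  case 0
  then have "hermite1 k = (\<lambda>_. 1)" by (simp add: fun_eq_iff hermite1_eq_poly)
  then show ?thesis using 0 by simp
next
  case (Suc m)
  have "(poly (hermite_poly k) has_real_derivative poly (pderiv (hermite_poly k)) t) (at t)"
    by (rule poly_DERIV)
  then show ?thesis
    unfolding Suc pderiv_hermite_poly by (simp add: hermite1_eq_poly[abs_def] algebra_simps del: hermite_poly.simps)
qed

lemma hermite1_recurrence:
  "2 * t * hermite1 k t = hermite1 (Suc k) t + 2 * real k * hermite1 (k - 1) t"
proof (cases k)
  case 0
  then show ?thesis by (simp add: hermite1_eq_poly)
next
  case (Suc m)
  have "hermite1 (Suc k) t = 2 * t * hermite1 k t - poly (pderiv (hermite_poly k)) t"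
    by (simp add: hermite1_eq_poly)
  then show ?thesis
    unfolding Suc pderiv_hermite_poly by (simp add: hermite1_eq_poly del: hermite_poly.simps)
qed

lemma continuous_hermite1 [continuous_intros]:
  "continuous_on S f \<Longrightarrow> continuous_on S (\<lambda>x. hermite1 k (f x))"
  unfolding hermite1_eq_poly by (intro continuous_intros)

lemma integrable_power_gaussian: "integrable lborel (\<lambda>t::real. t ^ m * exp (- (t\<^sup>2)))"
proof (cases "even m")
  case True
  then obtain k where "m = 2 * k" by auto
  then show ?thesis
    using has_bochner_integral_even_function[OF gaussian_moment_even_pos[where k=k]]
    by (simp add: has_bochner_integral_iff mult.commute)
next
  case False
  then obtain k where "m = 2 * k + 1" by (auto elim: oddE)
  then show ?thesis
    using has_bochner_integral_odd_function[OF gaussian_moment_odd_pos[where k=k]]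
    by (simp add: has_bochner_integral_iff mult.commute)
qed

lemma integrable_poly_gaussian: "integrable lborel (\<lambda>t::real. poly p t * exp (- (t\<^sup>2)))"
  unfolding poly_altdef sum_distrib_right mult.assoc
  by (intro Bochner_Integration.integrable_sum integrable_mult_right integrable_power_gaussian)

lemma integrable_hermite1_mult:
  "integrable lborel (\<lambda>t. hermite1 k t * hermite1 l t * exp (- (t\<^sup>2)))"
  using integrable_poly_gaussian[of "hermite_poly k * hermite_poly l"] by (simp add: hermite1_eq_poly)

lemma integral_gaussian: "(\<integral>t. exp (- ((t::real)\<^sup>2)) \<partial>lborel) = sqrt pi"
  using has_bochner_integral_even_function[OF gaussian_moment_0]
  by (simp add: has_bochner_integral_iff)

text \<open>Translating by \<open>v\<close> does not change the integral of \<open>F\<close>, and \<open>F (x + v) - F x\<close> is the integral of the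
  derivative along the segment from \<open>x\<close> to \<open>x + v\<close>. By Fubini every point of the segment contributes the same
  integral of \<open>F'\<close>, which is therefore zero. All integrations by parts below are instances.\<close>

lemma integral_directional_derivative_eq_0:
  fixes F F' :: "'a::euclidean_space \<Rightarrow> 'b::euclidean_space"
  assumes der: "\<And>x. ((\<lambda>t. F (x + t *\<^sub>R v)) has_vector_derivative F' x) (at 0)"
    and cont: "continuous_on UNIV F'"
    and F: "integrable lborel F" and F': "integrable lborel F'"
  shows "(\<integral>x. F' x \<partial>lborel) = 0"
proof -
  have [measurable]: "F' \<in> borel_measurable borel"
    using cont by (rule borel_measurable_continuous_onI)
  have shift: "integrable lborel (\<lambda>x. f (x + a))" "(\<integral>x. f (x + a) \<partial>lborel) = (\<integral>x. f x \<partial>lborel)"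
    if "integrable lborel f" for f :: "'a \<Rightarrow> 'c::{banach,second_countable_topology}" and a
  proof -
    have [measurable]: "f \<in> borel_measurable borel" using that by auto
    have eq: "lborel = distr lborel borel (\<lambda>x. x + a)"
    proof -
      have "(\<lambda>x. x + a) = (+) a" by (auto simp: fun_eq_iff add.commute)
      then show ?thesis using lborel_distr_plus[of a] by simp
    qed
    have "integrable (distr lborel borel (\<lambda>x. x + a)) f" using that eq by simp
    then show "integrable lborel (\<lambda>x. f (x + a))" by (simp add: integrable_distr_eq)
    have "(\<integral>x. f x \<partial>lborel) = (\<integral>x. f x \<partial>(distr lborel borel (\<lambda>x. x + a)))" using eq by simp
    also have "\<dots> = (\<integral>x. f (x + a) \<partial>lborel)" by (simp add: integral_distr)
    finally show "(\<integral>x. f (x + a) \<partial>lborel) = (\<integral>x. f x \<partial>lborel)" by simp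
  qed
  have der': "((\<lambda>t. F (x + t *\<^sub>R v)) has_vector_derivative F' (x + s *\<^sub>R v)) (at s)" for x s
  proof -
    have "((\<lambda>t. F ((x + s *\<^sub>R v) + t *\<^sub>R v)) has_vector_derivative F' (x + s *\<^sub>R v)) (at (s + - s))"
      using der by simp
    then have "((\<lambda>t. F ((x + s *\<^sub>R v) + t *\<^sub>R v)) \<circ> (\<lambda>t. t + - s) has_vector_derivative 1 *\<^sub>R F' (x + s *\<^sub>R v)) (at s)"
      by (intro vector_diff_chain_at) (auto intro!: derivative_eq_intros)
    then show ?thesis by (simp add: o_def algebra_simps)
  qed
  have ftc: "(\<integral>t. indicator {0..1::real} t *\<^sub>R F' (x + t *\<^sub>R v) \<partial>lborel) = F (x + v) - F x" for x
  proof -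
    have "continuous_on {0..1} (\<lambda>t. F' (x + t *\<^sub>R v))"
      by (rule continuous_on_compose2[OF cont]) (auto intro!: continuous_intros)
    then have "(\<integral>t. indicator {0..1::real} t *\<^sub>R F' (x + t *\<^sub>R v) \<partial>lborel) = F (x + 1 *\<^sub>R v) - F (x + 0 *\<^sub>R v)"
      by (intro integral_FTC_atLeastAtMost[where F = "\<lambda>t. F (x + t *\<^sub>R v)"] has_vector_derivative_at_within[OF der'])
        simp_all
    then show ?thesis by simp
  qed
  have prod: "integrable (lborel \<Otimes>\<^sub>M lborel) (\<lambda>(t, x). indicator {0..1::real} t *\<^sub>R F' (x + t *\<^sub>R v))"
  proof (rule lborel_pair.Fubini_integrable)
    have eq: "(\<integral>x. norm (indicator {0..1::real} t *\<^sub>R F' (x + t *\<^sub>R v)) \<partial>lborel) = indicator {0..1} t * (\<integral>x. norm (F' x) \<partial>lborel)" for t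
      using shift(2)[of "\<lambda>x. norm (F' x)" "t *\<^sub>R v"] F' by simp
    show "integrable lborel (\<lambda>t. \<integral>x. norm (case (t, x) of (t, x) \<Rightarrow> indicator {0..1::real} t *\<^sub>R F' (x + t *\<^sub>R v)) \<partial>lborel)"
      unfolding prod.case eq by (intro integrable_mult_left integrable_real_indicator) auto
    show "AE t in lborel. integrable lborel (\<lambda>x. case (t, x) of (t, x) \<Rightarrow> indicator {0..1::real} t *\<^sub>R F' (x + t *\<^sub>R v))"
      using shift(1)[OF F'] by simp
  qed simp
  have "0 = (\<integral>x. F (x + v) - F x \<partial>lborel)"
    using shift[OF F] F by simp
  also have "\<dots> = (\<integral>x. (\<integral>t. indicator {0..1::real} t *\<^sub>R F' (x + t *\<^sub>R v) \<partial>lborel) \<partial>lborel)"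
    by (simp add: ftc)
  also have "\<dots> = (\<integral>t. (\<integral>x. indicator {0..1::real} t *\<^sub>R F' (x + t *\<^sub>R v) \<partial>lborel) \<partial>lborel)"
    using prod by (rule lborel_pair.Fubini_integral)
  also have "\<dots> = (\<integral>t. indicator {0..1::real} t *\<^sub>R (\<integral>x. F' x \<partial>lborel) \<partial>lborel)"
    using shift(2)[OF F'] by simp
  also have "\<dots> = (\<integral>x. F' x \<partial>lborel)"
    by simp
  finally show ?thesis by simp
qed

lemma hermite1_gaussian_derivative:
  "((\<lambda>t. hermite1 l t * exp (- (t\<^sup>2))) has_real_derivative - hermite1 (Suc l) t * exp (- (t\<^sup>2))) (at t)"
proof -
  have "((\<lambda>t. hermite1 l t * exp (- (t\<^sup>2))) has_real_derivative
     (2 * real l * hermite1 (l - 1) t - 2 * t * hermite1 l t) * exp (- (t\<^sup>2))) (at t)"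
    by (rule derivative_eq_intros hermite1_has_derivative refl | simp)+ (simp add: algebra_simps)
  then show ?thesis unfolding hermite1_recurrence by simp
qed

text \<open>Since \<open>H\<^bsub>l+1\<^esub> exp (- t\<^sup>2)\<close> is the negative derivative of \<open>H\<^sub>l exp (- t\<^sup>2)\<close>, integration by parts lowers both
  indices. Orthogonality follows by induction.\<close>

lemma integral_hermite1_Suc:
  "(\<integral>t. hermite1 k t * hermite1 (Suc l) t * exp (- (t\<^sup>2)) \<partial>lborel)
    = 2 * real k * (\<integral>t. hermite1 (k - 1) t * hermite1 l t * exp (- (t\<^sup>2)) \<partial>lborel)"
proof -
  let ?F = "\<lambda>t. hermite1 k t * (hermite1 l t * exp (- (t\<^sup>2)))"
  let ?F' = "\<lambda>t. 2 * real k * (hermite1 (k - 1) t * hermite1 l t * exp (- (t\<^sup>2))) - hermite1 k t * hermite1 (Suc l) t * exp (- (t\<^sup>2))"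
  have der: "(?F has_real_derivative ?F' t) (at t)" for t
    by (rule derivative_eq_intros hermite1_has_derivative hermite1_gaussian_derivative refl)+ (simp add: algebra_simps)
  have "(\<integral>t. ?F' t \<partial>lborel) = 0"
  proof (rule integral_directional_derivative_eq_0[where v = 1 and F = ?F])
    show "((\<lambda>t. ?F (x + t *\<^sub>R 1)) has_vector_derivative ?F' x) (at 0)" for x
    proof -
      have "((\<lambda>t. ?F (t + x)) has_real_derivative ?F' x) (at 0)"
        using der[of x] DERIV_shift[of ?F "?F' x" 0 x] by simp
      then show ?thesis by (simp add: has_real_derivative_iff_has_vector_derivative add.commute)
    qed
    show "continuous_on UNIV ?F'" by (intro continuous_intros)
    show "integrable lborel ?F" using integrable_hermite1_mult[of k l] by (simp add: mult.assoc)
    show "integrable lborel ?F'"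
      by (intro Bochner_Integration.integrable_diff integrable_mult_right integrable_hermite1_mult)
  qed
  then show ?thesis
    by (subst (asm) Bochner_Integration.integral_diff) (auto intro!: integrable_hermite1_mult)
qed

lemma integral_hermite1:
  "(\<integral>t. hermite1 k t * hermite1 l t * exp (- (t\<^sup>2)) \<partial>lborel) = (if k = l then 2 ^ k * fact k * sqrt pi else 0)"
proof (induction l arbitrary: k)
  case 0
  show ?case
  proof (cases k)
    case (Suc m)
    then show ?thesis
      using integral_hermite1_Suc[of 0 m] by simp
  qed (simp add: integral_gaussian)
next
  case (Suc l)
  then show ?case
    using integral_hermite1_Suc[of k l] by (cases k) auto
qed

section \<open>Integrals of products over coordinates\<close>

lemma lborel_vec_eq_distr_PiM:
  "(lborel :: (real ^ 'n) measure) = distr (\<Pi>\<^sub>M i\<in>UNIV. lborel) borel (\<lambda>f. \<chi> i. f i)"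
proof (rule lborel_eqI)
  interpret product_sigma_finite "\<lambda>_::'n. lborel :: real measure" ..
  have meas: "(\<lambda>f. (\<chi> i. f i) :: real ^ 'n) \<in> (\<Pi>\<^sub>M i\<in>UNIV. lborel) \<rightarrow>\<^sub>M borel"
  proof (rule borel_measurable_euclidean_space[THEN iffD2], rule ballI)
    fix b :: "real ^ 'n" assume "b \<in> Basis"
    then obtain i where "b = axis i 1" by (auto simp: Basis_vec_def)
    then show "(\<lambda>f. ((\<chi> i. f i) :: real ^ 'n) \<bullet> b) \<in> borel_measurable (\<Pi>\<^sub>M i\<in>UNIV. lborel)"
      by (simp add: inner_axis)
  qed
  fix l u :: "real ^ 'n" assume le: "\<And>b. b \<in> Basis \<Longrightarrow> l \<bullet> b \<le> u \<bullet> b"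
  have le': "l $ i \<le> u $ i" for i using le[of "axis i 1"] by (simp add: inner_axis axis_in_Basis_iff)
  have "(\<lambda>f. (\<chi> i. f i) :: real ^ 'n) -` box l u \<inter> space (\<Pi>\<^sub>M i\<in>UNIV. lborel) = (\<Pi>\<^sub>E i\<in>UNIV. {l $ i <..< u $ i})"
    by (auto simp: box_def space_PiM Basis_vec_def inner_axis PiE_iff)
  then have "emeasure (distr (\<Pi>\<^sub>M i\<in>UNIV. lborel) borel (\<lambda>f. (\<chi> i. f i) :: real ^ 'n)) (box l u)
     = emeasure (\<Pi>\<^sub>M i\<in>(UNIV::'n set). lborel) (\<Pi>\<^sub>E i\<in>UNIV. {l $ i <..< u $ i})"
    by (subst emeasure_distr[OF meas]) auto
  also have "\<dots> = (\<Prod>i\<in>UNIV. ennreal (u $ i - l $ i))"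
    using le' by (subst emeasure_PiM) auto
  also have "\<dots> = ennreal (\<Prod>i\<in>UNIV. (u - l) \<bullet> axis i 1)"
    using le' by (simp add: prod_ennreal inner_axis)
  also have "(\<Prod>i\<in>UNIV. (u - l) \<bullet> axis i 1) = (\<Prod>b\<in>Basis. (u - l) \<bullet> b)"
  proof -
    have *: "Basis = range (\<lambda>i. axis i 1 :: real ^ 'n)" by (auto simp: Basis_vec_def)
    show ?thesis unfolding * by (subst prod.reindex) (auto simp: inj_on_def axis_eq_axis)
  qed
  finally show "emeasure (distr (\<Pi>\<^sub>M i\<in>UNIV. lborel) borel (\<lambda>f. (\<chi> i. f i) :: real ^ 'n)) (box l u) = (\<Prod>b\<in>Basis. (u - l) \<bullet> b)" .
qed simp

lemma measurable_vec_lambda_PiM [measurable]: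
  "(\<lambda>f. (\<chi> i. f i) :: real ^ 'n) \<in> (\<Pi>\<^sub>M i\<in>UNIV. lborel) \<rightarrow>\<^sub>M borel"
proof (rule borel_measurable_euclidean_space[THEN iffD2], rule ballI)
  fix b :: "real ^ 'n" assume "b \<in> Basis"
  then obtain i where "b = axis i 1" by (auto simp: Basis_vec_def)
  then show "(\<lambda>f. ((\<chi> i. f i) :: real ^ 'n) \<bullet> b) \<in> borel_measurable (\<Pi>\<^sub>M i\<in>UNIV. lborel)"
    by (simp add: inner_axis)
qed

lemma nn_integral_prod_vec:
  fixes f :: "'n::finite \<Rightarrow> real \<Rightarrow> ennreal"
  assumes [measurable]: "\<And>i. f i \<in> borel_measurable borel"
  shows "(\<integral>\<^sup>+x. (\<Prod>i\<in>UNIV. f i (x $ i)) \<partial>lborel) = (\<Prod>i\<in>UNIV. \<integral>\<^sup>+t. f i t \<partial>lborel)"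
proof -
  interpret product_sigma_finite "\<lambda>_::'n. lborel :: real measure" ..
  show ?thesis
    unfolding lborel_vec_eq_distr_PiM by (subst nn_integral_distr) (simp_all add: product_nn_integral_prod)
qed

lemma
  fixes f :: "'n::finite \<Rightarrow> real \<Rightarrow> real"
  assumes int: "\<And>i. integrable lborel (f i)"
  shows integrable_prod_vec: "integrable lborel (\<lambda>x. \<Prod>i\<in>UNIV. f i (x $ i))"
    and integral_prod_vec: "(\<integral>x. (\<Prod>i\<in>UNIV. f i (x $ i)) \<partial>lborel) = (\<Prod>i\<in>UNIV. \<integral>t. f i t \<partial>lborel)"
proof -
  interpret product_sigma_finite "\<lambda>_::'n. lborel :: real measure" ..
  have [measurable]: "f i \<in> borel_measurable borel" for i using int[of i] by auto
  show "integrable lborel (\<lambda>x. \<Prod>i\<in>UNIV. f i (x $ i))"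
    unfolding lborel_vec_eq_distr_PiM
    by (subst integrable_distr_eq) (auto intro!: product_integrable_prod int)
  show "(\<integral>x. (\<Prod>i\<in>UNIV. f i (x $ i)) \<partial>lborel) = (\<Prod>i\<in>UNIV. \<integral>t. f i t \<partial>lborel)"
    unfolding lborel_vec_eq_distr_PiM
    by (subst integral_distr) (auto intro!: product_integral_prod int)
qed


section \<open>Normalized Hermite polynomials in Gaussian \<open>L\<^sup>2\<close>\<close>

text \<open>The squared norm of \<open>hermite \<xi>\<close> in Gaussian \<open>L\<^sup>2\<close>.\<close>

definition hermite_sq :: "nat ^ 'n \<Rightarrow> real" where
  "hermite_sq \<xi> = 2 ^ mi_abs \<xi> * real (mi_fact \<xi>)"

text \<open>The normalized Hermite polynomials as real-valued functions, see \<open>nhermite_eq_hn\<close>.\<close>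

definition hn :: "nat ^ 'n \<Rightarrow> real ^ 'n \<Rightarrow> real" where
  "hn \<xi> x = hermite \<xi> x / sqrt (hermite_sq \<xi>)"

definition gauss_density :: "real ^ 'n \<Rightarrow> real" where
  "gauss_density x = pi powr (- real CARD('n) / 2) * exp (- (norm x)\<^sup>2)"

lemma hermite_sq_pos [simp]: "hermite_sq \<xi> > 0"
  by (simp add: hermite_sq_def mi_fact_def prod_pos)

lemma hermite_sq_nonneg [simp]: "hermite_sq \<xi> \<ge> 0"
  using hermite_sq_pos[of \<xi>] by linarith

lemma hermite_sq_neq_0 [simp]: "hermite_sq \<xi> \<noteq> 0"
  using hermite_sq_pos[of \<xi>] by linarith

lemma hermite_sq_eq_prod: "hermite_sq \<xi> = (\<Prod>i\<in>UNIV. 2 ^ (\<xi> $ i) * fact (\<xi> $ i))"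
  unfolding hermite_sq_def mi_fact_def mi_abs_def prod.distrib power_sum of_nat_prod by simp

lemma nhermite_eq_hn: "nhermite \<xi> x = complex_of_real (hn \<xi> x)"
proof -
  have "hermite_sq \<xi> powr (- 1 / 2) = 1 / sqrt (hermite_sq \<xi>)"
    using powr_minus[of "hermite_sq \<xi>" "1/2"] powr_half_sqrt[of "hermite_sq \<xi>"] hermite_sq_pos[of \<xi>]
    by (simp add: inverse_eq_divide less_imp_le)
  then show ?thesis
    unfolding nhermite_def hn_def hermite_sq_def[symmetric] by simp
qed

lemma gauss_density_pos [simp]: "gauss_density x > 0"
  by (simp add: gauss_density_def)

lemma gauss_density_nonneg [simp]: "gauss_density x \<ge> 0"
  by (simp add: less_imp_le)

lemma gauss_density_eq_prod: "gauss_density x = (\<Prod>i\<in>UNIV. exp (- (x $ i)\<^sup>2) / sqrt pi)"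
proof -
  have "pi powr (- real CARD('a) / 2) = (1 / sqrt pi) ^ CARD('a)"
  proof -
    have "1 / sqrt pi = pi powr (- 1 / 2)"
      by (simp add: powr_minus powr_half_sqrt inverse_eq_divide)
    then have "(1 / sqrt pi) ^ CARD('a) = (pi powr (- 1 / 2)) powr real CARD('a)"
      by (simp add: powr_realpow)
    then show ?thesis by (simp add: powr_powr)
  qed
  moreover have "exp (- (norm x)\<^sup>2) = (\<Prod>i\<in>UNIV. exp (- (x $ i)\<^sup>2))"
    by (simp add: norm_vec_def L2_set_def sum_nonneg exp_sum[symmetric] sum_negf)
  ultimately show ?thesis
    by (simp add: gauss_density_def prod_dividef power_divide)
qed

lemma continuous_gauss_density [continuous_intros]:
  "continuous_on S f \<Longrightarrow> continuous_on S (\<lambda>x. gauss_density (f x))"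
  unfolding gauss_density_def by (intro continuous_intros)

lemma continuous_hermite [continuous_intros]:
  "continuous_on S f \<Longrightarrow> continuous_on S (\<lambda>x. hermite \<xi> (f x))"
  unfolding hermite_def by (intro continuous_intros)

lemma continuous_hn [continuous_intros]:
  "continuous_on S f \<Longrightarrow> continuous_on S (\<lambda>x. hn \<xi> (f x))"
  unfolding hn_def by (intro continuous_intros) simp_all

lemma measurable_gauss_density [measurable]: "gauss_density \<in> borel_measurable borel"
  using continuous_gauss_density[of UNIV "\<lambda>x. x"] by (intro borel_measurable_continuous_onI) simp

lemma measurable_hermite [measurable]: "hermite \<xi> \<in> borel_measurable borel"
  using continuous_hermite[of UNIV "\<lambda>x. x" \<xi>] by (intro borel_measurable_continuous_onI) simp

lemma measurable_hn [measurable]: "hn \<xi> \<in> borel_measurable borel"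
  using continuous_hn[of UNIV "\<lambda>x. x" \<xi>] by (intro borel_measurable_continuous_onI) simp

lemma measurable_hn_lebesgue [measurable]: "hn \<xi> \<in> borel_measurable lebesgue"
  by (simp add: measurable_completion)

lemma measurable_gauss_density_lebesgue [measurable]: "gauss_density \<in> borel_measurable lebesgue"
  by (simp add: measurable_completion)

lemma gauss_measure_eq: "gauss_measure = density lebesgue (\<lambda>x. ennreal (gauss_density x))"
  by (simp add: gauss_measure_def gauss_density_def)

lemma sets_gauss_measure [measurable_cong, simp]: "sets gauss_measure = sets lebesgue"
  by (simp add: gauss_measure_def)

lemma space_gauss_measure [simp]: "space gauss_measure = UNIV"
  by (simp add: gauss_measure_def)

lemma measurable_gauss_measure [simp]: "borel_measurable gauss_measure = borel_measurable lebesgue"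
  by (rule measurable_cong_sets) auto

lemma AE_gauss_measure: "(AE x in gauss_measure. P x) \<longleftrightarrow> (AE x in lebesgue. P x)"
  unfolding gauss_measure_eq by (subst AE_density) auto

lemma nn_integral_gauss:
  assumes "f \<in> borel_measurable lebesgue"
  shows "(\<integral>\<^sup>+x. f x \<partial>gauss_measure) = (\<integral>\<^sup>+x. ennreal (gauss_density x) * f x \<partial>lebesgue)"
  unfolding gauss_measure_eq using assms by (intro nn_integral_density) auto

lemma nn_integral_gauss_lborel:
  assumes "f \<in> borel_measurable borel"
  shows "(\<integral>\<^sup>+x. f x \<partial>gauss_measure) = (\<integral>\<^sup>+x. ennreal (gauss_density x) * f x \<partial>lborel)"
  using assms by (subst nn_integral_gauss) (auto simp: nn_integral_completion measurable_completion)

lemma integrable_gauss_lborel_iff: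
  fixes f :: "real ^ 'n \<Rightarrow> 'b::{banach, second_countable_topology}"
  assumes [measurable]: "f \<in> borel_measurable borel"
  shows "integrable gauss_measure f \<longleftrightarrow> integrable lborel (\<lambda>x. gauss_density x *\<^sub>R f x)"
  unfolding gauss_measure_eq
  by (subst integrable_density) (auto simp: integrable_completion measurable_completion)

lemma integral_gauss_lborel:
  fixes f :: "real ^ 'n \<Rightarrow> 'b::{banach, second_countable_topology}"
  assumes [measurable]: "f \<in> borel_measurable borel"
  shows "(\<integral>x. f x \<partial>gauss_measure) = (\<integral>x. gauss_density x *\<^sub>R f x \<partial>lborel)"
  unfolding gauss_measure_eq
  by (subst integral_density) (auto simp: integral_completion measurable_completion)

lemma
  shows integrable_hermite_mult: "integrable gauss_measure (\<lambda>x. hermite \<xi> x * hermite \<eta> x)"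
    and integral_hermite_mult:
      "(\<integral>x. hermite \<xi> x * hermite \<eta> x \<partial>gauss_measure) = (if \<xi> = \<eta> then hermite_sq \<xi> else 0)"
proof -
  let ?f = "\<lambda>i t. hermite1 (\<xi> $ i) t * hermite1 (\<eta> $ i) t * exp (- t\<^sup>2) / sqrt pi"
  have eq: "gauss_density x *\<^sub>R (hermite \<xi> x * hermite \<eta> x) = (\<Prod>i\<in>UNIV. ?f i (x $ i))" for x
    by (simp add: gauss_density_eq_prod hermite_def prod.distrib prod_dividef)
  have int: "integrable lborel (?f i)" for i
    by (intro integrable_divide integrable_hermite1_mult)
  show "integrable gauss_measure (\<lambda>x. hermite \<xi> x * hermite \<eta> x)"
    by (subst integrable_gauss_lborel_iff) (auto simp only: eq intro!: integrable_prod_vec int, measurable)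
  have "(\<integral>x. hermite \<xi> x * hermite \<eta> x \<partial>gauss_measure) = (\<Prod>i\<in>UNIV. \<integral>t. ?f i t \<partial>lborel)"
    by (subst integral_gauss_lborel) (auto simp only: eq integral_prod_vec[OF int], measurable)
  also have "\<dots> = (\<Prod>i\<in>UNIV. if \<xi> $ i = \<eta> $ i then 2 ^ (\<xi> $ i) * fact (\<xi> $ i) else 0)"
    by (intro prod.cong) (auto simp: integral_hermite1)
  also have "\<dots> = (if \<xi> = \<eta> then hermite_sq \<xi> else 0)"
    by (auto simp: hermite_sq_eq_prod vec_eq_iff)
  finally show "(\<integral>x. hermite \<xi> x * hermite \<eta> x \<partial>gauss_measure) = (if \<xi> = \<eta> then hermite_sq \<xi> else 0)" .
qed

lemma
  shows integrable_hn_mult: "integrable gauss_measure (\<lambda>x. hn \<xi> x * hn \<eta> x)"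
    and integral_hn_mult: "(\<integral>x. hn \<xi> x * hn \<eta> x \<partial>gauss_measure) = (if \<xi> = \<eta> then 1 else 0)"
proof -
  have eq: "hn \<xi> x * hn \<eta> x = hermite \<xi> x * hermite \<eta> x / (sqrt (hermite_sq \<xi>) * sqrt (hermite_sq \<eta>))" for x
    by (simp add: hn_def)
  show "integrable gauss_measure (\<lambda>x. hn \<xi> x * hn \<eta> x)"
    unfolding eq by (intro integrable_divide integrable_hermite_mult)
  show "(\<integral>x. hn \<xi> x * hn \<eta> x \<partial>gauss_measure) = (if \<xi> = \<eta> then 1 else 0)"
    unfolding eq by (auto simp: integral_hermite_mult)
qed

lemma cmod_sum_real_sq:
  fixes c :: "'i \<Rightarrow> complex" and h :: "'i \<Rightarrow> real"
  shows "(cmod (\<Sum>s\<in>S. c s * h s))\<^sup>2 = (\<Sum>s\<in>S. \<Sum>t\<in>S. Re (c s * cnj (c t)) * (h s * h t))"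
proof -
  have "complex_of_real ((cmod (\<Sum>s\<in>S. c s * h s))\<^sup>2) = (\<Sum>s\<in>S. c s * h s) * cnj (\<Sum>s\<in>S. c s * h s)"
    by (rule complex_norm_square)
  also have "\<dots> = (\<Sum>s\<in>S. \<Sum>t\<in>S. (c s * cnj (c t)) * complex_of_real (h s * h t))"
    by (simp add: sum_product algebra_simps)
  finally have "Re (complex_of_real ((cmod (\<Sum>s\<in>S. c s * h s))\<^sup>2)) = (\<Sum>s\<in>S. \<Sum>t\<in>S. Re ((c s * cnj (c t)) * complex_of_real (h s * h t)))"
    by (simp only: Re_sum)
  moreover have "Re (z * complex_of_real r) = Re z * r" for z r by simp
  ultimately show ?thesis by (simp only: Re_complex_of_real)
qed

text \<open>The reindexing \<open>f\<close> is there for sums of shifted polynomials \<open>hn (\<xi> + v)\<close>.\<close>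

lemma
  fixes c :: "'i \<Rightarrow> complex"
  assumes "finite S" "inj_on f S"
  shows integrable_hn_sum: "integrable gauss_measure (\<lambda>x. (cmod (\<Sum>s\<in>S. c s * hn (f s) x))\<^sup>2)"
    and integral_hn_sum: "(\<integral>x. (cmod (\<Sum>s\<in>S. c s * hn (f s) x))\<^sup>2 \<partial>gauss_measure) = (\<Sum>s\<in>S. (cmod (c s))\<^sup>2)"
proof -
  show "integrable gauss_measure (\<lambda>x. (cmod (\<Sum>s\<in>S. c s * hn (f s) x))\<^sup>2)"
    unfolding cmod_sum_real_sq
    by (intro Bochner_Integration.integrable_sum integrable_mult_right integrable_hn_mult)
  have "(\<integral>x. (cmod (\<Sum>s\<in>S. c s * hn (f s) x))\<^sup>2 \<partial>gauss_measure)
      = (\<Sum>s\<in>S. \<Sum>t\<in>S. Re (c s * cnj (c t)) * (if f s = f t then 1 else 0))"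
    unfolding cmod_sum_real_sq
    by (subst Bochner_Integration.integral_sum
        | (intro Bochner_Integration.integrable_sum integrable_mult_right integrable_hn_mult; fail)
        | rule sum.cong refl)+ (simp add: integral_hn_mult)
  also have "\<dots> = (\<Sum>s\<in>S. \<Sum>t\<in>S. if s = t then (cmod (c s))\<^sup>2 else 0)"
    using assms by (intro sum.cong refl) (auto simp: inj_on_def cmod_power2, simp add: power2_eq_square)
  also have "\<dots> = (\<Sum>s\<in>S. (cmod (c s))\<^sup>2)"
    using assms by simp
  finally show "(\<integral>x. (cmod (\<Sum>s\<in>S. c s * hn (f s) x))\<^sup>2 \<partial>gauss_measure) = (\<Sum>s\<in>S. (cmod (c s))\<^sup>2)" .
qed

lemma nn_integral_hn_sum:
  fixes c :: "'i \<Rightarrow> complex"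
  assumes "finite S" "inj_on f S"
  shows "(\<integral>\<^sup>+x. ennreal ((cmod (\<Sum>s\<in>S. c s * hn (f s) x))\<^sup>2) \<partial>gauss_measure) = ennreal (\<Sum>s\<in>S. (cmod (c s))\<^sup>2)"
  using assms by (subst nn_integral_eq_integral) (auto simp: integrable_hn_sum integral_hn_sum)

section \<open>Extension from the Hermite span\<close>

lemma finite_mi_abs_le: "finite {\<xi> :: nat ^ 'n. mi_abs \<xi> \<le> N}"
proof -
  have "\<xi> $ i \<le> mi_abs \<xi>" for \<xi> :: "nat ^ 'n" and i
    unfolding mi_abs_def by (rule member_le_sum) auto
  then have "vec_nth ` {\<xi> :: nat ^ 'n. mi_abs \<xi> \<le> N} \<subseteq> PiE UNIV (\<lambda>_. {..N})"
    by (fastforce intro: order_trans)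
  then have "finite (vec_nth ` {\<xi> :: nat ^ 'n. mi_abs \<xi> \<le> N})"
    by (rule finite_subset) (auto intro!: finite_PiE)
  then show ?thesis by (rule finite_imageD) (auto simp: inj_on_def vec_nth_inject)
qed

text \<open>Riesz--Fischer: a subsequence whose squared increments decay like \<open>4\<^sup>-\<^sup>k\<close> converges almost
  everywhere, and Fatou's lemma identifies its pointwise limit as the limit in \<open>L\<^sup>2\<close>.\<close>

lemma L2_Cauchy_limit:
  fixes G :: "nat \<Rightarrow> 'a \<Rightarrow> complex" and \<epsilon> :: "nat \<Rightarrow> real"
  assumes meas [measurable]: "\<And>k. G k \<in> borel_measurable M"
    and Cauchy: "\<And>N m. N \<le> m \<Longrightarrow> (\<integral>\<^sup>+x. ennreal ((cmod (G m x - G N x))\<^sup>2) \<partial>M) \<le> ennreal (\<epsilon> N)"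
    and lim: "\<epsilon> \<longlonglongrightarrow> 0"
  shows "\<exists>g\<in>borel_measurable M. \<forall>N. (\<integral>\<^sup>+x. ennreal ((cmod (g x - G N x))\<^sup>2) \<partial>M) \<le> ennreal (\<epsilon> N)"
proof -
  have "\<forall>k. \<exists>N. \<forall>n\<ge>N. \<epsilon> n \<le> (1/4) ^ k"
    using order_tendstoD(2)[OF lim, of "(1/4) ^ _"] by (simp add: eventually_sequentially) (meson less_imp_le)
  then obtain N0 where N0: "\<And>k n. n \<ge> N0 k \<Longrightarrow> \<epsilon> n \<le> (1/4) ^ k" by metis
  define r where "r k = k + (\<Sum>i\<le>k. N0 i)" for k
  have r_Suc: "r k \<le> r (Suc k)" for k by (simp add: r_def)
  have r_ge: "k \<le> r k" for k by (simp add: r_def)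
  have r_N0: "N0 k \<le> r k" for k
    unfolding r_def by (rule trans_le_add2) (rule member_le_sum; simp)
  define d where "d k x = (cmod (G (r (Suc k)) x - G (r k) x))\<^sup>2" for k x
  have [measurable]: "d k \<in> borel_measurable M" for k unfolding d_def by measurable
  have "(\<integral>\<^sup>+x. (\<Sum>k. ennreal (2 ^ k * d k x)) \<partial>M) = (\<Sum>k. \<integral>\<^sup>+x. ennreal (2 ^ k * d k x) \<partial>M)"
    by (rule nn_integral_suminf) simp
  also have "\<dots> \<le> (\<Sum>k. ennreal ((1/2) ^ k))"
  proof (rule suminf_le)
    fix k
    have "(\<integral>\<^sup>+x. ennreal (2 ^ k * d k x) \<partial>M) = ennreal (2 ^ k) * (\<integral>\<^sup>+x. ennreal (d k x) \<partial>M)"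
      by (subst nn_integral_cmult[symmetric]) (auto simp: ennreal_mult d_def)
    also have "\<dots> \<le> ennreal (2 ^ k) * ennreal ((1/4) ^ k)"
      unfolding d_def using Cauchy[OF r_Suc[of k]] N0[OF r_N0[of k]]
      by (intro mult_left_mono) (auto intro: order_trans ennreal_leI)
    also have "\<dots> = ennreal ((1/2) ^ k)"
      by (simp add: ennreal_mult[symmetric] power_mult_distrib[symmetric])
    finally show "(\<integral>\<^sup>+x. ennreal (2 ^ k * d k x) \<partial>M) \<le> ennreal ((1/2) ^ k)" .
  qed auto
  also have "\<dots> = ennreal (\<Sum>k. (1/2) ^ k)"
    by (rule suminf_ennreal2) (auto simp: summable_geometric)
  finally have "(\<integral>\<^sup>+x. (\<Sum>k. ennreal (2 ^ k * d k x)) \<partial>M) \<noteq> \<infinity>"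
    by (auto simp: top_unique)
  then have "AE x in M. (\<Sum>k. ennreal (2 ^ k * d k x)) \<noteq> \<infinity>"
    by (intro nn_integral_PInf_AE) auto
  then have conv: "AE x in M. convergent (\<lambda>k. G (r k) x)"
  proof eventually_elim
    case (elim x)
    then have "summable (\<lambda>k. 2 ^ k * d k x)"
      by (intro summable_suminf_not_top) (auto simp: d_def)
    then have "Bseq (\<lambda>k. 2 ^ k * d k x)"
      using summable_LIMSEQ_zero convergentI convergent_imp_Bseq by blast
    then obtain K where K: "K > 0" "\<And>k. norm (2 ^ k * d k x) \<le> K" by (auto elim: BseqE)
    have bound: "norm (G (r (Suc k)) x - G (r k) x) \<le> sqrt K * (1 / sqrt 2) ^ k" for k
    proof (rule power2_le_imp_le)
      have "2 ^ k * d k x \<le> K" using K(2)[of k] by (simp add: d_def)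
      then have "d k x \<le> K / 2 ^ k" by (simp add: field_simps)
      then show "(norm (G (r (Suc k)) x - G (r k) x))\<^sup>2 \<le> (sqrt K * (1 / sqrt 2) ^ k)\<^sup>2"
        using K(1) by (simp add: d_def power_mult_distrib power_divide power_commutes flip: power_mult)
          (simp add: power_mult mult.commute[of k])
    qed (use K(1) in simp)
    have "summable (\<lambda>k. G (r (Suc k)) x - G (r k) x)"
      by (rule summable_comparison_test'[where N = 0, OF _ bound]) (auto intro!: summable_mult summable_geometric)
    then have "convergent (\<lambda>n. \<Sum>k<n. G (r (Suc k)) x - G (r k) x)"
      by (simp add: summable_iff_convergent)
    then have "convergent (\<lambda>n. (G (r n) x - G (r 0) x) + G (r 0) x)"
      by (intro convergent_add convergent_const) (simp add: sum_lessThan_telescope[of "\<lambda>k. G (r k) x"])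
    then show ?case by simp
  qed
  define g where "g x = lim (\<lambda>k. G (r k) x)" for x
  have g [measurable]: "g \<in> borel_measurable M"
    unfolding g_def by (rule borel_measurable_lim_metric) auto
  have "(\<integral>\<^sup>+x. ennreal ((cmod (g x - G N x))\<^sup>2) \<partial>M) \<le> ennreal (\<epsilon> N)" for N
  proof -
    have "AE x in M. ennreal ((cmod (g x - G N x))\<^sup>2) = liminf (\<lambda>k. ennreal ((cmod (G (r k) x - G N x))\<^sup>2))"
      using conv
    proof eventually_elim
      case (elim x)
      then have "(\<lambda>k. G (r k) x) \<longlonglongrightarrow> g x" by (simp add: g_def convergent_LIMSEQ_iff)
      then have "(\<lambda>k. ennreal ((cmod (G (r k) x - G N x))\<^sup>2)) \<longlonglongrightarrow> ennreal ((cmod (g x - G N x))\<^sup>2)"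
        by (intro tendsto_intros)
      then show ?case by (rule lim_imp_Liminf[rotated, symmetric]) simp
    qed
    then have "(\<integral>\<^sup>+x. ennreal ((cmod (g x - G N x))\<^sup>2) \<partial>M) = (\<integral>\<^sup>+x. liminf (\<lambda>k. ennreal ((cmod (G (r k) x - G N x))\<^sup>2)) \<partial>M)"
      by (rule nn_integral_cong_AE)
    also have "\<dots> \<le> liminf (\<lambda>k. \<integral>\<^sup>+x. ennreal ((cmod (G (r k) x - G N x))\<^sup>2) \<partial>M)"
      by (rule nn_integral_liminf) simp
    also have "\<dots> \<le> liminf (\<lambda>k. ennreal (\<epsilon> N))"
      by (rule Liminf_mono)
        (auto simp: eventually_sequentially intro!: exI[of _ N] Cauchy order_trans[OF _ r_ge])
    finally show ?thesis by (simp add: Liminf_const)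
  qed
  with g show ?thesis by blast
qed

lemma integrable_L2_mult:
  fixes f g :: "'a \<Rightarrow> complex"
  assumes [measurable]: "f \<in> borel_measurable M" "g \<in> borel_measurable M"
    and "integrable M (\<lambda>x. (cmod (f x))\<^sup>2)" "integrable M (\<lambda>x. (cmod (g x))\<^sup>2)"
  shows "integrable M (\<lambda>x. f x * g x)"
proof (rule Bochner_Integration.integrable_bound)
  show "integrable M (\<lambda>x. (cmod (f x))\<^sup>2 + (cmod (g x))\<^sup>2)"
    using assms by (intro Bochner_Integration.integrable_add)
  have "a * b \<le> a\<^sup>2 + b\<^sup>2" if "a \<ge> 0" "b \<ge> 0" for a b :: real
  proof -
    have "2 * (a * b) \<le> a\<^sup>2 + b\<^sup>2" using sum_squares_bound[of a b] by simp
    moreover have "0 \<le> a * b" using that by simp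
    ultimately show ?thesis by linarith
  qed
  then show "AE x in M. norm (f x * g x) \<le> norm ((cmod (f x))\<^sup>2 + (cmod (g x))\<^sup>2)"
    by (intro AE_I2) (simp add: norm_mult)
qed simp

lemma in_L2_hn_sum:
  fixes c :: "nat ^ 'n \<Rightarrow> complex"
  assumes "finite S" shows "in_L2 gauss_measure (\<lambda>x. \<Sum>\<xi>\<in>S. c \<xi> * hn \<xi> x)"
  unfolding in_L2_def using assms integrable_hn_sum[of S "\<lambda>\<xi>. \<xi>" c] by (auto simp: inj_on_def)

lemma integrable_hn_L2:
  assumes "in_L2 gauss_measure f"
  shows "integrable gauss_measure (\<lambda>x. f x * complex_of_real (hn \<xi> x))"
  using assms in_L2_hn_sum[of "{\<xi>}" "\<lambda>_. 1"]
  by (intro integrable_L2_mult) (auto simp: in_L2_def)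

lemma Bessel_gauss:
  assumes f: "in_L2 gauss_measure f" and S: "finite S"
  shows "(\<Sum>\<xi>\<in>S. (cmod (gauss_pairing f (nhermite \<xi>)))\<^sup>2) \<le> (\<integral>x. (cmod (f x))\<^sup>2 \<partial>gauss_measure)"
proof -
  define c where "c \<xi> = gauss_pairing f (nhermite \<xi>)" for \<xi>
  define p where "p x = (\<Sum>\<xi>\<in>S. c \<xi> * hn \<xi> x)" for x
  have fp_eq: "f x * cnj (p x) = (\<Sum>\<xi>\<in>S. cnj (c \<xi>) * (f x * hn \<xi> x))" for x
    by (simp add: p_def sum_distrib_left algebra_simps)
  have fp: "integrable gauss_measure (\<lambda>x. f x * cnj (p x))"
    unfolding fp_eq by (intro Bochner_Integration.integrable_sum integrable_mult_right integrable_hn_L2 f)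
  have "(\<integral>x. f x * cnj (p x) \<partial>gauss_measure) = (\<Sum>\<xi>\<in>S. cnj (c \<xi>) * c \<xi>)"
    unfolding fp_eq
    by (subst Bochner_Integration.integral_sum)
      (auto intro!: integrable_mult_right integrable_hn_L2 f simp: c_def gauss_pairing_def nhermite_eq_hn)
  also have "\<dots> = complex_of_real (\<Sum>\<xi>\<in>S. (cmod (c \<xi>))\<^sup>2)"
    by (simp only: complex_norm_square mult.commute of_real_sum)
  finally have fp_int: "(\<integral>x. Re (f x * cnj (p x)) \<partial>gauss_measure) = (\<Sum>\<xi>\<in>S. (cmod (c \<xi>))\<^sup>2)"
    by (subst integral_Re[OF fp]) simp
  have sq: "(cmod (f x - p x))\<^sup>2 = (cmod (f x))\<^sup>2 - 2 * Re (f x * cnj (p x)) + (cmod (p x))\<^sup>2" for x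
    unfolding cmod_power2 by (simp add: power2_eq_square algebra_simps)
  have int_f: "integrable gauss_measure (\<lambda>x. (cmod (f x))\<^sup>2)" using f by (simp add: in_L2_def)
  have int_p: "integrable gauss_measure (\<lambda>x. (cmod (p x))\<^sup>2)"
    and p: "(\<integral>x. (cmod (p x))\<^sup>2 \<partial>gauss_measure) = (\<Sum>\<xi>\<in>S. (cmod (c \<xi>))\<^sup>2)"
    unfolding p_def using integrable_hn_sum[of S "\<lambda>\<xi>. \<xi>" c] integral_hn_sum[of S "\<lambda>\<xi>. \<xi>" c] S
    by (auto simp: inj_on_def)
  have "0 \<le> (\<integral>x. (cmod (f x - p x))\<^sup>2 \<partial>gauss_measure)" by simp
  also have "\<dots> = (\<integral>x. (cmod (f x))\<^sup>2 \<partial>gauss_measure) - 2 * (\<integral>x. Re (f x * cnj (p x)) \<partial>gauss_measure)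
      + (\<integral>x. (cmod (p x))\<^sup>2 \<partial>gauss_measure)"
    unfolding sq using int_f int_p integrable_Re[OF fp] by (simp del: times_complex.sel)
  finally show ?thesis
    unfolding fp_int p c_def by simp
qed

lemma gauss_pairing_linear:
  assumes "in_L2 gauss_measure f" "in_L2 gauss_measure g"
  shows "gauss_pairing (\<lambda>x. a * f x + b * g x) (nhermite \<xi>)
    = a * gauss_pairing f (nhermite \<xi>) + b * gauss_pairing g (nhermite \<xi>)"
proof -
  have "gauss_pairing (\<lambda>x. a * f x + b * g x) (nhermite \<xi>)
     = (\<integral>x. a * (f x * hn \<xi> x) + b * (g x * hn \<xi> x) \<partial>gauss_measure)"
    by (simp add: gauss_pairing_def nhermite_eq_hn algebra_simps)
  then show ?thesis
    using assms[THEN integrable_hn_L2, of \<xi>] by (simp add: gauss_pairing_def nhermite_eq_hn)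
qed

lemma in_L2_linear:
  assumes "in_L2 M f" "in_L2 M g"
  shows "in_L2 M (\<lambda>x. a * f x + b * g x)"
  unfolding in_L2_def
proof
  have [measurable]: "f \<in> borel_measurable M" "g \<in> borel_measurable M"
    using assms by (auto simp: in_L2_def)
  show m: "(\<lambda>x. a * f x + b * g x) \<in> borel_measurable M" by measurable
  show "integrable M (\<lambda>x. (cmod (a * f x + b * g x))\<^sup>2)"
  proof (rule Bochner_Integration.integrable_bound)
    show "integrable M (\<lambda>x. 2 * ((cmod a)\<^sup>2 * (cmod (f x))\<^sup>2) + 2 * ((cmod b)\<^sup>2 * (cmod (g x))\<^sup>2))"
      using assms by (intro Bochner_Integration.integrable_add integrable_mult_right) (auto simp: in_L2_def)
    have "(cmod (z + w))\<^sup>2 \<le> 2 * (cmod z)\<^sup>2 + 2 * (cmod w)\<^sup>2" for z w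
      using power_mono[OF norm_triangle_ineq[of z w], of 2] sum_squares_bound[of "cmod z" "cmod w"]
      by (simp add: power2_sum)
    from this[of "a * f _" "b * g _"]
    show "AE x in M. norm ((cmod (a * f x + b * g x))\<^sup>2)
      \<le> norm (2 * ((cmod a)\<^sup>2 * (cmod (f x))\<^sup>2) + 2 * ((cmod b)\<^sup>2 * (cmod (g x))\<^sup>2))"
      by (intro AE_I2) (simp add: norm_mult power_mult_distrib)
  qed simp
qed

lemma gauss_pairing_hn_sum:
  assumes "finite S"
  shows "gauss_pairing (\<lambda>x. \<Sum>\<xi>\<in>S. c \<xi> * nhermite \<xi> x) (nhermite \<eta>) = (if \<eta> \<in> S then c \<eta> else 0)"
proof -
  have int: "integrable gauss_measure (\<lambda>x. complex_of_real (hn \<xi> x * hn \<eta> x))" for \<xi>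
    using integrable_hn_mult[of \<xi> \<eta>] by (simp only: complex_of_real_integrable_eq)
  have "gauss_pairing (\<lambda>x. \<Sum>\<xi>\<in>S. c \<xi> * nhermite \<xi> x) (nhermite \<eta>)
    = (\<integral>x. (\<Sum>\<xi>\<in>S. c \<xi> * complex_of_real (hn \<xi> x * hn \<eta> x)) \<partial>gauss_measure)"
    by (simp add: gauss_pairing_def nhermite_eq_hn sum_distrib_right mult.assoc)
  also have "\<dots> = (\<Sum>\<xi>\<in>S. c \<xi> * complex_of_real (\<integral>x. hn \<xi> x * hn \<eta> x \<partial>gauss_measure))"
    by (subst Bochner_Integration.integral_sum)
      (auto intro!: integrable_mult_right int sum.cong simp del: of_real_mult)
  also have "\<dots> = (\<Sum>\<xi>\<in>S. if \<xi> = \<eta> then c \<xi> else 0)"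
    by (intro sum.cong) (auto simp: integral_hn_mult)
  finally show ?thesis using assms by simp
qed

lemma pseudo_multiplier_hn_sum:
  assumes "finite S"
  shows "pseudo_multiplier \<sigma> (\<lambda>x. \<Sum>\<xi>\<in>S. c \<xi> * nhermite \<xi> x) x = (\<Sum>\<xi>\<in>S. c \<xi> * \<sigma> x \<xi> * hn \<xi> x)"
proof -
  have "pseudo_multiplier \<sigma> (\<lambda>x. \<Sum>\<xi>\<in>S. c \<xi> * nhermite \<xi> x) x
     = (\<Sum>\<^sub>\<infinity>\<xi>\<in>S. \<sigma> x \<xi> * c \<xi> * nhermite \<xi> x)"
    unfolding pseudo_multiplier_def using assms
    by (intro infsum_cong_neutral) (auto simp: gauss_pairing_hn_sum)
  then show ?thesis using assms by (simp add: nhermite_eq_hn mult.commute)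
qed

text \<open>The estimate to which the theorem reduces. It is an abbreviation, since every use of it
  works with \<open>C\<close> and the sums directly.\<close>

abbreviation bounded_on_hermite_sums :: "(real ^ 'n \<Rightarrow> nat ^ 'n \<Rightarrow> complex) \<Rightarrow> bool" where
  "bounded_on_hermite_sums \<sigma> \<equiv> \<exists>C\<ge>0. \<forall>S c. finite S \<longrightarrow>
      (\<integral>\<^sup>+x. ennreal ((cmod (\<Sum>\<xi>\<in>S. c \<xi> * \<sigma> x \<xi> * hn \<xi> x))\<^sup>2) \<partial>gauss_measure) \<le> ennreal (C * (\<Sum>\<xi>\<in>S. (cmod (c \<xi>))\<^sup>2))"

text \<open>The extension sends \<open>f\<close> to the \<open>L\<^sup>2\<close> limit of the images of its partial Hermite sums.
  By Bessel's inequality the squared coefficients of \<open>f\<close> are summable, so these images form a Cauchy sequence.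
  The operator so defined depends on \<open>f\<close> only through its Hermite coefficients, and the partial sums of
  an element of the span are eventually constant.\<close>

lemma extends_to_bounded_L2_if_bounded_on_sums:
  fixes \<sigma> :: "real ^ 'n \<Rightarrow> nat ^ 'n \<Rightarrow> complex"
  assumes meas: "\<And>\<xi>. (\<lambda>x. \<sigma> x \<xi>) \<in> borel_measurable lebesgue"
    and bounded: "bounded_on_hermite_sums \<sigma>"
  shows "extends_to_bounded_L2 gauss_measure hermite_span (pseudo_multiplier \<sigma>)"
proof -
  obtain B where B: "B \<ge> 0" and bound: "\<And>S c. finite S \<Longrightarrow>
      (\<integral>\<^sup>+x. ennreal ((cmod (\<Sum>\<xi>\<in>S. c \<xi> * \<sigma> x \<xi> * hn \<xi> x))\<^sup>2) \<partial>gauss_measure) \<le> ennreal (B * (\<Sum>\<xi>\<in>S. (cmod (c \<xi>))\<^sup>2))"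
    using bounded by blast
  note [measurable] = meas
  let ?M = "gauss_measure :: (real ^ 'n) measure"
  define F :: "nat \<Rightarrow> (nat ^ 'n) set" where "F N = {\<xi>. mi_abs \<xi> \<le> N}" for N
  have F [simp]: "finite (F N)" for N by (simp add: F_def finite_mi_abs_le)
  have F_mono: "N \<le> m \<Longrightarrow> F N \<subseteq> F m" for N m by (auto simp: F_def)
  define a :: "(real ^ 'n \<Rightarrow> complex) \<Rightarrow> nat ^ 'n \<Rightarrow> complex"
    where "a f \<xi> = gauss_pairing f (nhermite \<xi>)" for f \<xi>
  define G where "G c N x = (\<Sum>\<xi>\<in>F N. c \<xi> * \<sigma> x \<xi> * hn \<xi> x)" for c N x
  have [measurable]: "G c N \<in> borel_measurable lebesgue" for c N
    unfolding G_def by measurable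
  define E where "E c g N = (\<integral>\<^sup>+x. ennreal ((cmod (g x - G c N x))\<^sup>2) \<partial>?M)" for c g N
  define P where "P c g \<longleftrightarrow> g \<in> borel_measurable lebesgue \<and> (E c g \<longlonglongrightarrow> 0)" for c g
  define T where "T f = (SOME g. P (a f) g)" for f
  have G_bound: "(\<integral>\<^sup>+x. ennreal ((cmod (G (a f) N x))\<^sup>2) \<partial>?M) \<le> ennreal (B * (\<integral>x. (cmod (f x))\<^sup>2 \<partial>?M))"
    if "in_L2 ?M f" for f N
    unfolding G_def using Bessel_gauss[OF that F] B
    by (intro order_trans[OF bound] ennreal_leI mult_left_mono) (auto simp: a_def)
  have T: "P (a f) (T f)" if f: "in_L2 ?M f" for f
  proof -
    define s where "s N = (\<Sum>\<xi>\<in>F N. (cmod (a f \<xi>))\<^sup>2)" for N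
    have s_mono: "incseq s"
      unfolding s_def by (intro incseq_SucI sum_mono2 F_mono) auto
    have "s N \<le> (\<integral>x. (cmod (f x))\<^sup>2 \<partial>?M)" for N
      unfolding s_def a_def using f by (intro Bessel_gauss) auto
    then obtain L where L: "s \<longlonglongrightarrow> L" "\<And>N. s N \<le> L"
      using incseq_convergent[OF s_mono] by metis
    have "\<exists>g\<in>borel_measurable ?M. \<forall>N. (\<integral>\<^sup>+x. ennreal ((cmod (g x - G (a f) N x))\<^sup>2) \<partial>?M) \<le> ennreal (B * (L - s N))"
    proof (rule L2_Cauchy_limit)
      fix N m :: nat assume le: "N \<le> m"
      have "G (a f) m x - G (a f) N x = (\<Sum>\<xi>\<in>F m - F N. a f \<xi> * \<sigma> x \<xi> * hn \<xi> x)" for x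
        unfolding G_def using F_mono[OF le] by (simp add: sum_diff)
      then have "(\<integral>\<^sup>+x. ennreal ((cmod (G (a f) m x - G (a f) N x))\<^sup>2) \<partial>?M) \<le> ennreal (B * (\<Sum>\<xi>\<in>F m - F N. (cmod (a f \<xi>))\<^sup>2))"
        using bound[of "F m - F N" "a f"] by simp
      also have "(\<Sum>\<xi>\<in>F m - F N. (cmod (a f \<xi>))\<^sup>2) = s m - s N"
        unfolding s_def using F_mono[OF le] by (simp add: sum_diff)
      also have "ennreal (B * (s m - s N)) \<le> ennreal (B * (L - s N))"
        using L(2)[of m] B by (intro ennreal_leI mult_left_mono) auto
      finally show "(\<integral>\<^sup>+x. ennreal ((cmod (G (a f) m x - G (a f) N x))\<^sup>2) \<partial>?M) \<le> ennreal (B * (L - s N))" .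
    next
      show "(\<lambda>N. B * (L - s N)) \<longlonglongrightarrow> 0"
        using tendsto_mult[OF tendsto_const tendsto_diff[OF tendsto_const L(1)], of B L] by simp
    qed simp
    then obtain g where g: "g \<in> borel_measurable lebesgue" "\<And>N. E (a f) g N \<le> ennreal (B * (L - s N))"
      by (auto simp: E_def)
    have "(\<lambda>N. ennreal (B * (L - s N))) \<longlonglongrightarrow> ennreal 0"
      using tendsto_mult[OF tendsto_const tendsto_diff[OF tendsto_const L(1)], of B L] by (intro tendsto_ennrealI) simp
    then have "E (a f) g \<longlonglongrightarrow> 0"
      by (intro tendsto_sandwich[OF _ _ tendsto_const, of 0 "E (a f) g" _ "\<lambda>N. ennreal (B * (L - s N))"])
        (use g(2) in auto)
    then have "P (a f) g" using g by (simp add: P_def)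
    then show ?thesis unfolding T_def by (rule someI[of "P (a f)"])
  qed
  note T_meas [measurable] = T[unfolded P_def, THEN conjunct1]
  note T_lim = T[unfolded P_def, THEN conjunct2]
  have T_bound: "(\<integral>\<^sup>+x. ennreal ((cmod (T f x))\<^sup>2) \<partial>?M) \<le> ennreal (2 * (B * (\<integral>x. (cmod (f x))\<^sup>2 \<partial>?M)))"
    if f: "in_L2 ?M f" for f
  proof (rule LIMSEQ_le_const)
    let ?C = "ennreal (2 * (B * (\<integral>x. (cmod (f x))\<^sup>2 \<partial>?M)))"
    have "(\<lambda>N. 2 * E (a f) (T f) N + ?C) \<longlonglongrightarrow> 2 * 0 + ?C"
      by (intro tendsto_add tendsto_const tendsto_mult_ennreal T_lim f) auto
    then show "(\<lambda>N. 2 * E (a f) (T f) N + ?C) \<longlonglongrightarrow> ?C" by simp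
    note [measurable] = T_meas[OF f]
    have "(\<integral>\<^sup>+x. ennreal ((cmod (T f x))\<^sup>2) \<partial>?M) \<le> 2 * E (a f) (T f) N + ?C" for N
    proof -
      have "(cmod z)\<^sup>2 \<le> 2 * (cmod (z - w))\<^sup>2 + 2 * (cmod w)\<^sup>2" for z w
        using power_mono[OF norm_triangle_ineq[of "z - w" w], of 2] sum_squares_bound[of "cmod (z - w)" "cmod w"]
        by (simp add: power2_sum)
      then have "(\<integral>\<^sup>+x. ennreal ((cmod (T f x))\<^sup>2) \<partial>?M)
        \<le> (\<integral>\<^sup>+x. 2 * ennreal ((cmod (T f x - G (a f) N x))\<^sup>2) + 2 * ennreal ((cmod (G (a f) N x))\<^sup>2) \<partial>?M)"
        by (intro nn_integral_mono) (simp flip: ennreal_numeral ennreal_mult ennreal_plus)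
      also have "\<dots> = 2 * E (a f) (T f) N + 2 * (\<integral>\<^sup>+x. ennreal ((cmod (G (a f) N x))\<^sup>2) \<partial>?M)"
        unfolding E_def by (simp add: nn_integral_add nn_integral_cmult)
      also have "\<dots> \<le> 2 * E (a f) (T f) N + 2 * ennreal (B * (\<integral>x. (cmod (f x))\<^sup>2 \<partial>?M))"
        by (intro add_left_mono mult_left_mono G_bound f) auto
      also have "2 * ennreal (B * (\<integral>x. (cmod (f x))\<^sup>2 \<partial>?M)) = ?C"
        using B by (simp flip: ennreal_numeral ennreal_mult)
      finally show ?thesis .
    qed
    then show "\<exists>N. \<forall>n\<ge>N. (\<integral>\<^sup>+x. ennreal ((cmod (T f x))\<^sup>2) \<partial>?M) \<le> 2 * E (a f) (T f) n + ?C"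
      by blast
  qed
  have T_L2: "in_L2 ?M (T f)" and T_int: "(\<integral>x. (cmod (T f x))\<^sup>2 \<partial>?M) \<le> 2 * (B * (\<integral>x. (cmod (f x))\<^sup>2 \<partial>?M))"
    if f: "in_L2 ?M f" for f
  proof -
    note [measurable] = T_meas[OF f]
    have int: "integrable ?M (\<lambda>x. (cmod (T f x))\<^sup>2)"
      by (rule integrableI_bounded) (use T_bound[OF f] in \<open>auto simp: less_top[symmetric] top_unique\<close>)
    then show "in_L2 ?M (T f)" by (simp add: in_L2_def)
    have "ennreal (\<integral>x. (cmod (T f x))\<^sup>2 \<partial>?M) \<le> ennreal (2 * (B * (\<integral>x. (cmod (f x))\<^sup>2 \<partial>?M)))"
      using T_bound[OF f] int by (simp add: nn_integral_eq_integral)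
    then show "(\<integral>x. (cmod (T f x))\<^sup>2 \<partial>?M) \<le> 2 * (B * (\<integral>x. (cmod (f x))\<^sup>2 \<partial>?M))"
      using B by (subst (asm) ennreal_le_iff) auto
  qed
  \<comment> \<open>Two limits of the same sequence in the mean agree almost everywhere: this gives linearity and the extension property.\<close>
  have AE_eqI: "AE x in ?M. g x = h x"
    if [measurable]: "g \<in> borel_measurable lebesgue" "h \<in> borel_measurable lebesgue"
      and e: "e \<longlonglongrightarrow> 0" "\<And>N. (\<integral>\<^sup>+x. ennreal ((cmod (g x - h x))\<^sup>2) \<partial>?M) \<le> e N" for g h and e :: "nat \<Rightarrow> ennreal"
  proof -
    have "(\<integral>\<^sup>+x. ennreal ((cmod (g x - h x))\<^sup>2) \<partial>?M) \<le> 0"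
      using e by (intro LIMSEQ_le_const[OF e(1)]) auto
    then have "AE x in ?M. ennreal ((cmod (g x - h x))\<^sup>2) = 0"
      by (subst nn_integral_0_iff_AE[symmetric]) auto
    then show ?thesis by eventually_elim auto
  qed
  have "bounded_operator_L2 ?M T"
    unfolding bounded_operator_L2_def
  proof (intro conjI allI impI)
    show "in_L2 ?M (T f)" if "in_L2 ?M f" for f using T_L2[OF that] .
    show "AE x in ?M. T f x = T g x" if "in_L2 ?M f" "in_L2 ?M g" "AE x in ?M. f x = g x" for f g
    proof -
      have "a f = a g"
        unfolding a_def gauss_pairing_def using that
        by (intro ext integral_cong_AE) (auto simp: in_L2_def nhermite_eq_hn)
      then show ?thesis by (simp add: T_def)
    qed
    show "AE x in ?M. T (\<lambda>y. \<alpha> * f y + \<beta> * g y) x = \<alpha> * T f x + \<beta> * T g x"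
      if fg: "in_L2 ?M f" "in_L2 ?M g" for f g \<alpha> \<beta>
    proof (rule AE_eqI)
      let ?h = "\<lambda>y. \<alpha> * f y + \<beta> * g y"
      have h: "in_L2 ?M ?h" by (rule in_L2_linear[OF fg])
      note [measurable] = T_meas[OF fg(1)] T_meas[OF fg(2)] T_meas[OF h]
      show "T ?h \<in> borel_measurable lebesgue" "(\<lambda>x. \<alpha> * T f x + \<beta> * T g x) \<in> borel_measurable lebesgue"
        by measurable
      let ?e = "\<lambda>N. 3 * E (a ?h) (T ?h) N + (3 * ennreal ((cmod \<alpha>)\<^sup>2) * E (a f) (T f) N + 3 * ennreal ((cmod \<beta>)\<^sup>2) * E (a g) (T g) N)"
      have "?e \<longlonglongrightarrow> 3 * 0 + (3 * ennreal ((cmod \<alpha>)\<^sup>2) * 0 + 3 * ennreal ((cmod \<beta>)\<^sup>2) * 0)"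
        by (intro tendsto_add tendsto_mult_ennreal tendsto_const T_lim fg h) (auto simp: ennreal_mult_eq_top_iff)
      then show "?e \<longlonglongrightarrow> 0" by simp
      fix N
      have G_lin: "G (a ?h) N x = \<alpha> * G (a f) N x + \<beta> * G (a g) N x" for x
        unfolding G_def a_def gauss_pairing_linear[OF fg]
        by (simp add: sum_distrib_left sum.distrib[symmetric] algebra_simps)
      have three: "(cmod (u - (\<alpha> * v + \<beta> * w)))\<^sup>2 \<le> 3 * (cmod u)\<^sup>2 + (3 * (cmod \<alpha>)\<^sup>2 * (cmod v)\<^sup>2 + 3 * (cmod \<beta>)\<^sup>2 * (cmod w)\<^sup>2)" for u v w
      proof -
        have "cmod (u - (\<alpha> * v + \<beta> * w)) \<le> cmod u + (cmod \<alpha> * cmod v + cmod \<beta> * cmod w)"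
          by (intro order_trans[OF norm_triangle_ineq4] add_mono order_trans[OF norm_triangle_ineq]) (auto simp: norm_mult)
        then have "(cmod (u - (\<alpha> * v + \<beta> * w)))\<^sup>2 \<le> (cmod u + (cmod \<alpha> * cmod v + cmod \<beta> * cmod w))\<^sup>2"
          by (intro power_mono) auto
        also have "(x + (y + z))\<^sup>2 \<le> 3 * x\<^sup>2 + (3 * y\<^sup>2 + 3 * z\<^sup>2)" for x y z :: real
          using sum_squares_bound[of x y] sum_squares_bound[of x z] sum_squares_bound[of y z]
          by (simp add: power2_sum algebra_simps)
        finally show ?thesis by (simp only: power_mult_distrib mult.assoc)
      qed
      have "ennreal ((cmod (T ?h x - (\<alpha> * T f x + \<beta> * T g x)))\<^sup>2)
         \<le> 3 * ennreal ((cmod (T ?h x - G (a ?h) N x))\<^sup>2)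
          + (3 * ennreal ((cmod \<alpha>)\<^sup>2) * ennreal ((cmod (T f x - G (a f) N x))\<^sup>2)
           + 3 * ennreal ((cmod \<beta>)\<^sup>2) * ennreal ((cmod (T g x - G (a g) N x))\<^sup>2))" for x
      proof -
        have eq: "T ?h x - (\<alpha> * T f x + \<beta> * T g x) = (T ?h x - G (a ?h) N x) - (\<alpha> * (T f x - G (a f) N x) + \<beta> * (T g x - G (a g) N x))"
          unfolding G_lin by (simp add: algebra_simps)
        show ?thesis
          unfolding eq
          using three[of "T ?h x - G (a ?h) N x" "T f x - G (a f) N x" "T g x - G (a g) N x"]
          by (simp flip: ennreal_numeral ennreal_mult ennreal_plus)
      qed
      then have "(\<integral>\<^sup>+x. ennreal ((cmod (T ?h x - (\<alpha> * T f x + \<beta> * T g x)))\<^sup>2) \<partial>?M)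
         \<le> (\<integral>\<^sup>+x. 3 * ennreal ((cmod (T ?h x - G (a ?h) N x))\<^sup>2)
          + (3 * ennreal ((cmod \<alpha>)\<^sup>2) * ennreal ((cmod (T f x - G (a f) N x))\<^sup>2)
           + 3 * ennreal ((cmod \<beta>)\<^sup>2) * ennreal ((cmod (T g x - G (a g) N x))\<^sup>2)) \<partial>?M)"
        by (intro nn_integral_mono)
      also have "\<dots> = ?e N"
        unfolding E_def by (simp add: nn_integral_add nn_integral_cmult)
      finally show "(\<integral>\<^sup>+x. ennreal ((cmod (T ?h x - (\<alpha> * T f x + \<beta> * T g x)))\<^sup>2) \<partial>?M) \<le> ?e N" .
    qed
    show "\<exists>C. \<forall>f. in_L2 ?M f \<longrightarrow> L2_norm ?M (T f) \<le> C * L2_norm ?M f"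
    proof (intro exI allI impI)
      fix f assume f: "in_L2 ?M f"
      have "L2_norm ?M (T f) \<le> sqrt (2 * B * (\<integral>x. (cmod (f x))\<^sup>2 \<partial>?M))"
        unfolding L2_norm_def using T_int[OF f] by (intro real_sqrt_le_mono) simp
      then show "L2_norm ?M (T f) \<le> sqrt (2 * B) * L2_norm ?M f"
        unfolding L2_norm_def by (simp add: real_sqrt_mult)
    qed
  qed
  moreover have "AE x in ?M. T f x = pseudo_multiplier \<sigma> f x" if "f \<in> hermite_span" for f
  proof -
    obtain S c where S: "finite S" and f_eq: "f = (\<lambda>x. \<Sum>\<xi>\<in>S. c \<xi> * nhermite \<xi> x)"
      using \<open>f \<in> hermite_span\<close> unfolding hermite_span_def mem_Collect_eq by (elim exE conjE)
    have f: "in_L2 ?M f" unfolding f_eq nhermite_eq_hn by (rule in_L2_hn_sum[OF S])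
    note [measurable] = T_meas[OF f]
    define N where "N = (\<Sum>\<xi>\<in>S. mi_abs \<xi>)"
    have "mi_abs \<xi> \<le> N" if "\<xi> \<in> S" for \<xi> unfolding N_def using that S by (intro member_le_sum) auto
    then have SF: "S \<subseteq> F m" if "N \<le> m" for m using that by (auto simp: F_def intro: order_trans)
    have pm: "pseudo_multiplier \<sigma> f x = (\<Sum>\<xi>\<in>S. c \<xi> * \<sigma> x \<xi> * hn \<xi> x)" for x
      unfolding f_eq using S by (rule pseudo_multiplier_hn_sum)
    have "G (a f) m x = pseudo_multiplier \<sigma> f x" if "N \<le> m" for m x
      unfolding pm G_def using SF[OF that] S
      by (intro sum.mono_neutral_cong_right) (auto simp: a_def f_eq gauss_pairing_hn_sum)
    then have E_eq: "(\<integral>\<^sup>+x. ennreal ((cmod (T f x - pseudo_multiplier \<sigma> f x))\<^sup>2) \<partial>?M) = E (a f) (T f) (m + N)" for m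
      unfolding E_def by simp
    show ?thesis
    proof (rule AE_eqI)
      show "(\<lambda>m. E (a f) (T f) (m + N)) \<longlonglongrightarrow> 0"
        using T_lim[OF f] by (rule LIMSEQ_ignore_initial_segment)
      show "pseudo_multiplier \<sigma> f \<in> borel_measurable lebesgue"
        using meas by (subst pm[abs_def]) measurable
    qed (measurable, rule eq_refl[OF E_eq])
  qed
  ultimately show ?thesis unfolding extends_to_bounded_L2_def by blast
qed


section \<open>The Christoffel function\<close>

lemma christoffel_derivative:
  "((\<lambda>t. (\<Sum>k\<le>M. (hermite1 k t)\<^sup>2 / (2 ^ k * fact k)) * exp (- t\<^sup>2)) has_real_derivative
     - (hermite1 M t * hermite1 (Suc M) t * exp (- t\<^sup>2)) / (2 ^ M * fact M)) (at t)"
proof (induction M)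
  case 0
  show ?case
    using hermite1_gaussian_derivative[of 0 t] by simp
next
  case (Suc M)
  let ?k = "Suc M"
  have "((\<lambda>t. hermite1 ?k t * (hermite1 ?k t * exp (- t\<^sup>2)) / (2 ^ ?k * fact ?k)) has_real_derivative
      (2 * real ?k * hermite1 M t * (hermite1 ?k t * exp (- t\<^sup>2)) + (- hermite1 (Suc ?k) t * exp (- t\<^sup>2)) * hermite1 ?k t) / (2 ^ ?k * fact ?k)) (at t)"
    using hermite1_has_derivative[of ?k t] hermite1_gaussian_derivative[of ?k t]
    by (intro DERIV_cdivide DERIV_mult) simp_all
  note deriv = DERIV_add[OF Suc this]
  have val: "- (hermite1 M t * hermite1 ?k t * exp (- t\<^sup>2)) / (2 ^ M * fact M) +
        (2 * real ?k * hermite1 M t * (hermite1 ?k t * exp (- t\<^sup>2)) + (- hermite1 (Suc ?k) t * exp (- t\<^sup>2)) * hermite1 ?k t) / (2 ^ ?k * fact ?k)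
      = - (hermite1 ?k t * hermite1 (Suc ?k) t * exp (- t\<^sup>2)) / (2 ^ ?k * fact ?k)"
  proof -
    have aux: "- (a * b * e) / c + (2 * k * a * (b * e) + (- d * e) * b) / C = - (b * d * e) / C"
      if "C = 2 * k * c" "c \<noteq> 0" "k \<noteq> 0" for a b c d e k C :: real
      using that by (simp add: field_simps)
    show ?thesis by (rule aux) (simp_all add: algebra_simps)
  qed
  have "(\<lambda>t. (\<Sum>k\<le>?k. (hermite1 k t)\<^sup>2 / (2 ^ k * fact k)) * exp (- t\<^sup>2))
    = (\<lambda>t. (\<Sum>k\<le>M. (hermite1 k t)\<^sup>2 / (2 ^ k * fact k)) * exp (- t\<^sup>2)
        + hermite1 ?k t * (hermite1 ?k t * exp (- t\<^sup>2)) / (2 ^ ?k * fact ?k))"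
    unfolding sum.atMost_Suc by (intro ext) (simp only: power2_eq_square distrib_right times_divide_eq_left mult.assoc)
  then show ?case using deriv unfolding val by simp
qed

text \<open>The arithmetic-geometric mean inequality with weight \<open>l = (2 (M + 1))\<^sup>1\<^sup>/\<^sup>2\<close> balances the norms of the two factors.\<close>

lemma integral_abs_hermite1_Suc:
  "(\<integral>t. \<bar>hermite1 M t * hermite1 (Suc M) t * exp (- t\<^sup>2)\<bar> \<partial>lborel) / (2 ^ M * fact M)
     \<le> sqrt pi * sqrt (2 * real (Suc M))"
proof -
  define l where "l = sqrt (2 * real (Suc M))"
  have l: "l > 0" "l * l = 2 * real (Suc M)" by (simp_all add: l_def)
  let ?A = "\<lambda>t. hermite1 M t * hermite1 M t * exp (- t\<^sup>2)" and ?B = "\<lambda>t. hermite1 (Suc M) t * hermite1 (Suc M) t * exp (- t\<^sup>2)"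
  have "(\<integral>t. \<bar>hermite1 M t * hermite1 (Suc M) t * exp (- t\<^sup>2)\<bar> \<partial>lborel) \<le> (\<integral>t. l / 2 * ?A t + 1 / (2 * l) * ?B t \<partial>lborel)"
  proof (rule integral_mono)
    fix t :: real
    have "2 * (l * \<bar>a\<bar>) * \<bar>b\<bar> \<le> (l * a)\<^sup>2 + b\<^sup>2" for a b
      using sum_squares_bound[of "l * \<bar>a\<bar>" "\<bar>b\<bar>"] by (simp add: power_mult_distrib)
    then have "\<bar>a\<bar> * \<bar>b\<bar> \<le> l / 2 * (a * a) + 1 / (2 * l) * (b * b)" for a b
      using l(1) by (simp add: field_simps power2_eq_square)
    from mult_right_mono[OF this, of "exp (- t\<^sup>2)" "hermite1 M t" "hermite1 (Suc M) t"]
    show "\<bar>hermite1 M t * hermite1 (Suc M) t * exp (- t\<^sup>2)\<bar> \<le> l / 2 * ?A t + 1 / (2 * l) * ?B t"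
      by (simp add: abs_mult distrib_right mult.assoc)
  qed (intro Bochner_Integration.integrable_add integrable_mult_right integrable_hermite1_mult integrable_abs)+
  also have "\<dots> = l / 2 * (2 ^ M * fact M * sqrt pi) + 1 / (2 * l) * (2 ^ Suc M * fact (Suc M) * sqrt pi)"
    by (subst Bochner_Integration.integral_add)
      (auto intro!: integrable_mult_right integrable_hermite1_mult simp: integral_hermite1)
  also have "\<dots> = l * (2 ^ M * fact M * sqrt pi)"
  proof -
    have "1 / (2 * l) * (2 ^ Suc M * fact (Suc M) * sqrt pi) = (l * l) / (2 * l) * (2 ^ M * fact M * sqrt pi)"
    proof -
      have *: "2 ^ Suc M * fact (Suc M) * sqrt pi = (l * l) * (2 ^ M * fact M * sqrt pi)"
        unfolding l(2) by simp
      show ?thesis unfolding * by simp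
    qed
    also have "(l * l) / (2 * l) = l / 2" using l(1) by simp
    finally have *: "1 / (2 * l) * (2 ^ Suc M * fact (Suc M) * sqrt pi) = l / 2 * (2 ^ M * fact M * sqrt pi)" .
    show ?thesis unfolding * by (simp add: distrib_right[symmetric])
  qed
  finally show ?thesis
    by (simp add: l_def divide_le_eq mult_ac)
qed

text \<open>Let \<open>D t\<close> be the left-hand side. Its derivative telescopes to a single term whose
  \<open>L\<^sup>1\<close> norm is of order \<open>\<surd>M\<close>, so \<open>D\<close> oscillates by at most that much. As \<open>D\<close> has total
  integral \<open>(M + 1)\<surd>\<pi>\<close>, its average over an interval of length \<open>\<surd>(M + 1)\<close> is of order \<open>\<surd>M\<close> as well.\<close>

lemma christoffel_bound:
  "(\<Sum>k\<le>M. (hermite1 k t)\<^sup>2 / (2 ^ k * fact k)) * exp (- t\<^sup>2) \<le> 3 * sqrt pi * sqrt (real (Suc M))"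
proof -
  define D where "D t = (\<Sum>k\<le>M. (hermite1 k t)\<^sup>2 / (2 ^ k * fact k)) * exp (- t\<^sup>2)" for t :: real
  define D' where "D' t = - (hermite1 M t * hermite1 (Suc M) t * exp (- t\<^sup>2)) / (2 ^ M * fact M)" for t :: real
  have D_nonneg: "D t \<ge> 0" for t unfolding D_def by (intro mult_nonneg_nonneg sum_nonneg) auto
  have D_eq: "D t = (\<Sum>k\<le>M. hermite1 k t * hermite1 k t * exp (- t\<^sup>2) / (2 ^ k * fact k))" for t
    by (simp add: D_def sum_distrib_right power2_eq_square)
  have D_int: "integrable lborel D"
    unfolding D_eq by (intro Bochner_Integration.integrable_sum integrable_divide integrable_hermite1_mult)
  have D_integral: "(\<integral>t. D t \<partial>lborel) = real (Suc M) * sqrt pi"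
    unfolding D_eq by (subst Bochner_Integration.integral_sum) (auto intro!: integrable_divide integrable_hermite1_mult simp: integral_hermite1)
  have D'_int: "integrable lborel (\<lambda>t. \<bar>D' t\<bar>)"
    unfolding D'_def by (intro integrable_abs integrable_divide integrable_minus integrable_hermite1_mult)
  define I where "I = (\<integral>t. \<bar>D' t\<bar> \<partial>lborel)"
  have I_le: "I \<le> sqrt pi * sqrt (2 * real (Suc M))"
    using integral_abs_hermite1_Suc[of M] by (simp add: I_def D'_def abs_mult)
  have osc: "\<bar>D b - D a\<bar> \<le> I" if "a \<le> b" for a b
  proof -
    have "(\<integral>t. indicator {a..b} t *\<^sub>R D' t \<partial>lborel) = D b - D a"
    proof (rule integral_FTC_atLeastAtMost[OF that])
      show "(D has_vector_derivative D' x) (at x within {a..b})" for x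
        unfolding D_def D'_def
        by (rule has_vector_derivative_at_within)
          (rule christoffel_derivative[unfolded has_real_derivative_iff_has_vector_derivative])
      show "continuous_on {a..b} D'" unfolding D'_def by (intro continuous_intros) auto
    qed
    then have "\<bar>D b - D a\<bar> = norm (\<integral>t. indicator {a..b} t *\<^sub>R D' t \<partial>lborel)" by simp
    also have "\<dots> \<le> (\<integral>t. norm (indicator {a..b} t *\<^sub>R D' t) \<partial>lborel)" by (rule integral_norm_bound)
    also have "\<dots> \<le> I"
      unfolding I_def
    proof (rule integral_mono)
      show "integrable lborel (\<lambda>t. norm (indicator {a..b} t *\<^sub>R D' t))"
        using integrable_mult_indicator[of "{a..b}" lborel "\<lambda>t. \<bar>D' t\<bar>"] D'_int by (simp add: abs_mult)
    qed (auto simp: D'_int split: split_indicator)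
    finally show ?thesis .
  qed
  have osc': "D t - I \<le> D s" for s
    using osc[of s t] osc[of t s] by (cases "s \<le> t") auto
  define L where "L = sqrt (real (Suc M))"
  have L: "L > 0" "L * L = real (Suc M)" by (simp_all add: L_def)
  have "L * (D t - I) = (\<integral>s. indicator {0..L} s *\<^sub>R (D t - I) \<partial>lborel)"
    using L(1) by simp
  also have "\<dots> \<le> (\<integral>s. D s \<partial>lborel)"
  proof (rule integral_mono[OF _ D_int])
    show "integrable lborel (\<lambda>s. indicator {0..L} s *\<^sub>R (D t - I))"
      by (intro integrable_scaleR_left integrable_real_indicator) (auto simp: emeasure_lborel_Icc_eq)
  qed (use osc' D_nonneg in \<open>auto split: split_indicator\<close>)
  also have "\<dots> = L * (L * sqrt pi)" unfolding D_integral L(2)[symmetric] by simp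
  finally have D_le: "D t - I \<le> L * sqrt pi" using L(1) by simp
  note I_le
  also have "sqrt pi * sqrt (2 * real (Suc M)) \<le> 2 * sqrt pi * L"
  proof -
    have "sqrt 2 \<le> (2::real)" by (rule real_le_lsqrt) auto
    then show ?thesis unfolding real_sqrt_mult L_def[symmetric] using L(1) by simp
  qed
  finally show ?thesis using D_le unfolding D_def[symmetric] L_def[symmetric] by (simp add: algebra_simps)
qed

lemma mi_nth_le_abs: "\<xi> $ i \<le> mi_abs \<xi>"
  unfolding mi_abs_def by (rule member_le_sum) auto

text \<open>The simplex \<open>|\<xi>| \<le> M\<close> is contained in the cube \<open>\<xi>\<^sub>i \<le> M\<close>, over which the sum factorizes into one-dimensional
  Christoffel functions.\<close>

lemma sum_hn_sq_le:
  fixes x :: "real ^ 'n"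
  shows "(\<Sum>\<xi> | mi_abs \<xi> \<le> M. (hn \<xi> x)\<^sup>2) \<le> (3 * sqrt pi * sqrt (real (Suc M))) ^ CARD('n) * exp ((norm x)\<^sup>2)"
proof -
  define g where "g i k = (hermite1 k (x $ i))\<^sup>2 / (2 ^ k * fact k)" for i k
  have hn_eq: "(hn \<xi> x)\<^sup>2 = (\<Prod>i\<in>UNIV. g i (\<xi> $ i))" for \<xi> :: "nat ^ 'n"
    by (simp add: hn_def g_def power_divide hermite_def prod_dividef hermite_sq_eq_prod[symmetric] prod_power_distrib)
  have "(\<Sum>\<xi> | mi_abs \<xi> \<le> M. (hn \<xi> x)\<^sup>2) = (\<Sum>f\<in>vec_nth ` {\<xi> :: nat ^ 'n. mi_abs \<xi> \<le> M}. \<Prod>i\<in>UNIV. g i (f i))"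
    unfolding hn_eq by (subst sum.reindex) (auto simp: inj_on_def vec_nth_inject)
  also have "\<dots> \<le> (\<Sum>f\<in>PiE UNIV (\<lambda>_. {..M}). \<Prod>i\<in>UNIV. g i (f i))"
    by (rule sum_mono2) (auto intro!: finite_PiE prod_nonneg order_trans[OF mi_nth_le_abs] simp: g_def)
  also have "\<dots> = (\<Prod>i\<in>UNIV. \<Sum>k\<le>M. g i k)"
    by (subst prod_sum_PiE) auto
  also have "\<dots> \<le> (\<Prod>i\<in>UNIV. 3 * sqrt pi * sqrt (real (Suc M)) * exp ((x $ i)\<^sup>2))"
  proof (rule prod_mono)
    fix i :: 'n
    have "(\<Sum>k\<le>M. g i k) * exp (- (x $ i)\<^sup>2) * exp ((x $ i)\<^sup>2) \<le> 3 * sqrt pi * sqrt (real (Suc M)) * exp ((x $ i)\<^sup>2)"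
      unfolding g_def by (intro mult_right_mono christoffel_bound) auto
    then show "0 \<le> (\<Sum>k\<le>M. g i k) \<and> (\<Sum>k\<le>M. g i k) \<le> 3 * sqrt pi * sqrt (real (Suc M)) * exp ((x $ i)\<^sup>2)"
      by (auto simp: mult.assoc mult_exp_exp g_def intro!: sum_nonneg)
  qed
  also have "\<dots> = (3 * sqrt pi * sqrt (real (Suc M))) ^ CARD('n) * exp (\<Sum>i\<in>UNIV. (x $ i)\<^sup>2)"
    by (simp add: prod.distrib exp_sum)
  also have "(\<Sum>i\<in>UNIV. (x $ i)\<^sup>2) = (norm x)\<^sup>2"
    by (simp add: norm_vec_def L2_set_def sum_nonneg)
  finally show ?thesis .
qed

section \<open>Off-diagonal decay of spectrally localized kernels\<close>

lemma mi_abs_axis [simp]: "mi_abs (axis i k) = k"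
  by (simp add: mi_abs_def axis_def)

lemma mi_abs_add [simp]: "mi_abs (\<xi> + \<eta>) = mi_abs \<xi> + mi_abs \<eta>"
  by (simp add: mi_abs_def sum.distrib)

lemma axis_add: "axis c a + axis c b = axis c (a + b :: nat)"
  by (simp add: vec_eq_iff axis_def)

lemma mi_minus_axis: "\<xi> $ c \<noteq> 0 \<Longrightarrow> \<xi> - axis c 1 + axis c 1 = (\<xi> :: nat ^ 'n)"
  by (auto simp: vec_eq_iff axis_def)

lemma hermite_split: "hermite \<xi> x = hermite1 (\<xi> $ c) (x $ c) * (\<Prod>j\<in>UNIV - {c}. hermite1 (\<xi> $ j) (x $ j))"
  unfolding hermite_def by (rule prod.remove) auto

lemma hermite_recurrence:
  "2 * x $ c * hermite \<xi> x = hermite (\<xi> + axis c 1) x + 2 * real (\<xi> $ c) * hermite (\<xi> - axis c 1) x"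
proof -
  have "(\<Prod>j\<in>UNIV - {c}. hermite1 ((\<xi> + axis c 1) $ j) (x $ j)) = (\<Prod>j\<in>UNIV - {c}. hermite1 (\<xi> $ j) (x $ j))"
    "(\<Prod>j\<in>UNIV - {c}. hermite1 ((\<xi> - axis c 1) $ j) (x $ j)) = (\<Prod>j\<in>UNIV - {c}. hermite1 (\<xi> $ j) (x $ j))"
    by (auto intro!: prod.cong simp: axis_def)
  then show ?thesis
    unfolding hermite_split[of _ x c]
    using arg_cong[OF hermite1_recurrence[of "x $ c" "\<xi> $ c"], of "\<lambda>z. z * (\<Prod>j\<in>UNIV - {c}. hermite1 (\<xi> $ j) (x $ j))"]
    by (simp add: axis_def algebra_simps)
qed

lemma hermite_sq_add_axis: "hermite_sq (\<xi> + axis c 1) = 2 * real (\<xi> $ c + 1) * hermite_sq \<xi>"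
proof -
  have split: "hermite_sq \<xi> = (2 ^ (\<xi> $ c) * fact (\<xi> $ c)) * (\<Prod>j\<in>UNIV - {c}. 2 ^ (\<xi> $ j) * fact (\<xi> $ j))" for \<xi>
    unfolding hermite_sq_eq_prod by (rule prod.remove) auto
  have "(\<Prod>j\<in>UNIV - {c}. 2 ^ ((\<xi> + axis c 1) $ j) * fact ((\<xi> + axis c 1) $ j)) = (\<Prod>j\<in>UNIV - {c}. 2 ^ (\<xi> $ j) * fact (\<xi> $ j) :: real)"
    by (intro prod.cong) (auto simp: axis_def)
  then show ?thesis
    unfolding split[of "\<xi> + axis c 1"] split[of \<xi>] by (simp add: axis_def algebra_simps)
qed

lemma hermite_sq_add_axis_le:
  assumes "mi_abs \<xi> \<le> R" "R \<ge> 1"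
  shows "hermite_sq (\<xi> + axis c j) \<le> (2 * real (j + 1) * real R) ^ j * hermite_sq \<xi>"
  using assms
proof (induction j)
  case 0
  have "\<xi> + axis c 0 = \<xi>" by (simp add: vec_eq_iff axis_def)
  then show ?case by (simp only:) simp
next
  case (Suc j)
  have le: "real (\<xi> $ c + j + 1) \<le> real (j + 2) * real R"
  proof -
    have "\<xi> $ c + j + 1 \<le> R + (j + 1) * 1" using mi_nth_le_abs[of \<xi> c] Suc.prems by simp
    also have "\<dots> \<le> R + (j + 1) * R" using Suc.prems by (intro add_left_mono mult_left_mono) auto
    finally have "\<xi> $ c + j + 1 \<le> (j + 2) * R" by simp
    then show ?thesis by (metis of_nat_le_iff of_nat_mult)
  qed
  have "hermite_sq (\<xi> + axis c (Suc j)) = hermite_sq (\<xi> + axis c j + axis c 1)"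
    by (simp add: add.assoc axis_add)
  also have "\<dots> = 2 * real (\<xi> $ c + j + 1) * hermite_sq (\<xi> + axis c j)"
    by (simp only: hermite_sq_add_axis) (simp add: axis_def)
  also have "\<dots> \<le> 2 * (real (j + 2) * real R) * ((2 * real (j + 1) * real R) ^ j * hermite_sq \<xi>)"
    using le Suc by (intro mult_mono) (auto simp: less_imp_le)
  also have "\<dots> \<le> 2 * (real (j + 2) * real R) * ((2 * real (j + 2) * real R) ^ j * hermite_sq \<xi>)"
    by (intro mult_left_mono mult_right_mono power_mono) auto
  finally show ?case by (simp add: mult_ac)
qed

text \<open>The kernel of \<open>(a\<^sub>x\<^sup>\<dagger>)\<^sup>i (a\<^sub>y\<^sup>\<dagger>)\<^sup>j\<close> applied to the diagonal operator with coefficients \<open>b\<close>,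
  where \<open>a\<^sup>\<dagger>\<close> is the creation operator in coordinate \<open>c\<close>. The unnormalized polynomials
  avoid all square roots.\<close>

definition raised_kernel ::
    "'n \<Rightarrow> nat \<Rightarrow> nat \<Rightarrow> nat \<Rightarrow> (nat ^ 'n \<Rightarrow> complex) \<Rightarrow> real ^ 'n \<Rightarrow> real ^ 'n \<Rightarrow> complex" where
  "raised_kernel c R i j b x y =
     (\<Sum>\<xi> | mi_abs \<xi> \<le> R. b \<xi> / hermite_sq \<xi> * hermite (\<xi> + axis c i) x * hermite (\<xi> + axis c j) y)"

lemma sum_shift_axis:
  fixes F :: "nat ^ 'n \<Rightarrow> complex"
  assumes "\<And>\<xi>. \<xi> $ c = 0 \<Longrightarrow> F \<xi> = 0" "\<And>\<xi>. R < mi_abs \<xi> \<Longrightarrow> F \<xi> = 0"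
  shows "(\<Sum>\<xi> | mi_abs \<xi> \<le> R. F \<xi>) = (\<Sum>\<xi> | mi_abs \<xi> \<le> R. F (\<xi> + axis c 1))"
proof -
  have fin: "finite ((\<lambda>\<xi>. \<xi> + axis c 1) ` {\<xi> :: nat ^ 'n. mi_abs \<xi> \<le> R})"
    by (intro finite_imageI finite_mi_abs_le)
  have "(\<Sum>\<xi> | mi_abs \<xi> \<le> R. F (\<xi> + axis c 1)) = (\<Sum>\<xi>\<in>(\<lambda>\<xi>. \<xi> + axis c 1) ` {\<xi>. mi_abs \<xi> \<le> R}. F \<xi>)"
    by (subst sum.reindex) (auto simp: inj_on_def)
  also have "\<dots> = (\<Sum>\<xi> | mi_abs \<xi> \<le> R. F \<xi>)"
  proof (rule sum.mono_neutral_cong[OF finite_mi_abs_le fin])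
    fix \<xi> assume \<xi>: "\<xi> \<in> {\<xi>. mi_abs \<xi> \<le> R} - (\<lambda>\<xi>. \<xi> + axis c 1) ` {\<xi>. mi_abs \<xi> \<le> R}"
    have "\<xi> $ c = 0"
    proof (rule ccontr)
      assume "\<xi> $ c \<noteq> 0"
      then have eq: "\<xi> = (\<xi> - axis c 1) + axis c 1" by (rule mi_minus_axis[symmetric])
      then have "mi_abs (\<xi> - axis c 1) \<le> R" using \<xi> by (metis DiffD1 add_leD1 mem_Collect_eq mi_abs_add)
      then show False using \<xi> eq by blast
    qed
    then show "F \<xi> = 0" by (rule assms)
  qed (use assms in \<open>auto simp: not_le\<close>)
  finally show ?thesis by simp
qed

text \<open>The three-term recurrence turns the factor \<open>2 x\<^sub>c\<close> into a raising and a lowering of the polynomial in \<open>x\<close>, and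
  similarly for \<open>y\<close>. The lowering in one variable carries the factor \<open>\<xi>\<^sub>c\<close> that the quotient of consecutive
  \<open>hermite_sq\<close> absorbs: after a shift of the summation index it becomes a raising in the other variable with the coefficient
  at \<open>\<xi> + e\<^sub>c\<close>. Pairing it with the genuine raising leaves a difference of \<open>b\<close>. The terms with \<open>i\<close> and \<open>j\<close>
  come from lowering the part of the index that was raised before.\<close>

lemma raised_kernel_mult_diff:
  assumes supp: "\<And>\<xi>. R < mi_abs \<xi> \<Longrightarrow> b \<xi> = 0"
  shows "2 * complex_of_real (x $ c - y $ c) * raised_kernel c R i j b x y =
     raised_kernel c R i (Suc j) (diff1 c b) x y - raised_kernel c R (Suc i) j (diff1 c b) x y
     + 2 * of_nat i * raised_kernel c R (i - 1) j b x y - 2 * of_nat j * raised_kernel c R i (j - 1) b x y"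
proof -
  define w where "w \<xi> = b \<xi> / hermite_sq \<xi>" for \<xi>
  define X where "X i \<xi> = complex_of_real (hermite (\<xi> + axis c i) x)" for i \<xi>
  define Y where "Y j \<xi> = complex_of_real (hermite (\<xi> + axis c j) y)" for j \<xi>
  have K: "raised_kernel c R i j b' x y = (\<Sum>\<xi> | mi_abs \<xi> \<le> R. b' \<xi> / hermite_sq \<xi> * X i \<xi> * Y j \<xi>)" for i j b'
    by (simp add: raised_kernel_def X_def Y_def)
  have step: "2 * complex_of_real (z $ c) * complex_of_real (hermite (\<xi> + axis c i) z) =
      hermite (\<xi> + axis c (Suc i)) z + 2 * of_nat (\<xi> $ c) * hermite (\<xi> + axis c i - axis c 1) z
       + 2 * of_nat i * hermite (\<xi> + axis c (i - 1)) z" for z \<xi> i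
  proof -
    have minus: "\<xi> + axis c i - axis c 1 = \<xi> + axis c (i - 1)" if "i > 0"
      using that by (auto simp: vec_eq_iff axis_def)
    have "2 * z $ c * hermite (\<xi> + axis c i) z = hermite (\<xi> + axis c (Suc i)) z
       + 2 * real (\<xi> $ c) * hermite (\<xi> + axis c i - axis c 1) z + 2 * real i * hermite (\<xi> + axis c (i - 1)) z"
      using minus by (subst hermite_recurrence) (cases "i = 0"; simp add: add.assoc axis_add distrib_right distrib_left; simp add: axis_def)
    from arg_cong[OF this, of complex_of_real] show ?thesis by simp
  qed
  have shift: "hermite_sq (\<xi> + axis c 1) = 2 * real (\<xi> $ c + 1) * hermite_sq \<xi>" for \<xi>
    by (rule hermite_sq_add_axis)
  have lower: "(\<xi> + axis c 1 + axis c i - axis c 1) = \<xi> + axis c i" "(\<xi> + axis c 1 + axis c i) = \<xi> + axis c (Suc i)" for \<xi> i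
    by (auto simp: vec_eq_iff axis_def)
  have lower': "(\<xi> + axis c (Suc i) - axis c 1) = \<xi> + axis c i" for \<xi> i
    by (auto simp: vec_eq_iff axis_def)
  have w_shift: "w (\<xi> + axis c 1) * (2 * of_nat ((\<xi> + axis c 1) $ c)) = b (\<xi> + axis c 1) / hermite_sq \<xi>" for \<xi>
  proof -
    have "w (\<xi> + axis c 1) * (2 * of_nat ((\<xi> + axis c 1) $ c))
       = b (\<xi> + axis c 1) * (2 * of_nat (\<xi> $ c + 1)) / (of_real (2 * real (\<xi> $ c + 1)) * of_real (hermite_sq \<xi>))"
      unfolding w_def shift by (simp add: axis_def)
    also have "\<dots> = b (\<xi> + axis c 1) / hermite_sq \<xi>"
      by (simp add: field_simps del: of_nat_add of_nat_Suc) (simp add: field_simps)?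
    finally show ?thesis .
  qed
  have A: "(\<Sum>\<xi> | mi_abs \<xi> \<le> R. w \<xi> * (2 * of_nat (\<xi> $ c)) * hermite (\<xi> + axis c i - axis c 1) x * Y j \<xi>)
      = (\<Sum>\<xi> | mi_abs \<xi> \<le> R. b (\<xi> + axis c 1) / hermite_sq \<xi> * X i \<xi> * Y (Suc j) \<xi>)"
    by (subst sum_shift_axis[of c]) (simp_all only: w_shift lower lower' X_def Y_def, simp_all add: supp w_def)
  have B: "(\<Sum>\<xi> | mi_abs \<xi> \<le> R. w \<xi> * (2 * of_nat (\<xi> $ c)) * X i \<xi> * hermite (\<xi> + axis c j - axis c 1) y)
      = (\<Sum>\<xi> | mi_abs \<xi> \<le> R. b (\<xi> + axis c 1) / hermite_sq \<xi> * X (Suc i) \<xi> * Y j \<xi>)"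
    by (subst sum_shift_axis[of c]) (simp_all only: w_shift lower lower' X_def Y_def, simp_all add: supp w_def)
  have "2 * complex_of_real (x $ c - y $ c) * raised_kernel c R i j b x y =
     (\<Sum>\<xi> | mi_abs \<xi> \<le> R. w \<xi> * (2 * complex_of_real (x $ c) * X i \<xi>) * Y j \<xi> - w \<xi> * X i \<xi> * (2 * complex_of_real (y $ c) * Y j \<xi>))"
    unfolding K w_def[symmetric] by (simp add: sum_distrib_left algebra_simps)
  also have "\<dots> = (\<Sum>\<xi> | mi_abs \<xi> \<le> R. w \<xi> * X (Suc i) \<xi> * Y j \<xi>)
     + (\<Sum>\<xi> | mi_abs \<xi> \<le> R. w \<xi> * (2 * of_nat (\<xi> $ c)) * hermite (\<xi> + axis c i - axis c 1) x * Y j \<xi>)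
     + 2 * of_nat i * (\<Sum>\<xi> | mi_abs \<xi> \<le> R. w \<xi> * X (i - 1) \<xi> * Y j \<xi>)
     - (\<Sum>\<xi> | mi_abs \<xi> \<le> R. w \<xi> * X i \<xi> * Y (Suc j) \<xi>)
     - (\<Sum>\<xi> | mi_abs \<xi> \<le> R. w \<xi> * (2 * of_nat (\<xi> $ c)) * X i \<xi> * hermite (\<xi> + axis c j - axis c 1) y)
     - 2 * of_nat j * (\<Sum>\<xi> | mi_abs \<xi> \<le> R. w \<xi> * X i \<xi> * Y (j - 1) \<xi>)"
    unfolding sum_distrib_left sum.distrib[symmetric] sum_subtractf[symmetric]
    by (intro sum.cong refl) (unfold X_def Y_def step, simp add: algebra_simps)
  also have "\<dots> = raised_kernel c R i (Suc j) (diff1 c b) x y - raised_kernel c R (Suc i) j (diff1 c b) x y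
     + 2 * of_nat i * raised_kernel c R (i - 1) j b x y - 2 * of_nat j * raised_kernel c R i (j - 1) b x y"
    unfolding A B unfolding K w_def diff1_def by (simp add: diff_divide_distrib left_diff_distrib sum_subtractf)
  finally show ?thesis .
qed


text \<open>The size of \<open>\<Sum> (hn \<xi> x)\<^sup>2\<close> over \<open>|\<xi>| \<le> R\<close>, up to a constant factor, as bounded in \<open>sum_hn_sq_le\<close>.\<close>

definition hermite_growth :: "nat \<Rightarrow> real ^ 'n \<Rightarrow> real" where
  "hermite_growth R x = sqrt (real R) ^ CARD('n) * exp ((norm x)\<^sup>2)"

lemma hermite_growth_nonneg [simp]: "hermite_growth R x \<ge> 0"
  by (simp add: hermite_growth_def)

lemma continuous_raised_kernel: "continuous_on S (raised_kernel c R i j b x)"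
  unfolding raised_kernel_def[abs_def] by (intro continuous_intros) auto

lemma measurable_raised_kernel [measurable]: "raised_kernel c R i j b x \<in> borel_measurable borel"
  by (intro borel_measurable_continuous_onI continuous_raised_kernel)

lemma measurable_raised_kernel_lebesgue [measurable]: "raised_kernel c R i j b x \<in> borel_measurable lebesgue"
  by (simp add: measurable_completion)

text \<open>Orthonormality in \<open>y\<close> reduces the integral to a Christoffel function in \<open>x\<close>; each creation operator costs a factor
  \<open>R\<close> in the squared norm.\<close>

lemma raised_kernel_L2:
  fixes x :: "real ^ 'n"
  assumes R: "R \<ge> 1" and b: "\<And>\<xi>. cmod (b \<xi>) \<le> \<beta>"
  shows "(\<integral>\<^sup>+y. ennreal ((cmod (raised_kernel c R i j b x y))\<^sup>2) \<partial>gauss_measure)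
    \<le> ennreal ((2 * real (i + 1)) ^ i * (2 * real (j + 1)) ^ j * (3 * sqrt pi * sqrt (real (i + 2))) ^ CARD('n)
        * \<beta>\<^sup>2 * real R ^ (i + j) * hermite_growth R x)"
proof -
  define A where "A = (2 * real (i + 1)) ^ i * (2 * real (j + 1)) ^ j"
  have A: "A \<ge> 0" by (simp add: A_def)
  let ?Q = "{\<xi> :: nat ^ 'n. mi_abs \<xi> \<le> R}"
  define d where "d \<xi> = b \<xi> * complex_of_real (hermite (\<xi> + axis c i) x * sqrt (hermite_sq (\<xi> + axis c j)) / hermite_sq \<xi>)" for \<xi>
  have "raised_kernel c R i j b x y = (\<Sum>\<xi>\<in>?Q. d \<xi> * hn (\<xi> + axis c j) y)" for y
    unfolding raised_kernel_def d_def hn_def by (intro sum.cong) (auto simp: less_imp_neq)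
  then have "(\<integral>\<^sup>+y. ennreal ((cmod (raised_kernel c R i j b x y))\<^sup>2) \<partial>gauss_measure) = ennreal (\<Sum>\<xi>\<in>?Q. (cmod (d \<xi>))\<^sup>2)"
    by (simp only:) (rule nn_integral_hn_sum, auto simp: finite_mi_abs_le inj_on_def)
  also have "(\<Sum>\<xi>\<in>?Q. (cmod (d \<xi>))\<^sup>2) \<le> (\<Sum>\<xi>\<in>?Q. A * \<beta>\<^sup>2 * real R ^ (i + j) * (hn (\<xi> + axis c i) x)\<^sup>2)"
  proof (rule sum_mono)
    fix \<xi> assume \<xi>: "\<xi> \<in> ?Q"
    let ?h = "hermite_sq \<xi>" and ?hi = "hermite_sq (\<xi> + axis c i)" and ?hj = "hermite_sq (\<xi> + axis c j)"
    have hi: "?hi \<le> (2 * real (i + 1) * real R) ^ i * ?h" and hj: "?hj \<le> (2 * real (j + 1) * real R) ^ j * ?h"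
      using \<xi> R by (simp_all only: mem_Collect_eq hermite_sq_add_axis_le)
    have "(hermite (\<xi> + axis c i) x)\<^sup>2 = (hn (\<xi> + axis c i) x)\<^sup>2 * ?hi"
      by (simp add: hn_def power_divide)
    then have "(cmod (d \<xi>))\<^sup>2 = (cmod (b \<xi>))\<^sup>2 * ((hn (\<xi> + axis c i) x)\<^sup>2 * (?hi / ?h) * (?hj / ?h))"
      by (simp add: d_def norm_mult power_mult_distrib power_divide norm_divide abs_mult power2_eq_square[of ?h])
    also have "\<dots> \<le> \<beta>\<^sup>2 * ((hn (\<xi> + axis c i) x)\<^sup>2 * (2 * real (i + 1) * real R) ^ i * (2 * real (j + 1) * real R) ^ j)"
    proof (intro mult_mono order_refl power_mono b)
      show "?hi / ?h \<le> (2 * real (i + 1) * real R) ^ i" "?hj / ?h \<le> (2 * real (j + 1) * real R) ^ j"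
        using hi hj by (simp_all add: divide_le_eq)
    qed (auto simp: divide_nonneg_nonneg)
    also have "\<dots> = A * \<beta>\<^sup>2 * real R ^ (i + j) * (hn (\<xi> + axis c i) x)\<^sup>2"
      by (simp add: A_def power_mult_distrib power_add)
    finally show "(cmod (d \<xi>))\<^sup>2 \<le> A * \<beta>\<^sup>2 * real R ^ (i + j) * (hn (\<xi> + axis c i) x)\<^sup>2" .
  qed
  also have "\<dots> = A * \<beta>\<^sup>2 * real R ^ (i + j) * (\<Sum>\<xi>\<in>?Q. (hn (\<xi> + axis c i) x)\<^sup>2)"
    by (simp add: sum_distrib_left)
  also have "(\<Sum>\<xi>\<in>?Q. (hn (\<xi> + axis c i) x)\<^sup>2) = (\<Sum>\<eta>\<in>(\<lambda>\<xi>. \<xi> + axis c i) ` ?Q. (hn \<eta> x)\<^sup>2)"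
    by (subst sum.reindex) (auto simp: inj_on_def)
  also have "\<dots> \<le> (\<Sum>\<eta> | mi_abs \<eta> \<le> R + i. (hn \<eta> x)\<^sup>2)"
    by (rule sum_mono2) (auto simp: finite_mi_abs_le)
  also have "\<dots> \<le> (3 * sqrt pi * sqrt (real (Suc (R + i)))) ^ CARD('n) * exp ((norm x)\<^sup>2)"
    by (rule sum_hn_sq_le)
  also have "\<dots> \<le> (3 * sqrt pi * (sqrt (real (i + 2)) * sqrt (real R))) ^ CARD('n) * exp ((norm x)\<^sup>2)"
  proof (intro mult_right_mono power_mono mult_left_mono)
    have "Suc (R + i) \<le> R + (i + 1) * 1" by simp
    also have "\<dots> \<le> R + (i + 1) * R" using R by (intro add_left_mono mult_left_mono) auto
    finally have "Suc (R + i) \<le> (i + 2) * R" by simp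
    then have "real (Suc (R + i)) \<le> real (i + 2) * real R" by (metis of_nat_le_iff of_nat_mult)
    then show "sqrt (real (Suc (R + i))) \<le> sqrt (real (i + 2)) * sqrt (real R)"
      by (simp only: real_sqrt_mult[symmetric] real_sqrt_le_iff)
  qed auto
  also have "A * \<beta>\<^sup>2 * real R ^ (i + j) * \<dots> = A * (3 * sqrt pi * sqrt (real (i + 2))) ^ CARD('n)
        * \<beta>\<^sup>2 * real R ^ (i + j) * hermite_growth R x"
    by (simp add: hermite_growth_def power_mult_distrib)
  finally show ?thesis
    using A by (simp add: A_def mult_left_mono ennreal_leI)
qed

lemma measurable_vec_nth_lebesgue [measurable]: "(\<lambda>x :: real ^ 'n. x $ i) \<in> borel_measurable lebesgue"
  by (simp add: measurable_completion)

lemma cmod_sq_four: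
  fixes A B C D :: complex
  shows "(cmod (A - B + C - D))\<^sup>2 \<le> 4 * ((cmod A)\<^sup>2 + (cmod B)\<^sup>2 + (cmod C)\<^sup>2 + (cmod D)\<^sup>2)"
proof -
  have two: "(cmod (z + w))\<^sup>2 \<le> 2 * (cmod z)\<^sup>2 + 2 * (cmod w)\<^sup>2" for z w
    using power_mono[OF norm_triangle_ineq[of z w], of 2] sum_squares_bound[of "cmod z" "cmod w"]
    by (simp add: power2_sum)
  have "A - B + C - D = (A + - B) + (C + - D)" by simp
  then have "(cmod (A - B + C - D))\<^sup>2 \<le> 2 * (cmod (A + - B))\<^sup>2 + 2 * (cmod (C + - D))\<^sup>2"
    using two[of "A + - B" "C + - D"] by (simp only:)
  also have "\<dots> \<le> 4 * ((cmod A)\<^sup>2 + (cmod B)\<^sup>2 + (cmod C)\<^sup>2 + (cmod D)\<^sup>2)"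
    using two[of A "- B"] two[of C "- D"] by simp
  finally show ?thesis .
qed

text \<open>Each factor \<open>x\<^sub>c - y\<^sub>c\<close> either turns a difference of the coefficients (gaining \<open>1/R\<close>) into one
  more creation operator (losing \<open>\<surd>R\<close>), or removes a creation operator; both gain \<open>R\<^sup>-\<^sup>1\<^sup>/\<^sup>2\<close> in norm.\<close>

lemma raised_kernel_weighted_L2:
  fixes c :: "'n::finite"
  shows "\<exists>C\<ge>0. \<forall>R \<beta> b x. R \<ge> 1 \<longrightarrow> \<beta> \<ge> 0 \<longrightarrow> (\<forall>\<xi>. R < mi_abs \<xi> \<longrightarrow> b \<xi> = 0) \<longrightarrow>
     (\<forall>l\<le>m. \<forall>\<xi>. cmod ((diff1 c ^^ l) b \<xi>) \<le> \<beta> / real R ^ l) \<longrightarrow>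
     (\<integral>\<^sup>+y. ennreal ((x $ c - y $ c) ^ (2 * m) * (cmod (raised_kernel c R i j b x y))\<^sup>2) \<partial>gauss_measure)
       \<le> ennreal (C * \<beta>\<^sup>2 * real R ^ (i + j) / real R ^ m * hermite_growth R x)"
proof (induction m arbitrary: i j)
  case 0
  let ?C = "(2 * real (i + 1)) ^ i * (2 * real (j + 1)) ^ j * (3 * sqrt pi * sqrt (real (i + 2))) ^ CARD('n)"
  show ?case
    using raised_kernel_L2[of _ _ _ c i j]
    by (intro exI[of _ ?C]) (simp add: mult.assoc)
next
  case (Suc m)
  obtain C1 where C1: "C1 \<ge> 0" "\<And>R \<beta> b x. R \<ge> 1 \<Longrightarrow> \<beta> \<ge> 0 \<Longrightarrow> (\<forall>\<xi>. R < mi_abs \<xi> \<longrightarrow> b \<xi> = 0) \<Longrightarrow>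
     (\<forall>l\<le>m. \<forall>\<xi>. cmod ((diff1 c ^^ l) b \<xi>) \<le> \<beta> / real R ^ l) \<Longrightarrow>
     (\<integral>\<^sup>+y. ennreal ((x $ c - y $ c) ^ (2 * m) * (cmod (raised_kernel c R i (Suc j) b x y))\<^sup>2) \<partial>gauss_measure)
       \<le> ennreal (C1 * \<beta>\<^sup>2 * real R ^ (i + Suc j) / real R ^ m * hermite_growth R x)"
    using Suc.IH[of i "Suc j"] by blast
  obtain C2 where C2: "C2 \<ge> 0" "\<And>R \<beta> b x. R \<ge> 1 \<Longrightarrow> \<beta> \<ge> 0 \<Longrightarrow> (\<forall>\<xi>. R < mi_abs \<xi> \<longrightarrow> b \<xi> = 0) \<Longrightarrow>
     (\<forall>l\<le>m. \<forall>\<xi>. cmod ((diff1 c ^^ l) b \<xi>) \<le> \<beta> / real R ^ l) \<Longrightarrow>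
     (\<integral>\<^sup>+y. ennreal ((x $ c - y $ c) ^ (2 * m) * (cmod (raised_kernel c R (Suc i) j b x y))\<^sup>2) \<partial>gauss_measure)
       \<le> ennreal (C2 * \<beta>\<^sup>2 * real R ^ (Suc i + j) / real R ^ m * hermite_growth R x)"
    using Suc.IH[of "Suc i" j] by blast
  obtain C3 where C3: "C3 \<ge> 0" "\<And>R \<beta> b x. R \<ge> 1 \<Longrightarrow> \<beta> \<ge> 0 \<Longrightarrow> (\<forall>\<xi>. R < mi_abs \<xi> \<longrightarrow> b \<xi> = 0) \<Longrightarrow>
     (\<forall>l\<le>m. \<forall>\<xi>. cmod ((diff1 c ^^ l) b \<xi>) \<le> \<beta> / real R ^ l) \<Longrightarrow>
     (\<integral>\<^sup>+y. ennreal ((x $ c - y $ c) ^ (2 * m) * (cmod (raised_kernel c R (i - 1) j b x y))\<^sup>2) \<partial>gauss_measure)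
       \<le> ennreal (C3 * \<beta>\<^sup>2 * real R ^ (i - 1 + j) / real R ^ m * hermite_growth R x)"
    using Suc.IH[of "i - 1" j] by blast
  obtain C4 where C4: "C4 \<ge> 0" "\<And>R \<beta> b x. R \<ge> 1 \<Longrightarrow> \<beta> \<ge> 0 \<Longrightarrow> (\<forall>\<xi>. R < mi_abs \<xi> \<longrightarrow> b \<xi> = 0) \<Longrightarrow>
     (\<forall>l\<le>m. \<forall>\<xi>. cmod ((diff1 c ^^ l) b \<xi>) \<le> \<beta> / real R ^ l) \<Longrightarrow>
     (\<integral>\<^sup>+y. ennreal ((x $ c - y $ c) ^ (2 * m) * (cmod (raised_kernel c R i (j - 1) b x y))\<^sup>2) \<partial>gauss_measure)
       \<le> ennreal (C4 * \<beta>\<^sup>2 * real R ^ (i + (j - 1)) / real R ^ m * hermite_growth R x)"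
    using Suc.IH[of i "j - 1"] by blast
  define I2 where "I2 = (2 * real i)\<^sup>2"
  define J2 where "J2 = (2 * real j)\<^sup>2"
  have IJ: "I2 \<ge> 0" "J2 \<ge> 0" by (simp_all add: I2_def J2_def)
  define C where "C = C1 + C2 + I2 * C3 + J2 * C4"
  have C: "C \<ge> 0" using C1 C2 C3 C4 IJ by (simp add: C_def)
  show ?case
  proof (intro exI[of _ C] conjI C allI impI)
    fix R :: nat and \<beta> :: real and b :: "nat ^ 'n \<Rightarrow> complex" and x :: "real ^ 'n"
    assume R: "R \<ge> 1" and \<beta>: "\<beta> \<ge> 0" and supp: "\<forall>\<xi>. R < mi_abs \<xi> \<longrightarrow> b \<xi> = 0"
      and diff: "\<forall>l\<le>Suc m. \<forall>\<xi>. cmod ((diff1 c ^^ l) b \<xi>) \<le> \<beta> / real R ^ l"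
    have R0: "real R > 0" using R by simp
    let ?w = "\<lambda>y. (x $ c - y $ c) ^ (2 * m)"
    let ?K = "\<lambda>i j b y. (cmod (raised_kernel c R i j b x y))\<^sup>2"
    define N where "N i j b = (\<integral>\<^sup>+y. ennreal (?w y * ?K i j b y) \<partial>gauss_measure)" for i j b
    define G where "G = \<beta>\<^sup>2 * real R ^ (i + j) / real R ^ Suc m * hermite_growth R x"
    have G: "G \<ge> 0" by (simp add: G_def)
    have supp': "\<forall>\<xi>. R < mi_abs \<xi> \<longrightarrow> diff1 c b \<xi> = 0" using supp by (simp add: diff1_def)
    have diff': "\<forall>l\<le>m. \<forall>\<xi>. cmod ((diff1 c ^^ l) (diff1 c b) \<xi>) \<le> \<beta> / real R / real R ^ l"
    proof (intro allI impI)
      fix l \<xi> assume "l \<le> m"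
      then have "cmod ((diff1 c ^^ Suc l) b \<xi>) \<le> \<beta> / real R ^ Suc l" using diff by (meson Suc_le_mono)
      then show "cmod ((diff1 c ^^ l) (diff1 c b) \<xi>) \<le> \<beta> / real R / real R ^ l"
        by (simp only: funpow_Suc_right o_apply) simp
    qed
    have diff0: "\<forall>l\<le>m. \<forall>\<xi>. cmod ((diff1 c ^^ l) b \<xi>) \<le> \<beta> / real R ^ l" using diff by simp
    have \<beta>': "\<beta> / real R \<ge> 0" using \<beta> by simp
    have N1: "N i (Suc j) (diff1 c b) \<le> ennreal (C1 * G)"
      using C1(2)[OF R \<beta>' supp' diff', of x] R0 by (simp add: N_def G_def power2_eq_square field_simps)
    have N2: "N (Suc i) j (diff1 c b) \<le> ennreal (C2 * G)"
      using C2(2)[OF R \<beta>' supp' diff', of x] R0 by (simp add: N_def G_def power2_eq_square field_simps)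
    \<comment> \<open>For \<open>i = 0\<close> the coefficient vanishes, so that the truncated \<open>i - 1\<close> does no harm; likewise for \<open>j\<close> below.\<close>
    have N3: "ennreal I2 * N (i - 1) j b \<le> ennreal (I2 * C3 * G)"
    proof (cases i)
      case 0
      then show ?thesis by (simp add: I2_def)
    next
      case (Suc i')
      have "N (i - 1) j b \<le> ennreal (C3 * G)"
        using C3(2)[OF R \<beta> supp diff0, of x] R0 by (simp add: N_def G_def Suc field_simps)
      then have "ennreal I2 * N (i - 1) j b \<le> ennreal I2 * ennreal (C3 * G)" by (intro mult_left_mono) auto
      then show ?thesis using IJ C3(1) G by (simp add: ennreal_mult[symmetric] mult.assoc)
    qed
    have N4: "ennreal J2 * N i (j - 1) b \<le> ennreal (J2 * C4 * G)"
    proof (cases j)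
      case 0
      then show ?thesis by (simp add: J2_def)
    next
      case (Suc i')
      have "N i (j - 1) b \<le> ennreal (C4 * G)"
        using C4(2)[OF R \<beta> supp diff0, of x] R0 by (simp add: N_def G_def Suc field_simps)
      then have "ennreal J2 * N i (j - 1) b \<le> ennreal J2 * ennreal (C4 * G)" by (intro mult_left_mono) auto
      then show ?thesis using IJ C4(1) G by (simp add: ennreal_mult[symmetric] mult.assoc)
    qed
    have pointwise: "(x $ c - y $ c) ^ (2 * Suc m) * ?K i j b y
       \<le> ?w y * ?K i (Suc j) (diff1 c b) y + ?w y * ?K (Suc i) j (diff1 c b) y
         + I2 * (?w y * ?K (i - 1) j b y) + J2 * (?w y * ?K i (j - 1) b y)" for y
    proof -
      have "4 * ((x $ c - y $ c)\<^sup>2 * ?K i j b y) = (cmod (2 * complex_of_real (x $ c - y $ c) * raised_kernel c R i j b x y))\<^sup>2"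
        by (simp add: norm_mult power_mult_distrib flip: of_real_diff)
      also have "\<dots> \<le> 4 * (?K i (Suc j) (diff1 c b) y + ?K (Suc i) j (diff1 c b) y
          + (cmod (2 * of_nat i * raised_kernel c R (i - 1) j b x y))\<^sup>2 + (cmod (2 * of_nat j * raised_kernel c R i (j - 1) b x y))\<^sup>2)"
        using supp by (subst raised_kernel_mult_diff) (auto intro!: order_trans[OF cmod_sq_four] simp del: One_nat_def)
      finally have "(x $ c - y $ c)\<^sup>2 * ?K i j b y
         \<le> ?K i (Suc j) (diff1 c b) y + ?K (Suc i) j (diff1 c b) y + I2 * ?K (i - 1) j b y + J2 * ?K i (j - 1) b y"
        by (simp add: norm_mult power_mult_distrib I2_def J2_def)
      then have "?w y * ((x $ c - y $ c)\<^sup>2 * ?K i j b y)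
         \<le> ?w y * (?K i (Suc j) (diff1 c b) y + ?K (Suc i) j (diff1 c b) y + I2 * ?K (i - 1) j b y + J2 * ?K i (j - 1) b y)"
        by (rule mult_left_mono) simp
      then show ?thesis by (simp add: algebra_simps power2_eq_square)
    qed
    have "(\<integral>\<^sup>+y. ennreal ((x $ c - y $ c) ^ (2 * Suc m) * ?K i j b y) \<partial>gauss_measure)
       \<le> (\<integral>\<^sup>+y. ennreal (?w y * ?K i (Suc j) (diff1 c b) y) + ennreal (?w y * ?K (Suc i) j (diff1 c b) y)
         + ennreal I2 * ennreal (?w y * ?K (i - 1) j b y) + ennreal J2 * ennreal (?w y * ?K i (j - 1) b y) \<partial>gauss_measure)"
      using IJ by (intro nn_integral_mono order_trans[OF ennreal_leI[OF pointwise]])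
        (simp add: ennreal_mult[symmetric] ennreal_plus[symmetric] del: ennreal_plus)
    also have "\<dots> = N i (Suc j) (diff1 c b) + N (Suc i) j (diff1 c b) + ennreal I2 * N (i - 1) j b + ennreal J2 * N i (j - 1) b"
      unfolding N_def by (simp add: nn_integral_add nn_integral_cmult)
    also have "\<dots> \<le> ennreal (C1 * G) + ennreal (C2 * G) + ennreal (I2 * C3 * G) + ennreal (J2 * C4 * G)"
      by (intro add_mono N1 N2 N3 N4)
    also have "\<dots> = ennreal (C * G)"
      using C1 C2 C3 C4 IJ G by (simp add: C_def algebra_simps ennreal_plus[symmetric] del: ennreal_plus)
    finally show "(\<integral>\<^sup>+y. ennreal ((x $ c - y $ c) ^ (2 * Suc m) * ?K i j b y) \<partial>gauss_measure)
       \<le> ennreal (C * \<beta>\<^sup>2 * real R ^ (i + j) / real R ^ Suc m * hermite_growth R x)"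
      by (simp only: G_def times_divide_eq_left times_divide_eq_right mult.assoc)
  qed
qed


section \<open>Symbols localized in frequency\<close>

text \<open>Of order \<open>(\<surd>R |x - y|)\<^sup>2\<^sup>K\<close> away from the diagonal, and a sum over coordinates of the weights for which
  \<open>raised_kernel_weighted_L2\<close> controls the kernel.\<close>

definition decay_weight :: "nat \<Rightarrow> nat \<Rightarrow> real ^ 'n \<Rightarrow> real ^ 'n \<Rightarrow> real" where
  "decay_weight K R x y = 1 + (\<Sum>c\<in>UNIV. real R ^ K * (x $ c - y $ c) ^ (2 * K))"

lemma decay_weight_ge_1: "decay_weight K R x y \<ge> 1"
  unfolding decay_weight_def by (simp add: sum_nonneg)

lemma decay_weight_pos: "decay_weight K R x y > 0"
  using decay_weight_ge_1[of K R x y] by simp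

text \<open>The largest factor to the power \<open>2 K\<close> is bounded by the weight. The product form reduces
  integrability of the inverse weight to dimension one, where it holds because \<open>2 K / n > 1\<close>.\<close>

lemma decay_weight_ge_prod:
  fixes x y :: "real ^ 'n"
  shows "(\<Prod>c\<in>UNIV. max 1 (sqrt (real R) * \<bar>x $ c - y $ c\<bar>) powr (2 * real K / CARD('n))) \<le> decay_weight K R x y"
proof -
  define u where "u c = max 1 (sqrt (real R) * \<bar>x $ c - y $ c\<bar>)" for c
  define p where "p = 2 * real K / CARD('n)"
  have p: "p \<ge> 0" by (simp add: p_def)
  have "Max (range u) \<in> range u" by (rule Max_in) auto
  then obtain c0 where c0: "Max (range u) = u c0" by (rule imageE)
  have le: "u c \<le> u c0" for c unfolding c0[symmetric] by (rule Max_ge) auto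
  have u1: "u c \<ge> 1" for c by (simp add: u_def)
  have "(\<Prod>c\<in>UNIV. u c powr p) \<le> (\<Prod>c\<in>(UNIV::'n set). u c0 powr p)"
    using le u1 p by (intro prod_mono) (auto intro!: powr_mono2 order_trans[OF zero_le_one])
  also have "\<dots> = (u c0 powr p) powr real CARD('n)"
    using u1[of c0] by (subst powr_realpow) auto
  also have "\<dots> = u c0 powr real (2 * K)"
    by (simp add: powr_powr p_def)
  also have "\<dots> = u c0 ^ (2 * K)"
    using u1[of c0] by (intro powr_realpow) auto
  also have "\<dots> \<le> decay_weight K R x y"
  proof (cases "sqrt (real R) * \<bar>x $ c0 - y $ c0\<bar> \<le> 1")
    case True
    then have "u c0 = 1" by (simp add: u_def)
    then show ?thesis using decay_weight_ge_1[of K R x y] by simp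
  next
    case False
    then have "u c0 ^ (2 * K) = (sqrt (real R)) ^ (2 * K) * \<bar>x $ c0 - y $ c0\<bar> ^ (2 * K)"
      by (simp add: u_def power_mult_distrib)
    also have "\<dots> = real R ^ K * (x $ c0 - y $ c0) ^ (2 * K)"
      by (simp add: power_mult)
    also have "\<dots> \<le> (\<Sum>c\<in>UNIV. real R ^ K * (x $ c - y $ c) ^ (2 * K))"
      by (rule member_le_sum) auto
    finally show ?thesis unfolding decay_weight_def by simp
  qed
  finally show ?thesis by (simp add: u_def p_def)
qed

lemma nn_integral_max_powr_finite:
  assumes p: "p > 1"
  shows "(\<integral>\<^sup>+t. ennreal (max 1 \<bar>t\<bar> powr (- p)) \<partial>lborel) < \<infinity>"
proof -
  let ?T = "\<lambda>t::real. ennreal (t powr (- p)) * indicator {1..} t"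
  have "((\<lambda>t. - (t powr (1 - p) / (p - 1))) \<longlongrightarrow> - (0 / (p - 1))) at_top"
    using p by (intro tendsto_intros tendsto_neg_powr filterlim_ident) auto
  moreover have "DERIV (\<lambda>t. - (t powr (1 - p) / (p - 1))) x :> x powr (- p)" if "1 \<le> x" for x
  proof -
    have "DERIV (\<lambda>t. t powr (1 - p)) x :> (1 - p) * x powr (1 - p - 1)"
      using that by (intro has_real_derivative_powr) auto
    from DERIV_minus[OF DERIV_cdivide[OF this, of "p - 1"]] show ?thesis
    proof (rule DERIV_cong)
      have "(1 - p) / (p - 1) = - 1" using p by (simp add: divide_eq_eq)
      then show "- ((1 - p) * x powr (1 - p - 1) / (p - 1)) = x powr (- p)"
        by (simp add: times_divide_eq_left[symmetric] del: times_divide_eq_left)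
    qed
  qed
  ultimately have tail: "(\<integral>\<^sup>+t. ?T t \<partial>lborel) = ennreal (0 - (- (1 powr (1 - p) / (p - 1))))"
    by (intro nn_integral_FTC_atLeast) auto
  have refl: "(\<integral>\<^sup>+t. ?T (- t) \<partial>lborel) = (\<integral>\<^sup>+t. ?T t \<partial>lborel)"
    using nn_integral_real_affine[of ?T "-1" 0] by simp
  have "(\<integral>\<^sup>+t. ennreal (max 1 \<bar>t\<bar> powr (- p)) \<partial>lborel)
    \<le> (\<integral>\<^sup>+t. indicator {-1..1} t + (?T t + ?T (- t)) \<partial>lborel)"
  proof (rule nn_integral_mono)
    fix t :: real
    consider "t \<le> -1" | "-1 < t" "t < 1" | "t \<ge> 1" by linarith
    then show "ennreal (max 1 \<bar>t\<bar> powr (- p)) \<le> indicator {-1..1} t + (?T t + ?T (- t))"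
      by cases (auto simp: max_def intro!: add_increasing add_increasing2 split: split_indicator)
  qed
  also have "\<dots> = (\<integral>\<^sup>+t. indicator {-1..1::real} t \<partial>lborel) + ((\<integral>\<^sup>+t. ?T t \<partial>lborel) + (\<integral>\<^sup>+t. ?T (- t) \<partial>lborel))"
    by (simp add: nn_integral_add)
  also have "\<dots> < \<infinity>"
    unfolding refl tail by simp
  finally show ?thesis .
qed

lemma nn_integral_decay_weight:
  assumes "CARD('n) < 2 * K"
  shows "\<exists>J\<ge>0. \<forall>R (y :: real ^ 'n). R \<ge> 1 \<longrightarrow>
    (\<integral>\<^sup>+x. ennreal (1 / decay_weight K R x y) \<partial>lborel) \<le> ennreal (J / sqrt (real R) ^ CARD('n))"
proof -
  define p where "p = 2 * real K / CARD('n)"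
  have p: "p > 1" using assms by (simp add: p_def)
  obtain j where j: "j \<ge> 0" "(\<integral>\<^sup>+t. ennreal (max 1 \<bar>t\<bar> powr (- p)) \<partial>lborel) = ennreal j"
    using nn_integral_max_powr_finite[OF p] by (auto simp: less_top_ennreal)
  show ?thesis
  proof (intro exI[of _ "j ^ CARD('n)"] conjI allI impI)
    fix R :: nat and y :: "real ^ 'n" assume R: "R \<ge> 1"
    define f where "f c t = max 1 (sqrt (real R) * \<bar>t - y $ c\<bar>) powr (- p)" for c t
    have [measurable]: "f c \<in> borel_measurable borel" for c unfolding f_def by measurable
    have int_f: "(\<integral>\<^sup>+t. ennreal (f c t) \<partial>lborel) = ennreal (j / sqrt (real R))" for c
    proof -
      have "(\<integral>\<^sup>+t. ennreal (f c t) \<partial>lborel) = ennreal \<bar>1 / sqrt (real R)\<bar> * (\<integral>\<^sup>+t. ennreal (f c (y $ c + 1 / sqrt (real R) * t)) \<partial>lborel)"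
        using R by (intro nn_integral_real_affine) auto
      also have "(\<lambda>t. f c (y $ c + 1 / sqrt (real R) * t)) = (\<lambda>t. max 1 \<bar>t\<bar> powr (- p))"
        using R by (simp add: f_def abs_mult)
      finally show ?thesis using j by (simp add: ennreal_mult[symmetric])
    qed
    have "(\<integral>\<^sup>+x. ennreal (1 / decay_weight K R x y) \<partial>lborel) \<le> (\<integral>\<^sup>+x. (\<Prod>c\<in>UNIV. ennreal (f c (x $ c))) \<partial>lborel)"
    proof (rule nn_integral_mono)
      fix x :: "real ^ 'n"
      have "1 / decay_weight K R x y \<le> 1 / (\<Prod>c\<in>UNIV. max 1 (sqrt (real R) * \<bar>x $ c - y $ c\<bar>) powr p)"
        using decay_weight_ge_prod[of R x y K] decay_weight_pos[of K R x y]
        by (intro divide_left_mono) (auto simp: p_def intro!: prod_pos mult_pos_pos)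
      also have "\<dots> = (\<Prod>c\<in>UNIV. f c (x $ c))"
        by (simp add: f_def powr_minus prod_inversef[symmetric] inverse_eq_divide prod_dividef)
      finally show "ennreal (1 / decay_weight K R x y) \<le> (\<Prod>c\<in>UNIV. ennreal (f c (x $ c)))"
        by (subst prod_ennreal) (auto simp: f_def intro: ennreal_leI)
    qed
    also have "\<dots> = (\<Prod>c\<in>(UNIV::'n set). ennreal (j / sqrt (real R)))"
      by (subst nn_integral_prod_vec) (auto simp: int_f)
    also have "\<dots> = ennreal (j ^ CARD('n) / sqrt (real R) ^ CARD('n))"
      using j R by (simp add: ennreal_power power_divide)
    finally show "(\<integral>\<^sup>+x. ennreal (1 / decay_weight K R x y) \<partial>lborel) \<le> ennreal (j ^ CARD('n) / sqrt (real R) ^ CARD('n))" .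
  qed (use j in simp)
qed

lemma continuous_decay_weight: "continuous_on S (\<lambda>z. decay_weight K R (fst z) (snd z))"
  unfolding decay_weight_def by (intro continuous_intros)

lemma measurable_decay_weight [measurable]:
  "(\<lambda>(x, y). decay_weight K R x y) \<in> borel_measurable (borel \<Otimes>\<^sub>M borel)"
  unfolding borel_prod using continuous_decay_weight[of UNIV K R]
  by (intro borel_measurable_continuous_onI) (simp add: case_prod_beta)

text \<open>Cauchy--Schwarz in \<open>y\<close> against the weight, using the off-diagonal decay of the kernel in each
  coordinate direction.\<close>

lemma localized_sum_pointwise:
  "\<exists>C\<ge>0. \<forall>R \<beta> a (x :: real ^ 'n) d. R \<ge> 1 \<longrightarrow> \<beta> \<ge> 0 \<longrightarrow> (\<forall>\<xi>. R < mi_abs \<xi> \<longrightarrow> a \<xi> = 0) \<longrightarrow>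
     (\<forall>c. \<forall>l\<le>K. \<forall>\<xi>. cmod ((diff1 c ^^ l) a \<xi>) \<le> \<beta> / real R ^ l) \<longrightarrow>
     ennreal ((cmod (\<Sum>\<xi> | mi_abs \<xi> \<le> R. d \<xi> * a \<xi> * hn \<xi> x))\<^sup>2)
      \<le> ennreal (C * \<beta>\<^sup>2 * hermite_growth R x) *
        (\<integral>\<^sup>+y. ennreal ((cmod (\<Sum>\<xi> | mi_abs \<xi> \<le> R. d \<xi> * hn \<xi> y))\<^sup>2 / decay_weight K R x y) \<partial>gauss_measure)"
proof -
  define P where "P c C \<longleftrightarrow> C \<ge> 0 \<and> (\<forall>R \<beta> b x. R \<ge> 1 \<longrightarrow> \<beta> \<ge> 0 \<longrightarrow> (\<forall>\<xi>. R < mi_abs \<xi> \<longrightarrow> b \<xi> = 0) \<longrightarrow>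
     (\<forall>l\<le>K. \<forall>\<xi>. cmod ((diff1 c ^^ l) b \<xi>) \<le> \<beta> / real R ^ l) \<longrightarrow>
     (\<integral>\<^sup>+y. ennreal ((x $ c - y $ c) ^ (2 * K) * (cmod (raised_kernel c R 0 0 b x y))\<^sup>2) \<partial>gauss_measure)
       \<le> ennreal (C * \<beta>\<^sup>2 * real R ^ (0 + 0) / real R ^ K * hermite_growth R x))" for c :: 'n and C
  have "\<forall>c. \<exists>C. P c C"
    using raised_kernel_weighted_L2[of K _ 0 0, where 'n = 'n] unfolding P_def by blast
  then obtain C where P: "\<And>c. P c (C c)" by metis
  have C: "C c \<ge> 0" for c using P[of c] by (simp add: P_def)
  define C0 where "C0 = (3 * sqrt pi * sqrt 2) ^ CARD('n)"
  define Ct where "Ct = C0 + (\<Sum>c\<in>UNIV. C c)"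
  have C0: "C0 \<ge> 0" by (simp add: C0_def)
  have Ct: "Ct \<ge> 0" using C0 C by (simp add: Ct_def sum_nonneg)
  show ?thesis
  proof (intro exI[of _ Ct] conjI Ct allI impI)
    fix R :: nat and \<beta> :: real and a :: "nat ^ 'n \<Rightarrow> complex" and x :: "real ^ 'n" and d :: "nat ^ 'n \<Rightarrow> complex"
    assume R: "R \<ge> 1" and \<beta>: "\<beta> \<ge> 0" and supp: "\<forall>\<xi>. R < mi_abs \<xi> \<longrightarrow> a \<xi> = 0"
      and diff: "\<forall>c. \<forall>l\<le>K. \<forall>\<xi>. cmod ((diff1 c ^^ l) a \<xi>) \<le> \<beta> / real R ^ l"
    let ?Q = "{\<xi> :: nat ^ 'n. mi_abs \<xi> \<le> R}"
    let ?W = "decay_weight K R x"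
    note Q = finite_mi_abs_le[of R, where 'n = 'n]
    note W = decay_weight_pos[of K R x]
    have [measurable]: "?W \<in> borel_measurable borel"
      using measurable_decay_weight[of K R, where 'a = 'n] by measurable
    have [measurable]: "?W \<in> borel_measurable lebesgue" by (simp add: measurable_completion)
    define f where "f y = (\<Sum>\<xi>\<in>?Q. d \<xi> * hn \<xi> y)" for y
    define k where "k y = (\<Sum>\<xi>\<in>?Q. a \<xi> * hn \<xi> x * hn \<xi> y)" for y
    have [measurable]: "f \<in> borel_measurable lebesgue" "k \<in> borel_measurable lebesgue"
      unfolding f_def k_def by measurable
    have k_eq: "raised_kernel c R 0 0 a x y = k y" for c y
    proof -
      have "axis c (0::nat) = 0" by (simp add: vec_eq_iff axis_def)
      then have "\<xi> + axis c 0 = \<xi>" for \<xi> :: "nat ^ 'n" by simp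
      then have "raised_kernel c R 0 0 a x y = (\<Sum>\<xi>\<in>?Q. a \<xi> / hermite_sq \<xi> * hermite \<xi> x * hermite \<xi> y)"
        unfolding raised_kernel_def by (simp only:)
      also have "\<dots> = k y"
        unfolding k_def hn_def
        by (intro sum.cong refl) (simp add: of_real_mult[symmetric] del: of_real_mult)
      finally show ?thesis .
    qed
    have f_L2: "in_L2 gauss_measure f" unfolding f_def by (rule in_L2_hn_sum[OF Q])
    have fk: "f y * k y = (\<Sum>\<xi>\<in>?Q. (a \<xi> * hn \<xi> x) * (f y * hn \<xi> y))" for y
      by (simp add: k_def sum_distrib_left mult_ac)
    have int: "integrable gauss_measure (\<lambda>y. f y * k y)"
      unfolding fk by (intro Bochner_Integration.integrable_sum integrable_mult_right integrable_hn_L2 f_L2)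
    have "(\<integral>y. f y * k y \<partial>gauss_measure) = (\<Sum>\<xi>\<in>?Q. (a \<xi> * hn \<xi> x) * gauss_pairing f (nhermite \<xi>))"
      unfolding fk
      by (subst Bochner_Integration.integral_sum)
        (auto intro!: integrable_mult_right integrable_hn_L2 f_L2 simp: gauss_pairing_def nhermite_eq_hn)
    also have "\<dots> = (\<Sum>\<xi>\<in>?Q. d \<xi> * a \<xi> * hn \<xi> x)"
      using gauss_pairing_hn_sum[OF Q, of d]
      by (intro sum.cong refl) (simp add: f_def[abs_def] nhermite_eq_hn)
    finally have sum_eq: "(\<Sum>\<xi>\<in>?Q. d \<xi> * a \<xi> * hn \<xi> x) = (\<integral>y. f y * k y \<partial>gauss_measure)" by simp
    have "ennreal (cmod (\<Sum>\<xi>\<in>?Q. d \<xi> * a \<xi> * hn \<xi> x)) \<le> (\<integral>\<^sup>+y. ennreal (cmod (f y * k y)) \<partial>gauss_measure)"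
      unfolding sum_eq by (rule integral_norm_bound_ennreal[OF int])
    also have "\<dots> = (\<integral>\<^sup>+y. ennreal (cmod (k y) * sqrt (?W y)) * ennreal (cmod (f y) / sqrt (?W y)) \<partial>gauss_measure)"
      using W by (intro nn_integral_cong) (simp add: ennreal_mult[symmetric] norm_mult less_imp_le less_imp_neq[THEN not_sym])
    finally have "(ennreal (cmod (\<Sum>\<xi>\<in>?Q. d \<xi> * a \<xi> * hn \<xi> x)))\<^sup>2 \<le> \<dots>\<^sup>2"
      by (rule power_mono) simp
    also have "\<dots> \<le> (\<integral>\<^sup>+y. (ennreal (cmod (k y) * sqrt (?W y)))\<^sup>2 \<partial>gauss_measure) * (\<integral>\<^sup>+y. (ennreal (cmod (f y) / sqrt (?W y)))\<^sup>2 \<partial>gauss_measure)"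
      by (rule Cauchy_Schwarz_nn_integral) (simp_all add: measurable_gauss_measure)
    also have "(\<integral>\<^sup>+y. (ennreal (cmod (k y) * sqrt (?W y)))\<^sup>2 \<partial>gauss_measure) \<le> ennreal (Ct * \<beta>\<^sup>2 * hermite_growth R x)"
    proof -
      have "(ennreal (cmod (k y) * sqrt (?W y)))\<^sup>2 = ennreal ((cmod (k y))\<^sup>2)
          + (\<Sum>c\<in>UNIV. ennreal (real R ^ K) * ennreal ((x $ c - y $ c) ^ (2 * K) * (cmod (k y))\<^sup>2))" for y
      proof -
        have "(ennreal (cmod (k y) * sqrt (?W y)))\<^sup>2 = ennreal ((cmod (k y))\<^sup>2 * ?W y)"
          using W[of y] by (simp add: ennreal_power power_mult_distrib less_imp_le)
        also have "(cmod (k y))\<^sup>2 * ?W y = (cmod (k y))\<^sup>2 + (\<Sum>c\<in>UNIV. real R ^ K * ((x $ c - y $ c) ^ (2 * K) * (cmod (k y))\<^sup>2))"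
          by (simp add: decay_weight_def distrib_left sum_distrib_left mult_ac)
        also have "ennreal \<dots> = ennreal ((cmod (k y))\<^sup>2) + (\<Sum>c\<in>UNIV. ennreal (real R ^ K * ((x $ c - y $ c) ^ (2 * K) * (cmod (k y))\<^sup>2)))"
          by (subst ennreal_plus) (auto intro!: sum_nonneg simp: sum_ennreal)
        finally show ?thesis by (simp add: ennreal_mult)
      qed
      then have "(\<integral>\<^sup>+y. (ennreal (cmod (k y) * sqrt (?W y)))\<^sup>2 \<partial>gauss_measure)
         = (\<integral>\<^sup>+y. ennreal ((cmod (k y))\<^sup>2) \<partial>gauss_measure)
           + (\<Sum>c\<in>UNIV. ennreal (real R ^ K) * (\<integral>\<^sup>+y. ennreal ((x $ c - y $ c) ^ (2 * K) * (cmod (k y))\<^sup>2) \<partial>gauss_measure))"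
        by (simp add: nn_integral_add nn_integral_sum nn_integral_cmult)
      also have "\<dots> \<le> ennreal (C0 * \<beta>\<^sup>2 * hermite_growth R x)
          + (\<Sum>c\<in>UNIV. ennreal (real R ^ K) * ennreal (C c * \<beta>\<^sup>2 * real R ^ (0 + 0) / real R ^ K * hermite_growth R x))"
      proof (intro add_mono sum_mono mult_left_mono)
        have "cmod (a \<xi>) \<le> \<beta>" for \<xi> using diff[rule_format, of 0 _ \<xi>] by simp
        then show "(\<integral>\<^sup>+y. ennreal ((cmod (k y))\<^sup>2) \<partial>gauss_measure) \<le> ennreal (C0 * \<beta>\<^sup>2 * hermite_growth R x)"
          using raised_kernel_L2[OF R, of a \<beta> undefined 0 0 x] by (simp add: k_eq C0_def)
        show "(\<integral>\<^sup>+y. ennreal ((x $ c - y $ c) ^ (2 * K) * (cmod (k y))\<^sup>2) \<partial>gauss_measure)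
           \<le> ennreal (C c * \<beta>\<^sup>2 * real R ^ (0 + 0) / real R ^ K * hermite_growth R x)" for c
          unfolding k_eq[of c, symmetric]
          by (rule P[of c, unfolded P_def, THEN conjunct2, rule_format, OF R \<beta>]) (simp_all add: supp diff)
      qed simp
      also have "\<dots> = ennreal (C0 * \<beta>\<^sup>2 * hermite_growth R x) + (\<Sum>c\<in>UNIV. ennreal (C c * \<beta>\<^sup>2 * hermite_growth R x))"
        using R C by (simp add: ennreal_mult[symmetric])
      also have "\<dots> = ennreal (Ct * \<beta>\<^sup>2 * hermite_growth R x)"
        using C0 C by (subst sum_ennreal) (auto simp: Ct_def distrib_right sum_distrib_right ennreal_plus[symmetric] sum_nonneg simp del: ennreal_plus)
      finally show ?thesis .
    qed
    also have "(\<integral>\<^sup>+y. (ennreal (cmod (f y) / sqrt (?W y)))\<^sup>2 \<partial>gauss_measure) = (\<integral>\<^sup>+y. ennreal ((cmod (f y))\<^sup>2 / ?W y) \<partial>gauss_measure)"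
      using W by (intro nn_integral_cong) (simp add: ennreal_power power_divide less_imp_le)
    finally show "ennreal ((cmod (\<Sum>\<xi>\<in>?Q. d \<xi> * a \<xi> * hn \<xi> x))\<^sup>2)
      \<le> ennreal (Ct * \<beta>\<^sup>2 * hermite_growth R x) * (\<integral>\<^sup>+y. ennreal ((cmod (\<Sum>\<xi>\<in>?Q. d \<xi> * hn \<xi> y))\<^sup>2 / ?W y) \<partial>gauss_measure)"
      by (simp add: ennreal_power f_def mult_right_mono)
  qed
qed

text \<open>The pointwise estimate is integrated over \<open>x\<close>: the Gaussian density cancels the growth of the Hermite
  polynomials, and Tonelli moves the \<open>x\<close>-integration onto the inverse decay weight. Its integral, of order \<open>R\<^sup>-\<^sup>n\<^sup>/\<^sup>2\<close>,
  compensates the factor \<open>R\<^sup>n\<^sup>/\<^sup>2\<close> of the Christoffel function, so the bound is uniform in \<open>R\<close>.\<close>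

lemma localized_symbol_bounded:
  assumes K: "CARD('n) < 2 * K"
  shows "\<exists>C\<ge>0. \<forall>R \<beta> (\<sigma> :: real ^ 'n \<Rightarrow> nat ^ 'n \<Rightarrow> complex). R \<ge> 1 \<longrightarrow> \<beta> \<ge> 0 \<longrightarrow>
     (AE x in lebesgue. (\<forall>\<xi>. R < mi_abs \<xi> \<longrightarrow> \<sigma> x \<xi> = 0) \<and>
        (\<forall>c. \<forall>l\<le>K. \<forall>\<xi>. cmod ((diff1 c ^^ l) (\<sigma> x) \<xi>) \<le> \<beta> / real R ^ l)) \<longrightarrow>
     (\<forall>S d. finite S \<longrightarrow>
       (\<integral>\<^sup>+x. ennreal ((cmod (\<Sum>\<xi>\<in>S. d \<xi> * \<sigma> x \<xi> * hn \<xi> x))\<^sup>2) \<partial>gauss_measure)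
         \<le> ennreal (C * \<beta>\<^sup>2 * (\<Sum>\<xi>\<in>S. (cmod (d \<xi>))\<^sup>2)))"
proof -
  obtain C1 where C1: "C1 \<ge> 0" and pointwise: "\<And>R \<beta> a (x :: real ^ 'n) d. R \<ge> 1 \<Longrightarrow> \<beta> \<ge> 0 \<Longrightarrow> (\<forall>\<xi>. R < mi_abs \<xi> \<longrightarrow> a \<xi> = 0) \<Longrightarrow>
     (\<forall>c. \<forall>l\<le>K. \<forall>\<xi>. cmod ((diff1 c ^^ l) a \<xi>) \<le> \<beta> / real R ^ l) \<Longrightarrow>
     ennreal ((cmod (\<Sum>\<xi> | mi_abs \<xi> \<le> R. d \<xi> * a \<xi> * hn \<xi> x))\<^sup>2)
      \<le> ennreal (C1 * \<beta>\<^sup>2 * hermite_growth R x) *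
        (\<integral>\<^sup>+y. ennreal ((cmod (\<Sum>\<xi> | mi_abs \<xi> \<le> R. d \<xi> * hn \<xi> y))\<^sup>2 / decay_weight K R x y) \<partial>gauss_measure)"
    using localized_sum_pointwise[of K, where 'n = 'n] by blast
  obtain J where J: "J \<ge> 0" and weight: "\<And>R (y :: real ^ 'n). R \<ge> 1 \<Longrightarrow>
    (\<integral>\<^sup>+x. ennreal (1 / decay_weight K R x y) \<partial>lborel) \<le> ennreal (J / sqrt (real R) ^ CARD('n))"
    using nn_integral_decay_weight[OF K] by blast
  show ?thesis
  proof (intro exI[of _ "C1 * J"] conjI allI impI)
    show "0 \<le> C1 * J" using C1 J by simp
    fix R :: nat and \<beta> :: real and \<sigma> :: "real ^ 'n \<Rightarrow> nat ^ 'n \<Rightarrow> complex" and S :: "(nat ^ 'n) set" and d :: "nat ^ 'n \<Rightarrow> complex"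
    assume R: "R \<ge> 1" and \<beta>: "\<beta> \<ge> 0" and S: "finite S"
      and ae: "AE x in lebesgue. (\<forall>\<xi>. R < mi_abs \<xi> \<longrightarrow> \<sigma> x \<xi> = 0) \<and>
        (\<forall>c. \<forall>l\<le>K. \<forall>\<xi>. cmod ((diff1 c ^^ l) (\<sigma> x) \<xi>) \<le> \<beta> / real R ^ l)"
    let ?Q = "{\<xi> :: nat ^ 'n. mi_abs \<xi> \<le> R}"
    note Q = finite_mi_abs_le[of R, where 'n = 'n]
    define e where "e \<xi> = (if \<xi> \<in> S then d \<xi> else 0)" for \<xi>
    define f where "f y = (\<Sum>\<xi>\<in>?Q. e \<xi> * hn \<xi> y)" for y
    have [measurable]: "f \<in> borel_measurable borel" unfolding f_def by measurable
    define I where "I x = (\<integral>\<^sup>+y. ennreal ((cmod (f y))\<^sup>2 / decay_weight K R x y) \<partial>gauss_measure)" for x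
    have I_eq: "I x = (\<integral>\<^sup>+y. ennreal (gauss_density y) * ennreal ((cmod (f y))\<^sup>2 / decay_weight K R x y) \<partial>lborel)" for x
      unfolding I_def by (rule nn_integral_gauss_lborel) measurable
    have [measurable]: "I \<in> borel_measurable borel"
      unfolding I_eq by measurable
    have growth: "ennreal (gauss_density x) * (ennreal (C1 * \<beta>\<^sup>2 * hermite_growth R x) * I x) \<le> ennreal (C1 * \<beta>\<^sup>2 * sqrt (real R) ^ CARD('n)) * I x" for x :: "real ^ 'n"
    proof -
      have "pi powr (- real CARD('n) / 2) \<le> 1"
        using powr_mono[of "- real CARD('n) / 2" 0 pi] pi_gt3 by simp
      then have "gauss_density x * (C1 * \<beta>\<^sup>2 * hermite_growth R x) \<le> C1 * \<beta>\<^sup>2 * sqrt (real R) ^ CARD('n)"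
        using C1 mult_left_le_one_le[of "C1 * \<beta>\<^sup>2 * sqrt (real R) ^ CARD('n)" "pi powr (- real CARD('n) / 2)"]
        by (simp add: gauss_density_def hermite_growth_def exp_minus field_simps)
      then show ?thesis
        using C1 by (simp add: mult.assoc[symmetric] ennreal_mult[symmetric] mult_right_mono ennreal_leI)
    qed
    have "(\<integral>\<^sup>+x. ennreal ((cmod (\<Sum>\<xi>\<in>S. d \<xi> * \<sigma> x \<xi> * hn \<xi> x))\<^sup>2) \<partial>gauss_measure)
       \<le> (\<integral>\<^sup>+x. ennreal (C1 * \<beta>\<^sup>2 * hermite_growth R x) * I x \<partial>gauss_measure)"
    proof (rule nn_integral_mono_AE)
      show "AE x in gauss_measure. ennreal ((cmod (\<Sum>\<xi>\<in>S. d \<xi> * \<sigma> x \<xi> * hn \<xi> x))\<^sup>2) \<le> ennreal (C1 * \<beta>\<^sup>2 * hermite_growth R x) * I x"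
        unfolding AE_gauss_measure using ae
      proof eventually_elim
        case (elim x)
        have "(\<Sum>\<xi>\<in>S. d \<xi> * \<sigma> x \<xi> * hn \<xi> x) = (\<Sum>\<xi>\<in>?Q. e \<xi> * \<sigma> x \<xi> * hn \<xi> x)"
          using elim by (intro sum.mono_neutral_cong[OF Q S]) (auto simp: e_def not_le)
        then show ?case
          using pointwise[OF R \<beta>, of "\<sigma> x" e x] elim unfolding I_def f_def by simp
      qed
    qed
    also have "\<dots> = (\<integral>\<^sup>+x. ennreal (gauss_density x) * (ennreal (C1 * \<beta>\<^sup>2 * hermite_growth R x) * I x) \<partial>lborel)"
      by (rule nn_integral_gauss_lborel) (simp add: hermite_growth_def)
    also have "\<dots> \<le> (\<integral>\<^sup>+x. ennreal (C1 * \<beta>\<^sup>2 * sqrt (real R) ^ CARD('n)) * I x \<partial>lborel)"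
      by (intro nn_integral_mono growth)
    also have "\<dots> = ennreal (C1 * \<beta>\<^sup>2 * sqrt (real R) ^ CARD('n)) * (\<integral>\<^sup>+x. I x \<partial>lborel)"
      by (rule nn_integral_cmult) simp
    also have "(\<integral>\<^sup>+x. I x \<partial>lborel) = (\<integral>\<^sup>+y. (\<integral>\<^sup>+x. ennreal (gauss_density y) * ennreal ((cmod (f y))\<^sup>2 / decay_weight K R x y) \<partial>lborel) \<partial>lborel)"
      unfolding I_eq by (rule lborel_pair.Fubini'[symmetric]) measurable
    also have "\<dots> = (\<integral>\<^sup>+y. ennreal (gauss_density y) * (ennreal ((cmod (f y))\<^sup>2) * (\<integral>\<^sup>+x. ennreal (1 / decay_weight K R x y) \<partial>lborel)) \<partial>lborel)"
    proof (intro nn_integral_cong)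
      fix y
      have "ennreal ((cmod (f y))\<^sup>2 / decay_weight K R x y) = ennreal ((cmod (f y))\<^sup>2) * ennreal (1 / decay_weight K R x y)" for x
        using decay_weight_pos[of K R x y] by (simp add: ennreal_mult[symmetric] less_imp_le)
      then show "(\<integral>\<^sup>+x. ennreal (gauss_density y) * ennreal ((cmod (f y))\<^sup>2 / decay_weight K R x y) \<partial>lborel)
         = ennreal (gauss_density y) * (ennreal ((cmod (f y))\<^sup>2) * (\<integral>\<^sup>+x. ennreal (1 / decay_weight K R x y) \<partial>lborel))"
        by (simp add: nn_integral_cmult)
    qed
    also have "\<dots> \<le> (\<integral>\<^sup>+y. ennreal (gauss_density y) * (ennreal ((cmod (f y))\<^sup>2) * ennreal (J / sqrt (real R) ^ CARD('n))) \<partial>lborel)"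
      by (intro nn_integral_mono mult_left_mono weight R) auto
    also have "\<dots> = (\<integral>\<^sup>+y. ennreal ((cmod (f y))\<^sup>2) * ennreal (J / sqrt (real R) ^ CARD('n)) \<partial>gauss_measure)"
      by (rule nn_integral_gauss_lborel[symmetric]) measurable
    also have "\<dots> = (\<integral>\<^sup>+y. ennreal ((cmod (f y))\<^sup>2) \<partial>gauss_measure) * ennreal (J / sqrt (real R) ^ CARD('n))"
      by (rule nn_integral_multc) (simp add: measurable_completion)
    also have "(\<integral>\<^sup>+y. ennreal ((cmod (f y))\<^sup>2) \<partial>gauss_measure) = ennreal (\<Sum>\<xi>\<in>?Q. (cmod (e \<xi>))\<^sup>2)"
      unfolding f_def using nn_integral_hn_sum[OF Q, of "\<lambda>\<xi>. \<xi>" e] by (simp add: inj_on_def)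
    also have "(\<Sum>\<xi>\<in>?Q. (cmod (e \<xi>))\<^sup>2) = (\<Sum>\<xi>\<in>?Q \<inter> S. (cmod (d \<xi>))\<^sup>2)"
      using Q by (intro sum.mono_neutral_cong_right) (auto simp: e_def)
    also have "ennreal \<dots> \<le> ennreal (\<Sum>\<xi>\<in>S. (cmod (d \<xi>))\<^sup>2)"
      using S by (intro ennreal_leI sum_mono2) auto
    also have "ennreal (C1 * \<beta>\<^sup>2 * sqrt (real R) ^ CARD('n)) * (\<dots> * ennreal (J / sqrt (real R) ^ CARD('n)))
      = ennreal (C1 * J * \<beta>\<^sup>2 * (\<Sum>\<xi>\<in>S. (cmod (d \<xi>))\<^sup>2))"
    proof -
      have nz: "sqrt (real R) ^ CARD('n) > 0" using R by simp
      have "(C1 * \<beta>\<^sup>2 * s) * (D * (J / s)) = C1 * J * \<beta>\<^sup>2 * D" if "s > 0" for s D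
        using that by simp
      from this[OF nz] show ?thesis
        using C1 J by (simp add: ennreal_mult[symmetric] sum_nonneg)
    qed
    finally show "(\<integral>\<^sup>+x. ennreal ((cmod (\<Sum>\<xi>\<in>S. d \<xi> * \<sigma> x \<xi> * hn \<xi> x))\<^sup>2) \<partial>gauss_measure)
         \<le> ennreal (C1 * J * \<beta>\<^sup>2 * (\<Sum>\<xi>\<in>S. (cmod (d \<xi>))\<^sup>2))"
      by (simp add: mult_left_mono mult_right_mono)
  qed
qed


section \<open>Dyadic cutoffs\<close>

definition fdiff :: "(nat \<Rightarrow> real) \<Rightarrow> nat \<Rightarrow> real" where
  "fdiff b k = b (Suc k) - b k"

definition forward_avg :: "nat \<Rightarrow> (nat \<Rightarrow> real) \<Rightarrow> nat \<Rightarrow> real" where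
  "forward_avg L b k = (\<Sum>i<L. b (k + i)) / real L"

lemma forward_avg_bounds:
  assumes "L \<ge> 1" "\<And>k. 0 \<le> b k \<and> b k \<le> 1"
  shows "0 \<le> (forward_avg L ^^ m) b k \<and> (forward_avg L ^^ m) b k \<le> 1"
proof (induction m arbitrary: k)
  case (Suc m)
  let ?g = "(forward_avg L ^^ m) b"
  have "(\<Sum>i<L. ?g (k + i)) \<le> (\<Sum>i<L. 1)" using Suc by (intro sum_mono) auto
  moreover have "0 \<le> (\<Sum>i<L. ?g (k + i))" using Suc by (intro sum_nonneg) auto
  ultimately show ?case
    using assms(1) by (simp add: forward_avg_def[of L ?g k] divide_le_eq)
qed (use assms in simp)

lemma fdiff_forward_avg:
  "fdiff (forward_avg L b) = (\<lambda>k. (b (k + L) - b k) / real L)"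
proof
  fix k
  have "(\<Sum>i<L. b (Suc k + i)) - (\<Sum>i<L. b (k + i)) = (\<Sum>i<L. b (k + Suc i) - b (k + i))"
    by (simp add: sum_subtractf)
  also have "\<dots> = b (k + L) - b k"
    using sum_lessThan_telescope[of "\<lambda>i. b (k + i)" L] by simp
  finally show "fdiff (forward_avg L b) k = (b (k + L) - b k) / real L"
    by (simp add: fdiff_def forward_avg_def diff_divide_distrib[symmetric])
qed

lemma fdiff_power_shift_diff:
  "(fdiff ^^ l) (\<lambda>k. (g (k + L) - g k) / r) k = ((fdiff ^^ l) g (k + L) - (fdiff ^^ l) g k) / r"
  by (induction l arbitrary: k) (simp_all add: fdiff_def diff_divide_distrib)

text \<open>One averaging over \<open>L\<close> consecutive values turns a difference into a difference quotient over the distance \<open>L\<close>,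
  which gains \<open>2 / L\<close>.\<close>

lemma fdiff_power_forward_avg_bound:
  assumes "L \<ge> 1" "\<And>k. 0 \<le> b k \<and> b k \<le> 1" "l \<le> m"
  shows "\<bar>(fdiff ^^ l) ((forward_avg L ^^ m) b) k\<bar> \<le> (2 / real L) ^ l"
  using assms(3)
proof (induction m arbitrary: l k)
  case 0
  then show ?case using assms(2)[of k] by simp
next
  case (Suc m)
  show ?case
  proof (cases l)
    case 0
    have "0 \<le> (forward_avg L ^^ Suc m) b k \<and> (forward_avg L ^^ Suc m) b k \<le> 1"
      using assms(1,2) by (rule forward_avg_bounds)
    then show ?thesis using 0 by (simp only: funpow_0 power_0 abs_of_nonneg)
  next
    case (Suc l')
    let ?g = "(forward_avg L ^^ m) b"
    have "(fdiff ^^ l) ((forward_avg L ^^ Suc m) b) k = ((fdiff ^^ l') ?g (k + L) - (fdiff ^^ l') ?g k) / real L"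
      unfolding Suc funpow_Suc_right[of l'] o_apply
      by (simp add: fdiff_forward_avg fdiff_power_shift_diff)
    moreover have "\<bar>(fdiff ^^ l') ?g (k + L) - (fdiff ^^ l') ?g k\<bar> \<le> 2 * (2 / real L) ^ l'"
      using Suc.IH[of l' "k + L"] Suc.IH[of l' k] Suc.prems Suc by linarith
    ultimately show ?thesis
      using assms(1) by (simp add: Suc divide_right_mono)
  qed
qed

text \<open>Averaging \<open>K\<close> times makes \<open>K\<close> differences controllable; the step is placed at \<open>(K + 1) L\<close> because the averages look
  ahead by at most \<open>K (L - 1)\<close>, so that the value \<open>1\<close> survives below \<open>L\<close>.\<close>

definition cutoff :: "nat \<Rightarrow> nat \<Rightarrow> nat \<Rightarrow> real" where
  "cutoff K L = (forward_avg L ^^ K) (\<lambda>k. if k < Suc K * L then 1 else 0)"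

lemma cutoff_eq_1:
  assumes "L \<ge> 1" "k < L"
  shows "cutoff K L k = 1"
proof -
  have "(forward_avg L ^^ m) (\<lambda>k. if k < N then 1 else 0) k = 1" if "k + m * L < N" for m k N
    using that
  proof (induction m arbitrary: k)
    case (Suc m)
    have "(forward_avg L ^^ m) (\<lambda>k. if k < N then 1 else 0) (k + i) = 1" if "i < L" for i
      using Suc.prems that by (intro Suc.IH) auto
    then show ?case
      using assms by (simp add: forward_avg_def[of L "(forward_avg L ^^ m) (\<lambda>k. if k < N then 1 else 0)" k])
  qed simp
  then show ?thesis using assms by (simp add: cutoff_def)
qed

lemma cutoff_eq_0:
  assumes "Suc K * L \<le> k"
  shows "cutoff K L k = 0"
proof -
  have "(forward_avg L ^^ m) (\<lambda>k. if k < N then 1 else 0) k = 0" if "N \<le> k" for m k N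
    using that
  proof (induction m arbitrary: k)
    case (Suc m)
    then show ?case by (simp add: forward_avg_def[of L "(forward_avg L ^^ m) (\<lambda>k. if k < N then 1 else 0)" k])
  qed simp
  then show ?thesis using assms by (simp add: cutoff_def)
qed

lemma cutoff_fdiff_bound:
  assumes "L \<ge> 1" "l \<le> K"
  shows "\<bar>(fdiff ^^ l) (cutoff K L) k\<bar> \<le> (2 / real L) ^ l"
  unfolding cutoff_def using assms by (intro fdiff_power_forward_avg_bound) auto

text \<open>With the base \<open>q = K + 1\<close> the cutoff at scale \<open>q\<^sup>j\<close> is \<open>1\<close> below \<open>q\<^sup>j\<close> and \<open>0\<close> from \<open>q\<^sup>j\<^sup>+\<^sup>1\<close> on, so
  the \<open>j\<close>-th piece lives between \<open>q\<^sup>j\<^sup>-\<^sup>1\<close> and \<open>q\<^sup>j\<^sup>+\<^sup>1\<close>.\<close>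

definition dyadic_piece :: "nat \<Rightarrow> nat \<Rightarrow> nat \<Rightarrow> real" where
  "dyadic_piece K j k = cutoff K (Suc K ^ j) k - (if j = 0 then 0 else cutoff K (Suc K ^ (j - 1)) k)"

lemma sum_dyadic_piece: "(\<Sum>j\<le>J. dyadic_piece K j k) = cutoff K (Suc K ^ J) k"
  by (induction J) (simp_all add: dyadic_piece_def)

lemma dyadic_piece_upper: "Suc K ^ Suc j \<le> k \<Longrightarrow> dyadic_piece K j k = 0"
proof -
  assume k: "Suc K ^ Suc j \<le> k"
  have "Suc K * Suc K ^ (j - 1) \<le> k" if "j \<noteq> 0"
    using k that power_increasing[of "Suc (j - 1)" "Suc j" "Suc K"] by (simp del: power_Suc add: power_Suc[symmetric])
  then show ?thesis using k by (auto simp: dyadic_piece_def cutoff_eq_0)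
qed

lemma dyadic_piece_lower:
  assumes "Suc K * Suc k < Suc K ^ j"
  shows "dyadic_piece K j k = 0"
proof (cases j)
  case 0
  then show ?thesis using assms by simp
next
  case (Suc i)
  then have "Suc K * Suc k < Suc K * Suc K ^ i" using assms by (simp only: power_Suc)
  then have "Suc k < Suc K ^ i" by (simp only: mult_less_cancel1)
  moreover have "Suc K ^ i \<le> Suc K ^ j" using Suc by (simp add: power_increasing)
  ultimately show ?thesis by (simp add: dyadic_piece_def Suc cutoff_eq_1 del: power_Suc)
qed

lemma fdiff_power_diff: "(fdiff ^^ l) (\<lambda>k. f k - g k) k = (fdiff ^^ l) f k - (fdiff ^^ l) g k"
  by (induction l arbitrary: k) (simp_all add: fdiff_def)

lemma dyadic_piece_fdiff_bound:
  assumes l: "l \<le> K"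
  shows "\<bar>(fdiff ^^ l) (dyadic_piece K j) k\<bar> \<le> 2 * (2 * real (Suc K) / real (Suc K ^ j)) ^ l"
proof (cases j)
  case 0
  have "dyadic_piece K j = cutoff K (Suc K ^ j)" by (auto simp: dyadic_piece_def 0)
  then have "\<bar>(fdiff ^^ l) (dyadic_piece K j) k\<bar> \<le> (2 / real (Suc K ^ j)) ^ l"
    using cutoff_fdiff_bound[OF _ l, of "Suc K ^ j" k] by simp
  also have "\<dots> \<le> (2 * real (Suc K) / real (Suc K ^ j)) ^ l"
    by (intro power_mono divide_right_mono) auto
  also have "\<dots> \<le> 2 * \<dots>" by simp
  finally show ?thesis .
next
  case (Suc i)
  have eq: "dyadic_piece K j = (\<lambda>k. cutoff K (Suc K ^ j) k - cutoff K (Suc K ^ i) k)"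
    by (auto simp: dyadic_piece_def Suc)
  have "\<bar>(fdiff ^^ l) (dyadic_piece K j) k\<bar> \<le> (2 / real (Suc K ^ j)) ^ l + (2 / real (Suc K ^ i)) ^ l"
    unfolding eq fdiff_power_diff
    using cutoff_fdiff_bound[OF _ l, of "Suc K ^ j" k] cutoff_fdiff_bound[OF _ l, of "Suc K ^ i" k]
    by (simp del: power_Suc)
  also have "(2 / real (Suc K ^ i)) = 2 * real (Suc K) / real (Suc K ^ j)"
    unfolding Suc power_Suc of_nat_mult mult.commute[of 2] by (subst mult_divide_mult_cancel_left) auto
  also have "(2 / real (Suc K ^ j)) ^ l \<le> (2 * real (Suc K) / real (Suc K ^ j)) ^ l"
    by (intro power_mono divide_right_mono) auto
  finally show ?thesis by simp
qed

section \<open>Dyadic blocks of a symbol\<close>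

lemma diff1_power_radial:
  "(diff1 c ^^ l) (\<lambda>\<xi>. complex_of_real (b (mi_abs \<xi>))) \<xi> = complex_of_real ((fdiff ^^ l) b (mi_abs \<xi>))"
  by (induction l arbitrary: \<xi>) (simp_all add: diff1_def fdiff_def)

lemma diff1_power_shift: "(diff1 c ^^ l) (\<lambda>\<xi>. a (\<xi> + v)) \<xi> = (diff1 c ^^ l) a (\<xi> + v)"
  by (induction l arbitrary: \<xi>) (simp_all add: diff1_def add_ac)

lemma diff1_power_add: "(diff1 c ^^ l) (\<lambda>\<xi>. f \<xi> + g \<xi>) \<xi> = (diff1 c ^^ l) f \<xi> + (diff1 c ^^ l) g \<xi>"
  by (induction l arbitrary: \<xi>) (simp_all add: diff1_def)

lemma diff1_power_eq_0:
  assumes "\<And>r. r \<le> l \<Longrightarrow> a (\<xi> + axis c r) = 0"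
  shows "(diff1 c ^^ l) a \<xi> = 0"
  using assms
proof (induction l arbitrary: \<xi>)
  case 0
  have "\<xi> + axis c 0 = \<xi>" by (simp add: vec_eq_iff axis_def)
  with 0[of 0] show ?case by simp
next
  case (Suc l)
  have "(diff1 c ^^ l) a (\<xi> + axis c 1) = 0"
  proof (rule Suc.IH)
    fix r assume "r \<le> l"
    then have "a (\<xi> + axis c (1 + r)) = 0" by (intro Suc.prems) simp
    then show "a (\<xi> + axis c 1 + axis c r) = 0" by (simp only: add.assoc axis_add)
  qed
  moreover have "(diff1 c ^^ l) a \<xi> = 0" using Suc.prems by (intro Suc.IH) simp
  ultimately show ?case by (simp add: diff1_def[of c "(diff1 c ^^ l) a" \<xi>])
qed

text \<open>The Leibniz rule for differences shifts one of the two factors by a unit vector, hence the hypotheses at the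
  points \<open>\<xi> + r e\<^sub>c\<close>.\<close>

lemma diff1_power_mult_bound:
  assumes "\<And>i r. i + r \<le> l \<Longrightarrow> cmod ((diff1 c ^^ i) f (\<xi> + axis c r)) \<le> F * \<rho> ^ i"
    and "\<And>i r. i + r \<le> l \<Longrightarrow> cmod ((diff1 c ^^ i) g (\<xi> + axis c r)) \<le> G * \<rho> ^ i"
  shows "cmod ((diff1 c ^^ l) (\<lambda>\<xi>. f \<xi> * g \<xi>) \<xi>) \<le> 2 ^ l * (F * G * \<rho> ^ l)"
  using assms
proof (induction l arbitrary: f g F G)
  case 0
  have "\<xi> + axis c 0 = \<xi>" by (simp add: vec_eq_iff axis_def)
  then have "cmod (f \<xi>) \<le> F" "cmod (g \<xi>) \<le> G" using 0(1)[of 0 0] 0(2)[of 0 0] by (simp_all only: funpow_0 power_0 mult_1_right add_0 le_refl)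
  then show ?case by (auto simp: norm_mult intro!: mult_mono order_trans[OF norm_ge_zero])
next
  case (Suc l)
  let ?E = "\<lambda>\<xi>. g (\<xi> + axis c 1)"
  have "diff1 c (\<lambda>\<xi>. f \<xi> * g \<xi>) = (\<lambda>\<xi>. diff1 c f \<xi> * ?E \<xi> + f \<xi> * diff1 c g \<xi>)"
    by (rule ext) (simp add: diff1_def algebra_simps)
  then have eq: "(diff1 c ^^ Suc l) (\<lambda>\<xi>. f \<xi> * g \<xi>) \<xi>
     = (diff1 c ^^ l) (\<lambda>\<xi>. diff1 c f \<xi> * ?E \<xi>) \<xi> + (diff1 c ^^ l) (\<lambda>\<xi>. f \<xi> * diff1 c g \<xi>) \<xi>"
    unfolding funpow_Suc_right o_apply by (simp only: diff1_power_add)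
  have "cmod ((diff1 c ^^ l) (\<lambda>\<xi>. diff1 c f \<xi> * ?E \<xi>) \<xi>) \<le> 2 ^ l * ((F * \<rho>) * G * \<rho> ^ l)"
  proof (rule Suc.IH)
    fix i r assume ir: "i + r \<le> l"
    show "cmod ((diff1 c ^^ i) (diff1 c f) (\<xi> + axis c r)) \<le> F * \<rho> * \<rho> ^ i"
      using Suc.prems(1)[of "Suc i" r] ir unfolding funpow_Suc_right o_apply by (simp add: mult.assoc)
    show "cmod ((diff1 c ^^ i) ?E (\<xi> + axis c r)) \<le> G * \<rho> ^ i"
      using Suc.prems(2)[of i "r + 1"] ir unfolding diff1_power_shift by (simp add: add.assoc axis_add)
  qed
  moreover have "cmod ((diff1 c ^^ l) (\<lambda>\<xi>. f \<xi> * diff1 c g \<xi>) \<xi>) \<le> 2 ^ l * (F * (G * \<rho>) * \<rho> ^ l)"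
  proof (rule Suc.IH)
    fix i r assume ir: "i + r \<le> l"
    show "cmod ((diff1 c ^^ i) f (\<xi> + axis c r)) \<le> F * \<rho> ^ i" using Suc.prems(1)[of i r] ir by simp
    show "cmod ((diff1 c ^^ i) (diff1 c g) (\<xi> + axis c r)) \<le> G * \<rho> * \<rho> ^ i"
      using Suc.prems(2)[of "Suc i" r] ir unfolding funpow_Suc_right o_apply by (simp add: mult.assoc)
  qed
  ultimately have "cmod ((diff1 c ^^ Suc l) (\<lambda>\<xi>. f \<xi> * g \<xi>) \<xi>) \<le> 2 ^ l * ((F * \<rho>) * G * \<rho> ^ l) + 2 ^ l * (F * (G * \<rho>) * \<rho> ^ l)"
    unfolding eq by (rule norm_triangle_mono)
  also have "\<dots> = 2 ^ Suc l * (F * G * \<rho> ^ Suc l)" by simp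
  finally show ?case .
qed

text \<open>Symbol estimates of order \<open>\<tau>\<close> for differences in a single direction, since the kernel estimates treat one
  coordinate at a time.\<close>

definition symbol_bound :: "nat \<Rightarrow> real \<Rightarrow> real \<Rightarrow> (nat ^ 'n \<Rightarrow> complex) \<Rightarrow> bool" where
  "symbol_bound K \<tau> B s \<longleftrightarrow>
    (\<forall>c. \<forall>l\<le>K. \<forall>\<xi>. cmod ((diff1 c ^^ l) s \<xi>) \<le> B * mi_bracket \<xi> powr (\<tau> - real l))"

definition block :: "nat \<Rightarrow> nat \<Rightarrow> (nat ^ 'n \<Rightarrow> complex) \<Rightarrow> nat ^ 'n \<Rightarrow> complex" where
  "block K j s \<xi> = s \<xi> * complex_of_real (dyadic_piece K j (mi_abs \<xi>))"

lemma block_eq_0_upper: "Suc K ^ Suc j \<le> mi_abs \<xi> \<Longrightarrow> block K j s \<xi> = 0"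
  by (simp add: block_def dyadic_piece_upper del: power_Suc)

text \<open>On the support of a block \<open>mi_bracket \<xi>\<close> is comparable to \<open>q\<^sup>j\<close>, even after shifting \<open>\<xi>\<close> by up to \<open>K\<close> unit vectors, so
  the symbol estimates become estimates at the single scale \<open>q\<^sup>j\<close>.\<close>

lemma block_diff_bound:
  fixes s :: "nat ^ 'n \<Rightarrow> complex"
  assumes K: "K \<ge> 1" and s: "symbol_bound K \<tau> B s" and B: "B \<ge> 0" and l: "l \<le> K"
  defines "q \<equiv> real (Suc K)"
  shows "cmod ((diff1 c ^^ l) (block K j s) \<xi>)
    \<le> (2 ^ Suc K * q powr (2 * \<bar>\<tau>\<bar>) * q ^ (3 * K)) * B * (q ^ j) powr \<tau> / (q ^ Suc j) ^ l"
    (is "_ \<le> ?bound")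
proof -
  have q: "q \<ge> 2" using K by (simp add: q_def)
  have q0: "q > 0" using q by simp
  have bound_nonneg: "?bound \<ge> 0" using q B by simp
  \<comment> \<open>In the first two cases the block vanishes at all points that the difference involves.\<close>
  consider "Suc K ^ Suc j \<le> mi_abs \<xi>" | "Suc K * (Suc (mi_abs \<xi>) * Suc K) < Suc K ^ j"
    | "mi_abs \<xi> < Suc K ^ Suc j" "Suc K ^ j \<le> Suc K * (Suc (mi_abs \<xi>) * Suc K)" by linarith
  then show ?thesis
  proof cases
    case 1
    have "(diff1 c ^^ l) (block K j s) \<xi> = 0"
      using 1 by (intro diff1_power_eq_0 block_eq_0_upper) (simp del: power_Suc)
    then show ?thesis using bound_nonneg by (simp only: norm_zero)
  next
    case 2
    have "(diff1 c ^^ l) (block K j s) \<xi> = 0"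
    proof (rule diff1_power_eq_0)
      fix r assume "r \<le> l"
      then have "Suc (mi_abs (\<xi> + axis c r)) \<le> Suc (mi_abs \<xi>) * Suc K"
        using l by simp
      then have "Suc K * Suc (mi_abs (\<xi> + axis c r)) < Suc K ^ j"
        using 2 by (meson le_less_trans mult_le_mono2)
      then show "block K j s (\<xi> + axis c r) = 0"
        by (simp add: block_def dyadic_piece_lower del: mult_Suc mult_Suc_right mi_abs_add)
    qed
    then show ?thesis using bound_nonneg by (simp only: norm_zero)
  next
    case 3
    define \<rho> where "\<rho> = q\<^sup>2 / q ^ j"
    define F where "F = B * (q powr (2 * \<bar>\<tau>\<bar>) * (q ^ j) powr \<tau>)"
    have \<rho>: "\<rho> > 0" using q0 by (simp add: \<rho>_def)
    have "cmod ((diff1 c ^^ l) (\<lambda>\<xi>. s \<xi> * complex_of_real (dyadic_piece K j (mi_abs \<xi>))) \<xi>) \<le> 2 ^ l * (F * 2 * \<rho> ^ l)"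
    proof (rule diff1_power_mult_bound)
      fix i r assume ir: "i + r \<le> l"
      let ?b = "mi_bracket (\<xi> + axis c r)"
      have upper: "?b \<le> q ^ j * q\<^sup>2"
      proof -
        have "Suc (mi_abs \<xi> + r) \<le> Suc K ^ Suc j + K * 1" using 3(1) ir l by linarith
        also have "\<dots> \<le> Suc K ^ Suc j + K * Suc K ^ Suc j"
          by (intro add_left_mono mult_left_mono one_le_power) auto
        also have "\<dots> = Suc K ^ j * (Suc K)\<^sup>2" by (simp add: power2_eq_square algebra_simps)
        finally have "real (Suc (mi_abs \<xi> + r)) \<le> real (Suc K ^ j * (Suc K)\<^sup>2)" by (simp only: of_nat_le_iff)
        then show ?thesis by (simp add: mi_bracket_def q_def)
      qed
      have lower: "q ^ j / q\<^sup>2 \<le> ?b"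
      proof -
        have "real (Suc K ^ j) \<le> real (Suc K * (Suc (mi_abs \<xi>) * Suc K))" using 3(2) by (simp only: of_nat_le_iff)
        then have "q ^ j \<le> q\<^sup>2 * real (Suc (mi_abs \<xi>))"
          by (simp only: q_def power2_eq_square of_nat_mult of_nat_power mult_ac)
        also have "\<dots> \<le> q\<^sup>2 * ?b" by (intro mult_left_mono) (auto simp: mi_bracket_def)
        finally show ?thesis using q0 by (simp add: divide_le_eq mult.commute)
      qed
      have b0: "?b > 0" by (simp add: mi_bracket_def add_pos_nonneg)
      have "?b powr \<tau> \<le> q powr (2 * \<bar>\<tau>\<bar>) * (q ^ j) powr \<tau>"
      proof (cases "\<tau> \<ge> 0")
        case True
        have "?b powr \<tau> \<le> (q ^ j * q\<^sup>2) powr \<tau>" using upper b0 True by (intro powr_mono2) auto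
        also have "\<dots> = q powr (2 * \<bar>\<tau>\<bar>) * (q ^ j) powr \<tau>"
        proof -
          have "(q\<^sup>2) powr \<tau> = q powr (2 * \<tau>)"
            using powr_powr[of q 2 \<tau>] q0 by simp
          then show ?thesis using True q0 by (simp add: powr_mult mult.commute)
        qed
        finally show ?thesis .
      next
        case False
        have "?b powr \<tau> \<le> (q ^ j / q\<^sup>2) powr \<tau>" using lower b0 False q0 by (intro powr_mono2') auto
        also have "\<dots> = q powr (2 * \<bar>\<tau>\<bar>) * (q ^ j) powr \<tau>"
        proof -
          have "(q\<^sup>2) powr \<tau> = q powr (2 * \<tau>)"
            using powr_powr[of q 2 \<tau>] q0 by simp
          then show ?thesis
            using False q0 by (simp add: powr_divide powr_minus inverse_eq_divide)
        qed
        finally show ?thesis .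
      qed
      moreover have "?b powr (- real i) \<le> \<rho> ^ i"
      proof -
        have "?b powr (- real i) \<le> (q ^ j / q\<^sup>2) powr (- real i)" using lower b0 q0 by (intro powr_mono2') auto
        also have "\<dots> = inverse ((q ^ j / q\<^sup>2) ^ i)" using q0 by (simp add: powr_minus powr_realpow)
        also have "\<dots> = \<rho> ^ i" by (simp add: \<rho>_def power_divide)
        finally show ?thesis .
      qed
      ultimately have "?b powr (\<tau> - real i) \<le> (q powr (2 * \<bar>\<tau>\<bar>) * (q ^ j) powr \<tau>) * \<rho> ^ i"
        unfolding diff_conv_add_uminus powr_add using \<rho> by (intro mult_mono) auto
      then have "B * ?b powr (\<tau> - real i) \<le> F * \<rho> ^ i"
        unfolding F_def mult.assoc using B by (intro mult_left_mono) (auto simp: mult.assoc)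
      moreover have "cmod ((diff1 c ^^ i) s (\<xi> + axis c r)) \<le> B * ?b powr (\<tau> - real i)"
        using s ir l by (simp add: symbol_bound_def)
      ultimately show "cmod ((diff1 c ^^ i) s (\<xi> + axis c r)) \<le> F * \<rho> ^ i" by linarith
      have "cmod ((diff1 c ^^ i) (\<lambda>\<xi>. complex_of_real (dyadic_piece K j (mi_abs \<xi>))) (\<xi> + axis c r)) \<le> 2 * (2 * q / q ^ j) ^ i"
        unfolding diff1_power_radial norm_of_real using dyadic_piece_fdiff_bound[of i K j] ir l by (simp add: q_def)
      also have "\<dots> \<le> 2 * \<rho> ^ i"
        unfolding \<rho>_def using q by (intro mult_left_mono power_mono divide_right_mono) (auto simp: power2_eq_square)
      finally show "cmod ((diff1 c ^^ i) (\<lambda>\<xi>. complex_of_real (dyadic_piece K j (mi_abs \<xi>))) (\<xi> + axis c r)) \<le> 2 * \<rho> ^ i" .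
    qed
    also have "2 ^ l * (F * 2 * \<rho> ^ l) = 2 ^ Suc l * q ^ (3 * l) * F / (q ^ Suc j) ^ l"
    proof -
      have "\<rho> = q ^ 3 / q ^ Suc j" using q0 by (simp add: \<rho>_def power2_eq_square power3_eq_cube)
      then show ?thesis by (simp add: power_divide power_mult)
    qed
    also have "\<dots> \<le> 2 ^ Suc K * q ^ (3 * K) * F / (q ^ Suc j) ^ l"
      using q l B by (intro divide_right_mono mult_right_mono mult_mono power_increasing) (auto simp: F_def)
    also have "\<dots> = ?bound" by (simp add: F_def mult_ac)
    finally show ?thesis unfolding block_def[abs_def] .
  qed
qed

text \<open>The shift \<open>v\<close> is for the sums in which differentiation has replaced \<open>hn \<xi>\<close> by \<open>hn (\<xi> - e\<^sub>i)\<close>: there the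
  coefficient is evaluated one step above the index of the polynomial. The constant is chosen before the symbol, so
  it serves the symbol and its derivatives alike.\<close>

lemma dyadic_block_bounded:
  fixes K :: nat and \<tau> :: real
  assumes K: "CARD('n) < 2 * K"
  shows "\<exists>C\<ge>0. \<forall>B (\<sigma> :: real ^ 'n \<Rightarrow> nat ^ 'n \<Rightarrow> complex). B \<ge> 0 \<longrightarrow>
     (AE x in lebesgue. symbol_bound K \<tau> B (\<sigma> x)) \<longrightarrow>
     (\<forall>j v S d. finite S \<longrightarrow>
       (\<integral>\<^sup>+x. ennreal ((cmod (\<Sum>\<xi>\<in>S. d \<xi> * block K j (\<sigma> x) (\<xi> + v) * hn \<xi> x))\<^sup>2) \<partial>gauss_measure)
         \<le> ennreal (C * (B * real (Suc K ^ j) powr \<tau>)\<^sup>2 * (\<Sum>\<xi>\<in>S. (cmod (d \<xi>))\<^sup>2)))"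
proof -
  obtain C where C: "C \<ge> 0" and loc0: "\<forall>R \<beta> (\<sigma> :: real ^ 'n \<Rightarrow> nat ^ 'n \<Rightarrow> complex). R \<ge> 1 \<longrightarrow> \<beta> \<ge> 0 \<longrightarrow>
     (AE x in lebesgue. (\<forall>\<xi>. R < mi_abs \<xi> \<longrightarrow> \<sigma> x \<xi> = 0) \<and>
        (\<forall>c. \<forall>l\<le>K. \<forall>\<xi>. cmod ((diff1 c ^^ l) (\<sigma> x) \<xi>) \<le> \<beta> / real R ^ l)) \<longrightarrow>
     (\<forall>S d. finite S \<longrightarrow>
       (\<integral>\<^sup>+x. ennreal ((cmod (\<Sum>\<xi>\<in>S. d \<xi> * \<sigma> x \<xi> * hn \<xi> x))\<^sup>2) \<partial>gauss_measure)
         \<le> ennreal (C * \<beta>\<^sup>2 * (\<Sum>\<xi>\<in>S. (cmod (d \<xi>))\<^sup>2)))"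
    using localized_symbol_bounded[OF K] by (elim exE conjE)
  note loc = loc0[rule_format]
  have K1: "K \<ge> 1" using K by (cases K) auto
  define A where "A = 2 ^ Suc K * real (Suc K) powr (2 * \<bar>\<tau>\<bar>) * real (Suc K) ^ (3 * K)"
  have A: "A \<ge> 0" by (simp add: A_def)
  show ?thesis
  proof (intro exI[of _ "C * A\<^sup>2"] conjI allI impI)
    show "0 \<le> C * A\<^sup>2" using C by simp
    fix B :: real and \<sigma> :: "real ^ 'n \<Rightarrow> nat ^ 'n \<Rightarrow> complex" and j v and S :: "(nat ^ 'n) set" and d :: "nat ^ 'n \<Rightarrow> complex"
    assume B: "B \<ge> 0" and \<sigma>: "AE x in lebesgue. symbol_bound K \<tau> B (\<sigma> x)" and S: "finite S"
    let ?\<beta> = "A * (B * real (Suc K ^ j) powr \<tau>)"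
    have "(\<integral>\<^sup>+x. ennreal ((cmod (\<Sum>\<xi>\<in>S. d \<xi> * block K j (\<sigma> x) (\<xi> + v) * hn \<xi> x))\<^sup>2) \<partial>gauss_measure)
       \<le> ennreal (C * ?\<beta>\<^sup>2 * (\<Sum>\<xi>\<in>S. (cmod (d \<xi>))\<^sup>2))"
    proof (rule loc[OF _ _ _ S, where R = "Suc K ^ Suc j"])
      show "AE x in lebesgue. (\<forall>\<xi>. Suc K ^ Suc j < mi_abs \<xi> \<longrightarrow> block K j (\<sigma> x) (\<xi> + v) = 0) \<and>
        (\<forall>c. \<forall>l\<le>K. \<forall>\<xi>. cmod ((diff1 c ^^ l) (\<lambda>\<xi>. block K j (\<sigma> x) (\<xi> + v)) \<xi>) \<le> ?\<beta> / real (Suc K ^ Suc j) ^ l)"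
        using \<sigma>
      proof eventually_elim
        case (elim x)
        show ?case
        proof (intro conjI allI impI)
          show "block K j (\<sigma> x) (\<xi> + v) = 0" if "Suc K ^ Suc j < mi_abs \<xi>" for \<xi>
            using that by (intro block_eq_0_upper) (simp del: power_Suc)
          show "cmod ((diff1 c ^^ l) (\<lambda>\<xi>. block K j (\<sigma> x) (\<xi> + v)) \<xi>) \<le> ?\<beta> / real (Suc K ^ Suc j) ^ l"
            if "l \<le> K" for c l \<xi>
            unfolding diff1_power_shift using block_diff_bound[OF K1 elim B that, of c j "\<xi> + v"]
            by (simp only: A_def of_nat_power mult.assoc)
        qed
      qed
    next
      show "1 \<le> Suc K ^ Suc j" by (rule one_le_power) simp
    qed (use A B in simp)
    then show "(\<integral>\<^sup>+x. ennreal ((cmod (\<Sum>\<xi>\<in>S. d \<xi> * block K j (\<sigma> x) (\<xi> + v) * hn \<xi> x))\<^sup>2) \<partial>gauss_measure)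
       \<le> ennreal (C * A\<^sup>2 * (B * real (Suc K ^ j) powr \<tau>)\<^sup>2 * (\<Sum>\<xi>\<in>S. (cmod (d \<xi>))\<^sup>2))"
      by (simp only: power_mult_distrib[of A] mult.assoc)
  qed
qed

lemma sum_blocks:
  assumes "mi_abs \<xi> < Suc K ^ J"
  shows "(\<Sum>j\<le>J. block K j s \<xi>) = s \<xi>"
  using assms by (simp add: block_def sum_distrib_left[symmetric] of_real_sum[symmetric] sum_dyadic_piece cutoff_eq_1 del: of_real_sum)

lemma ex_block_range:
  assumes "finite S" "K \<ge> 1"
  obtains J where "\<And>\<xi>. \<xi> \<in> S \<Longrightarrow> mi_abs \<xi> < Suc K ^ J"
proof -
  define J where "J = (\<Sum>\<xi>\<in>S. mi_abs \<xi>)"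
  have "mi_abs \<xi> < Suc K ^ J" if "\<xi> \<in> S" for \<xi>
  proof -
    have "mi_abs \<xi> \<le> J" unfolding J_def using that assms(1) by (intro member_le_sum) auto
    also have "J < 2 ^ J" by (rule less_exp)
    also have "\<dots> \<le> Suc K ^ J" using assms(2) by (intro power_mono) auto
    finally show ?thesis .
  qed
  then show ?thesis by (rule that)
qed

section \<open>Symbols of negative order\<close>

text \<open>The triangle inequality for a geometric series in \<open>L\<^sup>2\<close>, by Cauchy--Schwarz with the weights \<open>\<mu>\<^sup>j\<close>.\<close>

lemma nn_integral_geometric_sum:
  fixes v :: "nat \<Rightarrow> 'a \<Rightarrow> complex"
  assumes [measurable]: "\<And>j. v j \<in> borel_measurable M"
    and \<mu>: "0 < \<mu>" "\<mu> < 1" and D: "D \<ge> 0"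
    and v: "\<And>j. (\<integral>\<^sup>+x. ennreal ((cmod (v j x))\<^sup>2) \<partial>M) \<le> ennreal (D * (\<mu> ^ j)\<^sup>2)"
  shows "(\<integral>\<^sup>+x. ennreal ((cmod (\<Sum>j\<le>J. v j x))\<^sup>2) \<partial>M) \<le> ennreal (D / (1 - \<mu>)\<^sup>2)"
proof -
  have geo: "(\<Sum>j\<le>J. \<mu> ^ j) \<le> 1 / (1 - \<mu>)"
    using \<mu> by (subst sum_gp0) (auto intro: divide_right_mono)
  have "(cmod (\<Sum>j\<le>J. v j x))\<^sup>2 \<le> (1 / (1 - \<mu>)) * (\<Sum>j\<le>J. (cmod (v j x))\<^sup>2 / \<mu> ^ j)" for x
  proof -
    have "(cmod (\<Sum>j\<le>J. v j x))\<^sup>2 \<le> (\<Sum>j\<le>J. sqrt (\<mu> ^ j) * (cmod (v j x) / sqrt (\<mu> ^ j)))\<^sup>2"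
      using \<mu> by (intro power_mono) (auto intro: order_trans[OF norm_sum])
    also have "\<dots> \<le> (\<Sum>j\<le>J. (sqrt (\<mu> ^ j))\<^sup>2) * (\<Sum>j\<le>J. (cmod (v j x) / sqrt (\<mu> ^ j))\<^sup>2)"
      by (rule Cauchy_Schwarz_ineq_sum)
    also have "\<dots> = (\<Sum>j\<le>J. \<mu> ^ j) * (\<Sum>j\<le>J. (cmod (v j x))\<^sup>2 / \<mu> ^ j)"
      using \<mu> by (simp add: power_divide)
    also have "\<dots> \<le> (1 / (1 - \<mu>)) * (\<Sum>j\<le>J. (cmod (v j x))\<^sup>2 / \<mu> ^ j)"
      using \<mu> by (intro mult_right_mono geo sum_nonneg) auto
    finally show ?thesis .
  qed
  note le = this
  have "(\<integral>\<^sup>+x. ennreal ((cmod (\<Sum>j\<le>J. v j x))\<^sup>2) \<partial>M)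
    \<le> (\<integral>\<^sup>+x. ennreal (1 / (1 - \<mu>)) * (\<Sum>j\<le>J. ennreal (1 / \<mu> ^ j) * ennreal ((cmod (v j x))\<^sup>2)) \<partial>M)"
  proof (intro nn_integral_mono)
    fix x
    have "ennreal ((cmod (v j x))\<^sup>2 / \<mu> ^ j) = ennreal (1 / \<mu> ^ j) * ennreal ((cmod (v j x))\<^sup>2)" for j
      using \<mu> by (simp add: ennreal_mult[symmetric])
    then have "(\<Sum>j\<le>J. ennreal (1 / \<mu> ^ j) * ennreal ((cmod (v j x))\<^sup>2)) = ennreal (\<Sum>j\<le>J. (cmod (v j x))\<^sup>2 / \<mu> ^ j)"
      using \<mu> by (subst sum_ennreal[symmetric]) auto
    then show "ennreal ((cmod (\<Sum>j\<le>J. v j x))\<^sup>2)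
      \<le> ennreal (1 / (1 - \<mu>)) * (\<Sum>j\<le>J. ennreal (1 / \<mu> ^ j) * ennreal ((cmod (v j x))\<^sup>2))"
      using \<mu> le[of x] by (simp add: ennreal_mult[symmetric] sum_nonneg ennreal_leI del: times_divide_eq_left)
  qed
  also have "\<dots> = ennreal (1 / (1 - \<mu>)) * (\<Sum>j\<le>J. ennreal (1 / \<mu> ^ j) * (\<integral>\<^sup>+x. ennreal ((cmod (v j x))\<^sup>2) \<partial>M))"
    by (simp add: nn_integral_cmult nn_integral_sum)
  also have "\<dots> \<le> ennreal (1 / (1 - \<mu>)) * (\<Sum>j\<le>J. ennreal (1 / \<mu> ^ j) * ennreal (D * (\<mu> ^ j)\<^sup>2))"
    by (intro mult_left_mono sum_mono v) auto
  also have "\<dots> = ennreal (1 / (1 - \<mu>) * (D * (\<Sum>j\<le>J. \<mu> ^ j)))"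
    using \<mu> D by (simp add: ennreal_mult[symmetric] sum_nonneg sum_distrib_left power2_eq_square mult_ac)
  also have "\<dots> \<le> ennreal (1 / (1 - \<mu>) * (D * (1 / (1 - \<mu>))))"
    using \<mu> D geo by (intro ennreal_leI mult_left_mono) auto
  finally show ?thesis by (simp add: power2_eq_square)
qed

text \<open>The block at frequency \<open>q\<^sup>j\<close> has norm of order \<open>q\<^sup>j\<^sup>\<tau>\<close>, which decays geometrically.\<close>

lemma negative_order_symbol_bounded:
  fixes \<sigma> :: "real ^ 'n \<Rightarrow> nat ^ 'n \<Rightarrow> complex"
  assumes K: "CARD('n) < 2 * K" and \<tau>: "\<tau> < 0" and B: "B \<ge> 0"
    and meas [measurable]: "\<And>\<xi>. (\<lambda>x. \<sigma> x \<xi>) \<in> borel_measurable lebesgue"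
    and \<sigma>: "AE x in lebesgue. symbol_bound K \<tau> B (\<sigma> x)"
  shows "bounded_on_hermite_sums \<sigma>"
proof -
  obtain C where C: "C \<ge> 0" and blk0: "\<forall>B (\<sigma> :: real ^ 'n \<Rightarrow> nat ^ 'n \<Rightarrow> complex). B \<ge> 0 \<longrightarrow>
     (AE x in lebesgue. symbol_bound K \<tau> B (\<sigma> x)) \<longrightarrow>
     (\<forall>j v S d. finite S \<longrightarrow>
       (\<integral>\<^sup>+x. ennreal ((cmod (\<Sum>\<xi>\<in>S. d \<xi> * block K j (\<sigma> x) (\<xi> + v) * hn \<xi> x))\<^sup>2) \<partial>gauss_measure)
         \<le> ennreal (C * (B * real (Suc K ^ j) powr \<tau>)\<^sup>2 * (\<Sum>\<xi>\<in>S. (cmod (d \<xi>))\<^sup>2)))"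
    using dyadic_block_bounded[OF K, of \<tau>] by (elim exE conjE)
  note blk = blk0[rule_format, OF B \<sigma>]
  have K1: "K \<ge> 1" using K by (cases K) auto
  define \<mu> where "\<mu> = real (Suc K) powr \<tau>"
  have "real (Suc K) powr \<tau> < real (Suc K) powr 0" using K1 \<tau> by (intro powr_less_mono) auto
  then have \<mu>: "0 < \<mu>" "\<mu> < 1" by (simp_all add: \<mu>_def)
  have \<mu>_pow: "real (Suc K ^ j) powr \<tau> = \<mu> ^ j" for j
    by (simp add: \<mu>_def powr_power powr_realpow[symmetric] powr_powr mult.commute del: of_nat_Suc)
  show ?thesis
  proof (intro exI[of _ "C * B\<^sup>2 / (1 - \<mu>)\<^sup>2"] conjI allI impI)
    show "0 \<le> C * B\<^sup>2 / (1 - \<mu>)\<^sup>2" using C by simp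
    fix S :: "(nat ^ 'n) set" and c :: "nat ^ 'n \<Rightarrow> complex" assume S: "finite S"
    obtain J where J: "\<And>\<xi>. \<xi> \<in> S \<Longrightarrow> mi_abs \<xi> < Suc K ^ J" using ex_block_range[OF S K1] by blast
    define v where "v j x = (\<Sum>\<xi>\<in>S. c \<xi> * block K j (\<sigma> x) \<xi> * hn \<xi> x)" for j x
    have "(\<Sum>\<xi>\<in>S. c \<xi> * \<sigma> x \<xi> * hn \<xi> x) = (\<Sum>j\<le>J. v j x)" for x
      unfolding v_def by (subst sum.swap) (auto intro!: sum.cong simp: sum_distrib_left[symmetric] sum_distrib_right[symmetric] sum_blocks J)
    moreover have "(\<integral>\<^sup>+x. ennreal ((cmod (\<Sum>j\<le>J. v j x))\<^sup>2) \<partial>gauss_measure) \<le> ennreal (C * B\<^sup>2 * (\<Sum>\<xi>\<in>S. (cmod (c \<xi>))\<^sup>2) / (1 - \<mu>)\<^sup>2)"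
    proof (rule nn_integral_geometric_sum[OF _ \<mu>])
      show "v j \<in> borel_measurable gauss_measure" for j
        unfolding v_def block_def by measurable
      show "(\<integral>\<^sup>+x. ennreal ((cmod (v j x))\<^sup>2) \<partial>gauss_measure) \<le> ennreal (C * B\<^sup>2 * (\<Sum>\<xi>\<in>S. (cmod (c \<xi>))\<^sup>2) * (\<mu> ^ j)\<^sup>2)" for j
        using blk[OF S, of c j 0] unfolding v_def \<mu>_pow by (simp add: power_mult_distrib mult_ac)
    qed (use C in \<open>auto intro!: mult_nonneg_nonneg sum_nonneg\<close>)
    ultimately show "(\<integral>\<^sup>+x. ennreal ((cmod (\<Sum>\<xi>\<in>S. c \<xi> * \<sigma> x \<xi> * hn \<xi> x))\<^sup>2) \<partial>gauss_measure)
       \<le> ennreal (C * B\<^sup>2 / (1 - \<mu>)\<^sup>2 * (\<Sum>\<xi>\<in>S. (cmod (c \<xi>))\<^sup>2))" by simp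
  qed
qed


section \<open>Ladder operators and integration by parts\<close>

lemma hermite_has_directional_derivative:
  "((\<lambda>t. hermite \<xi> (x + t *\<^sub>R axis i 1)) has_real_derivative 2 * real (\<xi> $ i) * hermite (\<xi> - axis i 1) x) (at 0)"
proof -
  define P where "P = (\<Prod>j\<in>UNIV - {i}. hermite1 (\<xi> $ j) (x $ j))"
  have "(\<Prod>j\<in>UNIV - {i}. hermite1 (\<xi> $ j) ((x + t *\<^sub>R axis i 1) $ j)) = P" for t
    unfolding P_def by (intro prod.cong) (auto simp: axis_def)
  then have eq: "hermite \<xi> (x + t *\<^sub>R axis i 1) = hermite1 (\<xi> $ i) (t + x $ i) * P" for t
    by (subst hermite_split[of _ _ i]) (simp add: axis_def add.commute)
  have "(\<Prod>j\<in>UNIV - {i}. hermite1 ((\<xi> - axis i 1) $ j) (x $ j)) = P"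
    unfolding P_def by (intro prod.cong) (auto simp: axis_def)
  then have val: "hermite (\<xi> - axis i 1) x = hermite1 (\<xi> $ i - 1) (x $ i) * P"
    by (subst hermite_split[of _ _ i]) (simp add: axis_def)
  have "((\<lambda>t. hermite1 (\<xi> $ i) (t + x $ i)) has_real_derivative 2 * real (\<xi> $ i) * hermite1 (\<xi> $ i - 1) (x $ i)) (at 0)"
    using hermite1_has_derivative[of "\<xi> $ i" "x $ i"]
      DERIV_shift[of "hermite1 (\<xi> $ i)" "2 * real (\<xi> $ i) * hermite1 (\<xi> $ i - 1) (x $ i)" 0 "x $ i"] by simp
  from DERIV_cmult_right[OF this, of P] show ?thesis
    unfolding eq val by (simp add: mult.assoc)
qed

lemma hermite_sq_minus_axis:
  assumes "\<xi> $ i \<noteq> 0"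
  shows "hermite_sq \<xi> = 2 * real (\<xi> $ i) * hermite_sq (\<xi> - axis i 1)"
  using hermite_sq_add_axis[of "\<xi> - axis i 1" i] mi_minus_axis[OF assms] assms by (simp add: axis_def)

text \<open>For \<open>\<xi>\<^sub>i = 0\<close> both sides vanish, whatever the truncated difference \<open>\<xi> - e\<^sub>i\<close> is.\<close>

lemma hn_lower_coeff:
  "2 * real (\<xi> $ i) * hermite (\<xi> - axis i 1) x / sqrt (hermite_sq \<xi>) = sqrt (2 * real (\<xi> $ i)) * hn (\<xi> - axis i 1) x"
proof (cases "\<xi> $ i = 0")
  case False
  define r where "r = sqrt (2 * real (\<xi> $ i))"
  have r: "r > 0" "r * r = 2 * real (\<xi> $ i)" using False by (simp_all add: r_def)
  have "sqrt (hermite_sq \<xi>) = r * sqrt (hermite_sq (\<xi> - axis i 1))"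
    unfolding hermite_sq_minus_axis[OF False] real_sqrt_mult r_def by simp
  then show ?thesis
    unfolding r(2)[symmetric] r_def[symmetric] using r(1) by (simp add: hn_def)
qed simp

lemma hn_has_directional_derivative:
  "((\<lambda>t. hn \<xi> (x + t *\<^sub>R axis i 1)) has_real_derivative sqrt (2 * real (\<xi> $ i)) * hn (\<xi> - axis i 1) x) (at 0)"
  using DERIV_cdivide[OF hermite_has_directional_derivative, of \<xi> x i "sqrt (hermite_sq \<xi>)"]
  unfolding hn_lower_coeff by (simp add: hn_def)

lemma hn_recurrence:
  "2 * x $ i * hn \<xi> x = sqrt (2 * real (\<xi> $ i + 1)) * hn (\<xi> + axis i 1) x + sqrt (2 * real (\<xi> $ i)) * hn (\<xi> - axis i 1) x"
proof -
  define r where "r = sqrt (2 * real (\<xi> $ i + 1))"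
  have r: "r > 0" by (simp add: r_def)
  have "sqrt (hermite_sq (\<xi> + axis i 1)) = r * sqrt (hermite_sq \<xi>)"
    unfolding hermite_sq_add_axis real_sqrt_mult r_def by simp
  then have raise: "hermite (\<xi> + axis i 1) x / sqrt (hermite_sq \<xi>) = r * hn (\<xi> + axis i 1) x"
    using r by (simp add: hn_def)
  have "2 * x $ i * hn \<xi> x = (2 * x $ i * hermite \<xi> x) / sqrt (hermite_sq \<xi>)"
    by (simp add: hn_def)
  also have "\<dots> = hermite (\<xi> + axis i 1) x / sqrt (hermite_sq \<xi>) + 2 * real (\<xi> $ i) * hermite (\<xi> - axis i 1) x / sqrt (hermite_sq \<xi>)"
    unfolding hermite_recurrence by (rule add_divide_distrib)
  finally show ?thesis unfolding raise hn_lower_coeff r_def .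
qed

lemma in_L2_add: "in_L2 M f \<Longrightarrow> in_L2 M g \<Longrightarrow> in_L2 M (\<lambda>x. f x + g x)"
  using in_L2_linear[of M f g 1 1] by simp

lemma in_L2_diff: "in_L2 M f \<Longrightarrow> in_L2 M g \<Longrightarrow> in_L2 M (\<lambda>x. f x - g x)"
  using in_L2_linear[of M f g 1 "-1"] by simp

lemma in_L2_zero: "in_L2 M (\<lambda>x. 0)"
  by (simp add: in_L2_def)

lemma in_L2_sum:
  assumes "\<And>s. s \<in> S \<Longrightarrow> in_L2 M (f s)"
  shows "in_L2 M (\<lambda>x. \<Sum>s\<in>S. f s x)"
  using assms by (induction S rule: infinite_finite_induct) (auto intro: in_L2_zero in_L2_add)

lemma in_L2_bounded_hn:
  assumes "continuous_on UNIV a" "\<And>x. cmod (a x) \<le> b"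
  shows "in_L2 gauss_measure (\<lambda>x. a x * hn \<xi> x)"
  unfolding in_L2_def
proof
  have a [measurable]: "a \<in> borel_measurable lebesgue"
    using assms(1) by (simp add: borel_measurable_continuous_onI measurable_completion)
  show "(\<lambda>x. a x * complex_of_real (hn \<xi> x)) \<in> borel_measurable gauss_measure" by simp
  show "integrable gauss_measure (\<lambda>x. (cmod (a x * complex_of_real (hn \<xi> x)))\<^sup>2)"
  proof (rule Bochner_Integration.integrable_bound)
    show "integrable gauss_measure (\<lambda>x. b\<^sup>2 * (hn \<xi> x * hn \<xi> x))"
      by (intro integrable_mult_right integrable_hn_mult)
    have "(cmod (a x))\<^sup>2 \<le> b\<^sup>2" for x using assms(2)[of x] by (intro power_mono) auto
    then show "AE x in gauss_measure. norm ((cmod (a x * complex_of_real (hn \<xi> x)))\<^sup>2) \<le> norm (b\<^sup>2 * (hn \<xi> x * hn \<xi> x))"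
      by (intro AE_I2) (auto simp: norm_mult power_mult_distrib power2_eq_square[of "hn _ _"] abs_mult intro!: mult_right_mono)
  qed simp
qed

lemma integrable_L2_cnj:
  assumes "in_L2 M u" "in_L2 M v"
  shows "integrable M (\<lambda>x. u x * cnj (v x))"
proof -
  have [measurable]: "u \<in> borel_measurable M" "v \<in> borel_measurable M" using assms by (auto simp: in_L2_def)
  have "(\<lambda>x. cnj (v x)) \<in> borel_measurable M"
    by (rule borel_measurable_continuous_on[of cnj]) (auto intro: continuous_intros)
  then show ?thesis
    using assms by (intro integrable_L2_mult) (auto simp: in_L2_def)
qed

lemma L2_Cauchy_Schwarz:
  assumes u: "in_L2 M u" and v: "in_L2 M v"
    and X: "(\<integral>\<^sup>+x. ennreal ((cmod (u x))\<^sup>2) \<partial>M) \<le> ennreal X" and Y: "(\<integral>\<^sup>+x. ennreal ((cmod (v x))\<^sup>2) \<partial>M) \<le> ennreal Y"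
    and nonneg: "X \<ge> 0" "Y \<ge> 0"
  shows "cmod (\<integral>x. u x * cnj (v x) \<partial>M) \<le> sqrt X * sqrt Y"
proof -
  have [measurable]: "u \<in> borel_measurable M" "v \<in> borel_measurable M" using assms by (auto simp: in_L2_def)
  have "ennreal (cmod (\<integral>x. u x * cnj (v x) \<partial>M)) \<le> (\<integral>\<^sup>+x. ennreal (cmod (u x * cnj (v x))) \<partial>M)"
    by (rule integral_norm_bound_ennreal[OF integrable_L2_cnj[OF u v]])
  also have "\<dots> = (\<integral>\<^sup>+x. ennreal (cmod (u x)) * ennreal (cmod (v x)) \<partial>M)"
    by (simp add: norm_mult ennreal_mult)
  finally have "(ennreal (cmod (\<integral>x. u x * cnj (v x) \<partial>M)))\<^sup>2 \<le> \<dots>\<^sup>2"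
    by (rule power_mono) simp
  also have "\<dots> \<le> (\<integral>\<^sup>+x. (ennreal (cmod (u x)))\<^sup>2 \<partial>M) * (\<integral>\<^sup>+x. (ennreal (cmod (v x)))\<^sup>2 \<partial>M)"
    by (rule Cauchy_Schwarz_nn_integral) auto
  also have "\<dots> \<le> ennreal X * ennreal Y"
    using X Y by (intro mult_mono) (auto simp: ennreal_power)
  finally have "ennreal ((cmod (\<integral>x. u x * cnj (v x) \<partial>M))\<^sup>2) \<le> ennreal (X * Y)"
    using nonneg by (simp add: ennreal_power ennreal_mult)
  then have "(cmod (\<integral>x. u x * cnj (v x) \<partial>M))\<^sup>2 \<le> X * Y"
    using nonneg by (subst (asm) ennreal_le_iff) auto
  then have "sqrt ((cmod (\<integral>x. u x * cnj (v x) \<partial>M))\<^sup>2) \<le> sqrt (X * Y)" by (rule real_sqrt_le_mono)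
  then show ?thesis by (simp add: real_sqrt_mult)
qed

text \<open>The adjoint of \<open>\<partial>\<^sub>i\<close> in Gaussian \<open>L\<^sup>2\<close> is \<open>2 x\<^sub>i - \<partial>\<^sub>i\<close>.\<close>

lemma gauss_integration_by_parts:
  fixes u u' w w' :: "real ^ 'n \<Rightarrow> complex"
  assumes du: "\<And>x. ((\<lambda>t. u (x + t *\<^sub>R axis i 1)) has_vector_derivative u' x) (at 0)"
    and dw: "\<And>x. ((\<lambda>t. w (x + t *\<^sub>R axis i 1)) has_vector_derivative w' x) (at 0)"
    and cont: "continuous_on UNIV u" "continuous_on UNIV u'" "continuous_on UNIV w" "continuous_on UNIV w'"
    and L2: "in_L2 gauss_measure u" "in_L2 gauss_measure u'" "in_L2 gauss_measure w" "in_L2 gauss_measure (\<lambda>x. 2 * x $ i * w x - w' x)"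
  shows "(\<integral>x. u' x * cnj (w x) \<partial>gauss_measure) = (\<integral>x. u x * cnj (2 * x $ i * w x - w' x) \<partial>gauss_measure)"
proof -
  let ?a = "\<lambda>x. u' x * cnj (w x)" and ?b = "\<lambda>x. u x * cnj (2 * x $ i * w x - w' x)"
  have meas: "?a \<in> borel_measurable borel" "?b \<in> borel_measurable borel" "(\<lambda>x. u x * cnj (w x)) \<in> borel_measurable borel"
    by (intro borel_measurable_continuous_onI continuous_intros cont)+
  have int: "integrable gauss_measure ?a" "integrable gauss_measure ?b" "integrable gauss_measure (\<lambda>x. u x * cnj (w x))"
    by (intro integrable_L2_cnj L2)+
  have int': "integrable lborel (\<lambda>x. gauss_density x *\<^sub>R ?a x)" "integrable lborel (\<lambda>x. gauss_density x *\<^sub>R ?b x)"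
    "integrable lborel (\<lambda>x. gauss_density x *\<^sub>R (u x * cnj (w x)))"
    using int meas by (simp_all add: integrable_gauss_lborel_iff)
  let ?F = "\<lambda>x. gauss_density x *\<^sub>R (u x * cnj (w x))"
  let ?F' = "\<lambda>x. gauss_density x *\<^sub>R ?a x - gauss_density x *\<^sub>R ?b x"
  have "(\<integral>x. ?F' x \<partial>lborel) = 0"
  proof (rule integral_directional_derivative_eq_0[where F = ?F and v = "axis i 1"])
    fix x :: "real ^ 'n"
    have "((\<lambda>t. gauss_density (x + t *\<^sub>R axis i 1)) has_real_derivative - (2 * x $ i) * gauss_density x) (at 0)"
    proof -
      have nrm: "(norm (x + t *\<^sub>R axis i 1))\<^sup>2 = (norm x)\<^sup>2 + 2 * t * x $ i + t\<^sup>2" for t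
        unfolding power2_norm_eq_inner by (simp add: inner_add_left inner_add_right inner_axis inner_commute power2_eq_square algebra_simps)
      show ?thesis unfolding gauss_density_def nrm
        by (auto intro!: derivative_eq_intros)
    qed
    then have dg: "((\<lambda>t. gauss_density (x + t *\<^sub>R axis i 1)) has_vector_derivative - (2 * x $ i) * gauss_density x) (at 0)"
      by (simp add: has_real_derivative_iff_has_vector_derivative)
    have "((\<lambda>t. cnj (w (x + t *\<^sub>R axis i 1))) has_vector_derivative cnj (w' x)) (at 0)"
      using bounded_linear.has_vector_derivative[OF bounded_linear_cnj dw[of x]] .
    from has_vector_derivative_mult[OF du[of x] this]
    have "((\<lambda>t. u (x + t *\<^sub>R axis i 1) * cnj (w (x + t *\<^sub>R axis i 1))) has_vector_derivative
       u x * cnj (w' x) + u' x * cnj (w x)) (at 0)" by simp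
    from has_vector_derivative_scaleR[OF dg[unfolded has_real_derivative_iff_has_vector_derivative[symmetric]] this]
    show "((\<lambda>t. ?F (x + t *\<^sub>R axis i 1)) has_vector_derivative ?F' x) (at 0)"
      by (rule has_vector_derivative_eq_rhs) (simp add: scaleR_conv_of_real algebra_simps)
  next
    show "continuous_on UNIV ?F'" by (intro continuous_intros cont)
    show "integrable lborel ?F'" using int' by (intro Bochner_Integration.integrable_diff)
  qed (rule int')
  then have "(\<integral>x. gauss_density x *\<^sub>R ?a x \<partial>lborel) = (\<integral>x. gauss_density x *\<^sub>R ?b x \<partial>lborel)"
    using int' by simp
  then show ?thesis using meas by (simp add: integral_gauss_lborel)
qed

section \<open>Almost orthogonality\<close>

text \<open>Schur's test for a matrix decaying geometrically away from the diagonal.\<close>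

lemma schur_geometric:
  fixes p :: "nat \<Rightarrow> real"
  assumes \<rho>: "0 < \<rho>" "\<rho> < 1"
  shows "(\<Sum>j\<le>J. \<Sum>k\<le>J. \<rho> ^ (if j \<le> k then k - j else j - k) * (p j * p k)) \<le> 2 / (1 - \<rho>) * (\<Sum>j\<le>J. (p j)\<^sup>2)"
proof -
  let ?e = "\<lambda>j k. if j \<le> k then k - j else j - k"
  have geo: "(\<Sum>d\<in>D. \<rho> ^ d) \<le> 1 / (1 - \<rho>)" if "finite D" for D
  proof -
    have "(\<Sum>d\<in>D. \<rho> ^ d) \<le> (\<Sum>d. \<rho> ^ d)"
      using \<rho> that by (intro sum_le_suminf summable_geometric) auto
    then show ?thesis using \<rho> by (simp add: suminf_geometric)
  qed
  have row: "(\<Sum>k\<le>J. \<rho> ^ ?e j k) \<le> 2 / (1 - \<rho>)" for j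
  proof -
    have "(\<Sum>k\<le>J. \<rho> ^ ?e j k) \<le> (\<Sum>k\<in>{k. k \<le> J \<and> j \<le> k}. \<rho> ^ (k - j)) + (\<Sum>k\<in>{k. k \<le> J \<and> k < j}. \<rho> ^ (j - k))"
    proof -
      have "{..J} = {k. k \<le> J \<and> j \<le> k} \<union> {k. k \<le> J \<and> k < j}" by auto
      then have "(\<Sum>k\<le>J. \<rho> ^ ?e j k) = (\<Sum>k\<in>{k. k \<le> J \<and> j \<le> k}. \<rho> ^ ?e j k) + (\<Sum>k\<in>{k. k \<le> J \<and> k < j}. \<rho> ^ ?e j k)"
        by (simp only:) (rule sum.union_disjoint, auto)
      then show ?thesis by simp
    qed
    also have "(\<Sum>k\<in>{k. k \<le> J \<and> j \<le> k}. \<rho> ^ (k - j)) = (\<Sum>d\<in>(\<lambda>k. k - j) ` {k. k \<le> J \<and> j \<le> k}. \<rho> ^ d)"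
      by (subst sum.reindex) (auto simp: inj_on_def)
    also have "\<dots> \<le> 1 / (1 - \<rho>)" by (intro geo) auto
    also have "(\<Sum>k\<in>{k. k \<le> J \<and> k < j}. \<rho> ^ (j - k)) = (\<Sum>d\<in>(\<lambda>k. j - k) ` {k. k \<le> J \<and> k < j}. \<rho> ^ d)"
      by (subst sum.reindex) (auto simp: inj_on_def)
    also have "\<dots> \<le> 1 / (1 - \<rho>)" by (intro geo) auto
    finally show ?thesis by simp
  qed
  have "(\<Sum>j\<le>J. \<Sum>k\<le>J. \<rho> ^ ?e j k * (p j * p k)) \<le> (\<Sum>j\<le>J. \<Sum>k\<le>J. \<rho> ^ ?e j k * ((p j)\<^sup>2 / 2) + \<rho> ^ ?e j k * ((p k)\<^sup>2 / 2))"
  proof (intro sum_mono)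
    fix j k
    have "p j * p k \<le> (p j)\<^sup>2 / 2 + (p k)\<^sup>2 / 2" using sum_squares_bound[of "p j" "p k"] by simp
    then have "\<rho> ^ ?e j k * (p j * p k) \<le> \<rho> ^ ?e j k * ((p j)\<^sup>2 / 2 + (p k)\<^sup>2 / 2)"
      using \<rho> by (intro mult_left_mono) auto
    then show "\<rho> ^ ?e j k * (p j * p k) \<le> \<rho> ^ ?e j k * ((p j)\<^sup>2 / 2) + \<rho> ^ ?e j k * ((p k)\<^sup>2 / 2)"
      by (simp only: distrib_left)
  qed
  also have "\<dots> = (\<Sum>j\<le>J. \<Sum>k\<le>J. \<rho> ^ ?e j k * ((p j)\<^sup>2 / 2)) + (\<Sum>j\<le>J. \<Sum>k\<le>J. \<rho> ^ ?e j k * ((p k)\<^sup>2 / 2))"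
    by (simp only: sum.distrib)
  also have "(\<Sum>j\<le>J. \<Sum>k\<le>J. \<rho> ^ ?e j k * ((p k)\<^sup>2 / 2)) = (\<Sum>j\<le>J. \<Sum>k\<le>J. \<rho> ^ ?e j k * ((p j)\<^sup>2 / 2))"
  proof (subst sum.swap, intro sum.cong refl)
    fix j k :: nat
    have "?e k j = ?e j k" by (cases j k rule: linorder_cases) auto
    then show "\<rho> ^ ?e k j * ((p j)\<^sup>2 / 2) = \<rho> ^ ?e j k * ((p j)\<^sup>2 / 2)" by (simp only:)
  qed
  also have "(\<Sum>j\<le>J. \<Sum>k\<le>J. \<rho> ^ ?e j k * ((p j)\<^sup>2 / 2)) = (\<Sum>j\<le>J. (\<Sum>k\<le>J. \<rho> ^ ?e j k) * ((p j)\<^sup>2 / 2))"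
    by (simp only: sum_distrib_right)
  also have "\<dots> \<le> (\<Sum>j\<le>J. 2 / (1 - \<rho>) * ((p j)\<^sup>2 / 2))"
    by (intro sum_mono mult_right_mono row) auto
  also have "\<dots> + \<dots> = 2 / (1 - \<rho>) * (\<Sum>j\<le>J. (p j)\<^sup>2)"
  proof -
    have "c * (z / 2) + c * (z / 2) = c * z" for c z :: real by simp
    then show ?thesis by (simp only: sum_distrib_left sum.distrib[symmetric])
  qed
  finally show ?thesis by (simp add: add_mono)
qed

lemma card_dyadic_overlap:
  assumes "K \<ge> 1"
  shows "card {j. j \<le> J \<and> dyadic_piece K j k \<noteq> 0} \<le> 3"
proof (cases "{j. j \<le> J \<and> dyadic_piece K j k \<noteq> 0} = {}")
  case False
  let ?A = "{j. j \<le> J \<and> dyadic_piece K j k \<noteq> 0}"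
  have fin: "finite ?A" by (rule finite_subset[of _ "{..J}"]) auto
  define i where "i = Min ?A"
  have i: "i \<in> ?A" unfolding i_def by (rule Min_in[OF fin False])
  have "?A \<subseteq> {i..i + 2}"
  proof
    fix j assume j: "j \<in> ?A"
    then have "i \<le> j" unfolding i_def by (rule Min_le[OF fin])
    moreover have "j \<le> i + 2"
    proof -
      have "k < Suc K ^ Suc i" using i dyadic_piece_upper[of K i k] by (auto simp del: power_Suc simp: not_le[symmetric])
      then have "Suc K * Suc k \<le> Suc K * Suc K ^ Suc i" by (intro mult_left_mono) (auto simp del: power_Suc)
      moreover have "Suc K ^ j \<le> Suc K * Suc k" using j dyadic_piece_lower[of K k j] by (auto simp del: power_Suc mult_Suc mult_Suc_right simp: not_less[symmetric])
      ultimately have "Suc K ^ j \<le> Suc K * Suc K ^ Suc i" by (rule order_trans[rotated])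
      then have "Suc K ^ j \<le> Suc K ^ (i + 2)" by (simp only: power_Suc[symmetric] add_2_eq_Suc')
      then show ?thesis using assms by (simp add: power_increasing_iff del: power_Suc add_2_eq_Suc')
    qed
    ultimately show "j \<in> {i..i + 2}" by simp
  qed
  then have "card ?A \<le> card {i..i + 2}" by (intro card_mono) auto
  then show ?thesis by simp
next
  case True
  show ?thesis unfolding True by simp
qed

lemma dyadic_piece_at_0: "j \<noteq> 0 \<Longrightarrow> dyadic_piece K j 0 = 0"
  by (simp add: dyadic_piece_def cutoff_eq_1)

lemma sum_lowered:
  fixes G :: "nat ^ 'n \<Rightarrow> 'a::comm_monoid_add"
  shows "(\<Sum>\<eta>\<in>(\<lambda>\<xi>. \<xi> - axis i 1) ` {\<xi>\<in>S. \<xi> $ i \<noteq> 0}. G (\<eta> + axis i 1)) = (\<Sum>\<xi> | \<xi> \<in> S \<and> \<xi> $ i \<noteq> 0. G \<xi>)"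
proof -
  have "inj_on (\<lambda>\<xi>. \<xi> - axis i 1) {\<xi>\<in>S. \<xi> $ i \<noteq> 0}"
  proof (rule inj_onI)
    fix \<xi> \<eta> assume "\<xi> \<in> {\<xi>\<in>S. \<xi> $ i \<noteq> 0}" "\<eta> \<in> {\<xi>\<in>S. \<xi> $ i \<noteq> 0}" and eq: "\<xi> - axis i 1 = \<eta> - axis i 1"
    then have nz: "\<xi> $ i \<noteq> 0" "\<eta> $ i \<noteq> 0" by auto
    note mi_minus_axis[OF nz(1)] mi_minus_axis[OF nz(2)]
    with eq show "\<xi> = \<eta>" by metis
  qed
  then show ?thesis
    by (subst sum.reindex) (auto intro!: sum.cong arg_cong[of _ _ G] mi_minus_axis simp del: One_nat_def)
qed


definition block_sum ::
    "nat \<Rightarrow> (real ^ 'n \<Rightarrow> nat ^ 'n \<Rightarrow> complex) \<Rightarrow> (nat ^ 'n) set \<Rightarrow> nat \<Rightarrow> (nat ^ 'n \<Rightarrow> complex) \<Rightarrow> real ^ 'n \<Rightarrow> complex" where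
  "block_sum K s S j d x = (\<Sum>\<xi>\<in>S. d \<xi> * block K j (s x) \<xi> * hn \<xi> x)"

text \<open>The sums arising from \<open>block_sum\<close> when a derivative falls on the Hermite polynomials. The condition \<open>\<xi>\<^sub>i \<noteq> 0\<close> keeps
  \<open>\<xi> \<mapsto> \<xi> - e\<^sub>i\<close> injective.\<close>

definition lowered_block_sum ::
    "nat \<Rightarrow> (real ^ 'n \<Rightarrow> nat ^ 'n \<Rightarrow> complex) \<Rightarrow> (nat ^ 'n) set \<Rightarrow> 'n \<Rightarrow> nat \<Rightarrow> (nat ^ 'n \<Rightarrow> complex) \<Rightarrow> real ^ 'n \<Rightarrow> complex" where
  "lowered_block_sum K s S i j d x = (\<Sum>\<xi> | \<xi> \<in> S \<and> \<xi> $ i \<noteq> 0. d \<xi> * block K j (s x) \<xi> * hn (\<xi> - axis i 1) x)"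

lemma block_sum_regular:
  assumes "\<And>\<xi>. continuous_on UNIV (\<lambda>x. s x \<xi>)" "\<And>x \<xi>. cmod (s x \<xi>) \<le> b \<xi>"
  shows "in_L2 gauss_measure (\<lambda>x. \<Sum>\<xi>\<in>S. d \<xi> * block K j (s x) \<xi> * hn (f \<xi>) x)"
    and "continuous_on UNIV (\<lambda>x. \<Sum>\<xi>\<in>S. d \<xi> * block K j (s x) \<xi> * hn (f \<xi>) x)"
proof -
  have cont: "continuous_on UNIV (\<lambda>x. d \<xi> * block K j (s x) \<xi>)" for \<xi>
    unfolding block_def by (intro continuous_intros assms)
  have bound: "cmod (d \<xi> * block K j (s x) \<xi>) \<le> cmod (d \<xi>) * (b \<xi> * \<bar>dyadic_piece K j (mi_abs \<xi>)\<bar>)" for \<xi> x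
    unfolding block_def norm_mult norm_of_real by (intro mult_left_mono mult_right_mono assms) auto
  show "in_L2 gauss_measure (\<lambda>x. \<Sum>\<xi>\<in>S. d \<xi> * block K j (s x) \<xi> * hn (f \<xi>) x)"
    by (intro in_L2_sum in_L2_bounded_hn[OF cont bound])
  show "continuous_on UNIV (\<lambda>x. \<Sum>\<xi>\<in>S. d \<xi> * block K j (s x) \<xi> * hn (f \<xi>) x)"
    by (intro continuous_intros cont)
qed

lemma block_sum_has_derivative:
  assumes "\<And>x \<xi>. ((\<lambda>t. s (x + t *\<^sub>R axis i 1) \<xi>) has_vector_derivative s' x \<xi>) (at 0)"
  shows "((\<lambda>t. \<Sum>\<xi>\<in>S. d \<xi> * block K j (s (x + t *\<^sub>R axis i 1)) \<xi> * hn (f \<xi>) (x + t *\<^sub>R axis i 1)) has_vector_derivative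
     (\<Sum>\<xi>\<in>S. d \<xi> * block K j (s' x) \<xi> * hn (f \<xi>) x)
      + (\<Sum>\<xi>\<in>S. d \<xi> * block K j (s x) \<xi> * complex_of_real (sqrt (2 * real (f \<xi> $ i)) * hn (f \<xi> - axis i 1) x))) (at 0)"
proof -
  have term_deriv: "((\<lambda>t. d \<xi> * block K j (s (x + t *\<^sub>R axis i 1)) \<xi> * hn (f \<xi>) (x + t *\<^sub>R axis i 1)) has_vector_derivative
     d \<xi> * block K j (s' x) \<xi> * hn (f \<xi>) x + d \<xi> * block K j (s x) \<xi> * complex_of_real (sqrt (2 * real (f \<xi> $ i)) * hn (f \<xi> - axis i 1) x)) (at 0)" for \<xi>
  proof -
    let ?p = "complex_of_real (dyadic_piece K j (mi_abs \<xi>))"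
    have h: "((\<lambda>t. complex_of_real (hn (f \<xi>) (x + t *\<^sub>R axis i 1))) has_vector_derivative
        complex_of_real (sqrt (2 * real (f \<xi> $ i)) * hn (f \<xi> - axis i 1) x)) (at 0)"
      by (rule has_vector_derivative_of_real) (rule hn_has_directional_derivative)
    have "((\<lambda>t. (d \<xi> * ?p) * s (x + t *\<^sub>R axis i 1) \<xi>) has_vector_derivative (d \<xi> * ?p) * s' x \<xi>) (at 0)"
      by (rule has_vector_derivative_mult_right) (rule assms)
    from has_vector_derivative_mult[OF this h] show ?thesis
      by (simp add: block_def mult_ac add.commute)
  qed
  show ?thesis
    unfolding sum.distrib[symmetric] by (rule has_vector_derivative_sum) (rule term_deriv)
qed

lemma cmod_add_sq: "(cmod (z + w))\<^sup>2 \<le> 2 * (cmod z)\<^sup>2 + 2 * (cmod w)\<^sup>2"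
  using power_mono[OF norm_triangle_ineq[of z w], of 2] sum_squares_bound[of "cmod z" "cmod w"]
  by (simp add: power2_sum)

lemma nn_integral_L2_add:
  fixes f g :: "'a \<Rightarrow> complex"
  assumes [measurable]: "f \<in> borel_measurable M" "g \<in> borel_measurable M"
    and "(\<integral>\<^sup>+x. ennreal ((cmod (f x))\<^sup>2) \<partial>M) \<le> ennreal X" "(\<integral>\<^sup>+x. ennreal ((cmod (g x))\<^sup>2) \<partial>M) \<le> ennreal Y"
    and "X \<ge> 0" "Y \<ge> 0"
  shows "(\<integral>\<^sup>+x. ennreal ((cmod (f x + g x))\<^sup>2) \<partial>M) \<le> ennreal (2 * X + 2 * Y)"
proof -
  have "(\<integral>\<^sup>+x. ennreal ((cmod (f x + g x))\<^sup>2) \<partial>M) \<le> (\<integral>\<^sup>+x. 2 * ennreal ((cmod (f x))\<^sup>2) + 2 * ennreal ((cmod (g x))\<^sup>2) \<partial>M)"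
    using cmod_add_sq by (intro nn_integral_mono) (simp flip: ennreal_numeral ennreal_mult ennreal_plus)
  also have "\<dots> = 2 * (\<integral>\<^sup>+x. ennreal ((cmod (f x))\<^sup>2) \<partial>M) + 2 * (\<integral>\<^sup>+x. ennreal ((cmod (g x))\<^sup>2) \<partial>M)"
    by (simp add: nn_integral_add nn_integral_cmult)
  also have "\<dots> \<le> 2 * ennreal X + 2 * ennreal Y"
    using assms by (intro add_mono mult_left_mono) auto
  also have "\<dots> = ennreal (2 * X + 2 * Y)"
    using assms by (simp flip: ennreal_numeral ennreal_mult ennreal_plus)
  finally show ?thesis .
qed

lemma lowered_block_sum_bound:
  fixes s :: "real ^ 'n \<Rightarrow> nat ^ 'n \<Rightarrow> complex"
  assumes blk: "\<And>j v S d. finite S \<Longrightarrow>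
       (\<integral>\<^sup>+x. ennreal ((cmod (\<Sum>\<xi>\<in>S. d \<xi> * block K j (s x) (\<xi> + v) * hn \<xi> x))\<^sup>2) \<partial>gauss_measure)
         \<le> ennreal (A j * (\<Sum>\<xi>\<in>S. (cmod (d \<xi>))\<^sup>2))"
    and A: "A j \<ge> 0" and S: "finite S"
  shows "(\<integral>\<^sup>+x. ennreal ((cmod (lowered_block_sum K s S i j d x))\<^sup>2) \<partial>gauss_measure) \<le> ennreal (A j * (\<Sum>\<xi>\<in>S. (cmod (d \<xi>))\<^sup>2))"
proof -
  let ?L = "(\<lambda>\<xi>. \<xi> - axis i 1) ` {\<xi>\<in>S. \<xi> $ i \<noteq> 0}"
  have cancel: "\<eta> + axis i 1 - axis i 1 = \<eta>" for \<eta> :: "nat ^ 'n" by (simp add: vec_eq_iff)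
  have "lowered_block_sum K s S i j d x = (\<Sum>\<eta>\<in>?L. d (\<eta> + axis i 1) * block K j (s x) (\<eta> + axis i 1) * hn \<eta> x)" for x
    unfolding lowered_block_sum_def
    using sum_lowered[of "\<lambda>\<xi>. d \<xi> * block K j (s x) \<xi> * hn (\<xi> - axis i 1) x" i S] by (simp only: cancel)
  then have "(\<integral>\<^sup>+x. ennreal ((cmod (lowered_block_sum K s S i j d x))\<^sup>2) \<partial>gauss_measure)
     \<le> ennreal (A j * (\<Sum>\<eta>\<in>?L. (cmod (d (\<eta> + axis i 1)))\<^sup>2))"
    using blk[of ?L "\<lambda>\<eta>. d (\<eta> + axis i 1)" j "axis i 1"] S by simp
  also have "(\<Sum>\<eta>\<in>?L. (cmod (d (\<eta> + axis i 1)))\<^sup>2) = (\<Sum>\<xi> | \<xi> \<in> S \<and> \<xi> $ i \<noteq> 0. (cmod (d \<xi>))\<^sup>2)"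
    by (rule sum_lowered)
  also have "ennreal (A j * \<dots>) \<le> ennreal (A j * (\<Sum>\<xi>\<in>S. (cmod (d \<xi>))\<^sup>2))"
    using A S by (intro ennreal_leI mult_left_mono sum_mono2) auto
  finally show ?thesis .
qed

text \<open>For \<open>j < k\<close> write \<open>hn \<xi> = \<Sum>\<^sub>i (\<xi>\<^sub>i/|\<xi>|) (2\<xi>\<^sub>i)\<^sup>-\<^sup>1\<^sup>/\<^sup>2 \<partial>\<^sub>i\<^sup>* hn (\<xi> - e\<^sub>i)\<close> in the high-frequency
  block \<open>T\<^sub>k\<close> and integrate by parts. The derivative falls either on \<open>T\<^sub>j\<close>, costing at most \<open>q\<^sup>j\<^sup>/\<^sup>2\<close>, or on the
  symbol of \<open>T\<^sub>k\<close>, costing \<open>q\<^sup>k\<^sup>\<delta>\<^sup>/\<^sup>2\<close>; the factor \<open>(2\<xi>\<^sub>i)\<^sup>-\<^sup>1\<^sup>/\<^sup>2 \<xi>\<^sub>i/|\<xi>|\<close> gains \<open>q\<^sup>-\<^sup>k\<^sup>/\<^sup>2\<close>. As \<open>\<delta> < 1\<close>, the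
  balance decays geometrically in \<open>k - j\<close>.\<close>

lemma block_cross_term:
  fixes \<sigma> :: "real ^ 'n \<Rightarrow> nat ^ 'n \<Rightarrow> complex" and D :: "'n \<Rightarrow> real ^ 'n \<Rightarrow> nat ^ 'n \<Rightarrow> complex"
  assumes K: "K \<ge> 1" and \<delta>: "0 \<le> \<delta>" "\<delta> < 1" and S: "finite S" and E: "E \<ge> 0"
    and cont: "\<And>\<xi>. continuous_on UNIV (\<lambda>x. \<sigma> x \<xi>)" "\<And>i \<xi>. continuous_on UNIV (\<lambda>x. D i x \<xi>)"
    and deriv: "\<And>i x \<xi>. ((\<lambda>t. \<sigma> (x + t *\<^sub>R axis i 1) \<xi>) has_vector_derivative D i x \<xi>) (at 0)"
    and bounded: "\<And>x \<xi>. cmod (\<sigma> x \<xi>) \<le> b \<xi>" "\<And>i x \<xi>. cmod (D i x \<xi>) \<le> b \<xi>"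
    and blk0: "\<And>j v S d. finite S \<Longrightarrow>
       (\<integral>\<^sup>+x. ennreal ((cmod (\<Sum>\<xi>\<in>S. d \<xi> * block K j (\<sigma> x) (\<xi> + v) * hn \<xi> x))\<^sup>2) \<partial>gauss_measure)
         \<le> ennreal (E * (\<Sum>\<xi>\<in>S. (cmod (d \<xi>))\<^sup>2))"
    and blk1: "\<And>i j v S d. finite S \<Longrightarrow>
       (\<integral>\<^sup>+x. ennreal ((cmod (\<Sum>\<xi>\<in>S. d \<xi> * block K j (D i x) (\<xi> + v) * hn \<xi> x))\<^sup>2) \<partial>gauss_measure)
         \<le> ennreal (E * real (Suc K ^ j) powr \<delta> * (\<Sum>\<xi>\<in>S. (cmod (d \<xi>))\<^sup>2))"
    and supp_a: "\<And>\<xi>. dyadic_piece K j (mi_abs \<xi>) = 0 \<Longrightarrow> a \<xi> = 0"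
    and supp_c: "\<And>\<xi>. dyadic_piece K k (mi_abs \<xi>) = 0 \<Longrightarrow> c \<xi> = 0"
    and jk: "j < k"
  shows "cmod (\<integral>x. block_sum K \<sigma> S j a x * cnj (block_sum K \<sigma> S k c x) \<partial>gauss_measure)
    \<le> 4 * real CARD('n) * E * real (Suc K) * sqrt (real (Suc K) powr (\<delta> - 1)) ^ (k - j)
        * (sqrt (\<Sum>\<xi>\<in>S. (cmod (a \<xi>))\<^sup>2) * sqrt (\<Sum>\<xi>\<in>S. (cmod (c \<xi>))\<^sup>2))"
proof -
  define q where "q = real (Suc K)"
  have q: "q \<ge> 2" using K by (simp add: q_def)
  have q0: "q > 0" and q1: "q \<ge> 1" using q by simp_all
  have qpow: "real (Suc K ^ l) = q ^ l" for l by (simp add: q_def)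
  define r where "r = q powr (\<delta> - 1)"
  define \<rho> where "\<rho> = sqrt r"
  have r: "r > 0" "r \<le> 1" "1 / q \<le> r"
  proof -
    show "r > 0" using q0 by (simp add: r_def)
    show "r \<le> 1" using powr_mono[of "\<delta> - 1" 0 q] q1 \<delta> q0 by (simp add: r_def)
    have "q powr (- 1) \<le> r" unfolding r_def using q1 \<delta> by (intro powr_mono) auto
    then show "1 / q \<le> r" using q0 by (simp add: powr_minus_divide)
  qed
  have \<rho>: "\<rho> \<ge> 0" "\<rho> ^ l * \<rho> ^ l = r ^ l" for l
    using r by (simp_all add: \<rho>_def power_mult_distrib[symmetric])
  have qk: "(q ^ l) powr \<delta> / q ^ l = r ^ l" for l
  proof -
    have "(q ^ l) powr \<delta> / q ^ l = (q ^ l) powr \<delta> / (q ^ l) powr 1" using q0 by simp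
    also have "\<dots> = (q ^ l) powr (\<delta> - 1)" by (rule powr_diff[symmetric])
    also have "\<dots> = r ^ l" using q0 by (simp add: r_def powr_realpow[symmetric] powr_powr mult.commute)
    finally show ?thesis .
  qed
  have q\<delta>: "(q ^ l) powr \<delta> \<le> q ^ l" for l
    using powr_mono[of \<delta> 1 "q ^ l"] q1 \<delta> q0 by (simp add: one_le_power)
  define Pa where "Pa = (\<Sum>\<xi>\<in>S. (cmod (a \<xi>))\<^sup>2)"
  define Pc where "Pc = (\<Sum>\<xi>\<in>S. (cmod (c \<xi>))\<^sup>2)"
  have P: "Pa \<ge> 0" "Pc \<ge> 0" by (simp_all add: Pa_def Pc_def sum_nonneg)
  \<comment> \<open>The coefficients of the lowered sums: \<open>dd i \<xi>\<close> times the factor \<open>(2 \<xi>\<^sub>i)\<^sup>1\<^sup>/\<^sup>2\<close> of the raising operator is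
    \<open>c \<xi>\<close> times \<open>\<xi>\<^sub>i/|\<xi>|\<close>, and these weights add up to \<open>1\<close>.\<close>
  define dd where "dd i \<xi> = c \<xi> * complex_of_real (sqrt (real (\<xi> $ i) / 2) / real (mi_abs \<xi>))" for i \<xi>
  define T where "T = block_sum K \<sigma> S j a"
  define dT where "dT i x = block_sum K (D i) S j a x + lowered_block_sum K \<sigma> S i j (\<lambda>\<xi>. a \<xi> * sqrt (2 * real (\<xi> $ i))) x" for i x
  define W where "W i = lowered_block_sum K \<sigma> S i k (dd i)" for i
  define V where "V i = lowered_block_sum K (D i) S i k (dd i)" for i
  define U where "U i x = (\<Sum>\<xi> | \<xi> \<in> S \<and> \<xi> $ i \<noteq> 0. (dd i \<xi> * sqrt (2 * real (\<xi> $ i))) * block K k (\<sigma> x) \<xi> * hn \<xi> x)" for i x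
  define W' where "W' i x = V i x + (\<Sum>\<xi> | \<xi> \<in> S \<and> \<xi> $ i \<noteq> 0. dd i \<xi> * block K k (\<sigma> x) \<xi>
      * complex_of_real (sqrt (2 * real ((\<xi> - axis i 1) $ i)) * hn (\<xi> - axis i 1 - axis i 1) x))" for i x
  note reg0 = block_sum_regular[OF cont(1) bounded(1)] and reg1 = block_sum_regular[OF cont(2) bounded(2)]
  have L2: "in_L2 gauss_measure T" "in_L2 gauss_measure (dT i)" "in_L2 gauss_measure (W i)" "in_L2 gauss_measure (V i)" "in_L2 gauss_measure (U i)" for i
    unfolding T_def dT_def[abs_def] W_def V_def U_def[abs_def] block_sum_def[abs_def] lowered_block_sum_def[abs_def]
    by (intro in_L2_add reg0 reg1)+
  have cont_T: "continuous_on UNIV T" "continuous_on UNIV (dT i)" "continuous_on UNIV (W i)" for i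
    unfolding T_def dT_def[abs_def] W_def block_sum_def[abs_def] lowered_block_sum_def[abs_def]
    by (intro continuous_on_add reg0 reg1)+
  have cont_W': "continuous_on UNIV (W' i)" for i
    unfolding W'_def[abs_def] V_def lowered_block_sum_def[abs_def] block_def
    by (intro continuous_intros cont)
  have deriv_T: "((\<lambda>t. T (x + t *\<^sub>R axis i 1)) has_vector_derivative dT i x) (at 0)" for i x
  proof -
    have "(\<Sum>\<xi>\<in>S. a \<xi> * block K j (\<sigma> x) \<xi> * complex_of_real (sqrt (2 * real (\<xi> $ i)) * hn (\<xi> - axis i 1) x))
       = lowered_block_sum K \<sigma> S i j (\<lambda>\<xi>. a \<xi> * sqrt (2 * real (\<xi> $ i))) x"
      unfolding lowered_block_sum_def using S
      by (intro sum.mono_neutral_cong_right) (auto simp: mult_ac)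
    then show ?thesis
      using block_sum_has_derivative[where s = \<sigma> and s' = "D i" and S = S and d = a and K = K and j = j and f = "\<lambda>\<xi>. \<xi>" and i = i and x = x, OF deriv]
      unfolding T_def dT_def block_sum_def by (simp only:)
  qed
  have deriv_W: "((\<lambda>t. W i (x + t *\<^sub>R axis i 1)) has_vector_derivative W' i x) (at 0)" for i x
    using block_sum_has_derivative[where s = \<sigma> and s' = "D i" and S = "{\<xi>. \<xi> \<in> S \<and> \<xi> $ i \<noteq> 0}" and d = "dd i" and K = K and j = k
        and f = "\<lambda>\<xi>. \<xi> - axis i 1" and i = i and x = x, OF deriv]
    unfolding W_def W'_def V_def lowered_block_sum_def by (simp only:)
  \<comment> \<open>The adjoint of the derivative raises \<open>hn (\<xi> - e\<^sub>i)\<close> back to \<open>hn \<xi>\<close>; \<open>V i\<close> is the part where the derivative falls on the symbol.\<close>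
  have raise: "2 * x $ i * W i x - W' i x = U i x - V i x" for i x
  proof -
    have "complex_of_real (2 * x $ i) * W i x - (W' i x - V i x)
      = (\<Sum>\<xi> | \<xi> \<in> S \<and> \<xi> $ i \<noteq> 0. dd i \<xi> * block K k (\<sigma> x) \<xi> *
          complex_of_real (2 * x $ i * hn (\<xi> - axis i 1) x - sqrt (2 * real ((\<xi> - axis i 1) $ i)) * hn (\<xi> - axis i 1 - axis i 1) x))"
      unfolding W_def W'_def lowered_block_sum_def of_real_diff right_diff_distrib sum_subtractf sum_distrib_left add_diff_cancel_left'
      by (simp add: mult_ac)
    also have "\<dots> = U i x"
      unfolding U_def
    proof (rule sum.cong[OF refl])
      fix \<xi> assume "\<xi> \<in> {\<xi>. \<xi> \<in> S \<and> \<xi> $ i \<noteq> 0}"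
      then have nz: "\<xi> $ i \<noteq> 0" by simp
      have "2 * x $ i * hn (\<xi> - axis i 1) x - sqrt (2 * real ((\<xi> - axis i 1) $ i)) * hn (\<xi> - axis i 1 - axis i 1) x
        = sqrt (2 * real ((\<xi> - axis i 1) $ i + 1)) * hn \<xi> x"
        unfolding hn_recurrence mi_minus_axis[OF nz] by simp
      also have "(\<xi> - axis i 1) $ i + 1 = \<xi> $ i" using nz by (simp add: axis_def)
      finally show "dd i \<xi> * block K k (\<sigma> x) \<xi> * complex_of_real (2 * x $ i * hn (\<xi> - axis i 1) x - sqrt (2 * real ((\<xi> - axis i 1) $ i)) * hn (\<xi> - axis i 1 - axis i 1) x)
        = dd i \<xi> * complex_of_real (sqrt (2 * real (\<xi> $ i))) * block K k (\<sigma> x) \<xi> * complex_of_real (hn \<xi> x)"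
        by (simp only: of_real_mult mult_ac)
    qed
    finally show ?thesis by (simp add: algebra_simps)
  qed
  have T_eq: "block_sum K \<sigma> S k c x = (\<Sum>i\<in>UNIV. (2 * x $ i * W i x - W' i x) + V i x)" for x
  proof -
    have "(\<Sum>i\<in>UNIV. (2 * x $ i * W i x - W' i x) + V i x) = (\<Sum>i\<in>UNIV. U i x)"
      unfolding raise by simp
    also have "\<dots> = (\<Sum>i\<in>UNIV. \<Sum>\<xi>\<in>S. complex_of_real (real (\<xi> $ i) / real (mi_abs \<xi>)) * (c \<xi> * block K k (\<sigma> x) \<xi> * hn \<xi> x))"
    proof (rule sum.cong[OF refl])
      fix i
      have coef: "dd i \<xi> * sqrt (2 * real (\<xi> $ i)) = c \<xi> * complex_of_real (real (\<xi> $ i) / real (mi_abs \<xi>))" for \<xi>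
      proof -
        have "sqrt (real (\<xi> $ i) / 2) * sqrt (2 * real (\<xi> $ i)) = real (\<xi> $ i)"
          unfolding real_sqrt_mult[symmetric] by (simp add: power2_eq_square[symmetric])
        then have "sqrt (real (\<xi> $ i) / 2) / real (mi_abs \<xi>) * sqrt (2 * real (\<xi> $ i)) = real (\<xi> $ i) / real (mi_abs \<xi>)"
          by (simp only: times_divide_eq_left)
        then show ?thesis unfolding dd_def mult.assoc of_real_mult[symmetric] by (simp only:)
      qed
      show "U i x = (\<Sum>\<xi>\<in>S. complex_of_real (real (\<xi> $ i) / real (mi_abs \<xi>)) * (c \<xi> * block K k (\<sigma> x) \<xi> * hn \<xi> x))"
        unfolding U_def coef using S by (intro sum.mono_neutral_cong_left) (auto simp: mult_ac)
    qed
    also have "\<dots> = (\<Sum>\<xi>\<in>S. \<Sum>i\<in>UNIV. complex_of_real (real (\<xi> $ i) / real (mi_abs \<xi>)) * (c \<xi> * block K k (\<sigma> x) \<xi> * hn \<xi> x))"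
      by (rule sum.swap)
    also have "\<dots> = (\<Sum>\<xi>\<in>S. c \<xi> * block K k (\<sigma> x) \<xi> * hn \<xi> x)"
    proof (rule sum.cong[OF refl])
      fix \<xi>
      let ?t = "c \<xi> * block K k (\<sigma> x) \<xi> * complex_of_real (hn \<xi> x)"
      have "(\<Sum>i\<in>UNIV. complex_of_real (real (\<xi> $ i) / real (mi_abs \<xi>)) * ?t)
         = complex_of_real (\<Sum>i\<in>UNIV. real (\<xi> $ i) / real (mi_abs \<xi>)) * ?t"
        by (simp only: sum_distrib_right of_real_sum)
      also have "(\<Sum>i\<in>UNIV. real (\<xi> $ i) / real (mi_abs \<xi>)) = real (mi_abs \<xi>) / real (mi_abs \<xi>)"
        by (simp only: sum_divide_distrib[symmetric] of_nat_sum[symmetric] mi_abs_def)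
      also have "complex_of_real (real (mi_abs \<xi>) / real (mi_abs \<xi>)) * ?t = ?t"
      proof (cases "mi_abs \<xi> = 0")
        case True
        then have "c \<xi> = 0" using jk by (intro supp_c) (simp add: dyadic_piece_at_0)
        then show ?thesis by simp
      qed simp
      finally show "(\<Sum>i\<in>UNIV. complex_of_real (real (\<xi> $ i) / real (mi_abs \<xi>)) * ?t) = ?t" .
    qed
    finally show ?thesis unfolding block_sum_def by (rule sym)
  qed
  have a_upper: "real (\<xi> $ i) \<le> q * q ^ j" if "a \<xi> \<noteq> 0" for \<xi> i
  proof -
    have "mi_abs \<xi> < Suc K ^ Suc j"
      using that supp_a dyadic_piece_upper[of K j "mi_abs \<xi>"] by (meson not_le)
    then have "\<xi> $ i \<le> Suc K ^ Suc j" using mi_nth_le_abs[of \<xi> i] by linarith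
    then have "real (\<xi> $ i) \<le> real (Suc K ^ Suc j)" by (simp only: of_nat_le_iff)
    then show ?thesis by (simp only: q_def of_nat_power power_Suc of_nat_mult)
  qed
  have dd_sq: "(\<Sum>\<xi>\<in>S. (cmod (dd i \<xi>))\<^sup>2) \<le> q / q ^ k * Pc" for i
    unfolding Pc_def sum_distrib_left
  proof (rule sum_mono)
    fix \<xi>
    show "(cmod (dd i \<xi>))\<^sup>2 \<le> q / q ^ k * (cmod (c \<xi>))\<^sup>2"
    proof (cases "c \<xi> = 0")
      case False
      define m where "m = mi_abs \<xi>"
      have piece: "dyadic_piece K k m \<noteq> 0" using False supp_c m_def by blast
      have m: "m \<ge> 1" using piece jk dyadic_piece_at_0[of k K] by (cases m) auto
      have "Suc K ^ k \<le> Suc K * Suc m" using piece dyadic_piece_lower[of K m k] by (meson not_le)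
      also have "\<dots> \<le> Suc K * (2 * m)" using m by (intro mult_left_mono) auto
      finally have "real (Suc K ^ k) \<le> real (Suc K * (2 * m))" by (simp only: of_nat_le_iff)
      then have qm: "q ^ k \<le> q * (2 * real m)" by (simp only: q_def of_nat_power of_nat_mult of_nat_numeral)
      have m0: "real m > 0" using m by simp
      have "(cmod (dd i \<xi>))\<^sup>2 = (cmod (c \<xi>))\<^sup>2 * (real (\<xi> $ i) / 2 / (real m)\<^sup>2)"
        by (simp add: dd_def norm_mult power_mult_distrib norm_divide power_divide m_def)
      also have "\<dots> \<le> (cmod (c \<xi>))\<^sup>2 * (q / q ^ k)"
      proof (rule mult_left_mono)
        have "real (\<xi> $ i) / 2 / (real m)\<^sup>2 \<le> real m / 2 / (real m)\<^sup>2"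
          using mi_nth_le_abs[of \<xi> i] by (intro divide_right_mono) (auto simp: m_def)
        also have "\<dots> = 1 / (2 * real m)" using m0 by (simp add: power2_eq_square)
        also have "\<dots> \<le> q / q ^ k" using qm m0 q0 by (simp add: divide_le_eq le_divide_eq field_simps)
        finally show "real (\<xi> $ i) / 2 / (real m)\<^sup>2 \<le> q / q ^ k" .
      qed simp
      finally show ?thesis by (simp only: mult.commute)
    qed (simp add: dd_def)
  qed
  have T_bound: "(\<integral>\<^sup>+x. ennreal ((cmod (T x))\<^sup>2) \<partial>gauss_measure) \<le> ennreal (E * Pa)"
    using blk0[OF S, of a j 0] by (simp add: T_def block_sum_def Pa_def)
  have W_bound: "(\<integral>\<^sup>+x. ennreal ((cmod (W i x))\<^sup>2) \<partial>gauss_measure) \<le> ennreal (E * (q / q ^ k * Pc))" for i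
  proof -
    have "(\<integral>\<^sup>+x. ennreal ((cmod (W i x))\<^sup>2) \<partial>gauss_measure) \<le> ennreal (E * (\<Sum>\<xi>\<in>S. (cmod (dd i \<xi>))\<^sup>2))"
      unfolding W_def using blk0 E S by (rule lowered_block_sum_bound[where A = "\<lambda>_. E"])
    also have "\<dots> \<le> ennreal (E * (q / q ^ k * Pc))"
      using dd_sq E by (intro ennreal_leI mult_left_mono)
    finally show ?thesis .
  qed
  have V_bound: "(\<integral>\<^sup>+x. ennreal ((cmod (V i x))\<^sup>2) \<partial>gauss_measure) \<le> ennreal (E * r ^ k * (q * Pc))" for i
  proof -
    have "(\<integral>\<^sup>+x. ennreal ((cmod (V i x))\<^sup>2) \<partial>gauss_measure) \<le> ennreal (E * real (Suc K ^ k) powr \<delta> * (\<Sum>\<xi>\<in>S. (cmod (dd i \<xi>))\<^sup>2))"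
      unfolding V_def using blk1 E S by (intro lowered_block_sum_bound[where A = "\<lambda>j. E * real (Suc K ^ j) powr \<delta>"]) auto
    also have "\<dots> \<le> ennreal (E * (q ^ k) powr \<delta> * (q / q ^ k * Pc))"
      unfolding qpow using dd_sq E by (intro ennreal_leI mult_left_mono) auto
    also have "E * (q ^ k) powr \<delta> * (q / q ^ k * Pc) = E * ((q ^ k) powr \<delta> / q ^ k) * (q * Pc)" by simp
    finally show ?thesis unfolding qk .
  qed
  have dT_bound: "(\<integral>\<^sup>+x. ennreal ((cmod (dT i x))\<^sup>2) \<partial>gauss_measure) \<le> ennreal (6 * (E * (q * (q ^ j * Pa))))" for i
  proof -
    have m1: "block_sum K (D i) S j a \<in> borel_measurable gauss_measure"
      and m2: "lowered_block_sum K \<sigma> S i j (\<lambda>\<xi>. a \<xi> * sqrt (2 * real (\<xi> $ i))) \<in> borel_measurable gauss_measure"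
    proof -
      have "in_L2 gauss_measure (block_sum K (D i) S j a)"
        unfolding block_sum_def[abs_def] by (rule reg1)
      then show "block_sum K (D i) S j a \<in> borel_measurable gauss_measure" by (simp only: in_L2_def)
      have "in_L2 gauss_measure (lowered_block_sum K \<sigma> S i j (\<lambda>\<xi>. a \<xi> * sqrt (2 * real (\<xi> $ i))))"
        unfolding lowered_block_sum_def[abs_def] by (rule reg0)
      then show "lowered_block_sum K \<sigma> S i j (\<lambda>\<xi>. a \<xi> * sqrt (2 * real (\<xi> $ i))) \<in> borel_measurable gauss_measure"
        by (simp only: in_L2_def)
    qed
    have b1: "(\<integral>\<^sup>+x. ennreal ((cmod (block_sum K (D i) S j a x))\<^sup>2) \<partial>gauss_measure) \<le> ennreal (E * (q ^ j * Pa))"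
    proof -
      have "(\<integral>\<^sup>+x. ennreal ((cmod (block_sum K (D i) S j a x))\<^sup>2) \<partial>gauss_measure) \<le> ennreal (E * (q ^ j) powr \<delta> * Pa)"
        using blk1[OF S, of a j i 0] unfolding qpow by (simp add: block_sum_def Pa_def)
      also have "\<dots> \<le> ennreal (E * (q ^ j * Pa))"
        unfolding mult.assoc using E P q\<delta>[of j] by (intro ennreal_leI mult_left_mono mult_right_mono)
      finally show ?thesis .
    qed
    have b2: "(\<integral>\<^sup>+x. ennreal ((cmod (lowered_block_sum K \<sigma> S i j (\<lambda>\<xi>. a \<xi> * sqrt (2 * real (\<xi> $ i))) x))\<^sup>2) \<partial>gauss_measure)
        \<le> ennreal (E * (2 * q * q ^ j * Pa))"
    proof -
      have "(\<integral>\<^sup>+x. ennreal ((cmod (lowered_block_sum K \<sigma> S i j (\<lambda>\<xi>. a \<xi> * sqrt (2 * real (\<xi> $ i))) x))\<^sup>2) \<partial>gauss_measure)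
        \<le> ennreal (E * (\<Sum>\<xi>\<in>S. (cmod (a \<xi> * sqrt (2 * real (\<xi> $ i))))\<^sup>2))"
        using blk0 E S by (rule lowered_block_sum_bound[where A = "\<lambda>_. E"])
      also have "(\<Sum>\<xi>\<in>S. (cmod (a \<xi> * sqrt (2 * real (\<xi> $ i))))\<^sup>2) \<le> 2 * q * q ^ j * Pa"
        unfolding Pa_def sum_distrib_left
      proof (rule sum_mono)
        fix \<xi>
        have "(cmod (a \<xi> * sqrt (2 * real (\<xi> $ i))))\<^sup>2 = (2 * real (\<xi> $ i)) * (cmod (a \<xi>))\<^sup>2"
          by (simp add: norm_mult power_mult_distrib)
        also have "\<dots> \<le> (2 * (q * q ^ j)) * (cmod (a \<xi>))\<^sup>2"
          using a_upper[of \<xi> i] by (cases "a \<xi> = 0") (auto intro!: mult_right_mono)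
        finally show "(cmod (a \<xi> * sqrt (2 * real (\<xi> $ i))))\<^sup>2 \<le> 2 * q * q ^ j * (cmod (a \<xi>))\<^sup>2"
          by (simp only: mult.assoc)
      qed
      finally show ?thesis using E by (simp add: mult_left_mono ennreal_leI)
    qed
    have "(\<integral>\<^sup>+x. ennreal ((cmod (dT i x))\<^sup>2) \<partial>gauss_measure) \<le> ennreal (2 * (E * (q ^ j * Pa)) + 2 * (E * (2 * q * q ^ j * Pa)))"
      unfolding dT_def using m1 m2 b1 b2 by (rule nn_integral_L2_add) (use E P q0 in auto)
    also have "\<dots> \<le> ennreal (6 * (E * (q * (q ^ j * Pa))))"
    proof (rule ennreal_leI)
      have "1 * (E * (q ^ j * Pa)) \<le> q * (E * (q ^ j * Pa))" using q1 E P q0 by (intro mult_right_mono) auto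
      then show "2 * (E * (q ^ j * Pa)) + 2 * (E * (2 * q * q ^ j * Pa)) \<le> 6 * (E * (q * (q ^ j * Pa)))"
        by (simp add: mult_ac)
    qed
    finally show ?thesis .
  qed
  have ratio: "q ^ j / q ^ k \<le> r ^ (k - j)"
  proof -
    have "q ^ j / q ^ k = (1 / q) ^ (k - j)"
      using jk q0 by (simp add: power_diff power_divide)
    also have "\<dots> \<le> r ^ (k - j)" using r q0 by (intro power_mono) auto
    finally show ?thesis .
  qed
  have r_mono: "r ^ k \<le> r ^ (k - j)" using r by (intro power_decreasing) auto
  define p where "p = sqrt Pa * sqrt Pc"
  have p: "p \<ge> 0" "p * p = Pa * Pc" using P by (simp_all add: p_def mult_ac)
  have inner_W: "cmod (\<integral>x. dT i x * cnj (W i x) \<partial>gauss_measure) \<le> 3 * E * q * \<rho> ^ (k - j) * p" for i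
  proof -
    have "cmod (\<integral>x. dT i x * cnj (W i x) \<partial>gauss_measure) \<le> sqrt (6 * (E * (q * (q ^ j * Pa)))) * sqrt (E * (q / q ^ k * Pc))"
      using L2(2,3) dT_bound W_bound by (rule L2_Cauchy_Schwarz) (use E P q0 in auto)
    also have "\<dots> = sqrt ((6 * (E * (q * (q ^ j * Pa)))) * (E * (q / q ^ k * Pc)))"
      by (simp only: real_sqrt_mult)
    also have "\<dots> \<le> 3 * E * q * \<rho> ^ (k - j) * p"
    proof (rule real_le_lsqrt)
      have "(6 * (E * (q * (q ^ j * Pa)))) * (E * (q / q ^ k * Pc)) = 6 * (E * E * (q * q) * (Pa * Pc)) * (q ^ j / q ^ k)"
        by (simp add: mult_ac)
      also have "\<dots> \<le> 9 * (E * E * (q * q) * (Pa * Pc)) * r ^ (k - j)"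
        using ratio E P q0 r by (intro mult_mono) auto
      also have "\<dots> = (3 * E * q * \<rho> ^ (k - j) * p)\<^sup>2"
        unfolding p(2)[symmetric] \<rho>(2)[symmetric] power2_eq_square by (simp add: mult_ac)
      finally show "(6 * (E * (q * (q ^ j * Pa)))) * (E * (q / q ^ k * Pc)) \<le> (3 * E * q * \<rho> ^ (k - j) * p)\<^sup>2" .
    qed (use E q0 p \<rho> in auto)
    finally show ?thesis .
  qed
  have inner_V: "cmod (\<integral>x. T x * cnj (V i x) \<partial>gauss_measure) \<le> E * q * \<rho> ^ (k - j) * p" for i
  proof -
    have "cmod (\<integral>x. T x * cnj (V i x) \<partial>gauss_measure) \<le> sqrt (E * Pa) * sqrt (E * r ^ k * (q * Pc))"
      using L2(1,4) T_bound V_bound by (rule L2_Cauchy_Schwarz) (use E P q0 r in auto)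
    also have "\<dots> = sqrt ((E * Pa) * (E * r ^ k * (q * Pc)))"
      by (simp only: real_sqrt_mult)
    also have "\<dots> \<le> E * q * \<rho> ^ (k - j) * p"
    proof (rule real_le_lsqrt)
      have "(E * Pa) * (E * r ^ k * (q * Pc)) = (E * E * (1 * q) * (Pa * Pc)) * r ^ k"
        by (simp add: mult_ac)
      also have "\<dots> \<le> (E * E * (q * q) * (Pa * Pc)) * r ^ (k - j)"
        using r_mono E P q1 r by (intro mult_mono) auto
      also have "\<dots> = (E * q * \<rho> ^ (k - j) * p)\<^sup>2"
        unfolding p(2)[symmetric] \<rho>(2)[symmetric] power2_eq_square by (simp add: mult_ac)
      finally show "(E * Pa) * (E * r ^ k * (q * Pc)) \<le> (E * q * \<rho> ^ (k - j) * p)\<^sup>2" .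
    qed (use E q0 p \<rho> in auto)
    finally show ?thesis .
  qed
  have UV: "in_L2 gauss_measure (\<lambda>x. 2 * x $ i * W i x - W' i x)" for i
    unfolding raise by (intro in_L2_diff L2)
  have "(\<integral>x. T x * cnj (block_sum K \<sigma> S k c x) \<partial>gauss_measure)
     = (\<integral>x. (\<Sum>i\<in>UNIV. T x * cnj (2 * x $ i * W i x - W' i x) + T x * cnj (V i x)) \<partial>gauss_measure)"
    unfolding T_eq by (simp only: cnj_sum complex_cnj_add sum_distrib_left distrib_left)
  also have "\<dots> = (\<Sum>i\<in>UNIV. \<integral>x. T x * cnj (2 * x $ i * W i x - W' i x) + T x * cnj (V i x) \<partial>gauss_measure)"
    by (intro Bochner_Integration.integral_sum Bochner_Integration.integrable_add integrable_L2_cnj L2 UV)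
  also have "\<dots> = (\<Sum>i\<in>UNIV. (\<integral>x. T x * cnj (2 * x $ i * W i x - W' i x) \<partial>gauss_measure) + (\<integral>x. T x * cnj (V i x) \<partial>gauss_measure))"
    by (intro sum.cong refl Bochner_Integration.integral_add integrable_L2_cnj L2 UV)
  also have "\<dots> = (\<Sum>i\<in>UNIV. (\<integral>x. dT i x * cnj (W i x) \<partial>gauss_measure) + (\<integral>x. T x * cnj (V i x) \<partial>gauss_measure))"
    by (intro sum.cong refl arg_cong2[of _ _ _ _ "(+)"] gauss_integration_by_parts[symmetric] deriv_T deriv_W cont_T cont_W' L2 UV)
  also have "cmod \<dots> \<le> (\<Sum>i\<in>(UNIV :: 'n set). 3 * E * q * \<rho> ^ (k - j) * p + E * q * \<rho> ^ (k - j) * p)"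
    by (intro order_trans[OF norm_sum] sum_mono norm_triangle_mono inner_W inner_V)
  also have "\<dots> = 4 * real CARD('n) * E * q * \<rho> ^ (k - j) * p"
    by simp
  finally show ?thesis
    unfolding T_def p_def \<rho>_def r_def q_def Pa_def Pc_def .
qed

lemma symbol_bound_0:
  assumes "symbol_bound K \<tau> B s"
  shows "cmod (s \<xi>) \<le> B * mi_bracket \<xi> powr \<tau>"
  using assms[unfolded symbol_bound_def, rule_format, of 0 undefined \<xi>] by simp

text \<open>The Gram matrix of the blocks decays geometrically away from the diagonal, so Schur's test bounds the whole sum by the
  coefficients of the blocks, and each frequency belongs to at most three blocks.\<close>

lemma smooth_symbol_bounded:
  fixes \<sigma> :: "real ^ 'n \<Rightarrow> nat ^ 'n \<Rightarrow> complex"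
  assumes K: "CARD('n) < 2 * K" and \<delta>: "0 \<le> \<delta>" "\<delta> < 1" and B: "B \<ge> 0"
    and C1: "\<And>\<xi>. C_k 1 (\<lambda>x. \<sigma> x \<xi>)"
    and b0: "\<And>x. symbol_bound K 0 B (\<sigma> x)"
    and b1: "\<And>i x. symbol_bound K (\<delta> / 2) B (\<lambda>\<xi>. partial1 i (\<lambda>y. \<sigma> y \<xi>) x)"
  shows "bounded_on_hermite_sums \<sigma>"
proof -
  have K1: "K \<ge> 1" using K by (cases K) auto
  define D where "D i x \<xi> = partial1 i (\<lambda>y. \<sigma> y \<xi>) x" for i x \<xi>
  have cont0: "continuous_on UNIV (\<lambda>x. \<sigma> x \<xi>)" for \<xi> using C1[of \<xi>] by simp
  have cont1: "continuous_on UNIV (\<lambda>x. D i x \<xi>)" for i \<xi>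
    using C1[of \<xi>] by (simp add: D_def[abs_def])
  have deriv: "((\<lambda>t. \<sigma> (x + t *\<^sub>R axis i 1) \<xi>) has_vector_derivative D i x \<xi>) (at 0)" for i x \<xi>
    unfolding D_def partial1_def using C1[of \<xi>] by (subst vector_derivative_works[symmetric]) simp
  define b where "b \<xi> = B * mi_bracket \<xi> powr (\<delta> / 2)" for \<xi> :: "nat ^ 'n"
  have bounded0: "cmod (\<sigma> x \<xi>) \<le> b \<xi>" for x \<xi>
  proof -
    have "cmod (\<sigma> x \<xi>) \<le> B * mi_bracket \<xi> powr 0" by (rule symbol_bound_0[OF b0])
    also have "\<dots> \<le> b \<xi>"
      unfolding b_def using B \<delta> by (intro mult_left_mono powr_mono) (auto simp: mi_bracket_def)
    finally show ?thesis .
  qed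
  have bounded1: "cmod (D i x \<xi>) \<le> b \<xi>" for i x \<xi>
    unfolding D_def b_def by (rule symbol_bound_0[OF b1])
  obtain A0 where A0: "A0 \<ge> 0" and blk0: "\<forall>B (\<sigma> :: real ^ 'n \<Rightarrow> nat ^ 'n \<Rightarrow> complex). B \<ge> 0 \<longrightarrow>
     (AE x in lebesgue. symbol_bound K 0 B (\<sigma> x)) \<longrightarrow>
     (\<forall>j v S d. finite S \<longrightarrow>
       (\<integral>\<^sup>+x. ennreal ((cmod (\<Sum>\<xi>\<in>S. d \<xi> * block K j (\<sigma> x) (\<xi> + v) * hn \<xi> x))\<^sup>2) \<partial>gauss_measure)
         \<le> ennreal (A0 * (B * real (Suc K ^ j) powr 0)\<^sup>2 * (\<Sum>\<xi>\<in>S. (cmod (d \<xi>))\<^sup>2)))"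
    using dyadic_block_bounded[OF K, of 0] by (elim exE conjE)
  obtain A1 where A1: "A1 \<ge> 0" and blk1: "\<forall>B (\<sigma> :: real ^ 'n \<Rightarrow> nat ^ 'n \<Rightarrow> complex). B \<ge> 0 \<longrightarrow>
     (AE x in lebesgue. symbol_bound K (\<delta> / 2) B (\<sigma> x)) \<longrightarrow>
     (\<forall>j v S d. finite S \<longrightarrow>
       (\<integral>\<^sup>+x. ennreal ((cmod (\<Sum>\<xi>\<in>S. d \<xi> * block K j (\<sigma> x) (\<xi> + v) * hn \<xi> x))\<^sup>2) \<partial>gauss_measure)
         \<le> ennreal (A1 * (B * real (Suc K ^ j) powr (\<delta> / 2))\<^sup>2 * (\<Sum>\<xi>\<in>S. (cmod (d \<xi>))\<^sup>2)))"
    using dyadic_block_bounded[OF K, of "\<delta> / 2"] by (elim exE conjE)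
  define E where "E = (A0 + A1) * B\<^sup>2"
  have E: "E \<ge> 0" using A0 A1 by (simp add: E_def)
  have bl0: "(\<integral>\<^sup>+x. ennreal ((cmod (\<Sum>\<xi>\<in>S. d \<xi> * block K j (\<sigma> x) (\<xi> + v) * hn \<xi> x))\<^sup>2) \<partial>gauss_measure)
         \<le> ennreal (E * (\<Sum>\<xi>\<in>S. (cmod (d \<xi>))\<^sup>2))" if S: "finite S" for j v S d
  proof -
    have ae: "AE x in lebesgue. symbol_bound K 0 B (\<sigma> x)" using b0 by simp
    have "A0 * (B * real (Suc K ^ j) powr 0)\<^sup>2 = A0 * B\<^sup>2" by simp
    also have "\<dots> \<le> E" unfolding E_def using A1 by (intro mult_right_mono) auto
    finally have "ennreal (A0 * (B * real (Suc K ^ j) powr 0)\<^sup>2 * (\<Sum>\<xi>\<in>S. (cmod (d \<xi>))\<^sup>2)) \<le> ennreal (E * (\<Sum>\<xi>\<in>S. (cmod (d \<xi>))\<^sup>2))"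
      by (intro ennreal_leI mult_right_mono sum_nonneg) auto
    then show ?thesis by (rule order_trans[OF blk0[rule_format, OF B ae S]])
  qed
  have bl1: "(\<integral>\<^sup>+x. ennreal ((cmod (\<Sum>\<xi>\<in>S. d \<xi> * block K j (D i x) (\<xi> + v) * hn \<xi> x))\<^sup>2) \<partial>gauss_measure)
         \<le> ennreal (E * real (Suc K ^ j) powr \<delta> * (\<Sum>\<xi>\<in>S. (cmod (d \<xi>))\<^sup>2))" if S: "finite S" for i j v S d
  proof -
    have ae: "AE x in lebesgue. symbol_bound K (\<delta> / 2) B (D i x)" using b1 by (simp add: D_def[abs_def])
    have "(z powr (\<delta> / 2))\<^sup>2 = z powr \<delta>" for z :: real
      by (simp add: power2_eq_square powr_add[symmetric])
    then have "A1 * (B * real (Suc K ^ j) powr (\<delta> / 2))\<^sup>2 = A1 * B\<^sup>2 * real (Suc K ^ j) powr \<delta>"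
      by (simp only: power_mult_distrib mult.assoc)
    also have "\<dots> \<le> E * real (Suc K ^ j) powr \<delta>" unfolding E_def using A0 by (intro mult_right_mono) auto
    finally have "ennreal (A1 * (B * real (Suc K ^ j) powr (\<delta> / 2))\<^sup>2 * (\<Sum>\<xi>\<in>S. (cmod (d \<xi>))\<^sup>2)) \<le> ennreal (E * real (Suc K ^ j) powr \<delta> * (\<Sum>\<xi>\<in>S. (cmod (d \<xi>))\<^sup>2))"
      by (intro ennreal_leI mult_right_mono sum_nonneg) auto
    then show ?thesis by (rule order_trans[OF blk1[rule_format, OF B ae S]])
  qed
  define q where "q = real (Suc K)"
  have q: "q \<ge> 2" using K1 by (simp add: q_def)
  define \<rho> where "\<rho> = sqrt (q powr (\<delta> - 1))"
  have "q powr (\<delta> - 1) < q powr 0" using q \<delta> by (intro powr_less_mono) auto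
  then have \<rho>: "0 < \<rho>" "\<rho> < 1" using q by (simp_all add: \<rho>_def)
  define F where "F = 4 * real CARD('n) * E * q"
  have F: "F \<ge> 0" "E \<le> F"
  proof -
    show "F \<ge> 0" using E q by (simp add: F_def)
    have "1 * E \<le> (4 * real CARD('n) * q) * E"
    proof (rule mult_right_mono[OF _ E])
      have "1 * 1 \<le> real CARD('n) * q" using q by (intro mult_mono) (auto simp: Suc_leI)
      then show "1 \<le> 4 * real CARD('n) * q" by simp
    qed
    then show "E \<le> F" by (simp add: F_def mult_ac)
  qed
  show ?thesis
  proof (intro exI[of _ "F * (2 / (1 - \<rho>)) * 3"] conjI allI impI)
    show "0 \<le> F * (2 / (1 - \<rho>)) * 3" using F \<rho> by simp
    fix S :: "(nat ^ 'n) set" and c :: "nat ^ 'n \<Rightarrow> complex" assume S: "finite S"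
    obtain J where J: "\<And>\<xi>. \<xi> \<in> S \<Longrightarrow> mi_abs \<xi> < Suc K ^ J" using ex_block_range[OF S K1] by blast
    \<comment> \<open>Restricting the coefficients to the support of the \<open>j\<close>-th piece leaves the block unchanged and makes their
      square sums, taken over all blocks, comparable to that of \<open>c\<close>.\<close>
    define a where "a j \<xi> = (if dyadic_piece K j (mi_abs \<xi>) = 0 then 0 else c \<xi>)" for j \<xi>
    define p where "p j = sqrt (\<Sum>\<xi>\<in>S. (cmod (a j \<xi>))\<^sup>2)" for j
    define T where "T j = block_sum K \<sigma> S j (a j)" for j
    have T_eq: "(\<Sum>\<xi>\<in>S. c \<xi> * \<sigma> x \<xi> * hn \<xi> x) = (\<Sum>j\<le>J. T j x)" for x
    proof -
      have "T j x = (\<Sum>\<xi>\<in>S. c \<xi> * block K j (\<sigma> x) \<xi> * hn \<xi> x)" for j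
        unfolding T_def block_sum_def by (intro sum.cong) (auto simp: a_def block_def)
      then show ?thesis
        by (simp only:, subst sum.swap)
          (auto intro!: sum.cong simp: sum_distrib_left[symmetric] sum_distrib_right[symmetric] sum_blocks J)
    qed
    have T_L2: "in_L2 gauss_measure (T j)" for j
      unfolding T_def block_sum_def[abs_def] by (rule block_sum_regular(1)[OF cont0 bounded0])
    have supp: "dyadic_piece K j (mi_abs \<xi>) = 0 \<Longrightarrow> a j \<xi> = 0" for j \<xi> by (simp add: a_def)
    have T_bound: "(\<integral>\<^sup>+x. ennreal ((cmod (T j x))\<^sup>2) \<partial>gauss_measure) \<le> ennreal (E * (p j)\<^sup>2)" for j
      using bl0[OF S, of "a j" j 0] by (simp add: T_def block_sum_def p_def sum_nonneg)
    define G where "G j k = (\<integral>x. T j x * cnj (T k x) \<partial>gauss_measure)" for j k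
    have G_less: "cmod (G j k) \<le> F * (\<rho> ^ (k - j) * (p j * p k))" if "j < k" for j k
    proof -
      have "cmod (G j k) \<le> 4 * real CARD('n) * E * real (Suc K) * sqrt (real (Suc K) powr (\<delta> - 1)) ^ (k - j)
        * (sqrt (\<Sum>\<xi>\<in>S. (cmod (a j \<xi>))\<^sup>2) * sqrt (\<Sum>\<xi>\<in>S. (cmod (a k \<xi>))\<^sup>2))"
        unfolding G_def T_def
        by (rule block_cross_term[OF K1 \<delta> S E cont0 cont1 deriv bounded0 bounded1 bl0 bl1 supp supp that])
      then show ?thesis by (simp only: F_def q_def \<rho>_def p_def mult.assoc)
    qed
    have G_sym: "cmod (G j k) = cmod (G k j)" for j k
    proof -
      have "cnj (G k j) = (\<integral>x. cnj (T k x * cnj (T j x)) \<partial>gauss_measure)"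
        unfolding G_def by (rule Bochner_Integration.integral_cnj[symmetric])
      also have "\<dots> = G j k" unfolding G_def by (simp add: mult.commute)
      finally have "G j k = cnj (G k j)" by (rule sym)
      then show ?thesis by (simp only: complex_mod_cnj)
    qed
    have G_bound: "cmod (G j k) \<le> F * (\<rho> ^ (if j \<le> k then k - j else j - k) * (p j * p k))" for j k
    proof (cases j k rule: linorder_cases)
      case less
      then show ?thesis using G_less[of j k] by simp
    next
      case equal
      have "cmod (G j j) \<le> sqrt (E * (p j)\<^sup>2) * sqrt (E * (p j)\<^sup>2)"
        unfolding G_def using T_L2 T_L2 T_bound T_bound by (rule L2_Cauchy_Schwarz) (use E in auto)
      also have "\<dots> = E * (p j * p j)" using E by (simp add: power2_eq_square)
      also have "\<dots> \<le> F * (p j * p j)" using F by (intro mult_right_mono) auto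
      finally show ?thesis using equal by simp
    next
      case greater
      then show ?thesis using G_less[of k j] G_sym[of j k] by (simp add: mult_ac)
    qed
    have int_G: "integrable gauss_measure (\<lambda>x. T j x * cnj (T k x))" for j k
      by (intro integrable_L2_cnj T_L2)
    have sq: "complex_of_real ((cmod (\<Sum>j\<le>J. T j x))\<^sup>2) = (\<Sum>j\<le>J. \<Sum>k\<le>J. T j x * cnj (T k x))" for x
      unfolding complex_norm_square by (simp add: sum_product)
    have "in_L2 gauss_measure (\<lambda>x. \<Sum>j\<le>J. T j x)" by (intro in_L2_sum T_L2)
    then have int: "integrable gauss_measure (\<lambda>x. (cmod (\<Sum>j\<le>J. T j x))\<^sup>2)" by (simp add: in_L2_def)
    have "complex_of_real (\<integral>x. (cmod (\<Sum>j\<le>J. T j x))\<^sup>2 \<partial>gauss_measure) = (\<integral>x. (\<Sum>j\<le>J. \<Sum>k\<le>J. T j x * cnj (T k x)) \<partial>gauss_measure)"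
      unfolding sq[symmetric] by (rule integral_complex_of_real[symmetric])
    also have "\<dots> = (\<Sum>j\<le>J. \<Sum>k\<le>J. G j k)"
      unfolding G_def by (subst Bochner_Integration.integral_sum, intro Bochner_Integration.integrable_sum int_G)
        (intro sum.cong refl Bochner_Integration.integral_sum int_G)
    finally have "\<bar>\<integral>x. (cmod (\<Sum>j\<le>J. T j x))\<^sup>2 \<partial>gauss_measure\<bar> = cmod (\<Sum>j\<le>J. \<Sum>k\<le>J. G j k)"
      by (metis norm_of_real)
    then have "(\<integral>x. (cmod (\<Sum>j\<le>J. T j x))\<^sup>2 \<partial>gauss_measure) \<le> cmod (\<Sum>j\<le>J. \<Sum>k\<le>J. G j k)" by simp
    also have "\<dots> \<le> (\<Sum>j\<le>J. \<Sum>k\<le>J. F * (\<rho> ^ (if j \<le> k then k - j else j - k) * (p j * p k)))"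
      by (intro order_trans[OF norm_sum] sum_mono G_bound)
    also have "\<dots> = F * (\<Sum>j\<le>J. \<Sum>k\<le>J. \<rho> ^ (if j \<le> k then k - j else j - k) * (p j * p k))"
      by (simp only: sum_distrib_left)
    also have "\<dots> \<le> F * (2 / (1 - \<rho>) * (\<Sum>j\<le>J. (p j)\<^sup>2))"
      by (intro mult_left_mono schur_geometric \<rho> F)
    also have "(\<Sum>j\<le>J. (p j)\<^sup>2) \<le> 3 * (\<Sum>\<xi>\<in>S. (cmod (c \<xi>))\<^sup>2)"
    proof -
      have "(\<Sum>j\<le>J. (p j)\<^sup>2) = (\<Sum>\<xi>\<in>S. \<Sum>j\<le>J. (cmod (a j \<xi>))\<^sup>2)"
        by (subst sum.swap) (simp add: p_def sum_nonneg)
      also have "\<dots> \<le> (\<Sum>\<xi>\<in>S. 3 * (cmod (c \<xi>))\<^sup>2)"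
      proof (rule sum_mono)
        fix \<xi>
        have "(\<Sum>j\<le>J. (cmod (a j \<xi>))\<^sup>2) = (\<Sum>j | j \<le> J \<and> dyadic_piece K j (mi_abs \<xi>) \<noteq> 0. (cmod (c \<xi>))\<^sup>2)"
          by (intro sum.mono_neutral_cong_right) (auto simp: a_def)
        also have "\<dots> = real (card {j. j \<le> J \<and> dyadic_piece K j (mi_abs \<xi>) \<noteq> 0}) * (cmod (c \<xi>))\<^sup>2" by simp
        also have "\<dots> \<le> 3 * (cmod (c \<xi>))\<^sup>2"
          using card_dyadic_overlap[OF K1, of J "mi_abs \<xi>"] by (intro mult_right_mono) auto
        finally show "(\<Sum>j\<le>J. (cmod (a j \<xi>))\<^sup>2) \<le> 3 * (cmod (c \<xi>))\<^sup>2" .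
      qed
      finally show ?thesis by (simp only: sum_distrib_left)
    qed
    finally have "(\<integral>x. (cmod (\<Sum>j\<le>J. T j x))\<^sup>2 \<partial>gauss_measure) \<le> F * (2 / (1 - \<rho>)) * 3 * (\<Sum>\<xi>\<in>S. (cmod (c \<xi>))\<^sup>2)"
      using F \<rho> by (simp add: mult.assoc mult_left_mono divide_right_mono)
    then show "(\<integral>\<^sup>+x. ennreal ((cmod (\<Sum>\<xi>\<in>S. c \<xi> * \<sigma> x \<xi> * hn \<xi> x))\<^sup>2) \<partial>gauss_measure)
       \<le> ennreal (F * (2 / (1 - \<rho>)) * 3 * (\<Sum>\<xi>\<in>S. (cmod (c \<xi>))\<^sup>2))"
      unfolding T_eq using int by (subst nn_integral_eq_integral) (auto intro: ennreal_leI)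
  qed
qed


section \<open>Smooth functions of one variable\<close>

fun times_differentiable :: "nat \<Rightarrow> (real \<Rightarrow> real) \<Rightarrow> bool" where
  "times_differentiable 0 f \<longleftrightarrow> continuous_on UNIV f"
| "times_differentiable (Suc k) f \<longleftrightarrow>
    (\<exists>f'. (\<forall>x. (f has_real_derivative f' x) (at x)) \<and> times_differentiable k f')"

definition smooth :: "(real \<Rightarrow> real) \<Rightarrow> bool" where
  "smooth f \<longleftrightarrow> (\<forall>k. times_differentiable k f)"

lemma times_differentiable_continuous: "times_differentiable k f \<Longrightarrow> continuous_on UNIV f"
proof (cases k)
  case (Suc m)
  assume "times_differentiable k f"
  then obtain f' where "\<And>x. (f has_real_derivative f' x) (at x)" unfolding Suc by auto
  then show ?thesis by (intro continuous_at_imp_continuous_on ballI DERIV_isCont)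
qed simp

lemma times_differentiable_Suc_D: "times_differentiable (Suc k) f \<Longrightarrow> times_differentiable k f"
proof (induction k arbitrary: f)
  case 0
  then show ?case by (rule times_differentiable_continuous[where k = "Suc 0", unfolded times_differentiable.simps(1)[symmetric]])
next
  case (Suc k)
  then obtain f' where f': "\<And>x. (f has_real_derivative f' x) (at x)" "times_differentiable (Suc k) f'" by auto
  have "times_differentiable k f'" by (rule Suc.IH) (rule f'(2))
  with f'(1) show ?case by auto
qed

lemma times_differentiable_add:
  "times_differentiable k f \<Longrightarrow> times_differentiable k g \<Longrightarrow> times_differentiable k (\<lambda>x. f x + g x)"
proof (induction k arbitrary: f g)
  case 0
  then show ?case by (auto intro: continuous_intros)
next
  case (Suc k)
  from Suc.prems obtain f' g' where d: "\<And>x. (f has_real_derivative f' x) (at x)" "times_differentiable k f'"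
    "\<And>x. (g has_real_derivative g' x) (at x)" "times_differentiable k g'" by auto
  show ?case
    unfolding times_differentiable.simps
    by (intro exI[of _ "\<lambda>x. f' x + g' x"] conjI allI DERIV_add d Suc.IH)
qed

lemma times_differentiable_mult:
  "times_differentiable k f \<Longrightarrow> times_differentiable k g \<Longrightarrow> times_differentiable k (\<lambda>x. f x * g x)"
proof (induction k arbitrary: f g)
  case 0
  then show ?case by (auto intro: continuous_intros)
next
  case (Suc k)
  from Suc.prems obtain f' g' where d: "\<And>x. (f has_real_derivative f' x) (at x)" "times_differentiable k f'"
    "\<And>x. (g has_real_derivative g' x) (at x)" "times_differentiable k g'" by auto
  note low = Suc.prems[THEN times_differentiable_Suc_D]
  show ?case
    unfolding times_differentiable.simps
    by (intro exI[of _ "\<lambda>x. f' x * g x + g' x * f x"] conjI allI DERIV_mult d times_differentiable_add Suc.IH low)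
qed

lemma times_differentiable_const: "times_differentiable k (\<lambda>x. c)"
proof (induction k arbitrary: c)
  case (Suc k)
  show ?case unfolding times_differentiable.simps by (intro exI[of _ "\<lambda>x. 0"] conjI allI DERIV_const Suc.IH)
qed simp

lemma times_differentiable_ident: "times_differentiable k (\<lambda>x. x)"
proof (cases k)
  case (Suc k)
  then show ?thesis by (auto intro!: exI[of _ "\<lambda>x. 1"] times_differentiable_const)
qed auto

lemma times_differentiable_affine:
  "times_differentiable k f \<Longrightarrow> times_differentiable k (\<lambda>x. f (a * x + b))"
proof (induction k arbitrary: f)
  case 0
  then have "continuous_on UNIV f" by simp
  then show ?case
    unfolding times_differentiable.simps
    by (rule continuous_on_compose2) (auto intro!: continuous_intros)
next
  case (Suc k)
  then obtain f' where f': "\<And>x. (f has_real_derivative f' x) (at x)" "times_differentiable k f'" by auto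
  have "((\<lambda>x. f (a * x + b)) has_real_derivative f' (a * x + b) * a) (at x)" for x
    by (rule DERIV_chain2[OF f'(1)]) (auto intro!: derivative_eq_intros)
  then show ?case
    by (auto intro!: exI[of _ "\<lambda>x. f' (a * x + b) * a"] times_differentiable_mult times_differentiable_const Suc.IH f'(2))
qed

lemma times_differentiable_inverse:
  assumes "\<And>x. f x \<noteq> 0"
  shows "times_differentiable k f \<Longrightarrow> times_differentiable k (\<lambda>x. inverse (f x))"
proof (induction k)
  case 0
  then show ?case using assms by (auto intro: continuous_intros)
next
  case (Suc k)
  then obtain f' where f': "\<And>x. (f has_real_derivative f' x) (at x)" "times_differentiable k f'" by auto
  have inv: "times_differentiable k (\<lambda>x. inverse (f x))"
    by (rule Suc.IH) (rule times_differentiable_Suc_D[OF Suc.prems])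
  have "((\<lambda>x. inverse (f x)) has_real_derivative (-1) * (inverse (f x) * f' x * inverse (f x))) (at x)" for x
    by (rule DERIV_cong[OF DERIV_inverse'[OF f'(1) assms]]) simp
  then show ?case
    unfolding times_differentiable.simps
    by (intro exI[of _ "\<lambda>x. (-1) * (inverse (f x) * f' x * inverse (f x))"] conjI allI
        times_differentiable_mult times_differentiable_const inv f'(2))
qed

lemma smooth_intros:
  "smooth (\<lambda>x. c)" "smooth (\<lambda>x. x)"
  "smooth f \<Longrightarrow> smooth g \<Longrightarrow> smooth (\<lambda>x. f x + g x)"
  "smooth f \<Longrightarrow> smooth g \<Longrightarrow> smooth (\<lambda>x. f x * g x)"
  "smooth f \<Longrightarrow> smooth (\<lambda>x. f (a * x + b))"
  by (simp_all add: smooth_def times_differentiable_const times_differentiable_ident times_differentiable_add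
      times_differentiable_mult times_differentiable_affine)

lemma smooth_diff: "smooth f \<Longrightarrow> smooth g \<Longrightarrow> smooth (\<lambda>x. f x - g x)"
  using smooth_intros(3)[of f "\<lambda>x. (-1) * g x"] smooth_intros(4)[of "\<lambda>_. -1" g] smooth_intros(1)[of "-1"] by simp

lemma smooth_has_derivative: "smooth f \<Longrightarrow> (f has_real_derivative deriv f x) (at x)"
  unfolding smooth_def using DERIV_imp_deriv by (metis times_differentiable.simps(2))

lemma smooth_deriv: "smooth f \<Longrightarrow> smooth (deriv f)"
  unfolding smooth_def
proof
  fix k assume f: "\<forall>k. times_differentiable k f"
  then obtain f' where f': "\<And>x. (f has_real_derivative f' x) (at x)" "times_differentiable k f'"
    using times_differentiable.simps(2)[of k f] by blast
  have "deriv f = f'" using f'(1) by (intro ext DERIV_imp_deriv)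
  with f'(2) show "times_differentiable k (deriv f)" by simp
qed

lemma smooth_continuous: "smooth f \<Longrightarrow> continuous_on A f"
  unfolding smooth_def using times_differentiable_continuous continuous_on_subset by blast

lemma smooth_higher_deriv: "smooth f \<Longrightarrow> smooth ((deriv ^^ k) f)"
  by (induction k) (auto intro: smooth_deriv)

lemma deriv_cong_eqI: "(\<And>x. (f has_real_derivative f' x) (at x)) \<Longrightarrow> deriv f = f'"
  by (intro ext DERIV_imp_deriv)

lemma deriv_affine:
  assumes "smooth f"
  shows "(deriv ^^ k) (\<lambda>x. c * f (a * x + b)) = (\<lambda>x. c * a ^ k * (deriv ^^ k) f (a * x + b))"
proof (induction k)
  case (Suc k)
  have "((\<lambda>x. c * a ^ k * (deriv ^^ k) f (a * x + b)) has_real_derivative c * a ^ k * (deriv ((deriv ^^ k) f) (a * x + b) * a)) (at x)" for x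
    by (intro DERIV_cmult DERIV_chain2[OF smooth_has_derivative[OF smooth_higher_deriv[OF assms]]]) (auto intro!: derivative_eq_intros)
  then have D: "deriv (\<lambda>x. c * a ^ k * (deriv ^^ k) f (a * x + b)) = (\<lambda>x. c * a ^ k * (deriv ((deriv ^^ k) f) (a * x + b) * a))"
    by (rule deriv_cong_eqI)
  show ?case unfolding funpow.simps o_apply Suc D by (simp add: mult_ac)
qed simp

lemma higher_deriv_ident_mult:
  assumes "smooth f"
  shows "(deriv ^^ Suc k) (\<lambda>z. z * f z) = (\<lambda>z. z * (deriv ^^ Suc k) f z + real (Suc k) * (deriv ^^ k) f z)"
proof (induction k)
  case 0
  have "((\<lambda>z. z * f z) has_real_derivative z * deriv f z + f z) (at z)" for z
    using DERIV_mult[OF DERIV_ident smooth_has_derivative[OF assms], of z] by (simp add: mult.commute add.commute)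
  then show ?case by (simp add: deriv_cong_eqI)
next
  case (Suc k)
  let ?g = "\<lambda>k. (deriv ^^ k) f"
  have g: "(?g k has_real_derivative ?g (Suc k) z) (at z)" for k z
    using smooth_has_derivative[OF smooth_higher_deriv[OF assms]] by simp
  have "((\<lambda>z. z * ?g (Suc k) z + real (Suc k) * ?g k z) has_real_derivative
      (z * ?g (Suc (Suc k)) z + real (Suc (Suc k)) * ?g (Suc k) z)) (at z)" for z
    by (rule DERIV_cong[OF DERIV_add[OF DERIV_mult[OF DERIV_ident g] DERIV_cmult[OF g]]]) (simp add: algebra_simps)
  then have "deriv (\<lambda>z. z * ?g (Suc k) z + real (Suc k) * ?g k z) = (\<lambda>z. z * ?g (Suc (Suc k)) z + real (Suc (Suc k)) * ?g (Suc k) z)"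
    by (rule deriv_cong_eqI)
  then show ?case using Suc by simp
qed

lemma deriv_eq_0_outside:
  assumes f: "smooth f" and zero: "\<And>z. z \<notin> {0..1} \<Longrightarrow> f z = 0" and z: "z \<notin> {0..1::real}"
  shows "deriv f z = 0"
proof (rule DERIV_imp_deriv)
  have "open (- {0..1::real})" by (intro open_Compl) auto
  then show "(f has_real_derivative 0) (at z)"
    by (rule has_field_derivative_transform_within_open[OF DERIV_const[of 0]]) (use z zero in auto)
qed

section \<open>A smooth step\<close>

text \<open>The family is closed under differentiation up to linear combinations, so smoothness can be proved for all \<open>m\<close> at once.\<close>

definition flat_exp :: "nat \<Rightarrow> real \<Rightarrow> real" where
  "flat_exp m z = (if z > 0 then (1 / z) ^ m * exp (- (1 / z)) else 0)"

lemma flat_exp_le: "\<bar>flat_exp m z\<bar> \<le> real (m + 2) ^ (m + 2) * z\<^sup>2"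
proof (cases "z > 0")
  case True
  define u where "u = 1 / z"
  have u: "u > 0" using True by (simp add: u_def)
  have "(u / real (m + 2)) ^ (m + 2) \<le> (1 + u / real (m + 2)) ^ (m + 2)"
    using u by (intro power_mono) auto
  also have "\<dots> \<le> exp u"
    by (rule exp_ge_one_plus_x_over_n_power_n) (use u in auto)
  finally have "u ^ (m + 2) \<le> real (m + 2) ^ (m + 2) * exp u"
    by (simp add: power_divide divide_le_eq mult.commute)
  then have "u ^ m * u\<^sup>2 \<le> real (m + 2) ^ (m + 2) * exp u" by (simp only: power_add)
  then have "u ^ m * u\<^sup>2 * exp (- u) \<le> real (m + 2) ^ (m + 2) * exp u * exp (- u)"
    by (rule mult_right_mono) simp
  moreover have "exp u * exp (- u) = 1" by (simp add: mult_exp_exp)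
  ultimately have "u ^ m * (u\<^sup>2 * exp (- u)) \<le> real (m + 2) ^ (m + 2)"
    by (simp only: mult.assoc mult_1_right)
  then have "u ^ m * exp (- u) * u\<^sup>2 \<le> real (m + 2) ^ (m + 2)"
    by (simp only: mult_ac)
  then have "u ^ m * exp (- u) \<le> real (m + 2) ^ (m + 2) / u\<^sup>2"
    using u by (subst pos_le_divide_eq) auto
  then show ?thesis using True by (simp add: flat_exp_def u_def power_divide)
qed (simp add: flat_exp_def)

lemma flat_exp_has_derivative:
  "(flat_exp m has_real_derivative (- real m) * flat_exp (m + 1) z + flat_exp (m + 2) z) (at z)"
proof -
  consider "z > 0" | "z < 0" | "z = 0" by linarith
  then show ?thesis
  proof cases
    case 1
    have "((\<lambda>z. (1 / z) ^ m * exp (- (1 / z))) has_real_derivative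
       (- real m) * flat_exp (m + 1) z + flat_exp (m + 2) z) (at z)"
    proof -
      have du: "((\<lambda>z. 1 / z) has_real_derivative - ((1 / z)\<^sup>2)) (at z)"
        using 1 by (auto intro!: derivative_eq_intros simp: power2_eq_square)
      from DERIV_mult[OF DERIV_power[OF du, of m] DERIV_chain2[OF DERIV_exp DERIV_minus[OF du]]]
      show ?thesis
        by (rule DERIV_cong) (use 1 in \<open>cases m; simp add: flat_exp_def power2_eq_square algebra_simps add_divide_distrib[symmetric]\<close>)
    qed
    then show ?thesis
      by (rule has_field_derivative_transform_within_open[of _ _ _ "{0<..}"]) (use 1 in \<open>auto simp: flat_exp_def\<close>)
  next
    case 2
    have "((\<lambda>_. 0) has_real_derivative (- real m) * flat_exp (m + 1) z + flat_exp (m + 2) z) (at z)"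
      using 2 by (simp add: flat_exp_def)
    then show ?thesis
      by (rule has_field_derivative_transform_within_open[of _ _ _ "{..<0}"]) (use 2 in \<open>auto simp: flat_exp_def\<close>)
  next
    case 3
    have "((\<lambda>h. flat_exp m h / h) \<longlongrightarrow> 0) (at 0)"
    proof (rule Lim_null_comparison)
      show "\<forall>\<^sub>F h in at 0. norm (flat_exp m h / h) \<le> real (m + 2) ^ (m + 2) * \<bar>h\<bar>"
      proof (rule eventually_at_filter[THEN iffD2], rule always_eventually, intro allI impI)
        fix h :: real assume "h \<noteq> 0"
        then show "norm (flat_exp m h / h) \<le> real (m + 2) ^ (m + 2) * \<bar>h\<bar>"
          using flat_exp_le[of m h] by (simp add: divide_le_eq power2_eq_square abs_mult[symmetric] mult.assoc del: power_Suc)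
      qed
      show "((\<lambda>h. real (m + 2) ^ (m + 2) * \<bar>h\<bar>) \<longlongrightarrow> 0) (at 0)"
        by (rule tendsto_mult_right_zero) (rule tendsto_rabs_zero, rule tendsto_ident_at)
    qed
    then show ?thesis unfolding 3 DERIV_def by (simp add: flat_exp_def)
  qed
qed

lemma smooth_flat_exp: "smooth (flat_exp m)"
proof -
  have "times_differentiable k (flat_exp m)" for k m
  proof (induction k arbitrary: m)
    case 0
    show ?case
      unfolding times_differentiable.simps
      by (intro continuous_at_imp_continuous_on ballI DERIV_isCont[OF flat_exp_has_derivative])
  next
    case (Suc k)
    show ?case
      unfolding times_differentiable.simps
      by (intro exI[of _ "\<lambda>z. (- real m) * flat_exp (m + 1) z + flat_exp (m + 2) z"] conjI allI flat_exp_has_derivative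
          times_differentiable_add times_differentiable_mult times_differentiable_const Suc.IH)
  qed
  then show ?thesis by (simp add: smooth_def)
qed

lemma ex_smooth_step:
  "\<exists>\<theta>. smooth \<theta> \<and> (\<forall>z\<le>0. \<theta> z = 0) \<and> (\<forall>z\<ge>1. \<theta> z = 1)"
proof -
  \<comment> \<open>The quotient \<open>g z / (g z + g (1 - z))\<close>; the arguments are written in the affine form of the smoothness rules.\<close>
  let ?g = "flat_exp 0"
  let ?d = "\<lambda>z. ?g z + ?g ((-1) * z + 1)"
  have d: "?d z \<noteq> 0" for z :: real
  proof -
    have "?g z > 0 \<or> ?g ((-1) * z + 1) > 0" "?g z \<ge> 0" "?g ((-1) * z + 1) \<ge> 0" by (auto simp: flat_exp_def)
    then show ?thesis by linarith
  qed
  have "smooth ?d" by (intro smooth_intros smooth_flat_exp)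
  then have "smooth (\<lambda>z. inverse (?d z))" using d by (auto simp: smooth_def intro!: times_differentiable_inverse)
  then have "smooth (\<lambda>z. ?g z * inverse (?d z))" by (intro smooth_intros smooth_flat_exp)
  moreover have "?g z * inverse (?d z) = 1" if "z \<ge> 1" for z :: real
    using that by (simp add: flat_exp_def)
  moreover have "?g z * inverse (?d z) = 0" if "z \<le> 0" for z :: real
    using that by (simp add: flat_exp_def)
  ultimately show ?thesis by blast
qed

text \<open>Passing from a mollifier to its dyadic dilation adds an exact \<open>s\<close>-th derivative of a bump; this is what turns
  increments of mollifications into weak derivatives of order \<open>s\<close>. For \<open>s = 1\<close> take
  \<open>\<phi> = \<theta>'\<close> and \<open>\<psi> z = \<theta> z - \<theta> (2 z)\<close> with a smooth step \<open>\<theta>\<close>. In the induction step, the operator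
  \<open>1 + (1/s) (d/dz) z\<close> is applied to \<open>\<phi>\<close>: it preserves the integral and commutes with the dyadic scaling, and it
  maps \<open>\<psi>\<^sup>(\<^sup>s\<^sup>)\<close> to \<open>(z \<psi> / s)\<^sup>(\<^sup>s\<^sup>+\<^sup>1\<^sup>)\<close>.\<close>

lemma ex_refinable_mollifier:
  assumes "s \<ge> 1"
  shows "\<exists>\<phi> \<psi>. smooth \<phi> \<and> smooth \<psi> \<and> (\<forall>z. z \<notin> {0..1} \<longrightarrow> \<phi> z = 0 \<and> \<psi> z = 0) \<and>
     (\<integral>z. \<phi> z \<partial>lborel) = 1 \<and> (\<forall>z. \<phi> z - 2 * \<phi> (2 * z) = (deriv ^^ s) \<psi> z)"
  using assms
proof (induction s rule: nat_induct_at_least)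
  case base
  obtain \<theta> where \<theta>: "smooth \<theta>" "\<And>z. z \<le> 0 \<Longrightarrow> \<theta> z = 0" "\<And>z. z \<ge> 1 \<Longrightarrow> \<theta> z = 1"
    using ex_smooth_step by blast
  define \<psi> where "\<psi> z = \<theta> z - 1 * \<theta> (2 * z + 0)" for z
  have \<psi>: "smooth \<psi>" unfolding \<psi>_def by (intro smooth_diff smooth_intros \<theta>)
  have deriv_\<psi>: "deriv \<psi> = (\<lambda>z. deriv \<theta> z - 2 * deriv \<theta> (2 * z))"
  proof (rule deriv_cong_eqI)
    fix z
    have "((\<lambda>z. \<theta> (2 * z)) has_real_derivative deriv \<theta> (2 * z) * 2) (at z)"
      by (rule DERIV_chain2[OF smooth_has_derivative[OF \<theta>(1)]]) (auto intro!: derivative_eq_intros)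
    from DERIV_diff[OF smooth_has_derivative[OF \<theta>(1)] this]
    show "(\<psi> has_real_derivative deriv \<theta> z - 2 * deriv \<theta> (2 * z)) (at z)" by (simp add: \<psi>_def[abs_def] mult.commute)
  qed
  have outside: "deriv \<theta> z = 0" if "z \<notin> {0..1}" for z
  proof (rule DERIV_imp_deriv)
    show "(\<theta> has_real_derivative 0) (at z)"
    proof (cases "z < 0")
      case True
      show ?thesis
        by (rule has_field_derivative_transform_within_open[OF DERIV_const[of 0], of "{..<0}"]) (use True \<theta> in auto)
    next
      case False
      show ?thesis
        by (rule has_field_derivative_transform_within_open[OF DERIV_const[of 1], of "{1<..}"]) (use False that \<theta> in auto)
    qed
  qed
  have "(\<integral>z. indicator {0..1} z *\<^sub>R deriv \<theta> z \<partial>lborel) = \<theta> 1 - \<theta> 0"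
  proof (rule integral_FTC_atLeastAtMost)
    show "(\<theta> has_vector_derivative deriv \<theta> x) (at x within {0..1})" for x
      using smooth_has_derivative[OF \<theta>(1)] by (simp add: has_real_derivative_iff_has_vector_derivative has_vector_derivative_at_within)
  qed (auto intro: smooth_continuous smooth_deriv \<theta>)
  moreover have "(\<lambda>z. indicator {0..1} z *\<^sub>R deriv \<theta> z) = deriv \<theta>"
    using outside by (auto split: split_indicator)
  ultimately have "(\<integral>z. deriv \<theta> z \<partial>lborel) = 1" using \<theta> by simp
  moreover have "\<psi> z = 0" if "z \<notin> {0..1}" for z
    using that \<theta>(2)[of z] \<theta>(2)[of "2 * z"] \<theta>(3)[of z] \<theta>(3)[of "2 * z"] by (auto simp: \<psi>_def not_le)
  ultimately show ?case
    using \<psi> \<theta>(1) outside deriv_\<psi> by (intro exI[of _ "deriv \<theta>"] exI[of _ \<psi>]) (simp add: smooth_deriv)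
next
  case (Suc s)
  then obtain \<phi> \<psi> where \<phi>: "smooth \<phi>" "\<And>z. z \<notin> {0..1} \<Longrightarrow> \<phi> z = 0" "(\<integral>z. \<phi> z \<partial>lborel) = 1"
    and \<psi>: "smooth \<psi>" "\<And>z. z \<notin> {0..1} \<Longrightarrow> \<psi> z = 0" and eq: "\<And>z. \<phi> z - 2 * \<phi> (2 * z) = (deriv ^^ s) \<psi> z" by blast
  have s: "real s > 0" using Suc.hyps by simp
  define \<zeta> where "\<zeta> z = z * \<phi> z" for z
  have \<zeta>: "smooth \<zeta>" unfolding \<zeta>_def by (intro smooth_intros \<phi>)
  have \<zeta>0: "\<zeta> z = 0" if "z \<notin> {0..1}" for z using \<phi>(2)[OF that] by (simp add: \<zeta>_def)
  have deriv_\<zeta>: "deriv \<zeta> = (\<lambda>z. z * deriv \<phi> z + \<phi> z)"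
    using higher_deriv_ident_mult[OF \<phi>(1), of 0] by (simp add: \<zeta>_def[abs_def])
  define \<phi>' where "\<phi>' z = \<phi> z + (1 / real s) * deriv \<zeta> z" for z
  define \<psi>' where "\<psi>' z = (1 / real s) * (z * \<psi> z)" for z
  have smooth': "smooth \<phi>'" "smooth \<psi>'"
    unfolding \<phi>'_def \<psi>'_def by (intro smooth_intros smooth_deriv \<phi> \<psi> \<zeta>)+
  have outside: "\<phi>' z = 0" "\<psi>' z = 0" if "z \<notin> {0..1}" for z
    using \<phi>(2)[OF that] \<psi>(2)[OF that] deriv_eq_0_outside[OF \<zeta> \<zeta>0 that] by (simp_all add: \<phi>'_def \<psi>'_def)
  have int: "integrable lborel f" if "smooth f" "\<And>z. z \<notin> {0..1} \<Longrightarrow> f z = 0" for f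
  proof -
    have "integrable lborel (\<lambda>z. indicator {0..1} z *\<^sub>R f z)"
      by (rule borel_integrable_compact) (auto intro: smooth_continuous that)
    moreover have "(\<lambda>z. indicator {0..1} z *\<^sub>R f z) = f" using that(2) by (auto split: split_indicator)
    ultimately show ?thesis by (simp only:)
  qed
  have "(\<integral>z. deriv \<zeta> z \<partial>lborel) = 0"
  proof (rule integral_directional_derivative_eq_0[where v = 1 and F = \<zeta>])
    show "((\<lambda>t. \<zeta> (x + t *\<^sub>R 1)) has_vector_derivative deriv \<zeta> x) (at 0)" for x
      using smooth_has_derivative[OF \<zeta>, of x] DERIV_shift[of \<zeta> "deriv \<zeta> x" 0 x]
      by (simp add: has_real_derivative_iff_has_vector_derivative[symmetric] add.commute)
    show "integrable lborel \<zeta>" using \<zeta> \<zeta>0 by (rule int)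
    show "integrable lborel (deriv \<zeta>)" by (rule int[OF smooth_deriv[OF \<zeta>] deriv_eq_0_outside[OF \<zeta> \<zeta>0]])
  qed (auto intro: smooth_continuous smooth_deriv \<zeta>)
  then have one: "(\<integral>z. \<phi>' z \<partial>lborel) = 1"
    unfolding \<phi>'_def using \<phi> int[OF \<phi>(1,2)] int[OF smooth_deriv[OF \<zeta>] deriv_eq_0_outside[OF \<zeta> \<zeta>0]] by simp
  have refine: "\<phi>' z - 2 * \<phi>' (2 * z) = (deriv ^^ Suc s) \<psi>' z" for z
  proof -
    let ?D = "\<lambda>k. (deriv ^^ k) \<psi>"
    have "((\<lambda>z. \<phi> z - 2 * \<phi> (2 * z)) has_real_derivative deriv \<phi> z - 2 * (deriv \<phi> (2 * z) * 2)) (at z)"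
      by (intro DERIV_diff DERIV_cmult DERIV_chain2[OF smooth_has_derivative[OF \<phi>(1)]] smooth_has_derivative \<phi>)
        (auto intro!: derivative_eq_intros)
    moreover have "((\<lambda>z. \<phi> z - 2 * \<phi> (2 * z)) has_real_derivative ?D (Suc s) z) (at z)"
      unfolding eq using smooth_has_derivative[OF smooth_higher_deriv[OF \<psi>(1)], of s z] by simp
    ultimately have d: "?D (Suc s) z = deriv \<phi> z - 4 * deriv \<phi> (2 * z)"
      using DERIV_unique by fastforce
    have "(deriv ^^ Suc s) \<psi>' z = (1 / real s) * (deriv ^^ Suc s) (\<lambda>z. z * \<psi> z) z"
    proof -
      have "smooth (\<lambda>z. z * \<psi> z)" by (intro smooth_intros \<psi>)
      from deriv_affine[OF this, of "Suc s" "1 / real s" 1 0] show ?thesis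
        by (simp add: \<psi>'_def[abs_def] fun_eq_iff)
    qed
    also have "\<dots> = (1 / real s) * (z * ?D (Suc s) z + real (Suc s) * ?D s z)"
      by (simp only: higher_deriv_ident_mult[OF \<psi>(1)])
    also have "\<dots> = (1 / real s) * (z * (deriv \<phi> z - 4 * deriv \<phi> (2 * z)) + (\<phi> z - 2 * \<phi> (2 * z))) + (\<phi> z - 2 * \<phi> (2 * z))"
      unfolding d eq[symmetric] using s by (simp add: field_simps)
    also have "\<dots> = \<phi>' z - 2 * \<phi>' (2 * z)"
      unfolding \<phi>'_def deriv_\<zeta> by (simp add: algebra_simps)
    finally show ?thesis by simp
  qed
  show ?case
    using smooth' outside one refine by (intro exI[of _ \<phi>'] exI[of _ \<psi>']) blast
qed

section \<open>Test functions of product form\<close>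

definition tensor :: "('n \<Rightarrow> real \<Rightarrow> real) \<Rightarrow> real ^ 'n \<Rightarrow> real" where
  "tensor f x = (\<Prod>i\<in>UNIV. f i (x $ i))"

lemma tensor_split: "tensor f x = f i (x $ i) * (\<Prod>j\<in>UNIV - {i}. f j (x $ j))"
  unfolding tensor_def by (rule prod.remove) auto

lemma tensor_has_partial:
  assumes "smooth (f i)"
  shows "((\<lambda>t. complex_of_real (tensor f (x + t *\<^sub>R axis i 1))) has_vector_derivative
     complex_of_real (tensor (f(i := deriv (f i))) x)) (at 0)"
proof (rule has_vector_derivative_of_real)
  define P where "P = (\<Prod>j\<in>UNIV - {i}. f j (x $ j))"
  have "(\<Prod>j\<in>UNIV - {i}. f j ((x + t *\<^sub>R axis i 1) $ j)) = P" for t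
    unfolding P_def by (intro prod.cong) (auto simp: axis_def)
  then have eq: "tensor f (x + t *\<^sub>R axis i 1) = f i (t + x $ i) * P" for t
    by (subst tensor_split[of _ _ i]) (simp add: axis_def add.commute)
  have "(\<Prod>j\<in>UNIV - {i}. (f(i := deriv (f i))) j (x $ j)) = P"
    unfolding P_def by (intro prod.cong) auto
  then have val: "tensor (f(i := deriv (f i))) x = deriv (f i) (x $ i) * P"
    by (subst tensor_split[of _ _ i]) simp
  have "((\<lambda>t. f i (t + x $ i)) has_real_derivative deriv (f i) (x $ i)) (at 0)"
    using smooth_has_derivative[OF assms, of "x $ i"] DERIV_shift[of "f i" "deriv (f i) (x $ i)" 0 "x $ i"] by simp
  from DERIV_cmult_right[OF this, of P]
  show "((\<lambda>t. tensor f (x + t *\<^sub>R axis i 1)) has_real_derivative tensor (f(i := deriv (f i))) x) (at 0)"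
    unfolding eq val .
qed

lemma partial1_tensor:
  assumes "smooth (f i)"
  shows "partial1 i (\<lambda>x. complex_of_real (tensor f x)) = (\<lambda>x. complex_of_real (tensor (f(i := deriv (f i))) x))"
  unfolding partial1_def using tensor_has_partial[where f = f and i = i, OF assms]
  by (intro ext vector_derivative_at)

lemma continuous_tensor:
  fixes f :: "'n::finite \<Rightarrow> real \<Rightarrow> real"
  assumes "\<And>i. smooth (f i)"
  shows "continuous_on UNIV (tensor f)"
  unfolding tensor_def
proof (intro continuous_on_prod)
  show "continuous_on UNIV (\<lambda>x. f i (x $ i))" for i
    by (rule continuous_on_compose2[OF smooth_continuous[OF assms[of i], of UNIV]]) (auto intro!: continuous_intros)
qed

lemma C_k_tensor:
  assumes "\<And>i. smooth (f i)"
  shows "C_k k (\<lambda>x. complex_of_real (tensor f x))"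
  using assms
proof (induction k arbitrary: f)
  case 0
  then show ?case by (auto intro!: continuous_intros continuous_tensor)
next
  case (Suc k)
  show ?case
    unfolding C_k.simps
  proof (intro conjI allI)
    show "continuous_on UNIV (\<lambda>x. complex_of_real (tensor f x))"
      by (intro continuous_intros continuous_tensor Suc.prems)
    show "(\<lambda>t. complex_of_real (tensor f (x + t *\<^sub>R axis i 1))) differentiable at 0" for i x
      by (rule differentiableI_vector) (rule tensor_has_partial[OF Suc.prems])
    show "C_k k (partial1 i (\<lambda>x. complex_of_real (tensor f x)))" for i
      unfolding partial1_tensor[OF Suc.prems]
      by (rule Suc.IH) (auto intro: Suc.prems smooth_deriv)
  qed
qed

lemma mi_pow_axis: "mi_pow D (axis i l) = D i ^^ l"
proof -
  have fold: "foldr (\<lambda>j h. (D j ^^ (axis i l $ j)) \<circ> h) xs id = (if i \<in> set xs then D i ^^ l else id)" if "distinct xs" for xs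
    using that by (induction xs) (auto simp: axis_def)
  have "i \<in> set coords" by (simp add: coords(2))
  with fold[OF coords(1)] show ?thesis unfolding mi_pow_def by (simp only: if_True)
qed

lemma mi_pow_0: "mi_pow D 0 = id"
proof -
  have "foldr (\<lambda>j h. (D j ^^ (0 $ j)) \<circ> h) xs id = id" for xs
    by (induction xs) auto
  then show ?thesis unfolding mi_pow_def .
qed

lemma partial1_power_tensor:
  assumes "\<And>i. smooth (f i)"
  shows "(partial1 i ^^ l) (\<lambda>x. complex_of_real (tensor f x)) = (\<lambda>x. complex_of_real (tensor (f(i := (deriv ^^ l) (f i))) x))"
proof (induction l)
  case (Suc l)
  have "smooth ((f(i := (deriv ^^ l) (f i))) i)" by (simp add: smooth_higher_deriv assms)
  from partial1_tensor[where f = "f(i := (deriv ^^ l) (f i))" and i = i, OF this] show ?case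
    unfolding funpow.simps o_apply Suc by (simp only: fun_upd_upd fun_upd_same)
qed simp

lemma test_function_tensor:
  assumes "\<And>i. smooth (f i)" and "\<And>i t. t \<notin> {a i..b i} \<Longrightarrow> f i t = 0"
  shows "test_function (\<lambda>x. complex_of_real (tensor f x))"
  unfolding test_function_def
proof (intro conjI allI)
  show "C_k k (\<lambda>x. complex_of_real (tensor f x))" for k by (rule C_k_tensor[OF assms(1)])
  have "{x. complex_of_real (tensor f x) \<noteq> 0} \<subseteq> cbox (\<chi> i. a i) (\<chi> i. b i)"
  proof
    fix x assume "x \<in> {x. complex_of_real (tensor f x) \<noteq> 0}"
    then have "f i (x $ i) \<noteq> 0" for i by (auto simp: tensor_def)
    then have "x $ i \<in> {a i..b i}" for i using assms(2) by blast
    then show "x \<in> cbox (\<chi> i. a i) (\<chi> i. b i)" by (simp add: mem_box_cart)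
  qed
  then have "bounded {x. complex_of_real (tensor f x) \<noteq> 0}" by (rule bounded_subset[OF bounded_cbox])
  then show "compact (closure {x. complex_of_real (tensor f x) \<noteq> 0})" by simp
qed


section \<open>Kernels refining one coordinate at a time\<close>

text \<open>The summand \<open>0\<close> makes the argument syntactically affine, as in the rules for \<open>smooth\<close>.\<close>

definition dyadic_scale :: "(real \<Rightarrow> real) \<Rightarrow> nat \<Rightarrow> real \<Rightarrow> real" where
  "dyadic_scale f N t = 2 ^ N * f (2 ^ N * t + 0)"

lemma smooth_dyadic_scale: "smooth f \<Longrightarrow> smooth (dyadic_scale f N)"
  unfolding dyadic_scale_def by (intro smooth_intros)

lemma integral_dyadic_scale: "(\<integral>t. dyadic_scale f N t \<partial>lborel) = (\<integral>t. f t \<partial>lborel)"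
  using lborel_integral_real_affine[of "2 ^ N" f 0] by (simp add: dyadic_scale_def)

lemma nn_integral_dyadic_scale_sq:
  assumes [measurable]: "f \<in> borel_measurable borel"
  shows "(\<integral>\<^sup>+t. ennreal ((dyadic_scale f N t)\<^sup>2) \<partial>lborel) = ennreal (2 ^ N) * (\<integral>\<^sup>+t. ennreal ((f t)\<^sup>2) \<partial>lborel)"
proof -
  have "(\<integral>\<^sup>+t. ennreal ((f t)\<^sup>2) \<partial>lborel) = ennreal (2 ^ N) * (\<integral>\<^sup>+t. ennreal ((f (2 ^ N * t))\<^sup>2) \<partial>lborel)"
    using nn_integral_real_affine[of "\<lambda>t. ennreal ((f t)\<^sup>2)" "2 ^ N" 0] by simp
  then have "ennreal (2 ^ N) * (\<integral>\<^sup>+t. ennreal ((f t)\<^sup>2) \<partial>lborel) = ennreal (2 ^ N) * (ennreal (2 ^ N) * (\<integral>\<^sup>+t. ennreal ((f (2 ^ N * t))\<^sup>2) \<partial>lborel))"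
    by simp
  also have "\<dots> = (\<integral>\<^sup>+t. ennreal ((dyadic_scale f N t)\<^sup>2) \<partial>lborel)"
    by (simp add: nn_integral_cmult[symmetric] ennreal_mult[symmetric] dyadic_scale_def power_mult_distrib power2_eq_square[of "2 ^ N"] mult.assoc)
  finally show ?thesis by simp
qed

lemma compact_support_integrable:
  assumes "smooth f" "\<And>z. z \<notin> {0..1} \<Longrightarrow> f z = 0"
  shows "integrable lborel f" "\<exists>A\<ge>0. (\<integral>\<^sup>+t. ennreal ((f t)\<^sup>2) \<partial>lborel) = ennreal A"
proof -
  have int: "integrable lborel g" if "continuous_on UNIV g" "\<And>z. z \<notin> {0..1} \<Longrightarrow> g z = 0" for g :: "real \<Rightarrow> real"
  proof -
    have "integrable lborel (\<lambda>z. indicator {0..1} z *\<^sub>R g z)"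
      by (rule borel_integrable_compact) (auto intro: continuous_on_subset that)
    moreover have "(\<lambda>z. indicator {0..1} z *\<^sub>R g z) = g" using that(2) by (auto split: split_indicator)
    ultimately show ?thesis by (simp only:)
  qed
  show "integrable lborel f" using assms by (intro int smooth_continuous)
  have "integrable lborel (\<lambda>z. (f z)\<^sup>2)"
    using assms by (intro int continuous_intros smooth_continuous) auto
  then show "\<exists>A\<ge>0. (\<integral>\<^sup>+t. ennreal ((f t)\<^sup>2) \<partial>lborel) = ennreal A"
    by (intro exI[of _ "\<integral>t. (f t)\<^sup>2 \<partial>lborel"]) (auto simp: nn_integral_eq_integral)
qed

lemma nn_integral_tensor_sq:
  fixes f :: "'n::finite \<Rightarrow> real \<Rightarrow> real"
  assumes [measurable]: "\<And>i. f i \<in> borel_measurable borel"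
  shows "(\<integral>\<^sup>+z. ennreal ((tensor f z)\<^sup>2) \<partial>lborel) = (\<Prod>i\<in>UNIV. \<integral>\<^sup>+t. ennreal ((f i t)\<^sup>2) \<partial>lborel)"
proof -
  have "ennreal ((tensor f z)\<^sup>2) = (\<Prod>i\<in>UNIV. ennreal ((f i (z $ i))\<^sup>2))" for z
    by (simp add: tensor_def prod_power_distrib prod_ennreal)
  then show ?thesis by (simp only:) (rule nn_integral_prod_vec, measurable)
qed

lemma smooth_measurable: "smooth f \<Longrightarrow> f \<in> borel_measurable borel"
  by (intro borel_measurable_continuous_onI smooth_continuous)

lemma dyadic_scale_support:
  assumes "\<And>z. z \<notin> {0..1} \<Longrightarrow> f z = 0" "dyadic_scale f N t \<noteq> 0"
  shows "0 \<le> t \<and> t \<le> (1/2) ^ N"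
proof -
  have "2 ^ N * t \<in> {0..1}" using assms by (auto simp: dyadic_scale_def)
  moreover have "(2 :: real) ^ N > 0" by simp
  ultimately show ?thesis by (auto simp: zero_le_mult_iff power_divide le_divide_eq mult.commute not_le)
qed

text \<open>The kernel form of the Sobolev embedding. \<open>\<Phi> M\<close> is a product of one-dimensional mollifiers, and a step from \<open>M\<close> to
  \<open>M + 1\<close> doubles the dilation of a single factor, the coordinates taking turns. By \<open>ex_refinable_mollifier\<close> the
  increment is the pure derivative \<open>\<partial>\<^sub>i\<^sup>s\<close> of a product kernel. At dilation \<open>2\<^sup>a\<close> the \<open>s\<close> antiderivatives gain \<open>2\<^sup>-\<^sup>s\<^sup>a\<close>,
  while the \<open>L\<^sup>2\<close> norm of the product grows like \<open>2\<^sup>n\<^sup>a\<^sup>/\<^sup>2\<close>; since \<open>n < 2 s\<close> and \<open>a\<close> is about \<open>m / n\<close>, the kernels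
  decay geometrically in \<open>m\<close>.\<close>

lemma ex_sobolev_kernels:
  assumes s: "CARD('n) < 2 * s"
  shows "\<exists>(\<Phi> :: nat \<Rightarrow> real ^ 'n \<Rightarrow> real) (\<kappa> :: nat \<Rightarrow> real ^ 'n \<Rightarrow> real) \<nu> A D \<mu>.
     0 < \<mu> \<and> \<mu> < 1 \<and> D \<ge> 0 \<and>
     (\<forall>m x. test_function (\<lambda>y. complex_of_real (\<kappa> m (y - x)))) \<and>
     (\<forall>m. \<nu> m = 0 \<or> (\<exists>i. \<nu> m = axis i s)) \<and>
     (\<forall>M x y. complex_of_real (\<Phi> M (y - x)) = (\<Sum>m\<le>M. partial_mi (\<nu> m) (\<lambda>y. complex_of_real (\<kappa> m (y - x))) y)) \<and>
     (\<forall>m. (\<integral>\<^sup>+z. ennreal ((\<kappa> m z)\<^sup>2) \<partial>lborel) \<le> ennreal (D * (\<mu> ^ m)\<^sup>2)) \<and>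
     (\<forall>m. continuous_on UNIV (\<Phi> m) \<and> continuous_on UNIV (\<kappa> m)) \<and>
     (\<forall>M. integrable lborel (\<Phi> M) \<and> (\<integral>z. \<Phi> M z \<partial>lborel) = 1 \<and> (\<integral>z. \<bar>\<Phi> M z\<bar> \<partial>lborel) \<le> A) \<and>
     (\<forall>M z. \<Phi> M z \<noteq> 0 \<longrightarrow> (\<forall>i. 0 \<le> z $ i \<and> z $ i \<le> 1)) \<and>
     (\<forall>\<epsilon>>0. \<exists>M0. \<forall>M\<ge>M0. \<forall>z. \<Phi> M z \<noteq> 0 \<longrightarrow> (\<forall>i. 0 \<le> z $ i \<and> z $ i \<le> \<epsilon>))"
proof -
  let ?n = "CARD('n)"
  have s1: "s \<ge> 1" using s by (cases s) auto
  have n: "?n > 0" by simp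
  obtain \<phi> \<psi> where \<phi>: "smooth \<phi>" "\<And>z. z \<notin> {0..1} \<Longrightarrow> \<phi> z = 0" "(\<integral>z. \<phi> z \<partial>lborel) = 1"
    and \<psi>: "smooth \<psi>" "\<And>z. z \<notin> {0..1} \<Longrightarrow> \<psi> z = 0" and refine: "\<And>z. \<phi> z - 2 * \<phi> (2 * z) = (deriv ^^ s) \<psi> z"
    using ex_refinable_mollifier[OF s1] by blast
  obtain A\<phi> where A\<phi>: "A\<phi> \<ge> 0" "(\<integral>\<^sup>+t. ennreal ((\<phi> t)\<^sup>2) \<partial>lborel) = ennreal A\<phi>"
    using compact_support_integrable(2)[OF \<phi>(1,2)] by blast
  obtain A\<psi> where A\<psi>: "A\<psi> \<ge> 0" "(\<integral>\<^sup>+t. ennreal ((\<psi> t)\<^sup>2) \<partial>lborel) = ennreal A\<psi>"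
    using compact_support_integrable(2)[OF \<psi>(1,2)] by blast
  define A where "A = max 1 (max A\<phi> A\<psi>)"
  have A: "A \<ge> 1" "A\<phi> \<le> A" "A\<psi> \<le> A" by (auto simp: A_def)
  note [measurable] = smooth_measurable[OF \<phi>(1)] smooth_measurable[OF \<psi>(1)]
  obtain r :: "'n \<Rightarrow> nat" where r: "bij_betw r UNIV {..<?n}"
    using finite_same_card_bij[of "UNIV :: 'n set" "{..<?n}"] by auto
  have r_lt: "r i < ?n" for i using r by (auto simp: bij_betw_def)
  have r_inj: "r i = r j \<Longrightarrow> i = j" for i j using r by (auto simp: bij_betw_def inj_on_def)
  \<comment> \<open>The dilation exponent of coordinate \<open>i\<close> after \<open>m\<close> steps. With \<open>r\<close> an enumeration of the coordinates, exactly one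
    level increases in each step, in the direction \<open>dir m\<close>.\<close>
  define lev where "lev m i = (m + r i) div ?n" for m i
  have lev_ge: "m div ?n \<le> lev m i" for m i unfolding lev_def by (intro div_le_mono) simp
  have lev_le: "lev m i \<le> m div ?n + 1" for m i
  proof -
    have "lev m i \<le> (m + ?n) div ?n" unfolding lev_def using r_lt[of i] by (intro div_le_mono) simp
    then show ?thesis by simp
  qed
  have "\<forall>m. \<exists>i. ?n dvd Suc (m + r i)"
  proof
    fix m
    have "?n - 1 - m mod ?n \<in> r ` UNIV" using r by (simp add: bij_betw_def)
    then obtain i where i: "r i = ?n - 1 - m mod ?n" by auto
    have "m mod ?n < ?n" by simp
    then have "Suc (m + r i) = ?n * (m div ?n) + ?n"
      unfolding i using mult_div_mod_eq[of ?n m] by linarith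
    then show "\<exists>i. ?n dvd Suc (m + r i)" by (intro exI[of _ i]) simp
  qed
  then obtain dir where dir: "\<And>m. ?n dvd Suc (m + r (dir m))" by metis
  have dir_unique: "i = dir m" if "?n dvd Suc (m + r i)" for m i
  proof -
    have "?n dvd Suc (m + r i) - Suc (m + r (dir m))" "?n dvd Suc (m + r (dir m)) - Suc (m + r i)"
      by (rule dvd_diff_nat[OF that dir], rule dvd_diff_nat[OF dir that])
    then have "?n dvd r i - r (dir m)" "?n dvd r (dir m) - r i" by simp_all
    moreover have "r i - r (dir m) < ?n" "r (dir m) - r i < ?n"
      using r_lt[of i] r_lt[of "dir m"] by linarith+
    ultimately have "r i - r (dir m) = 0" "r (dir m) - r i = 0"
      using nat_dvd_not_less[of "r i - r (dir m)" ?n] nat_dvd_not_less[of "r (dir m) - r i" ?n] by blast+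
    then show ?thesis by (intro r_inj) linarith
  qed
  have lev_Suc: "lev (Suc m) i = (if i = dir m then Suc (lev m i) else lev m i)" for m i
  proof (cases "i = dir m")
    case True
    then show ?thesis using dir[of m] by (simp add: lev_def div_Suc dvd_eq_mod_eq_0)
  next
    case False
    then have "\<not> ?n dvd Suc (m + r i)" using dir_unique by blast
    then show ?thesis using False by (simp add: lev_def div_Suc dvd_eq_mod_eq_0)
  qed
  define f where "f m i = dyadic_scale \<phi> (lev m i)" for m i
  define \<Phi> where "\<Phi> m = tensor (f m)" for m
  \<comment> \<open>The product of \<open>f m\<close> with its factor in direction \<open>dir m\<close> replaced by the \<open>s\<close>-th antiderivative of the increment.\<close>
  define h where "h m = (f m)(dir m := (\<lambda>t. - ((1/2) ^ (s * lev m (dir m))) * dyadic_scale \<psi> (lev m (dir m)) t))" for m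
  define \<kappa> where "\<kappa> m = (case m of 0 \<Rightarrow> \<Phi> 0 | Suc m \<Rightarrow> tensor (h m))" for m
  define \<nu> where "\<nu> m = (case m of 0 \<Rightarrow> 0 | Suc m \<Rightarrow> axis (dir m) s)" for m :: nat
  have smooth_f: "smooth (f m i)" for m i unfolding f_def by (intro smooth_dyadic_scale \<phi>)
  have smooth_h: "smooth (h m i)" for m i
  proof (cases "i = dir m")
    case True
    show ?thesis
      unfolding True h_def fun_upd_same by (intro smooth_intros smooth_dyadic_scale \<psi>)
  next
    case False
    then show ?thesis using smooth_f by (simp add: h_def)
  qed
  have shift: "(\<lambda>y. complex_of_real (tensor g (y - x))) = (\<lambda>y. complex_of_real (tensor (\<lambda>i t. g i (1 * t + (- (x $ i)))) y))" for g x
    by (simp add: tensor_def)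
  have smooth_shift: "smooth (\<lambda>t. g i (1 * t + (- (x $ i))))" if "\<And>i. smooth (g i)" for g and x :: "real ^ 'n" and i
    by (intro smooth_intros that)
  have f_supp: "f m i t = 0" if "t \<notin> {0..1}" for m i t
  proof (rule ccontr)
    assume "f m i t \<noteq> 0"
    then have "0 \<le> t \<and> t \<le> (1/2) ^ lev m i" unfolding f_def using \<phi>(2) by (rule dyadic_scale_support[rotated])
    moreover have "(1/2 :: real) ^ lev m i \<le> 1" by (rule power_le_one) auto
    ultimately show False using that by auto
  qed
  have h_supp: "h m i t = 0" if "t \<notin> {0..1}" for m i t
  proof (cases "i = dir m")
    case True
    have "dyadic_scale \<psi> (lev m (dir m)) t = 0"
    proof (rule ccontr)
      assume "dyadic_scale \<psi> (lev m (dir m)) t \<noteq> 0"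
      then have "0 \<le> t \<and> t \<le> (1/2) ^ lev m (dir m)" using \<psi>(2) by (rule dyadic_scale_support[rotated])
      moreover have "(1/2 :: real) ^ lev m (dir m) \<le> 1" by (rule power_le_one) auto
      ultimately show False using that by auto
    qed
    then show ?thesis by (simp add: h_def True)
  qed (simp add: h_def f_supp[OF that])
  have test: "test_function (\<lambda>y. complex_of_real (tensor g (y - x)))"
    if "\<And>i. smooth (g i)" "\<And>i t. t \<notin> {0..1} \<Longrightarrow> g i t = 0" for g and x :: "real ^ 'n"
    unfolding shift
  proof (rule test_function_tensor[where a = "\<lambda>i. x $ i" and b = "\<lambda>i. x $ i + 1"])
    show "smooth (\<lambda>t. g i (1 * t + (- (x $ i))))" for i by (rule smooth_shift[OF that(1)])
    show "g i (1 * t + (- (x $ i))) = 0" if "t \<notin> {x $ i..x $ i + 1}" for i t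
      using that by (intro \<open>\<And>i t. t \<notin> {0..1} \<Longrightarrow> g i t = 0\<close>) auto
  qed
  have test_\<kappa>: "test_function (\<lambda>y. complex_of_real (\<kappa> m (y - x)))" for m x
    unfolding \<kappa>_def \<Phi>_def by (cases m) (auto intro: test smooth_f smooth_h f_supp h_supp)
  have step: "complex_of_real (\<Phi> (Suc m) (y - x)) = complex_of_real (\<Phi> m (y - x))
      + partial_mi (\<nu> (Suc m)) (\<lambda>y. complex_of_real (\<kappa> (Suc m) (y - x))) y" for m x y
  proof -
    let ?i = "dir m" and ?N = "lev m (dir m)"
    let ?P = "\<Prod>j\<in>UNIV - {?i}. f m j ((y - x) $ j)"
    have P: "(\<Prod>j\<in>UNIV - {?i}. f (Suc m) j ((y - x) $ j)) = ?P"
      by (intro prod.cong) (auto simp: f_def lev_Suc)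
    have dh: "(deriv ^^ s) (\<lambda>t. h m ?i (1 * t + (- (x $ ?i)))) = (\<lambda>t. dyadic_scale \<phi> (Suc ?N) (t - x $ ?i) - dyadic_scale \<phi> ?N (t - x $ ?i))"
    proof -
      have "(\<lambda>t. h m ?i (1 * t + (- (x $ ?i)))) = (\<lambda>t. (- ((1/2) ^ (s * ?N)) * 2 ^ ?N) * \<psi> (2 ^ ?N * t + (- (2 ^ ?N * (x $ ?i)))))"
        by (auto simp: h_def dyadic_scale_def right_diff_distrib)
      then have "(deriv ^^ s) (\<lambda>t. h m ?i (1 * t + (- (x $ ?i)))) =
         (\<lambda>t. (- ((1/2) ^ (s * ?N)) * 2 ^ ?N) * (2 ^ ?N) ^ s * (deriv ^^ s) \<psi> (2 ^ ?N * t + (- (2 ^ ?N * (x $ ?i)))))"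
        by (simp only: deriv_affine[OF \<psi>(1)])
      also have "\<dots> = (\<lambda>t. - (2 ^ ?N * (deriv ^^ s) \<psi> (2 ^ ?N * (t - x $ ?i))))"
      proof -
        have "(1/2 :: real) ^ (s * ?N) * (2 ^ ?N) ^ s = 1"
          by (simp add: power_mult[symmetric] mult.commute[of s] power_divide)
        then have "(- ((1/2) ^ (s * ?N)) * 2 ^ ?N) * (2 ^ ?N) ^ s = - (2 ^ ?N :: real)"
          by (metis mult.assoc mult.commute mult.left_neutral mult_minus_left)
        then show ?thesis by (simp only:) (simp add: right_diff_distrib)
      qed
      also have "\<dots> = (\<lambda>t. dyadic_scale \<phi> (Suc ?N) (t - x $ ?i) - dyadic_scale \<phi> ?N (t - x $ ?i))"
        unfolding refine[symmetric] by (simp add: dyadic_scale_def algebra_simps)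
      finally show ?thesis .
    qed
    have "partial_mi (\<nu> (Suc m)) (\<lambda>y. complex_of_real (\<kappa> (Suc m) (y - x))) y
      = complex_of_real (tensor ((\<lambda>i t. h m i (1 * t + (- (x $ i))))(?i := (deriv ^^ s) (\<lambda>t. h m ?i (1 * t + (- (x $ ?i)))))) y)"
      unfolding \<nu>_def \<kappa>_def nat.case mi_pow_axis shift
      by (subst partial1_power_tensor) (rule smooth_shift[OF smooth_h], rule refl)
    also have "tensor ((\<lambda>i t. h m i (1 * t + (- (x $ i))))(?i := (deriv ^^ s) (\<lambda>t. h m ?i (1 * t + (- (x $ ?i)))))) y
       = (dyadic_scale \<phi> (Suc ?N) ((y - x) $ ?i) - dyadic_scale \<phi> ?N ((y - x) $ ?i)) * ?P"
      unfolding dh by (subst tensor_split[of _ _ ?i]) (auto simp: h_def intro!: prod.cong)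
    also have "\<dots> = \<Phi> (Suc m) (y - x) - \<Phi> m (y - x)"
      unfolding \<Phi>_def tensor_split[of _ _ ?i] P by (simp add: f_def lev_Suc left_diff_distrib)
    finally show ?thesis by simp
  qed
  have sum: "complex_of_real (\<Phi> M (y - x)) = (\<Sum>m\<le>M. partial_mi (\<nu> m) (\<lambda>y. complex_of_real (\<kappa> m (y - x))) y)" for M x y
  proof (induction M)
    case 0
    show ?case by (simp add: \<nu>_def \<kappa>_def mi_pow_0)
  next
    case (Suc M)
    show ?case unfolding sum.atMost_Suc Suc[symmetric] by (rule step)
  qed
  \<comment> \<open>The squared norms decay at least like \<open>(1/2) ^ (m div n)\<close>, because \<open>2 s - n \<ge> 1\<close>.\<close>
  define \<mu> where "\<mu> = 2 powr (- 1 / (2 * real ?n))"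
  have "2 powr (- 1 / (2 * real ?n)) < 2 powr 0" using n by (intro powr_less_mono) auto
  then have \<mu>: "0 < \<mu>" "\<mu> < 1" by (simp_all add: \<mu>_def)
  define D where "D = 2 * (2 * A) ^ ?n"
  have D: "D \<ge> 0" using A by (simp add: D_def)
  have \<mu>_pow: "(1/2) ^ (m div ?n) \<le> 2 * (\<mu> ^ Suc m)\<^sup>2" for m
  proof -
    have "real (Suc m) \<le> real ?n * (real (m div ?n) + 1)"
    proof -
      have "m mod ?n < ?n" by simp
      then have "Suc m \<le> ?n * (m div ?n) + ?n" using mult_div_mod_eq[of ?n m] by linarith
      then have "Suc m \<le> ?n * (m div ?n + 1)" by (simp only: distrib_left mult_1_right)
      then have "real (Suc m) \<le> real (?n * (m div ?n + 1))" by (simp only: of_nat_le_iff)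
      then show ?thesis by (simp only: of_nat_mult of_nat_add of_nat_1)
    qed
    then have le: "real (Suc m) / real ?n \<le> real (m div ?n) + 1" using n by (simp add: divide_le_eq mult.commute)
    have "(\<mu> ^ Suc m)\<^sup>2 = \<mu> ^ (Suc m * 2)" by (simp only: power_mult)
    also have "\<dots> = \<mu> powr real (Suc m * 2)" by (rule powr_realpow[symmetric]) (rule \<mu>(1))
    also have "\<dots> = 2 powr (- 1 / (2 * real ?n) * real (Suc m * 2))" unfolding \<mu>_def by (rule powr_powr)
    also have "- 1 / (2 * real ?n) * real (Suc m * 2) = - (real (Suc m) / real ?n)" using n by (simp add: field_simps)
    finally have "2 powr (- (real (m div ?n) + 1)) \<le> (\<mu> ^ Suc m)\<^sup>2"
      using le by (simp only:) (intro powr_mono; simp)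
    moreover have "2 powr (- (real (m div ?n) + 1)) = (1/2) ^ (m div ?n) / 2"
    proof -
      have "2 powr (- (real (m div ?n) + 1)) = inverse (2 powr (real (m div ?n) + 1))" by (rule powr_minus)
      also have "2 powr (real (m div ?n) + 1) = (2::real) ^ (m div ?n) * 2" by (simp add: powr_add powr_realpow)
      finally show ?thesis by (simp add: power_divide inverse_eq_divide)
    qed
    ultimately show ?thesis by simp
  qed
  have f_sq: "(\<integral>\<^sup>+t. ennreal ((f m i t)\<^sup>2) \<partial>lborel) \<le> ennreal (2 ^ (m div ?n + 1) * A)" for m i
  proof -
    have "(\<integral>\<^sup>+t. ennreal ((f m i t)\<^sup>2) \<partial>lborel) = ennreal (2 ^ lev m i * A\<phi>)"
      unfolding f_def using A\<phi> by (simp add: nn_integral_dyadic_scale_sq ennreal_mult)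
    also have "\<dots> \<le> ennreal (2 ^ (m div ?n + 1) * A)"
      using lev_le[of m i] A A\<phi> by (intro ennreal_leI mult_mono power_increasing) auto
    finally show ?thesis .
  qed
  have \<kappa>_sq: "(\<integral>\<^sup>+z. ennreal ((\<kappa> m z)\<^sup>2) \<partial>lborel) \<le> ennreal (D * (\<mu> ^ m)\<^sup>2)" for m
  proof (cases m)
    case 0
    have "(\<integral>\<^sup>+z. ennreal ((\<kappa> m z)\<^sup>2) \<partial>lborel) = (\<Prod>i\<in>UNIV. \<integral>\<^sup>+t. ennreal ((f 0 i t)\<^sup>2) \<partial>lborel)"
      unfolding \<kappa>_def 0 nat.case \<Phi>_def by (rule nn_integral_tensor_sq) (rule smooth_measurable[OF smooth_f])
    also have "\<dots> \<le> (\<Prod>i\<in>(UNIV :: 'n set). ennreal (2 * A))"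
      using f_sq[of 0] by (intro prod_mono_ennreal) simp
    also have "\<dots> = ennreal ((2 * A) ^ ?n)" using A by (simp add: ennreal_power)
    also have "\<dots> \<le> ennreal (D * (\<mu> ^ m)\<^sup>2)" using A by (intro ennreal_leI) (simp add: D_def 0)
    finally show ?thesis .
  next
    case (Suc k)
    let ?i = "dir k" and ?N = "lev k (dir k)" and ?a = "k div ?n"
    have "(\<integral>\<^sup>+z. ennreal ((\<kappa> m z)\<^sup>2) \<partial>lborel) = (\<Prod>i\<in>UNIV. \<integral>\<^sup>+t. ennreal ((h k i t)\<^sup>2) \<partial>lborel)"
      unfolding \<kappa>_def Suc nat.case by (rule nn_integral_tensor_sq) (rule smooth_measurable[OF smooth_h])
    also have "\<dots> = (\<integral>\<^sup>+t. ennreal ((h k ?i t)\<^sup>2) \<partial>lborel) * (\<Prod>i\<in>UNIV - {?i}. \<integral>\<^sup>+t. ennreal ((h k i t)\<^sup>2) \<partial>lborel)"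
      by (rule prod.remove) auto
    also have "\<dots> \<le> ennreal ((1/2) ^ (?a * (2 * s - 1)) * A) * (\<Prod>i\<in>UNIV - {?i}. ennreal (2 ^ (?a + 1) * A))"
    proof (intro mult_mono prod_mono_ennreal)
      have "(\<integral>\<^sup>+t. ennreal ((h k ?i t)\<^sup>2) \<partial>lborel) = (\<integral>\<^sup>+t. ennreal (((1/2) ^ (s * ?N))\<^sup>2) * ennreal ((dyadic_scale \<psi> ?N t)\<^sup>2) \<partial>lborel)"
        by (simp add: h_def power_mult_distrib ennreal_mult)
      also have "\<dots> = ennreal (((1/2) ^ (s * ?N))\<^sup>2) * (ennreal (2 ^ ?N) * ennreal A\<psi>)"
        using smooth_measurable[OF smooth_dyadic_scale[OF \<psi>(1)], of ?N]
        by (simp add: nn_integral_cmult nn_integral_dyadic_scale_sq A\<psi>)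
      also have "\<dots> = ennreal (((1/2) ^ (s * ?N))\<^sup>2 * 2 ^ ?N * A\<psi>)"
        using A\<psi> by (simp add: ennreal_mult[symmetric] mult.assoc)
      also have "((1/2 :: real) ^ (s * ?N))\<^sup>2 * 2 ^ ?N = (1/2) ^ (?N * (2 * s - 1))"
      proof -
        have "?N * (2 * s) = ?N * (2 * s - 1) + ?N" using s1 by (cases s) auto
        then have e: "s * ?N * 2 = ?N * (2 * s - 1) + ?N" by (simp only: mult_ac)
        have "((1/2 :: real) ^ (s * ?N))\<^sup>2 = (1/2) ^ (s * ?N * 2)" by (simp only: power_mult)
        also have "\<dots> = (1/2) ^ (?N * (2 * s - 1)) * (1/2) ^ ?N" unfolding e by (rule power_add)
        finally have "((1/2 :: real) ^ (s * ?N))\<^sup>2 = (1/2) ^ (?N * (2 * s - 1)) * (1/2) ^ ?N" .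
        then show ?thesis by (simp add: power_divide)
      qed
      also have "ennreal ((1/2) ^ (?N * (2 * s - 1)) * A\<psi>) \<le> ennreal ((1/2) ^ (?a * (2 * s - 1)) * A)"
        using A A\<psi> lev_ge[of k ?i] by (intro ennreal_leI mult_mono power_decreasing mult_le_mono1) auto
      finally show "(\<integral>\<^sup>+t. ennreal ((h k ?i t)\<^sup>2) \<partial>lborel) \<le> ennreal ((1/2) ^ (?a * (2 * s - 1)) * A)" .
      show "(\<integral>\<^sup>+t. ennreal ((h k i t)\<^sup>2) \<partial>lborel) \<le> ennreal (2 ^ (?a + 1) * A)"
        if "i \<in> UNIV - {?i}" for i
        using f_sq[of k i] that by (simp add: h_def)
    qed auto
    also have "\<dots> = ennreal ((1/2) ^ (?a * (2 * s - 1)) * A * (2 ^ (?a + 1) * A) ^ (?n - 1))"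
      using A by (simp add: ennreal_power ennreal_mult[symmetric] card_Diff_singleton)
    also have "\<dots> \<le> ennreal ((2 * A) ^ ?n * (1/2) ^ ?a)"
    proof (rule ennreal_leI)
      have e: "?a * (2 * s - 1) = ?a * (?n - 1) + ?a * (2 * s - ?n)"
        using s n by (simp add: distrib_left[symmetric] del: distrib_left)
      have "(1/2 :: real) ^ (?a * (2 * s - 1)) * A * (2 ^ (?a + 1) * A) ^ (?n - 1)
         = (1/2) ^ (?a * (2 * s - ?n)) * (((1/2) ^ (?a * (?n - 1)) * 2 ^ (?a * (?n - 1))) * (2 ^ (?n - 1) * (A * A ^ (?n - 1))))"
        unfolding e by (simp add: power_add power_mult_distrib power_mult[symmetric] mult_ac)
      also have "(1/2 :: real) ^ (?a * (?n - 1)) * 2 ^ (?a * (?n - 1)) = 1" by (simp add: power_divide)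
      also have "A * A ^ (?n - 1) = A ^ ?n" using n by (simp add: power_eq_if)
      also have "(1/2 :: real) ^ (?a * (2 * s - ?n)) * (1 * (2 ^ (?n - 1) * A ^ ?n)) \<le> (1/2) ^ ?a * (1 * (2 ^ ?n * A ^ ?n))"
        using A s by (intro mult_mono power_decreasing power_increasing mult_left_mono) auto
      finally show "(1/2) ^ (?a * (2 * s - 1)) * A * (2 ^ (?a + 1) * A) ^ (?n - 1) \<le> (2 * A) ^ ?n * (1/2) ^ ?a"
        by (simp add: power_mult_distrib mult_ac)
    qed
    also have "\<dots> \<le> ennreal ((2 * A) ^ ?n * (2 * (\<mu> ^ Suc k)\<^sup>2))"
      using A by (intro ennreal_leI mult_left_mono \<mu>_pow) auto
    finally show ?thesis by (simp only: D_def Suc mult_ac)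
  qed
  have cont: "continuous_on UNIV (\<Phi> m)" "continuous_on UNIV (\<kappa> m)" for m
    unfolding \<Phi>_def \<kappa>_def by (auto split: nat.splits intro: continuous_tensor smooth_f smooth_h)
  have int_f: "integrable lborel (f m i)" for m i
    using smooth_f f_supp by (rule compact_support_integrable(1))
  have int_\<Phi>: "integrable lborel (\<Phi> M)" "(\<integral>z. \<Phi> M z \<partial>lborel) = 1" for M
  proof -
    show "integrable lborel (\<Phi> M)"
      unfolding \<Phi>_def tensor_def[abs_def] by (rule integrable_prod_vec[OF int_f])
    have "(\<integral>z. \<Phi> M z \<partial>lborel) = (\<Prod>i\<in>UNIV. \<integral>t. f M i t \<partial>lborel)"
      unfolding \<Phi>_def tensor_def by (rule integral_prod_vec[OF int_f])
    also have "\<dots> = 1" unfolding f_def integral_dyadic_scale \<phi>(3) by simp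
    finally show "(\<integral>z. \<Phi> M z \<partial>lborel) = 1" .
  qed
  have abs_\<Phi>: "(\<integral>z. \<bar>\<Phi> M z\<bar> \<partial>lborel) \<le> (\<integral>t. \<bar>\<phi> t\<bar> \<partial>lborel) ^ ?n" for M
  proof -
    have "(\<integral>z. \<bar>\<Phi> M z\<bar> \<partial>lborel) = (\<integral>z. (\<Prod>i\<in>UNIV. \<bar>f M i (z $ i)\<bar>) \<partial>lborel)"
      unfolding \<Phi>_def tensor_def abs_prod ..
    also have "\<dots> = (\<Prod>i\<in>UNIV. \<integral>t. \<bar>f M i t\<bar> \<partial>lborel)"
      by (rule integral_prod_vec) (intro integrable_abs int_f)
    also have "(\<lambda>i. \<integral>t. \<bar>f M i t\<bar> \<partial>lborel) = (\<lambda>i. \<integral>t. \<bar>\<phi> t\<bar> \<partial>lborel)"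
    proof
      fix i
      have "(\<integral>t. \<bar>f M i t\<bar> \<partial>lborel) = (\<integral>t. dyadic_scale (\<lambda>t. \<bar>\<phi> t\<bar>) (lev M i) t \<partial>lborel)"
        by (simp add: f_def dyadic_scale_def abs_mult)
      then show "(\<integral>t. \<bar>f M i t\<bar> \<partial>lborel) = (\<integral>t. \<bar>\<phi> t\<bar> \<partial>lborel)" by (simp only: integral_dyadic_scale)
    qed
    finally show ?thesis by simp
  qed
  have small: "\<exists>M0. \<forall>M\<ge>M0. \<forall>z. \<Phi> M z \<noteq> 0 \<longrightarrow> (\<forall>i. 0 \<le> z $ i \<and> z $ i \<le> \<epsilon>)" if "\<epsilon> > 0" for \<epsilon>
  proof -
    obtain N where N: "(1/2 :: real) ^ N < \<epsilon>" using real_arch_pow_inv[OF \<open>\<epsilon> > 0\<close>, of "1/2"] by auto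
    show ?thesis
    proof (intro exI[of _ "?n * N"] allI impI)
      fix M z i assume M: "?n * N \<le> M" and nz: "\<Phi> M z \<noteq> 0"
      have "f M i (z $ i) \<noteq> 0" using nz by (auto simp: \<Phi>_def tensor_def)
      then have b: "0 \<le> z $ i \<and> z $ i \<le> (1/2) ^ lev M i"
        unfolding f_def using \<phi>(2) by (rule dyadic_scale_support[rotated])
      have "N \<le> M div ?n" using div_le_mono[OF M, of ?n] by simp
      then have "N \<le> lev M i" using lev_ge[of M i] by linarith
      then have "(1/2 :: real) ^ lev M i \<le> (1/2) ^ N" by (intro power_decreasing) auto
      with b N show "0 \<le> z $ i \<and> z $ i \<le> \<epsilon>" by linarith
    qed
  qed
  have unit: "0 \<le> z $ i" "z $ i \<le> 1" if "\<Phi> M z \<noteq> 0" for M z i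
  proof -
    have "f M i (z $ i) \<noteq> 0" using that by (auto simp: \<Phi>_def tensor_def)
    then show "0 \<le> z $ i" "z $ i \<le> 1" using f_supp[of "z $ i" M i] by auto
  qed
  have \<nu>: "\<nu> m = 0 \<or> (\<exists>i. \<nu> m = axis i s)" for m by (auto simp: \<nu>_def split: nat.splits)
  show ?thesis
    by (rule exI[of _ \<Phi>], rule exI[of _ \<kappa>], rule exI[of _ \<nu>], rule exI[of _ "(\<integral>t. \<bar>\<phi> t\<bar> \<partial>lborel) ^ ?n"],
        rule exI[of _ D], rule exI[of _ \<mu>])
      (intro conjI allI impI \<mu> D test_\<kappa> \<nu> sum \<kappa>_sq cont int_\<Phi> abs_\<Phi> unit small)
qed


section \<open>Recovering a function from its mollifications\<close>

text \<open>Boxes are stable under intersection and generate the Borel sets, so by the Dynkin argument the integral over every Borel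
  subset of a large box vanishes.\<close>

lemma AE_eq_0_if_box_integrals_eq_0:
  fixes h :: "'a::euclidean_space \<Rightarrow> complex"
  assumes [measurable]: "h \<in> borel_measurable borel"
    and int: "\<And>a b. set_integrable lborel (box a b) h"
    and zero: "\<And>a b. (LINT x:box a b|lborel. h x) = 0"
  shows "AE x in lborel. h x = 0"
proof -
  have "AE x in lborel. indicator (box (- (real k *\<^sub>R One)) (real k *\<^sub>R One)) x *\<^sub>R h x = 0" for k
  proof (rule sigma_finite_measure.density_zero[OF sigma_finite_lborel])
    let ?B = "box (- (real k *\<^sub>R One)) (real k *\<^sub>R One) :: 'a set"
    let ?F = "\<lambda>x. indicator ?B x *\<^sub>R h x"
    show F: "integrable lborel ?F" using int[of "- (real k *\<^sub>R One)" "real k *\<^sub>R One"] by (simp add: set_integrable_def)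
    have FA: "set_integrable lborel A ?F" if "A \<in> sets borel" for A
      unfolding set_integrable_def by (rule integrable_mult_indicator[OF _ F]) (use that in simp)
    have total: "(LINT x|lborel. ?F x) = 0"
      using zero[of "- (real k *\<^sub>R One)" "real k *\<^sub>R One"] by (simp add: set_lebesgue_integral_def)
    fix A :: "'a set" assume "A \<in> sets lborel"
    then have A: "A \<in> sigma_sets UNIV (range (\<lambda>(a, b). box a b))"
      by (simp add: borel_eq_box)
    have stable: "Int_stable (range (\<lambda>(a, b). box a b :: 'a set))"
      by (auto simp: Int_stable_def box_Int_box)
    have sub: "range (\<lambda>(a, b). box a b :: 'a set) \<subseteq> Pow UNIV" by simp
    from stable sub A show "set_lebesgue_integral lborel A ?F = 0"
    proof (induct rule: sigma_sets_induct_disjoint)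
      case (basic A)
      then obtain a b where A: "A = box a b" by auto
      have "set_lebesgue_integral lborel A ?F = (LINT x:A \<inter> ?B|lborel. h x)"
        unfolding set_lebesgue_integral_def by (intro Bochner_Integration.integral_cong) (auto split: split_indicator)
      then show ?case unfolding A box_Int_box by (simp only: zero)
    next
      case empty
      show ?case by (simp add: set_lebesgue_integral_def)
    next
      case (compl A)
      then have A: "A \<in> sets borel" by (simp add: borel_eq_box)
      have "(LINT x|lborel. ?F x) = (LINT x|lborel. indicator A x *\<^sub>R ?F x + indicator (UNIV - A) x *\<^sub>R ?F x)"
        by (intro Bochner_Integration.integral_cong) (auto split: split_indicator)
      also have "\<dots> = set_lebesgue_integral lborel A ?F + set_lebesgue_integral lborel (UNIV - A) ?F"
        unfolding set_lebesgue_integral_def using FA[of A] FA[of "UNIV - A"] A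
        by (intro Bochner_Integration.integral_add) (auto simp: set_integrable_def)
      finally show ?case using total compl(2) by simp
    next
      case (union A)
      have A: "A i \<in> sets borel" for i using union(2) by (auto simp: borel_eq_box)
      have "set_lebesgue_integral lborel (\<Union>i. A i) ?F = (\<Sum>i. set_lebesgue_integral lborel (A i) ?F)"
        using A union(1) by (intro lebesgue_integral_countable_add FA) (auto simp: disjoint_family_on_def)
      then show ?case using union(3) by simp
    qed
  qed
  then have "AE x in lborel. \<forall>k. indicator (box (- (real k *\<^sub>R One)) (real k *\<^sub>R One)) x *\<^sub>R h x = 0"
    by (subst AE_all_countable) blast
  then show ?thesis
  proof eventually_elim
    case (elim x)
    obtain k :: nat where k: "norm x < real k" using reals_Archimedean2 by blast
    have "\<bar>x \<bullet> b\<bar> < real k" if "b \<in> Basis" for b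
      using Basis_le_norm[OF that, of x] k by simp
    then have "x \<in> box (- (real k *\<^sub>R One)) (real k *\<^sub>R One)"
      by (auto simp: mem_box abs_less_iff minus_less_iff)
    then show ?case using elim by (auto split: split_indicator_asm)
  qed
qed

lemma lborel_distr_reflect: "distr lborel borel (\<lambda>x. y - x) = (lborel :: 'a::euclidean_space measure)"
  using lborel_affine[of "-1" y] by (simp add: density_1)

lemma
  fixes f :: "'a::euclidean_space \<Rightarrow> 'b::{banach,second_countable_topology}"
  assumes "integrable lborel f"
  shows integrable_reflect: "integrable lborel (\<lambda>x. f (y - x))"
    and integral_reflect: "(\<integral>x. f (y - x) \<partial>lborel) = (\<integral>x. f x \<partial>lborel)"
proof -
  have [measurable]: "f \<in> borel_measurable borel" using assms by auto
  have "integrable (distr lborel borel (\<lambda>x. y - x)) f" using assms by (simp add: lborel_distr_reflect)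
  then show "integrable lborel (\<lambda>x. f (y - x))" by (simp add: integrable_distr_eq)
  have "(\<integral>x. f x \<partial>lborel) = (\<integral>x. f x \<partial>(distr lborel borel (\<lambda>x. y - x)))" by (simp add: lborel_distr_reflect)
  then show "(\<integral>x. f (y - x) \<partial>lborel) = (\<integral>x. f x \<partial>lborel)" by (simp add: integral_distr)
qed

lemma nn_integral_translate:
  fixes f :: "'a::euclidean_space \<Rightarrow> ennreal"
  assumes [measurable]: "f \<in> borel_measurable borel"
  shows "(\<integral>\<^sup>+y. f (y - x) \<partial>lborel) = (\<integral>\<^sup>+y. f y \<partial>lborel)"
proof -
  have "(\<lambda>y. y - x) = (+) (- x)" by auto
  then have "distr lborel borel (\<lambda>y. y - x) = lborel" using lborel_distr_plus[of "- x"] by simp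
  then have "(\<integral>\<^sup>+y. f y \<partial>lborel) = (\<integral>\<^sup>+y. f y \<partial>(distr lborel borel (\<lambda>y. y - x)))" by simp
  then show ?thesis by (simp add: nn_integral_distr)
qed

text \<open>The geometric increments make \<open>v M\<close> converge boundedly to some \<open>w\<close>. By Fubini the integral of \<open>v M\<close> over a box is that
  of \<open>u\<close> against the mollified indicator of the box, which converges to the indicator off the boundary. So \<open>w\<close> and
  \<open>u\<close> have the same integral over every box.\<close>

lemma mollified_limit:
  fixes u :: "real ^ 'n \<Rightarrow> complex" and \<Phi> :: "nat \<Rightarrow> real ^ 'n \<Rightarrow> real"
  assumes u [measurable]: "u \<in> borel_measurable borel"
    and loc: "\<And>a b. set_integrable lborel (cbox a b) u"
    and cont: "\<And>M. continuous_on UNIV (\<Phi> M)"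
    and int: "\<And>M. integrable lborel (\<Phi> M)" "\<And>M. (\<integral>z. \<Phi> M z \<partial>lborel) = 1" "\<And>M. (\<integral>z. \<bar>\<Phi> M z\<bar> \<partial>lborel) \<le> A"
    and unit: "\<And>M z i. \<Phi> M z \<noteq> 0 \<Longrightarrow> 0 \<le> z $ i \<and> z $ i \<le> 1"
    and small: "\<And>\<epsilon>. \<epsilon> > 0 \<Longrightarrow> \<exists>M0. \<forall>M\<ge>M0. \<forall>z. \<Phi> M z \<noteq> 0 \<longrightarrow> (\<forall>i. 0 \<le> z $ i \<and> z $ i \<le> \<epsilon>)"
    and v_def: "\<And>M x. v M x = (\<integral>y. \<Phi> M (y - x) *\<^sub>R u y \<partial>lborel)"
    and \<mu>: "0 < \<mu>" "\<mu> < 1" and v0: "\<And>x. cmod (v 0 x) \<le> E"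
    and v_Suc: "\<And>M x. cmod (v (Suc M) x - v M x) \<le> E * \<mu> ^ Suc M"
  shows "AE x in lborel. (\<lambda>M. v M x) \<longlonglongrightarrow> u x"
proof -
  have E: "E \<ge> 0" using v0[of 0] norm_ge_zero order_trans by blast
  have [measurable]: "\<Phi> M \<in> borel_measurable borel" for M by (intro borel_measurable_continuous_onI cont)
  have [measurable]: "v M \<in> borel_measurable borel" for M
    unfolding v_def[abs_def] by measurable
  have v_eq: "v M x = v 0 x + (\<Sum>m<M. v (Suc m) x - v m x)" for M x
    by (simp add: sum_lessThan_telescope[of "\<lambda>m. v m x"])
  have summable: "summable (\<lambda>m. v (Suc m) x - v m x)" for x
    by (rule summable_comparison_test'[where N = 0, OF _ v_Suc])
      (use \<mu> in \<open>auto intro!: summable_mult summable_geometric simp: summable_Suc_iff\<close>)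
  define w where "w x = v 0 x + (\<Sum>m. v (Suc m) x - v m x)" for x
  have lim: "(\<lambda>M. v M x) \<longlonglongrightarrow> w x" for x
  proof -
    have "(\<lambda>M. v 0 x + (\<Sum>m<M. v (Suc m) x - v m x)) \<longlonglongrightarrow> w x"
      unfolding w_def by (intro tendsto_add tendsto_const summable_LIMSEQ summable)
    then show ?thesis by (simp only: v_eq[symmetric])
  qed
  have [measurable]: "w \<in> borel_measurable borel" using lim by (rule borel_measurable_LIMSEQ_metric[rotated]) measurable
  have v_bound: "cmod (v M x) \<le> E / (1 - \<mu>)" for M x
  proof -
    have "cmod (v M x) \<le> cmod (v 0 x) + (\<Sum>m<M. cmod (v (Suc m) x - v m x))"
      unfolding v_eq[of M x] by (intro order_trans[OF norm_triangle_ineq] add_left_mono norm_sum)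
    also have "\<dots> \<le> E * \<mu> ^ 0 + (\<Sum>m<M. E * \<mu> ^ Suc m)"
      using v0[of x] v_Suc by (intro add_mono sum_mono) auto
    also have "\<dots> = E * (\<Sum>m<Suc M. \<mu> ^ m)"
      unfolding sum.lessThan_Suc_shift by (simp add: distrib_left sum_distrib_left)
    also have "\<dots> \<le> E * (1 / (1 - \<mu>))"
    proof (rule mult_left_mono[OF _ E])
      have "(\<Sum>m<Suc M. \<mu> ^ m) \<le> (\<Sum>m. \<mu> ^ m)" using \<mu> by (intro sum_le_suminf summable_geometric) auto
      then show "(\<Sum>m<Suc M. \<mu> ^ m) \<le> 1 / (1 - \<mu>)" using \<mu> by (simp add: suminf_geometric)
    qed
    finally show ?thesis by simp
  qed
  have w_bound: "cmod (w x) \<le> E / (1 - \<mu>)" for x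
    by (rule LIMSEQ_le_const2[OF tendsto_norm[OF lim]]) (use v_bound in blast)
  have box_fin: "emeasure lborel (box a b) < \<infinity>" for a b :: "real ^ 'n"
    by (rule emeasure_lborel_box_finite)
  have w_int: "set_integrable lborel (box a b) w" for a b :: "real ^ 'n"
    unfolding set_integrable_def
    by (rule Bochner_Integration.integrable_bound[of _ "\<lambda>x. indicator (box a b) x *\<^sub>R (E / (1 - \<mu>))"])
      (use E \<mu> box_fin in \<open>auto intro!: w_bound split: split_indicator\<close>)
  have u_int: "set_integrable lborel (box a b) u" for a b :: "real ^ 'n"
    by (rule set_integrable_subset[OF loc[of a b]]) (simp_all add: box_subset_cbox)
  have box_eq: "(LINT x:box a b|lborel. w x) = (LINT x:box a b|lborel. u x)" for a b :: "real ^ 'n"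
  proof -
    let ?I = "indicator (box a b) :: real ^ 'n \<Rightarrow> real"
    let ?Q = "cbox a (b + (\<chi> i. 1)) :: (real ^ 'n) set"
    define \<beta> where "\<beta> M y = (\<integral>x. ?I x * \<Phi> M (y - x) \<partial>lborel)" for M y
    have \<beta>_int: "integrable lborel (\<lambda>x. ?I x * \<Phi> M (y - x))" for M y
      using integrable_mult_indicator[OF _ integrable_reflect[OF int(1)], of "box a b" M y] by simp
    have \<beta>_abs: "(\<integral>x. norm (?I x * \<Phi> M (y - x)) \<partial>lborel) \<le> indicator ?Q y * A" for M y
    proof (cases "y \<in> ?Q")
      case True
      have "(\<integral>x. norm (?I x * \<Phi> M (y - x)) \<partial>lborel) \<le> (\<integral>x. \<bar>\<Phi> M (y - x)\<bar> \<partial>lborel)"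
        by (rule integral_mono) (auto intro!: integrable_norm \<beta>_int integrable_reflect[OF integrable_abs[OF int(1)]] split: split_indicator
            simp del: real_norm_def simp: real_norm_def)
      also have "\<dots> = (\<integral>x. \<bar>\<Phi> M x\<bar> \<partial>lborel)" by (rule integral_reflect[OF integrable_abs[OF int(1)]])
      also have "\<dots> \<le> A" by (rule int(3))
      finally show ?thesis using True by simp
    next
      case False
      have "?I x * \<Phi> M (y - x) = 0" for x
      proof (rule ccontr)
        assume "?I x * \<Phi> M (y - x) \<noteq> 0"
        then have x: "x \<in> box a b" and nz: "\<Phi> M (y - x) \<noteq> 0" by (auto split: split_indicator_asm)
        have "a $ i \<le> y $ i \<and> y $ i \<le> b $ i + 1" for i
          using x unit[OF nz, of i] by (auto simp: mem_box_cart dest!: spec[of _ i])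
        then show False using False by (simp add: mem_box_cart)
      qed
      then have "(\<lambda>x. norm (?I x * \<Phi> M (y - x))) = (\<lambda>x. 0)" by (simp only: norm_zero)
      then show ?thesis using False by (simp only: Bochner_Integration.integral_zero indicator_simps) simp
    qed
    have \<beta>_norm: "norm (\<beta> M y) \<le> indicator ?Q y * A" for M y
      unfolding \<beta>_def by (rule order_trans[OF integral_norm_bound \<beta>_abs])
    have \<beta>_lim: "(\<lambda>M. \<beta> M y) \<longlonglongrightarrow> ?I y" if y: "y \<notin> cbox a b - box a b" for y
    proof (cases "y \<in> box a b")
      case True
      have "\<exists>\<epsilon>>0. \<forall>i. y $ i - \<epsilon> > a $ i"
      proof -
        define d where "d = Min (range (\<lambda>i. y $ i - a $ i))"
        have d0: "d > 0" unfolding d_def using True by (subst Min_gr_iff) (auto simp: mem_box_cart)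
        have "d \<le> y $ i - a $ i" for i unfolding d_def by (rule Min_le) auto
        then have "y $ i - d / 2 > a $ i" for i using d0 by (smt (verit) field_sum_of_halves)
        then show ?thesis using d0 by (intro exI[of _ "d / 2"]) simp
      qed
      then obtain \<epsilon> where \<epsilon>: "\<epsilon> > 0" "\<And>i. y $ i - \<epsilon> > a $ i" by blast
      obtain M0 where M0: "\<And>M z i. M0 \<le> M \<Longrightarrow> \<Phi> M z \<noteq> 0 \<Longrightarrow> 0 \<le> z $ i \<and> z $ i \<le> \<epsilon>" using small[OF \<epsilon>(1)] by blast
      have "\<beta> M y = 1" if M: "M0 \<le> M" for M
      proof -
        have "?I x * \<Phi> M (y - x) = \<Phi> M (y - x)" for x
        proof (cases "\<Phi> M (y - x) = 0")
          case False
          have "a $ i < x $ i \<and> x $ i < b $ i" for i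
          proof -
            have "0 \<le> y $ i - x $ i" "y $ i - x $ i \<le> \<epsilon>" using M0[OF M False, of i] by auto
            moreover have "y $ i < b $ i" using True by (simp add: mem_box_cart)
            ultimately show ?thesis using \<epsilon>(2)[of i] by linarith
          qed
          then show ?thesis by (simp add: mem_box_cart)
        qed simp
        then have "\<beta> M y = (\<integral>x. \<Phi> M (y - x) \<partial>lborel)" unfolding \<beta>_def by (simp only:)
        then show ?thesis by (simp only: integral_reflect[OF int(1)] int(2))
      qed
      then have "\<forall>\<^sub>F M in sequentially. \<beta> M y = ?I y" using True by (auto simp: eventually_sequentially)
      then show ?thesis by (rule tendsto_eventually)
    next
      case False
      then have "y \<notin> cbox a b" using y by auto
      then obtain i where i: "y $ i < a $ i \<or> b $ i < y $ i" by (auto simp: mem_box_cart not_le)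
      obtain \<epsilon> where \<epsilon>: "\<epsilon> > 0" "b $ i < y $ i \<Longrightarrow> \<epsilon> < y $ i - b $ i"
      proof (cases "b $ i < y $ i")
        case True
        then have "(y $ i - b $ i) / 2 > 0" "(y $ i - b $ i) / 2 < y $ i - b $ i" by simp_all
        then show ?thesis by (rule that)
      qed (use that[of 1] in auto)
      obtain M0 where M0: "\<And>M z i. M0 \<le> M \<Longrightarrow> \<Phi> M z \<noteq> 0 \<Longrightarrow> 0 \<le> z $ i \<and> z $ i \<le> \<epsilon>" using small[OF \<epsilon>(1)] by blast
      have "\<beta> M y = 0" if M: "M0 \<le> M" for M
      proof -
        have "?I x * \<Phi> M (y - x) = 0" for x
        proof (rule ccontr)
          assume "?I x * \<Phi> M (y - x) \<noteq> 0"
          then have x: "x \<in> box a b" and nz: "\<Phi> M (y - x) \<noteq> 0" by (auto split: split_indicator_asm)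
          have "0 \<le> y $ i - x $ i" "y $ i - x $ i \<le> \<epsilon>" using M0[OF M nz, of i] by auto
          moreover have "a $ i < x $ i" "x $ i < b $ i" using x by (auto simp: mem_box_cart)
          ultimately show False using i \<epsilon>(2) by linarith
        qed
        then show ?thesis unfolding \<beta>_def by (simp only: Bochner_Integration.integral_zero)
      qed
      then have "\<forall>\<^sub>F M in sequentially. \<beta> M y = ?I y" using False by (auto simp: eventually_sequentially)
      then show ?thesis by (rule tendsto_eventually)
    qed
    have [measurable]: "\<beta> M \<in> borel_measurable borel" for M unfolding \<beta>_def[abs_def] by measurable
    have Qu: "integrable lborel (\<lambda>y. indicator ?Q y *\<^sub>R u y)"
      using loc[of a "b + (\<chi> i. 1)"] by (simp add: set_integrable_def)
    have fubini: "(LINT x:box a b|lborel. v M x) = (\<integral>y. \<beta> M y *\<^sub>R u y \<partial>lborel)" for M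
    proof -
      have prod: "integrable (lborel \<Otimes>\<^sub>M lborel) (\<lambda>(y, x). (?I x * \<Phi> M (y - x)) *\<^sub>R u y)"
      proof (rule lborel_pair.Fubini_integrable)
        show "integrable lborel (\<lambda>y. \<integral>x. norm (case (y, x) of (y, x) \<Rightarrow> (?I x * \<Phi> M (y - x)) *\<^sub>R u y) \<partial>lborel)"
        proof (rule Bochner_Integration.integrable_bound)
          show "integrable lborel (\<lambda>y. A * norm (indicator ?Q y *\<^sub>R u y))"
            using integrable_norm[OF Qu] by (rule integrable_mult_right)
          show "(\<lambda>y. \<integral>x. norm (case (y, x) of (y, x) \<Rightarrow> (?I x * \<Phi> M (y - x)) *\<^sub>R u y) \<partial>lborel) \<in> borel_measurable lborel"
            by measurable
          show "AE y in lborel. norm (\<integral>x. norm (case (y, x) of (y, x) \<Rightarrow> (?I x * \<Phi> M (y - x)) *\<^sub>R u y) \<partial>lborel) \<le> norm (A * norm (indicator ?Q y *\<^sub>R u y))"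
          proof (rule AE_I2)
            fix y
            have "(\<integral>x. norm (case (y, x) of (y, x) \<Rightarrow> (?I x * \<Phi> M (y - x)) *\<^sub>R u y) \<partial>lborel) = (\<integral>x. norm (?I x * \<Phi> M (y - x)) \<partial>lborel) * norm (u y)"
              unfolding prod.case norm_scaleR real_norm_def by simp
            also have "\<dots> \<le> indicator ?Q y * A * norm (u y)" by (intro mult_right_mono \<beta>_abs) simp
            also have "\<dots> = A * norm (indicator ?Q y *\<^sub>R u y)" by (simp split: split_indicator)
            finally have le: "(\<integral>x. norm (case (y, x) of (y, x) \<Rightarrow> (?I x * \<Phi> M (y - x)) *\<^sub>R u y) \<partial>lborel) \<le> A * norm (indicator ?Q y *\<^sub>R u y)" .
            have "0 \<le> (\<integral>x. norm (case (y, x) of (y, x) \<Rightarrow> (?I x * \<Phi> M (y - x)) *\<^sub>R u y) \<partial>lborel)"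
              by (rule Bochner_Integration.integral_nonneg) simp
            with le show "norm (\<integral>x. norm (case (y, x) of (y, x) \<Rightarrow> (?I x * \<Phi> M (y - x)) *\<^sub>R u y) \<partial>lborel) \<le> norm (A * norm (indicator ?Q y *\<^sub>R u y))"
              unfolding real_norm_def by linarith
          qed
        qed
        show "AE y in lborel. integrable lborel (\<lambda>x. case (y, x) of (y, x) \<Rightarrow> (?I x * \<Phi> M (y - x)) *\<^sub>R u y)"
          unfolding prod.case by (intro AE_I2 integrable_scaleR_left \<beta>_int)
      qed measurable
      have "(LINT x:box a b|lborel. v M x) = (\<integral>x. (\<integral>y. (?I x * \<Phi> M (y - x)) *\<^sub>R u y \<partial>lborel) \<partial>lborel)"
        unfolding set_lebesgue_integral_def v_def by (simp flip: scaleR_scaleR)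
      also have "\<dots> = (\<integral>y. (\<integral>x. (?I x * \<Phi> M (y - x)) *\<^sub>R u y \<partial>lborel) \<partial>lborel)"
        using prod by (rule lborel_pair.Fubini_integral)
      also have "\<dots> = (\<integral>y. \<beta> M y *\<^sub>R u y \<partial>lborel)"
        unfolding \<beta>_def by (intro Bochner_Integration.integral_cong refl integral_scaleR_left \<beta>_int)
      finally show ?thesis .
    qed
    have "(\<lambda>M. LINT x:box a b|lborel. v M x) \<longlonglongrightarrow> (LINT x:box a b|lborel. u x)"
      unfolding fubini unfolding set_lebesgue_integral_def
    proof (rule integral_dominated_convergence)
      show "integrable lborel (\<lambda>y. A * norm (indicator ?Q y *\<^sub>R u y))"
        using integrable_norm[OF Qu] by (rule integrable_mult_right)
      have "AE y in lborel. y \<notin> cbox a b - box a b"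
      proof (rule AE_not_in)
        show "cbox a b - box a b \<in> null_sets lborel"
          using box_fin[of a b] by (intro null_setsI) (auto simp: emeasure_Diff emeasure_lborel_box_eq emeasure_lborel_cbox_eq box_subset_cbox)
      qed
      then show "AE y in lborel. (\<lambda>M. \<beta> M y *\<^sub>R u y) \<longlonglongrightarrow> ?I y *\<^sub>R u y"
        by eventually_elim (intro tendsto_scaleR tendsto_const \<beta>_lim)
      show "AE y in lborel. norm (\<beta> M y *\<^sub>R u y) \<le> A * norm (indicator ?Q y *\<^sub>R u y)" for M
      proof (rule AE_I2)
        fix y
        have "norm (\<beta> M y *\<^sub>R u y) \<le> indicator ?Q y * A * norm (u y)"
          unfolding norm_scaleR using \<beta>_norm[of M y] by (intro mult_right_mono) auto
        also have "indicator ?Q y * A * norm (u y) = A * norm (indicator ?Q y *\<^sub>R u y)" by (simp split: split_indicator)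
        finally show "norm (\<beta> M y *\<^sub>R u y) \<le> A * norm (indicator ?Q y *\<^sub>R u y)" .
      qed
    qed measurable
    moreover have "(\<lambda>M. LINT x:box a b|lborel. v M x) \<longlonglongrightarrow> (LINT x:box a b|lborel. w x)"
      unfolding set_lebesgue_integral_def
    proof (rule integral_dominated_convergence)
      show "integrable lborel (\<lambda>x. ?I x *\<^sub>R (E / (1 - \<mu>)))"
        using box_fin by (intro integrable_scaleR_left integrable_real_indicator) auto
      show "AE x in lborel. (\<lambda>M. ?I x *\<^sub>R v M x) \<longlonglongrightarrow> ?I x *\<^sub>R w x"
        by (intro AE_I2 tendsto_scaleR tendsto_const lim)
      show "AE x in lborel. norm (?I x *\<^sub>R v M x) \<le> ?I x *\<^sub>R (E / (1 - \<mu>))" for M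
        using v_bound by (auto split: split_indicator)
    qed measurable
    ultimately show ?thesis by (rule LIMSEQ_unique[rotated])
  qed
  have "AE x in lborel. w x - u x = 0"
  proof (rule AE_eq_0_if_box_integrals_eq_0)
    show "set_integrable lborel (box a b) (\<lambda>x. w x - u x)" for a b :: "real ^ 'n"
      by (rule set_integral_diff(1)[OF w_int u_int])
    show "(LINT x:box a b|lborel. w x - u x) = 0" for a b :: "real ^ 'n"
      using set_integral_diff(2)[OF w_int u_int, of a b] box_eq[of a b] by simp
  qed measurable
  then show ?thesis
  proof eventually_elim
    case (elim x)
    then show ?case using lim[of x] by simp
  qed
qed


section \<open>Symbols with square integrable derivatives\<close>

text \<open>Product measurability and Tonelli are used for \<open>lborel\<close>, hence the Lebesgue measurable symbols and derivatives are replaced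
  by Borel measurable representatives.\<close>

lemma ex_borel_representative:
  fixes f :: "'a::euclidean_space \<Rightarrow> complex"
  assumes "f \<in> borel_measurable lebesgue"
  shows "\<exists>f'\<in>borel_measurable borel. AE x in lborel. f x = f' x"
proof -
  have "(\<lambda>x. Re (f x)) \<in> borel_measurable (completion lborel)" "(\<lambda>x. Im (f x)) \<in> borel_measurable (completion lborel)"
    using assms by measurable
  then obtain r i where [measurable]: "r \<in> borel_measurable lborel" "i \<in> borel_measurable lborel"
    and ae: "AE x in lborel. Re (f x) = r x" "AE x in lborel. Im (f x) = i x"
    using completion_ex_borel_measurable_real[of "\<lambda>x. Re (f x)" lborel]
      completion_ex_borel_measurable_real[of "\<lambda>x. Im (f x)" lborel] by metis
  show ?thesis
  proof (rule bexI[of _ "\<lambda>x. Complex (r x) (i x)"])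
    show "AE x in lborel. f x = Complex (r x) (i x)"
      using ae by eventually_elim (simp add: complex_eq_iff)
    have "(\<lambda>x. complex_of_real (r x) + \<i> * complex_of_real (i x)) \<in> borel_measurable borel" by measurable
    then show "(\<lambda>x. Complex (r x) (i x)) \<in> borel_measurable borel" by (simp add: Complex_eq)
  qed
qed

lemma AE_lebesgue_iff: "(AE x in lebesgue. P x) \<longleftrightarrow> (AE x in lborel. P x)"
  by (rule AE_completion_iff)

lemma borel_representative_integrals:
  fixes f f' h :: "'a::euclidean_space \<Rightarrow> complex"
  assumes f: "f \<in> borel_measurable lebesgue" and f' [measurable]: "f' \<in> borel_measurable borel"
    and ae: "AE x in lborel. f x = f' x" and h [measurable]: "h \<in> borel_measurable borel"
  shows "(\<integral>x. f x * h x \<partial>lebesgue) = (\<integral>x. f' x * h x \<partial>lborel)"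
proof -
  have h': "h \<in> borel_measurable lebesgue" "f' \<in> borel_measurable lebesgue" by (simp_all add: measurable_completion)
  have "(\<integral>x. f x * h x \<partial>lebesgue) = (\<integral>x. f' x * h x \<partial>lebesgue)"
    using f h' ae by (intro integral_cong_AE) (auto simp: AE_lebesgue_iff)
  also have "\<dots> = (\<integral>x. f' x * h x \<partial>lborel)" by (rule integral_completion) measurable
  finally show ?thesis .
qed

text \<open>Cauchy--Schwarz in \<open>y\<close> decouples the symbol variable from \<open>x\<close>, after which orthonormality of the Hermite
  polynomials can be used for each fixed \<open>y\<close>.\<close>

lemma kernel_paired_symbol_bound:
  fixes g :: "nat ^ 'n \<Rightarrow> real ^ 'n \<Rightarrow> complex" and \<kappa> :: "real ^ 'n \<Rightarrow> real" and c :: "nat ^ 'n \<Rightarrow> complex"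
  assumes g [measurable]: "\<And>\<xi>. g \<xi> \<in> borel_measurable borel"
    and g_int: "\<And>\<xi>. integrable lborel (\<lambda>y. (cmod (g \<xi> y))\<^sup>2)"
    and g_L2: "\<And>\<xi>. (\<integral>\<^sup>+y. ennreal ((cmod (g \<xi> y))\<^sup>2) \<partial>lborel) \<le> ennreal L"
    and \<kappa> [measurable]: "\<kappa> \<in> borel_measurable borel" and \<kappa>_L2: "(\<integral>\<^sup>+z. ennreal ((\<kappa> z)\<^sup>2) \<partial>lborel) \<le> ennreal D"
    and nonneg: "L \<ge> 0" "D \<ge> 0" and S: "finite S"
  shows "(\<integral>\<^sup>+x. ennreal ((cmod (\<Sum>\<xi>\<in>S. c \<xi> * (\<integral>y. g \<xi> y * \<kappa> (y - x) \<partial>lborel) * hn \<xi> x))\<^sup>2) \<partial>gauss_measure)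
    \<le> ennreal (D * (L * (\<Sum>\<xi>\<in>S. (cmod (c \<xi>))\<^sup>2)))"
proof -
  define \<Gamma> where "\<Gamma> x y = (\<Sum>\<xi>\<in>S. c \<xi> * g \<xi> y * hn \<xi> x)" for x y
  have \<kappa>_shift: "(\<integral>\<^sup>+y. ennreal ((\<kappa> (y - x))\<^sup>2) \<partial>lborel) \<le> ennreal D" for x
    using nn_integral_translate[of "\<lambda>z. ennreal ((\<kappa> z)\<^sup>2)" x] \<kappa>_L2 by simp
  have int: "integrable lborel (\<lambda>y. g \<xi> y * complex_of_real (\<kappa> (y - x)))" for \<xi> x
  proof (rule integrable_L2_mult)
    show "integrable lborel (\<lambda>y. (cmod (complex_of_real (\<kappa> (y - x))))\<^sup>2)"
      by (rule integrableI_bounded) (use \<kappa>_shift[of x] in \<open>auto simp: less_top[symmetric] top_unique\<close>)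
  qed (auto intro: g_int)
  have pointwise: "ennreal ((cmod (\<Sum>\<xi>\<in>S. c \<xi> * (\<integral>y. g \<xi> y * \<kappa> (y - x) \<partial>lborel) * hn \<xi> x))\<^sup>2)
     \<le> ennreal D * (\<integral>\<^sup>+y. ennreal ((cmod (\<Gamma> x y))\<^sup>2) \<partial>lborel)" for x
  proof -
    have [measurable]: "\<Gamma> x \<in> borel_measurable borel" unfolding \<Gamma>_def[abs_def] by measurable
    have eq: "\<Gamma> x y * complex_of_real (\<kappa> (y - x)) = (\<Sum>\<xi>\<in>S. (c \<xi> * hn \<xi> x) * (g \<xi> y * \<kappa> (y - x)))" for y
      unfolding \<Gamma>_def sum_distrib_right by (simp add: mult_ac)
    have int\<Gamma>: "integrable lborel (\<lambda>y. \<Gamma> x y * complex_of_real (\<kappa> (y - x)))"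
      unfolding eq by (intro Bochner_Integration.integrable_sum integrable_mult_right int)
    have "(\<integral>y. \<Gamma> x y * complex_of_real (\<kappa> (y - x)) \<partial>lborel) = (\<Sum>\<xi>\<in>S. \<integral>y. (c \<xi> * hn \<xi> x) * (g \<xi> y * \<kappa> (y - x)) \<partial>lborel)"
      unfolding eq by (intro Bochner_Integration.integral_sum integrable_mult_right int)
    also have "\<dots> = (\<Sum>\<xi>\<in>S. c \<xi> * (\<integral>y. g \<xi> y * \<kappa> (y - x) \<partial>lborel) * hn \<xi> x)"
    proof (intro sum.cong refl)
      fix \<xi>
      have "(\<integral>y. (c \<xi> * hn \<xi> x) * (g \<xi> y * \<kappa> (y - x)) \<partial>lborel) = (c \<xi> * hn \<xi> x) * (\<integral>y. g \<xi> y * \<kappa> (y - x) \<partial>lborel)"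
        by (rule integral_mult_right_zero)
      then show "(\<integral>y. (c \<xi> * hn \<xi> x) * (g \<xi> y * \<kappa> (y - x)) \<partial>lborel) = c \<xi> * (\<integral>y. g \<xi> y * \<kappa> (y - x) \<partial>lborel) * hn \<xi> x"
        by (simp only: mult.assoc mult.commute[of "complex_of_real (hn \<xi> x)"])
    qed
    finally have "ennreal (cmod (\<Sum>\<xi>\<in>S. c \<xi> * (\<integral>y. g \<xi> y * \<kappa> (y - x) \<partial>lborel) * hn \<xi> x)) \<le> (\<integral>\<^sup>+y. ennreal (cmod (\<Gamma> x y * complex_of_real (\<kappa> (y - x)))) \<partial>lborel)"
      using integral_norm_bound_ennreal[OF int\<Gamma>] by simp
    also have "\<dots> = (\<integral>\<^sup>+y. ennreal \<bar>\<kappa> (y - x)\<bar> * ennreal (cmod (\<Gamma> x y)) \<partial>lborel)"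
      by (simp add: norm_mult ennreal_mult[symmetric] mult.commute)
    finally have "(ennreal (cmod (\<Sum>\<xi>\<in>S. c \<xi> * (\<integral>y. g \<xi> y * \<kappa> (y - x) \<partial>lborel) * hn \<xi> x)))\<^sup>2 \<le> \<dots>\<^sup>2"
      by (rule power_mono) simp
    also have "\<dots> \<le> (\<integral>\<^sup>+y. (ennreal \<bar>\<kappa> (y - x)\<bar>)\<^sup>2 \<partial>lborel) * (\<integral>\<^sup>+y. (ennreal (cmod (\<Gamma> x y)))\<^sup>2 \<partial>lborel)"
      by (rule Cauchy_Schwarz_nn_integral) auto
    also have "\<dots> \<le> ennreal D * (\<integral>\<^sup>+y. ennreal ((cmod (\<Gamma> x y))\<^sup>2) \<partial>lborel)"
      using \<kappa>_shift[of x] by (intro mult_mono) (auto simp: ennreal_power)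
    finally show ?thesis by (simp add: ennreal_power)
  qed
  have [measurable]: "(\<lambda>(x, y). \<Gamma> x y) \<in> borel_measurable (borel \<Otimes>\<^sub>M borel)"
    unfolding \<Gamma>_def by measurable
  have "(\<integral>\<^sup>+x. ennreal ((cmod (\<Sum>\<xi>\<in>S. c \<xi> * (\<integral>y. g \<xi> y * \<kappa> (y - x) \<partial>lborel) * hn \<xi> x))\<^sup>2) \<partial>gauss_measure)
    \<le> (\<integral>\<^sup>+x. ennreal D * (\<integral>\<^sup>+y. ennreal ((cmod (\<Gamma> x y))\<^sup>2) \<partial>lborel) \<partial>gauss_measure)"
    by (intro nn_integral_mono pointwise)
  also have "\<dots> = (\<integral>\<^sup>+x. ennreal (gauss_density x) * (ennreal D * (\<integral>\<^sup>+y. ennreal ((cmod (\<Gamma> x y))\<^sup>2) \<partial>lborel)) \<partial>lborel)"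
    by (rule nn_integral_gauss_lborel) measurable
  also have "\<dots> = ennreal D * (\<integral>\<^sup>+x. (\<integral>\<^sup>+y. ennreal (gauss_density x) * ennreal ((cmod (\<Gamma> x y))\<^sup>2) \<partial>lborel) \<partial>lborel)"
    by (simp add: nn_integral_cmult mult.left_commute)
  also have "(\<integral>\<^sup>+x. (\<integral>\<^sup>+y. ennreal (gauss_density x) * ennreal ((cmod (\<Gamma> x y))\<^sup>2) \<partial>lborel) \<partial>lborel)
     = (\<integral>\<^sup>+y. (\<integral>\<^sup>+x. ennreal (gauss_density x) * ennreal ((cmod (\<Gamma> x y))\<^sup>2) \<partial>lborel) \<partial>lborel)"
    by (rule lborel_pair.Fubini'[symmetric]) measurable
  also have "\<dots> = (\<integral>\<^sup>+y. (\<Sum>\<xi>\<in>S. ennreal ((cmod (c \<xi>))\<^sup>2) * ennreal ((cmod (g \<xi> y))\<^sup>2)) \<partial>lborel)"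
  proof (rule nn_integral_cong)
    fix y
    have "(\<integral>\<^sup>+x. ennreal (gauss_density x) * ennreal ((cmod (\<Gamma> x y))\<^sup>2) \<partial>lborel) = (\<integral>\<^sup>+x. ennreal ((cmod (\<Gamma> x y))\<^sup>2) \<partial>gauss_measure)"
      by (rule nn_integral_gauss_lborel[symmetric]) measurable
    also have "\<dots> = ennreal (\<Sum>\<xi>\<in>S. (cmod (c \<xi> * g \<xi> y))\<^sup>2)"
      unfolding \<Gamma>_def using nn_integral_hn_sum[OF S, of "\<lambda>\<xi>. \<xi>" "\<lambda>\<xi>. c \<xi> * g \<xi> y"] by (simp add: inj_on_def)
    also have "\<dots> = (\<Sum>\<xi>\<in>S. ennreal ((cmod (c \<xi>))\<^sup>2) * ennreal ((cmod (g \<xi> y))\<^sup>2))"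
      by (simp add: norm_mult power_mult_distrib ennreal_mult[symmetric])
    finally show "(\<integral>\<^sup>+x. ennreal (gauss_density x) * ennreal ((cmod (\<Gamma> x y))\<^sup>2) \<partial>lborel) = (\<Sum>\<xi>\<in>S. ennreal ((cmod (c \<xi>))\<^sup>2) * ennreal ((cmod (g \<xi> y))\<^sup>2))" .
  qed
  also have "\<dots> = (\<Sum>\<xi>\<in>S. ennreal ((cmod (c \<xi>))\<^sup>2) * (\<integral>\<^sup>+y. ennreal ((cmod (g \<xi> y))\<^sup>2) \<partial>lborel))"
    by (simp add: nn_integral_sum nn_integral_cmult)
  also have "\<dots> \<le> (\<Sum>\<xi>\<in>S. ennreal ((cmod (c \<xi>))\<^sup>2) * ennreal L)"
    by (intro sum_mono mult_left_mono g_L2) simp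
  also have "\<dots> = ennreal (L * (\<Sum>\<xi>\<in>S. (cmod (c \<xi>))\<^sup>2))"
    using nonneg by (simp add: ennreal_mult[symmetric] sum_distrib_left mult.commute)
  also have "ennreal D * \<dots> = ennreal (D * (L * (\<Sum>\<xi>\<in>S. (cmod (c \<xi>))\<^sup>2)))"
    using nonneg by (intro ennreal_mult[symmetric]) (auto intro!: mult_nonneg_nonneg sum_nonneg)
  finally show ?thesis by (simp add: mult_left_mono)
qed

text \<open>The kernels write the mollified symbol \<open>v \<xi> M\<close> as a sum of terms \<open>w m \<xi>\<close>, \<open>m \<le> M\<close>, whose Hermite sums have
  geometrically decaying norms. The mollifications converge almost everywhere to the symbol, and Fatou's
  lemma transfers the bound to the limit.\<close>

lemma weakly_differentiable_symbol_bounded: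
  fixes \<sigma> :: "real ^ 'n \<Rightarrow> nat ^ 'n \<Rightarrow> complex"
  assumes s: "CARD('n) < 2 * s"
    and meas: "\<And>\<xi>. (\<lambda>x. \<sigma> x \<xi>) \<in> borel_measurable lebesgue"
    and weak: "\<And>\<nu>. mi_abs \<nu> \<le> s \<Longrightarrow> \<exists>C. \<forall>\<xi>. \<exists>g. is_weak_partial \<nu> (\<lambda>x. \<sigma> x \<xi>) g \<and> in_L2 lebesgue g \<and> L2_norm lebesgue g \<le> C"
  shows "bounded_on_hermite_sums \<sigma>"
proof -
  obtain \<Phi> \<kappa> :: "nat \<Rightarrow> real ^ 'n \<Rightarrow> real" and \<nu> A D \<mu> where \<mu>: "0 < \<mu>" "\<mu> < 1" and D: "D \<ge> 0"
    and test: "\<forall>m x. test_function (\<lambda>y. complex_of_real (\<kappa> m (y - x)))"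
    and \<nu>: "\<forall>m. \<nu> m = 0 \<or> (\<exists>i. \<nu> m = axis i s)"
    and sum: "\<forall>M x y. complex_of_real (\<Phi> M (y - x)) = (\<Sum>m\<le>M. partial_mi (\<nu> m) (\<lambda>y. complex_of_real (\<kappa> m (y - x))) y)"
    and \<kappa>_L2: "\<forall>m. (\<integral>\<^sup>+z. ennreal ((\<kappa> m z)\<^sup>2) \<partial>lborel) \<le> ennreal (D * (\<mu> ^ m)\<^sup>2)"
    and cont: "\<forall>m. continuous_on UNIV (\<Phi> m) \<and> continuous_on UNIV (\<kappa> m)"
    and \<Phi>_int: "\<forall>M. integrable lborel (\<Phi> M) \<and> (\<integral>z. \<Phi> M z \<partial>lborel) = 1 \<and> (\<integral>z. \<bar>\<Phi> M z\<bar> \<partial>lborel) \<le> A"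
    and unit: "\<forall>M z. \<Phi> M z \<noteq> 0 \<longrightarrow> (\<forall>i. 0 \<le> z $ i \<and> z $ i \<le> 1)"
    and small: "\<forall>\<epsilon>>0. \<exists>M0. \<forall>M\<ge>M0. \<forall>z. \<Phi> M z \<noteq> 0 \<longrightarrow> (\<forall>i. 0 \<le> z $ i \<and> z $ i \<le> \<epsilon>)"
    using ex_sobolev_kernels[OF s] by (elim exE conjE)
  have [measurable]: "\<Phi> M \<in> borel_measurable borel" "\<kappa> M \<in> borel_measurable borel" for M
    using cont by (auto intro: borel_measurable_continuous_onI)
  define N where "N = insert 0 (range (\<lambda>i :: 'n. axis i s))"
  have N: "finite N" "\<nu> m \<in> N" for m using \<nu> by (auto simp: N_def)
  have "\<exists>C. \<forall>\<xi>. \<exists>g. is_weak_partial n (\<lambda>x. \<sigma> x \<xi>) g \<and> in_L2 lebesgue g \<and> L2_norm lebesgue g \<le> C" if "n \<in> N" for n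
  proof (rule weak)
    have "mi_abs (0 :: nat ^ 'n) = 0" by (simp add: mi_abs_def)
    then show "mi_abs n \<le> s" using that by (auto simp: N_def)
  qed
  then have "\<forall>n. \<exists>C. n \<in> N \<longrightarrow> (\<forall>\<xi>. \<exists>g. is_weak_partial n (\<lambda>x. \<sigma> x \<xi>) g \<and> in_L2 lebesgue g \<and> L2_norm lebesgue g \<le> C)" by blast
  then obtain Cn where Cn: "\<And>n. n \<in> N \<Longrightarrow> \<forall>\<xi>. \<exists>g. is_weak_partial n (\<lambda>x. \<sigma> x \<xi>) g \<and> in_L2 lebesgue g \<and> L2_norm lebesgue g \<le> Cn n" by metis
  define L where "L = (\<Sum>n\<in>N. \<bar>Cn n\<bar>)"
  have L: "L \<ge> 0" by (simp add: L_def sum_nonneg)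
  have Cn_le: "Cn n \<le> L" if "n \<in> N" for n
    unfolding L_def using member_le_sum[of n N "\<lambda>n. \<bar>Cn n\<bar>"] that N by auto
  have "\<forall>n \<xi>. \<exists>g. n \<in> N \<longrightarrow> is_weak_partial n (\<lambda>x. \<sigma> x \<xi>) g \<and> in_L2 lebesgue g \<and> L2_norm lebesgue g \<le> L"
    using Cn Cn_le order_trans by meson
  then obtain G0 where G0: "\<And>n \<xi>. n \<in> N \<Longrightarrow> is_weak_partial n (\<lambda>x. \<sigma> x \<xi>) (G0 n \<xi>) \<and> in_L2 lebesgue (G0 n \<xi>) \<and> L2_norm lebesgue (G0 n \<xi>) \<le> L" by metis
  have "\<forall>\<xi>. \<exists>u. u \<in> borel_measurable borel \<and> (AE x in lborel. \<sigma> x \<xi> = u x)"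
    using ex_borel_representative[OF meas] by blast
  then obtain u where u [measurable]: "\<And>\<xi>. u \<xi> \<in> borel_measurable borel" and u_ae: "\<And>\<xi>. AE x in lborel. \<sigma> x \<xi> = u \<xi> x" by metis
  have "\<forall>m \<xi>. \<exists>g. g \<in> borel_measurable borel \<and> (AE x in lborel. G0 (\<nu> m) \<xi> x = g x)"
    using ex_borel_representative G0 N(2) unfolding in_L2_def by blast
  then obtain g where g [measurable]: "\<And>m \<xi>. g m \<xi> \<in> borel_measurable borel"
    and g_ae: "\<And>m \<xi>. AE x in lborel. G0 (\<nu> m) \<xi> x = g m \<xi> x" by metis
  have g_sq: "integrable lborel (\<lambda>y. (cmod (g m \<xi> y))\<^sup>2) \<and> (\<integral>\<^sup>+y. ennreal ((cmod (g m \<xi> y))\<^sup>2) \<partial>lborel) \<le> ennreal (L\<^sup>2)" for m \<xi>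
  proof -
    have G: "G0 (\<nu> m) \<xi> \<in> borel_measurable lebesgue" "integrable lebesgue (\<lambda>x. (cmod (G0 (\<nu> m) \<xi> x))\<^sup>2)" "L2_norm lebesgue (G0 (\<nu> m) \<xi>) \<le> L"
      using G0[OF N(2)] by (auto simp: in_L2_def)
    have g': "g m \<xi> \<in> borel_measurable lebesgue" by (simp add: measurable_completion)
    have ae: "AE x in lebesgue. (cmod (G0 (\<nu> m) \<xi> x))\<^sup>2 = (cmod (g m \<xi> x))\<^sup>2"
      unfolding AE_lebesgue_iff using g_ae[of m \<xi>] by eventually_elim simp
    have "integrable lebesgue (\<lambda>y. (cmod (g m \<xi> y))\<^sup>2)"
      using G g' by (intro integrable_cong_AE_imp[OF G(2)] ae) auto
    then have int: "integrable lborel (\<lambda>y. (cmod (g m \<xi> y))\<^sup>2)" by (subst (asm) integrable_completion) auto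
    have "(\<integral>x. (cmod (G0 (\<nu> m) \<xi> x))\<^sup>2 \<partial>lebesgue) = (\<integral>x. (cmod (g m \<xi> x))\<^sup>2 \<partial>lebesgue)"
      using G g' by (intro integral_cong_AE ae) auto
    also have "\<dots> = (\<integral>x. (cmod (g m \<xi> x))\<^sup>2 \<partial>lborel)" by (rule integral_completion) measurable
    finally have "sqrt (\<integral>x. (cmod (g m \<xi> x))\<^sup>2 \<partial>lborel) \<le> L" using G(3) by (simp add: L2_norm_def)
    then have "(\<integral>x. (cmod (g m \<xi> x))\<^sup>2 \<partial>lborel) \<le> L\<^sup>2" by (rule sqrt_le_D)
    then show ?thesis using int by (auto simp: nn_integral_eq_integral intro: ennreal_leI)
  qed
  define v where "v \<xi> M x = (\<integral>y. \<Phi> M (y - x) *\<^sub>R u \<xi> y \<partial>lborel)" for \<xi> M x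
  define w where "w m \<xi> x = (-1) ^ mi_abs (\<nu> m) * (\<integral>y. g m \<xi> y * \<kappa> m (y - x) \<partial>lborel)" for m \<xi> x
  have loc: "set_integrable lborel (cbox a b) (u \<xi>)" for a b \<xi>
  proof -
    have "(\<lambda>x. \<sigma> x \<xi>) absolutely_integrable_on cbox a b"
      using G0[of 0 \<xi>] by (auto simp: is_weak_partial_def locally_integrable_def N_def)
    then have "integrable lebesgue (\<lambda>x. indicator (cbox a b) x *\<^sub>R \<sigma> x \<xi>)" by (simp add: set_integrable_def)
    then have "integrable lebesgue (\<lambda>x. indicator (cbox a b) x *\<^sub>R u \<xi> x)"
    proof (rule integrable_cong_AE_imp)
      show "(\<lambda>x. indicator (cbox a b) x *\<^sub>R u \<xi> x) \<in> borel_measurable lebesgue"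
        by (intro measurable_completion) measurable
      show "AE x in lebesgue. indicator (cbox a b) x *\<^sub>R \<sigma> x \<xi> = indicator (cbox a b) x *\<^sub>R u \<xi> x"
        unfolding AE_lebesgue_iff using u_ae[of \<xi>] by eventually_elim simp
    qed
    then show ?thesis unfolding set_integrable_def by (subst (asm) integrable_completion) auto
  qed
  have \<Phi>u_int: "integrable lborel (\<lambda>y. \<Phi> M (y - x) *\<^sub>R u \<xi> y)" for M x \<xi>
  proof -
    let ?Q = "cbox x (x + (\<chi> i. 1))"
    have "bounded (\<Phi> M ` cbox 0 (\<chi> i. 1))"
      using cont by (intro compact_imp_bounded compact_continuous_image compact_cbox) (auto intro: continuous_on_subset)
    then obtain B where B: "\<And>z. z \<in> cbox 0 (\<chi> i. 1) \<Longrightarrow> \<bar>\<Phi> M z\<bar> \<le> B" by (auto simp: bounded_iff)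
    show ?thesis
    proof (rule Bochner_Integration.integrable_bound)
      show "integrable lborel (\<lambda>y. \<bar>B\<bar> * norm (indicator ?Q y *\<^sub>R u \<xi> y))"
        using loc[of x "x + (\<chi> i. 1)" \<xi>] unfolding set_integrable_def by (intro integrable_mult_right integrable_norm)
      show "AE y in lborel. norm (\<Phi> M (y - x) *\<^sub>R u \<xi> y) \<le> norm (\<bar>B\<bar> * norm (indicator ?Q y *\<^sub>R u \<xi> y))"
      proof (rule AE_I2)
        fix y
        show "norm (\<Phi> M (y - x) *\<^sub>R u \<xi> y) \<le> norm (\<bar>B\<bar> * norm (indicator ?Q y *\<^sub>R u \<xi> y))"
        proof (cases "\<Phi> M (y - x) = 0")
          case False
          have 1: "0 \<le> (y - x) $ i" "(y - x) $ i \<le> 1" for i using unit False by blast+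
          then have "y \<in> ?Q" by (auto simp: mem_box_cart algebra_simps)
          moreover have "\<bar>\<Phi> M (y - x)\<bar> \<le> \<bar>B\<bar>"
            using B[of "y - x"] 1 by (auto simp: mem_box_cart)
          ultimately show ?thesis by (simp add: mult_right_mono)
        qed simp
      qed
    qed measurable
  qed
  \<comment> \<open>The definition of the weak derivative, tested with the translated kernel.\<close>
  have weak_id: "(\<integral>y. u \<xi> y * h y \<partial>lborel) = w m \<xi> x"
    if h: "h \<in> borel_measurable borel" "h = partial_mi (\<nu> m) (\<lambda>y. complex_of_real (\<kappa> m (y - x)))" for h m \<xi> x
  proof -
    have wp: "is_weak_partial (\<nu> m) (\<lambda>x. \<sigma> x \<xi>) (G0 (\<nu> m) \<xi>)" and G: "G0 (\<nu> m) \<xi> \<in> borel_measurable lebesgue"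
      using G0[OF N(2)] by (auto simp: in_L2_def)
    have "(\<integral>y. u \<xi> y * h y \<partial>lborel) = (\<integral>y. \<sigma> y \<xi> * h y \<partial>lebesgue)"
      by (rule borel_representative_integrals[OF meas u u_ae h(1), symmetric])
    also have "\<dots> = (-1) ^ mi_abs (\<nu> m) * (\<integral>y. G0 (\<nu> m) \<xi> y * complex_of_real (\<kappa> m (y - x)) \<partial>lebesgue)"
      using wp test unfolding is_weak_partial_def h(2) by blast
    also have "(\<integral>y. G0 (\<nu> m) \<xi> y * complex_of_real (\<kappa> m (y - x)) \<partial>lebesgue) = (\<integral>y. g m \<xi> y * complex_of_real (\<kappa> m (y - x)) \<partial>lborel)"
      by (rule borel_representative_integrals[OF G g g_ae]) measurable
    finally show ?thesis by (simp add: w_def)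
  qed
  have v_0: "v \<xi> 0 x = w 0 \<xi> x" for \<xi> x
  proof -
    have "(\<lambda>y. complex_of_real (\<Phi> 0 (y - x))) = partial_mi (\<nu> 0) (\<lambda>y. complex_of_real (\<kappa> 0 (y - x)))"
      using sum by (simp add: fun_eq_iff)
    from weak_id[OF _ this, of \<xi>] show ?thesis by (simp add: v_def scaleR_conv_of_real mult.commute)
  qed
  have v_Suc: "v \<xi> (Suc M) x - v \<xi> M x = w (Suc M) \<xi> x" for \<xi> M x
  proof -
    have "(\<lambda>y. complex_of_real (\<Phi> (Suc M) (y - x)) - complex_of_real (\<Phi> M (y - x))) = partial_mi (\<nu> (Suc M)) (\<lambda>y. complex_of_real (\<kappa> (Suc M) (y - x)))"
      by (simp only: sum sum.atMost_Suc add_diff_cancel_left')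
    from weak_id[OF _ this, of \<xi>]
    have "(\<integral>y. u \<xi> y * (complex_of_real (\<Phi> (Suc M) (y - x)) - complex_of_real (\<Phi> M (y - x))) \<partial>lborel) = w (Suc M) \<xi> x" by simp
    moreover have "(\<integral>y. u \<xi> y * (complex_of_real (\<Phi> (Suc M) (y - x)) - complex_of_real (\<Phi> M (y - x))) \<partial>lborel)
       = (\<integral>y. \<Phi> (Suc M) (y - x) *\<^sub>R u \<xi> y - \<Phi> M (y - x) *\<^sub>R u \<xi> y \<partial>lborel)"
      by (simp add: scaleR_conv_of_real algebra_simps)
    ultimately show ?thesis unfolding v_def using \<Phi>u_int by (simp add: Bochner_Integration.integral_diff)
  qed
  have w_bound: "cmod (w m \<xi> x) \<le> (L * sqrt D) * \<mu> ^ m" for m \<xi> x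
  proof -
    have \<kappa>x: "(\<integral>\<^sup>+y. ennreal ((cmod (complex_of_real (\<kappa> m (y - x))))\<^sup>2) \<partial>lborel) \<le> ennreal (D * (\<mu> ^ m)\<^sup>2)"
      using nn_integral_translate[of "\<lambda>z. ennreal ((\<kappa> m z)\<^sup>2)" x] \<kappa>_L2 by simp
    have "cmod (w m \<xi> x) = cmod (\<integral>y. g m \<xi> y * cnj (complex_of_real (\<kappa> m (y - x))) \<partial>lborel)"
      by (simp add: w_def norm_mult norm_power)
    also have "\<dots> \<le> sqrt (L\<^sup>2) * sqrt (D * (\<mu> ^ m)\<^sup>2)"
    proof (rule L2_Cauchy_Schwarz)
      show "in_L2 lborel (g m \<xi>)" using g_sq by (simp add: in_L2_def)
      show "in_L2 lborel (\<lambda>y. complex_of_real (\<kappa> m (y - x)))"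
        unfolding in_L2_def
      proof
        show "integrable lborel (\<lambda>y. (cmod (complex_of_real (\<kappa> m (y - x))))\<^sup>2)"
          by (rule integrableI_bounded) (use \<kappa>x in \<open>auto simp: less_top[symmetric] top_unique\<close>)
      qed measurable
    qed (use g_sq \<kappa>x D in auto)
    also have "\<dots> = (L * sqrt D) * \<mu> ^ m" using L \<mu> by (simp add: real_sqrt_mult)
    finally show ?thesis .
  qed
  have limit: "AE x in lborel. (\<lambda>M. v \<xi> M x) \<longlonglongrightarrow> u \<xi> x" for \<xi>
  proof (rule mollified_limit[where \<Phi> = \<Phi> and A = A and \<mu> = \<mu> and E = "L * sqrt D"])
    show "cmod (v \<xi> 0 x) \<le> L * sqrt D" for x using w_bound[of 0 \<xi> x] by (simp add: v_0)
    show "cmod (v \<xi> (Suc M) x - v \<xi> M x) \<le> L * sqrt D * \<mu> ^ Suc M" for M x unfolding v_Suc by (rule w_bound)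
  qed (use u loc cont \<Phi>_int unit small \<mu> in \<open>auto simp: v_def\<close>)
  define B where "B = D * L\<^sup>2 / (1 - \<mu>)\<^sup>2"
  show ?thesis
  proof (intro exI[of _ B] conjI allI impI)
    show "0 \<le> B" using D by (simp add: B_def)
    fix S :: "(nat ^ 'n) set" and c :: "nat ^ 'n \<Rightarrow> complex" assume S: "finite S"
    have [measurable]: "w m \<xi> \<in> borel_measurable borel" for m \<xi>
      unfolding w_def[abs_def] by measurable
    have [measurable]: "w m \<xi> \<in> borel_measurable lebesgue" for m \<xi>
      by (simp add: measurable_completion)
    define W where "W m x = (\<Sum>\<xi>\<in>S. c \<xi> * w m \<xi> x * hn \<xi> x)" for m x
    have v_sum: "v \<xi> M x = (\<Sum>m\<le>M. w m \<xi> x)" for \<xi> M x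
    proof (induction M)
      case (Suc M)
      then show ?case using v_Suc[of \<xi> M x] by (simp add: algebra_simps)
    qed (simp add: v_0)
    have W_sum: "(\<Sum>\<xi>\<in>S. c \<xi> * v \<xi> M x * hn \<xi> x) = (\<Sum>m\<le>M. W m x)" for M x
      unfolding W_def v_sum by (subst sum.swap) (simp add: sum_distrib_left sum_distrib_right)
    have W_meas [measurable]: "W m \<in> borel_measurable gauss_measure" for m
      unfolding W_def[abs_def] by measurable
    have W_bound: "(\<integral>\<^sup>+x. ennreal ((cmod (W m x))\<^sup>2) \<partial>gauss_measure) \<le> ennreal (D * L\<^sup>2 * (\<Sum>\<xi>\<in>S. (cmod (c \<xi>))\<^sup>2) * (\<mu> ^ m)\<^sup>2)" for m
    proof -
      have "W m x = (\<Sum>\<xi>\<in>S. ((-1) ^ mi_abs (\<nu> m) * c \<xi>) * (\<integral>y. g m \<xi> y * \<kappa> m (y - x) \<partial>lborel) * hn \<xi> x)" for x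
        unfolding W_def w_def by (simp add: mult_ac)
      then have "(\<integral>\<^sup>+x. ennreal ((cmod (W m x))\<^sup>2) \<partial>gauss_measure)
         \<le> ennreal ((D * (\<mu> ^ m)\<^sup>2) * (L\<^sup>2 * (\<Sum>\<xi>\<in>S. (cmod ((-1) ^ mi_abs (\<nu> m) * c \<xi>))\<^sup>2)))"
        using kernel_paired_symbol_bound[where g = "g m" and \<kappa> = "\<kappa> m" and L = "L\<^sup>2" and D = "D * (\<mu> ^ m)\<^sup>2" and S = S
            and c = "\<lambda>\<xi>. (-1) ^ mi_abs (\<nu> m) * c \<xi>"] g_sq \<kappa>_L2 D S by simp
      then show ?thesis by (simp add: norm_mult norm_power mult_ac)
    qed
    have partial_bound: "(\<integral>\<^sup>+x. ennreal ((cmod (\<Sum>m\<le>M. W m x))\<^sup>2) \<partial>gauss_measure) \<le> ennreal (B * (\<Sum>\<xi>\<in>S. (cmod (c \<xi>))\<^sup>2))" for M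
    proof -
      have "(\<integral>\<^sup>+x. ennreal ((cmod (\<Sum>m\<le>M. W m x))\<^sup>2) \<partial>gauss_measure) \<le> ennreal (D * L\<^sup>2 * (\<Sum>\<xi>\<in>S. (cmod (c \<xi>))\<^sup>2) / (1 - \<mu>)\<^sup>2)"
        by (rule nn_integral_geometric_sum[OF W_meas \<mu> _ W_bound]) (use D in \<open>auto intro!: mult_nonneg_nonneg sum_nonneg\<close>)
      then show ?thesis by (simp add: B_def)
    qed
    have "AE x in lborel. \<forall>\<xi>\<in>S. \<sigma> x \<xi> = u \<xi> x \<and> (\<lambda>M. v \<xi> M x) \<longlonglongrightarrow> u \<xi> x"
      using S u_ae limit by (intro AE_finite_allI AE_conjI)
    then have "AE x in gauss_measure. ennreal ((cmod (\<Sum>\<xi>\<in>S. c \<xi> * \<sigma> x \<xi> * hn \<xi> x))\<^sup>2) = liminf (\<lambda>M. ennreal ((cmod (\<Sum>m\<le>M. W m x))\<^sup>2))"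
      unfolding AE_gauss_measure AE_lebesgue_iff
    proof eventually_elim
      case (elim x)
      have "(\<lambda>M. ennreal ((cmod (\<Sum>\<xi>\<in>S. c \<xi> * v \<xi> M x * hn \<xi> x))\<^sup>2)) \<longlonglongrightarrow> ennreal ((cmod (\<Sum>\<xi>\<in>S. c \<xi> * u \<xi> x * hn \<xi> x))\<^sup>2)"
        by (intro tendsto_intros) (use elim in auto)
      moreover have "(\<Sum>\<xi>\<in>S. c \<xi> * u \<xi> x * hn \<xi> x) = (\<Sum>\<xi>\<in>S. c \<xi> * \<sigma> x \<xi> * hn \<xi> x)"
        using elim by (intro sum.cong) auto
      ultimately have "(\<lambda>M. ennreal ((cmod (\<Sum>m\<le>M. W m x))\<^sup>2)) \<longlonglongrightarrow> ennreal ((cmod (\<Sum>\<xi>\<in>S. c \<xi> * \<sigma> x \<xi> * hn \<xi> x))\<^sup>2)"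
        unfolding W_sum by simp
      then show ?case by (rule lim_imp_Liminf[rotated, symmetric]) simp
    qed
    then have "(\<integral>\<^sup>+x. ennreal ((cmod (\<Sum>\<xi>\<in>S. c \<xi> * \<sigma> x \<xi> * hn \<xi> x))\<^sup>2) \<partial>gauss_measure)
       = (\<integral>\<^sup>+x. liminf (\<lambda>M. ennreal ((cmod (\<Sum>m\<le>M. W m x))\<^sup>2)) \<partial>gauss_measure)"
      by (rule nn_integral_cong_AE)
    also have "\<dots> \<le> liminf (\<lambda>M. \<integral>\<^sup>+x. ennreal ((cmod (\<Sum>m\<le>M. W m x))\<^sup>2) \<partial>gauss_measure)"
      by (rule nn_integral_liminf) measurable
    also have "\<dots> \<le> liminf (\<lambda>M :: nat. ennreal (B * (\<Sum>\<xi>\<in>S. (cmod (c \<xi>))\<^sup>2)))"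
      by (intro Liminf_mono always_eventually allI partial_bound)
    finally show "(\<integral>\<^sup>+x. ennreal ((cmod (\<Sum>\<xi>\<in>S. c \<xi> * \<sigma> x \<xi> * hn \<xi> x))\<^sup>2) \<partial>gauss_measure) \<le> ennreal (B * (\<Sum>\<xi>\<in>S. (cmod (c \<xi>))\<^sup>2))"
      by (simp add: Liminf_const)
  qed
qed


section \<open>Verification of the four conditions\<close>

lemma symbol_bound_if_bounds:
  fixes s :: "nat ^ 'n \<Rightarrow> complex"
  assumes "\<And>c l \<xi>. l \<le> K \<Longrightarrow> cmod ((diff1 c ^^ l) s \<xi>) \<le> C c l * mi_bracket \<xi> powr (\<tau> - real l)"
  shows "symbol_bound K \<tau> (\<Sum>c\<in>UNIV. \<Sum>l\<le>K. \<bar>C c l\<bar>) s"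
  unfolding symbol_bound_def
proof (intro allI impI)
  fix c :: 'n and l and \<xi> :: "nat ^ 'n" assume l: "l \<le> K"
  have "C c l \<le> \<bar>C c l\<bar>" by simp
  also have "\<dots> \<le> (\<Sum>l\<le>K. \<bar>C c l\<bar>)" using l by (intro member_le_sum) auto
  also have "\<dots> \<le> (\<Sum>c\<in>UNIV. \<Sum>l\<le>K. \<bar>C c l\<bar>)"
    by (intro member_le_sum[where f = "\<lambda>c. \<Sum>l\<le>K. \<bar>C c l\<bar>"]) (auto intro: sum_nonneg)
  finally have "C c l * mi_bracket \<xi> powr (\<tau> - real l) \<le> \<dots> * mi_bracket \<xi> powr (\<tau> - real l)"
    by (rule mult_right_mono) simp
  then show "cmod ((diff1 c ^^ l) s \<xi>) \<le> (\<Sum>c\<in>UNIV. \<Sum>l\<le>K. \<bar>C c l\<bar>) * mi_bracket \<xi> powr (\<tau> - real l)"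
    using assms[OF l, of c \<xi>] by linarith
qed

lemma symbol_bound_mono: "symbol_bound K \<tau> B s \<Longrightarrow> B \<le> B' \<Longrightarrow> symbol_bound K \<tau> B' s"
  unfolding symbol_bound_def by (meson mult_right_mono order_trans powr_ge_zero)

lemma C_k_mono: "j \<le> k \<Longrightarrow> C_k k f \<Longrightarrow> C_k j f"
proof (induction j arbitrary: k f)
  case 0
  then show ?case by (cases k) auto
next
  case (Suc j)
  then show ?case by (cases k) auto
qed

lemma diff1_power_has_vector_derivative:
  assumes "\<And>\<xi>. ((\<lambda>t. f t \<xi>) has_vector_derivative f' \<xi>) F"
  shows "((\<lambda>t. (diff1 c ^^ l) (f t) \<xi>) has_vector_derivative (diff1 c ^^ l) f' \<xi>) F"
proof (induction l arbitrary: \<xi>)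
  case 0
  then show ?case using assms by simp
next
  case (Suc l)
  show ?case
    using has_vector_derivative_diff[OF Suc.IH[of "\<xi> + axis c 1"] Suc.IH[of \<xi>]]
    by (simp add: diff1_def[of c "(diff1 c ^^ l) _"])
qed

lemma partial1_diff1_power:
  assumes "\<And>\<xi>. C_k 1 (\<lambda>x. \<sigma> x \<xi>)"
  shows "partial1 i (\<lambda>y. (diff1 c ^^ l) (\<sigma> y) \<xi>) x = (diff1 c ^^ l) (\<lambda>\<xi>. partial1 i (\<lambda>y. \<sigma> y \<xi>) x) \<xi>"
proof -
  have "((\<lambda>t. \<sigma> (x + t *\<^sub>R axis i 1) \<xi>) has_vector_derivative partial1 i (\<lambda>y. \<sigma> y \<xi>) x) (at 0)" for \<xi>
    unfolding partial1_def vector_derivative_works[symmetric] using assms[of \<xi>] by simp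
  then show ?thesis
    unfolding partial1_def[of i "\<lambda>y. (diff1 c ^^ l) (\<sigma> y) \<xi>"]
    by (intro vector_derivative_at diff1_power_has_vector_derivative[where f = "\<lambda>t. \<sigma> (x + t *\<^sub>R axis i 1)"])
qed

text \<open>The estimates for \<open>\<kappa> = l e\<^sub>c\<close> say that \<open>\<sigma>\<close> has order \<open>0\<close> (case \<open>\<nu> = 0\<close>) and that its first derivatives have order
  \<open>\<delta>/2\<close> (case \<open>\<nu> = e\<^sub>i\<close>). Adding up the finitely many constants makes them uniform.\<close>

lemma symbol_class_bounded:
  fixes \<sigma> :: "real ^ 'n \<Rightarrow> nat ^ 'n \<Rightarrow> complex"
  assumes \<sigma>: "symbol_class \<delta> K N \<sigma>" and K: "k \<le> K" "CARD('n) < 2 * k" and N: "1 \<le> N" and \<delta>: "0 \<le> \<delta>" "\<delta> < 1"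
  shows "bounded_on_hermite_sums \<sigma>"
proof -
  have C1: "C_k 1 (\<lambda>x. \<sigma> x \<xi>)" for \<xi>
    using \<sigma> N C_k_mono unfolding symbol_class_def by blast
  have bounds: "\<exists>C. \<forall>x \<xi>. cmod (partial_mi \<nu> (\<lambda>y. (diff1 c ^^ l) (\<sigma> y) \<xi>) x) \<le> C * mi_bracket \<xi> powr (\<delta> / 2 * real (mi_abs \<nu>) - real l)"
    if "mi_abs \<nu> \<le> N" "l \<le> k" for \<nu> c l
    using \<sigma>[unfolded symbol_class_def, THEN conjunct2, rule_format, of \<nu> "axis c l"] that K
    by (auto simp: mi_pow_axis)
  have "\<exists>C. \<forall>x \<xi>. cmod ((diff1 c ^^ l) (\<sigma> x) \<xi>) \<le> C * mi_bracket \<xi> powr (0 - real l)" if "l \<le> k" for c l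
    using bounds[of 0 l c] that by (simp add: mi_pow_0 mi_abs_def)
  then have "\<forall>c l. \<exists>C. l \<le> k \<longrightarrow> (\<forall>x \<xi>. cmod ((diff1 c ^^ l) (\<sigma> x) \<xi>) \<le> C * mi_bracket \<xi> powr (0 - real l))"
    by blast
  then obtain C0 where C0: "\<And>c l x \<xi>. l \<le> k \<Longrightarrow> cmod ((diff1 c ^^ l) (\<sigma> x) \<xi>) \<le> C0 c l * mi_bracket \<xi> powr (0 - real l)"
    by metis
  have "\<exists>C. \<forall>x \<xi>. cmod ((diff1 c ^^ l) (\<lambda>\<xi>. partial1 i (\<lambda>y. \<sigma> y \<xi>) x) \<xi>) \<le> C * mi_bracket \<xi> powr (\<delta> / 2 - real l)" if "l \<le> k" for i c l
    using bounds[of "axis i 1" l c] that N by (simp add: mi_pow_axis partial1_diff1_power[OF C1])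
  then have "\<forall>i c l. \<exists>C. l \<le> k \<longrightarrow> (\<forall>x \<xi>. cmod ((diff1 c ^^ l) (\<lambda>\<xi>. partial1 i (\<lambda>y. \<sigma> y \<xi>) x) \<xi>) \<le> C * mi_bracket \<xi> powr (\<delta> / 2 - real l))"
    by blast
  then obtain C1' where C1': "\<And>i c l x \<xi>. l \<le> k \<Longrightarrow> cmod ((diff1 c ^^ l) (\<lambda>\<xi>. partial1 i (\<lambda>y. \<sigma> y \<xi>) x) \<xi>) \<le> C1' i c l * mi_bracket \<xi> powr (\<delta> / 2 - real l)"
    by metis
  define B0 where "B0 = (\<Sum>c\<in>UNIV. \<Sum>l\<le>k. \<bar>C0 c l\<bar>)"
  define B1 where "B1 i = (\<Sum>c\<in>UNIV. \<Sum>l\<le>k. \<bar>C1' i c l\<bar>)" for i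
  have nonneg: "B0 \<ge> 0" "B1 i \<ge> 0" for i by (simp_all add: B0_def B1_def sum_nonneg)
  show ?thesis
  proof (rule smooth_symbol_bounded[where B = "B0 + (\<Sum>i\<in>UNIV. B1 i)", OF K(2) \<delta> _ C1])
    show "0 \<le> B0 + (\<Sum>i\<in>UNIV. B1 i)" using nonneg by (intro add_nonneg_nonneg sum_nonneg)
    show "symbol_bound k 0 (B0 + (\<Sum>i\<in>UNIV. B1 i)) (\<sigma> x)" for x
      by (rule symbol_bound_mono[of _ _ B0]) (use nonneg in \<open>auto simp: B0_def intro!: symbol_bound_if_bounds C0 sum_nonneg\<close>)
    have "B1 i \<le> (\<Sum>i\<in>UNIV. B1 i)" for i using nonneg by (intro member_le_sum) auto
    then have "B1 i \<le> B0 + (\<Sum>i\<in>UNIV. B1 i)" for i using nonneg(1) by (smt (verit))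
    moreover have "symbol_bound k (\<delta> / 2) (B1 i) (\<lambda>\<xi>. partial1 i (\<lambda>y. \<sigma> y \<xi>) x)" for i x
      unfolding B1_def by (intro symbol_bound_if_bounds C1')
    ultimately show "symbol_bound k (\<delta> / 2) (B0 + (\<Sum>i\<in>UNIV. B1 i)) (\<lambda>\<xi>. partial1 i (\<lambda>y. \<sigma> y \<xi>) x)" for i x
      by (blast intro: symbol_bound_mono)
  qed
qed

text \<open>There are countably many \<open>\<xi>\<close> and finitely many differences, so the exceptional null sets can be united.\<close>

lemma AE_symbol_bound_if_esssup:
  fixes \<sigma> :: "'a::euclidean_space \<Rightarrow> nat ^ 'n \<Rightarrow> complex"
  assumes "\<And>\<kappa>. mi_abs \<kappa> \<le> K \<Longrightarrow> \<exists>C. \<forall>\<xi>. esssup lebesgue (\<lambda>x. ereal (cmod (diff_mi \<kappa> (\<sigma> x) \<xi>)))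
             \<le> ereal (C * mi_bracket \<xi> powr (\<tau> - real (mi_abs \<kappa>)))"
  shows "\<exists>B\<ge>0. AE x in lebesgue. symbol_bound K \<tau> B (\<sigma> x)"
proof -
  have "\<exists>C. \<forall>\<xi>. esssup lebesgue (\<lambda>x. ereal (cmod ((diff1 c ^^ l) (\<sigma> x) \<xi>))) \<le> ereal (C * mi_bracket \<xi> powr (\<tau> - real l))"
    if "l \<le> K" for c l
    using assms[of "axis c l"] that by (simp add: mi_pow_axis)
  then have "\<forall>c l. \<exists>C. l \<le> K \<longrightarrow> (\<forall>\<xi>. esssup lebesgue (\<lambda>x. ereal (cmod ((diff1 c ^^ l) (\<sigma> x) \<xi>))) \<le> ereal (C * mi_bracket \<xi> powr (\<tau> - real l)))"
    by blast
  then obtain C where C: "\<And>c l \<xi>. l \<le> K \<Longrightarrow> esssup lebesgue (\<lambda>x. ereal (cmod ((diff1 c ^^ l) (\<sigma> x) \<xi>))) \<le> ereal (C c l * mi_bracket \<xi> powr (\<tau> - real l))"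
    by metis
  have "AE x in lebesgue. cmod ((diff1 c ^^ l) (\<sigma> x) \<xi>) \<le> C c l * mi_bracket \<xi> powr (\<tau> - real l)" if "l \<le> K" for c l \<xi>
    using esssup_AE[of "\<lambda>x. ereal (cmod ((diff1 c ^^ l) (\<sigma> x) \<xi>))" lebesgue]
  proof eventually_elim
    case (elim x)
    from order_trans[OF this C[OF that]] show ?case by (rule ereal_less_eq(3)[THEN iffD1])
  qed
  then have "AE x in lebesgue. \<forall>c. \<forall>l. l \<le> K \<longrightarrow> (\<forall>\<xi>. cmod ((diff1 c ^^ l) (\<sigma> x) \<xi>) \<le> C c l * mi_bracket \<xi> powr (\<tau> - real l))"
    by (simp add: AE_all_countable AE_impI)
  then have "AE x in lebesgue. symbol_bound K \<tau> (\<Sum>c\<in>UNIV. \<Sum>l\<le>K. \<bar>C c l\<bar>) (\<sigma> x)"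
    by eventually_elim (rule symbol_bound_if_bounds, blast)
  moreover have "0 \<le> (\<Sum>c\<in>UNIV. \<Sum>l\<le>K. \<bar>C c l\<bar>)" by (intro sum_nonneg) auto
  ultimately show ?thesis by blast
qed

theorem corollary1p6:
  fixes \<sigma> :: "real ^ 'n \<Rightarrow> nat ^ 'n \<Rightarrow> complex"
  assumes measurable: "\<And>\<xi>. (\<lambda>x. \<sigma> x \<xi>) \<in> borel_measurable lebesgue"
    and conditions:
      "(\<exists>\<delta>. 0 \<le> \<delta> \<and> \<delta> < 1 \<and>
          symbol_class \<delta> (CARD('n) + 1)
            (2 * nat \<lceil>(real CARD('n) + 1) / (2 * (1 - \<delta>))\<rceil>) \<sigma>)
       \<or> (\<exists>\<delta>. 0 \<le> \<delta> \<and> \<delta> < 1 \<and>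
          symbol_class \<delta> (CARD('n) div 2 + 1)
            (nat \<lfloor>2 * real CARD('n) / (1 - \<delta>)\<rfloor> + 1) \<sigma>)
       \<or> (\<exists>m<0. \<forall>\<kappa>. mi_abs \<kappa> \<le> CARD('n) div 2 + 1 \<longrightarrow>
          (\<exists>C. \<forall>\<xi>. esssup lebesgue (\<lambda>x. ereal (cmod (diff_mi \<kappa> (\<sigma> x) \<xi>)))
             \<le> ereal (C * mi_bracket \<xi> powr (m / 2 - real (mi_abs \<kappa>)))))
       \<or> (\<forall>\<nu>. mi_abs \<nu> \<le> CARD('n) div 2 + 1 \<longrightarrow>
          (\<exists>C. \<forall>\<xi>. \<exists>g. is_weak_partial \<nu> (\<lambda>x. \<sigma> x \<xi>) g \<and>
             in_L2 lebesgue g \<and> L2_norm lebesgue g \<le> C))"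
  shows "extends_to_bounded_L2 gauss_measure hermite_span (pseudo_multiplier \<sigma>)"
proof -
  \<comment> \<open>The least integer above \<open>n/2\<close>, as required by the decay of the kernels and by the Sobolev embedding.\<close>
  let ?K = "CARD('n) div 2 + 1"
  have K: "CARD('n) < 2 * ?K" by simp
  have "bounded_on_hermite_sums \<sigma>"
    using conditions
  proof (elim disjE exE conjE)
    fix \<delta> :: real assume \<delta>: "0 \<le> \<delta>" "\<delta> < 1"
      and \<sigma>: "symbol_class \<delta> (CARD('n) + 1) (2 * nat \<lceil>(real CARD('n) + 1) / (2 * (1 - \<delta>))\<rceil>) \<sigma>"
    have "0 < (real CARD('n) + 1) / (2 * (1 - \<delta>))" using \<delta> by simp
    then have "1 \<le> 2 * nat \<lceil>(real CARD('n) + 1) / (2 * (1 - \<delta>))\<rceil>" by linarith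
    moreover have "?K \<le> CARD('n) + 1" by simp
    ultimately show ?thesis using symbol_class_bounded[OF \<sigma> _ K] \<delta> by blast
  next
    fix \<delta> :: real assume \<delta>: "0 \<le> \<delta>" "\<delta> < 1"
      and \<sigma>: "symbol_class \<delta> ?K (nat \<lfloor>2 * real CARD('n) / (1 - \<delta>)\<rfloor> + 1) \<sigma>"
    then show ?thesis using K by (intro symbol_class_bounded[where k = ?K]) auto
  next
    fix m :: real assume m: "m < 0"
      and "\<forall>\<kappa>. mi_abs \<kappa> \<le> ?K \<longrightarrow> (\<exists>C. \<forall>\<xi>. esssup lebesgue (\<lambda>x. ereal (cmod (diff_mi \<kappa> (\<sigma> x) \<xi>)))
             \<le> ereal (C * mi_bracket \<xi> powr (m / 2 - real (mi_abs \<kappa>))))"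
    then obtain B where "B \<ge> 0" "AE x in lebesgue. symbol_bound ?K (m / 2) B (\<sigma> x)"
      using AE_symbol_bound_if_esssup[of ?K \<sigma> "m / 2"] by blast
    then show ?thesis using m by (intro negative_order_symbol_bounded[OF K _ _ measurable, of "m / 2"]) auto
  next
    assume "\<forall>\<nu>. mi_abs \<nu> \<le> ?K \<longrightarrow> (\<exists>C. \<forall>\<xi>. \<exists>g. is_weak_partial \<nu> (\<lambda>x. \<sigma> x \<xi>) g \<and>
             in_L2 lebesgue g \<and> L2_norm lebesgue g \<le> C)"
    then show ?thesis by (intro weakly_differentiable_symbol_bounded[OF K measurable]) blast
  qed
  then show ?thesis by (rule extends_to_bounded_L2_if_bounded_on_sums[OF measurable])
qed

end
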